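(* There exists a constant $C>0$, independent of $\varepsilon$ and $N$, such that $$\|u-u^\star\|_0\le C\big(N^{-2}+\varepsilon^{1/4}N^{-2}(\ln N)^2\big),$$ $$\varepsilon^{1/4}|u-u^\star|_1\le C\big(\varepsilon^{1/4}N^{-1}+N^{-2}(\ln N)^2\big),$$ $$\varepsilon^{3/4}\Big(\sum_{M\in\mathcal{M}^N}|u-u^\star|_{2,M}^2\Big)^{1/2}\le C\big(\varepsilon N^{-1}(\ln N)^2+N^{-1}\ln N\big).$$ If $\varepsilon^{1/4}\le(\ln N)^{-2}$, then $$\|u-u^\star\|_0\le CN^{-2},\qquad \varepsilon^{3/4}\Big(\sum_{M\in\mathcal{M}^N}|u-u^\star|_{2,M}^2\Big)^{1/2}\le CN^{-1}\ln N.$$ If $|S|_3\le C\varepsilon^{-1/4}$, then $$\varepsilon^{1/4}|u-u^\star|_1\le CN^{-2}(\ln N)^2.$$ If $\varepsilon^{1/4}\le(\ln N)^{-3}$ and $|S|_3+\sum_{i\in\{1,3\}}\|\boldsymbol{D}^{(3,0)}E_i\|_{0,\Omega_i}+\sum_{j\in\{2,4\}}\|\boldsymbol{D}^{(0,3)}E_j\|_{0,\Omega_j}\le C$, then $$\|u-u^\star\|_0\le CN^{-3}(\ln N)^3.$$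
   Context: Problem. $\Omega=(0,1)^2$, $0<\varepsilon\ll1$; $u$ solves $-\varepsilon\Delta u+cu=f$ in $\Omega$, $u=0$ on $\partial\Omega$, with smooth $c,f$, $0<2(c^\star)^2\le c$ for a constant $c^\star>0$, and $f=0$ at the four corners of $\Omega$, so that $u\in C^3(\overline\Omega)$. A decomposition $u=S+\sum_{i=1}^4E_i+E_{12}+E_{23}+E_{34}+E_{41}$ is fixed such that on $\overline\Omega$, for $0\le i+j\le3$ and constants $C$ independent of $\varepsilon$: $|\partial_x^i\partial_y^jS|\le C(1+\varepsilon^{1-(i+j)/2})$, $|\partial_x^i\partial_y^jE_1|\le C(1+\varepsilon^{1-i/2})\varepsilon^{-j/2}e^{-c^\star y/\sqrt\varepsilon}$, $|\partial_x^i\partial_y^jE_{12}|\le C\varepsilon^{-(i+j)/2}e^{-c^\star(x+y)/\sqrt\varepsilon}$, with analogous bounds for the other terms: $E_1,E_2,E_3,E_4$ are boundary layers at the edges $y=0$, $x=0$, $y=1$, $x=1$, respectively (for $E_2,E_4$ the roles of $x$ and $y$ are exchanged, and distances to the corresponding edge are used), and $E_{12},E_{23},E_{34},E_{41}$ are corner layers at $(0,0),(0,1),(1,1),(1,0)$. (Existence of such a decomposition is known.) Mesh. $N$ is a multiple of 8, $\lambda=\min\{\frac14,\frac{\lambda_0\sqrt\varepsilon}{c^\star}\ln N\}$ with fixed $\lambda_0\ge3$; it is assumed that $\sqrt\varepsilon\le CN^{-1}$, from which $\lambda<\frac14$ follows. The 1D mesh $0=x_0<\dots<x_N=1$ divides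 $[0,\lambda]$ and $[1-\lambda,1]$ into $N/4$ equal intervals each (length $h=4\lambda/N$) and $[\lambda,1-\lambda]$ into $N/2$ equal intervals (length $H=2(1-2\lambda)/N$); $y_j=x_j$. $\Omega^N$ is the tensor product mesh. Subdomains: $\Omega_0=(\lambda,1-\lambda)^2$, $\Omega_1=(\lambda,1-\lambda)\times(0,\lambda)$, $\Omega_2=(0,\lambda)\times(\lambda,1-\lambda)$, $\Omega_3=(\lambda,1-\lambda)\times(1-\lambda,1)$, $\Omega_4=(1-\lambda,1)\times(\lambda,1-\lambda)$, $\Omega_{12}=(0,\lambda)^2$, $\Omega_{23}=(0,\lambda)\times(1-\lambda,1)$, $\Omega_{34}=(1-\lambda,1)^2$, $\Omega_{41}=(1-\lambda,1)\times(0,\lambda)$, $\Omega_f=\Omega_{12}\cup\Omega_{23}\cup\Omega_{34}\cup\Omega_{41}$. The macro-element triangulation $\mathcal{M}^N$ of $\Omega\setminus\Omega_0$ consists of: the rectangles $[x_{i-1},x_{i+1}]\times[y_{j-1},y_{j+1}]\subset\overline{\Omega_f}$ with $i,j$ odd; $[x_i,x_{i+1}]\times[y_{j-1},y_{j+1}]\subset\overline{\Omega_1}\cup\overline{\Omega_3}$ with $j$ odd; $[x_{i-1},x_{i+1}]\times[y_j,y_{j+1}]\subset\overline{\Omega_2}\cup\overline{\Omega_4}$ with $i$ odd. 1D functions. For $J=[a,b]$ with midpoint $m$, half-length $r=(b-a)/2$ and $e\in\{a,b\}$ let $\varphi^J_e,\psi^J_e\in C^1(J)$ be quadratic on each of $[a,m],[m,b]$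 with $\varphi^J_e(k)=\delta_{ek}$, $(\varphi^J_e)'(k)=0$, $\psi^J_e(k)=0$, $(\psi^J_e)'(k)=\delta_{ek}$ for $k\in\{a,b\}$. Let $\ell^J_\xi$, $\xi\in\{a,m,b\}$, be the quadratic Lagrange basis on $J$ for the nodes $a,m,b$. Let $d^J_a,d^J_b\in\mathrm{span}\{\psi^J_a+\psi^J_b,\ ((x-m)/r)^2-\frac16\}$ be determined by $\int_J(\psi^J_k)'d^J_e\,dx=\delta_{ke}$ for $k,e\in\{a,b\}$. Quasi-interpolant $u^\star$, regarded as an element of the finite element space $V^N=\{v\in H^1(\Omega): v|_T\in Q_2(T)\ \forall T\in\Omega^N\}$ on the mesh (on macro-elements in $\overline{\Omega_f}$, $\overline{\Omega_1}\cup\overline{\Omega_3}$ and $\overline{\Omega_2}\cup\overline{\Omega_4}$ it is piecewise biquadratic with respect to the subdivision of the macro-element into mesh elements). (i) On each $T\in\Omega^N$, $T\subset\overline{\Omega_0}$: $u^\star=u^I$, the biquadratic nodal interpolant of $u$ at the vertices, edge midpoints and centre of $T$. (ii) With each macro-element vertex $X\in\overline{\Omega_f}$ a macro-element edge $\sigma_X\ni X$, $\sigma_X\subset\overline{\Omega_f}$, is associated (an edge of one of the macro-elements in $\overline{\Omega_f}$). On a macro-element $M=J\times K\subset\overline{\Omega_f}$, $$u^\star=\sum_{X=(e,g)}\Big(u(X)\varphi^J_e(x)\varphi^K_g(y)+u_x(X)\psi^J_e(x)\varphi^K_g(y)+u_y(X)\varphi^J_e(x)\psi^K_g(y)+a_X\psi^J_e(x)\psi^K_g(y)\Big),$$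 summed over the four vertices $X$ of $M$, with $a_X=\int_{J'}u_{xy}(x,g)d^{J'}_e(x)\,dx$ if $\sigma_X=J'\times\{g\}$, and $a_X=\int_{K'}u_{xy}(e,y)d^{K'}_g(y)\,dy$ if $\sigma_X=\{e\}\times K'$. (iii) On a macro-element $M=J\times K\subset\overline{\Omega_1}\cup\overline{\Omega_3}$, $$u^\star=\sum_{\xi}\sum_{\eta}\ell^J_\xi(x)\big(u(\xi,\eta)\varphi^K_\eta(y)+g(\xi,\eta)\psi^K_\eta(y)\big),$$ $\xi$ running over the endpoints and midpoint of $J$, $\eta$ over the endpoints of $K$, where $g(\xi,\eta)=u_y(\xi,\eta)$ if $\eta\notin\{\lambda,1-\lambda\}$ and $g(\xi,\eta)=\partial_y(u^I|_{\Omega_0})(\xi,\eta)$ if $\eta\in\{\lambda,1-\lambda\}$. (iv) On macro-elements in $\overline{\Omega_2}\cup\overline{\Omega_4}$ the definition is as in (iii) with the roles of $x$ and $y$ exchanged. Norms. $\|\cdot\|_{0,D}$ is the $L_2(D)$ norm, $|\cdot|_{k,D}$ the $H^k(D)$ semi-norm, the subscript $D$ being dropped for $D=\Omega$; in particular $|u-u^\star|_1$ is the $H^1(\Omega)$ semi-norm. $\boldsymbol{D}^{(i,j)}=\partial_x^i\partial_y^j$. $C$ denotes generic positive constants independent of $\varepsilon$ and $N$.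
   Formalization: The semi-norm |u-u*|_1 is taken elementwise: as defined in (ii)-(iv), u* can jump across the eight macro-element edges ending at corners of Ω_0 and so need not lie in H^1(Ω); where it does, this is the H^1(Ω) semi-norm. *)

theory Defs
  imports "HOL-Analysis.Analysis"
begin

section \<open>Partial derivatives and function spaces on the closed unit square\<close>

abbreviation unit_square :: "(real \<times> real) set" where
  "unit_square \<equiv> {0<..<1} \<times> {0<..<1}"

abbreviation closed_unit_square :: "(real \<times> real) set" where
  "closed_unit_square \<equiv> {0..1} \<times> {0..1}"

text \<open>Derivatives are taken within \<open>[0,1]\<close>, hence one-sided on the boundary of the square.\<close>

definition diff_x :: "(real \<times> real \<Rightarrow> real) \<Rightarrow> real \<times> real \<Rightarrow> real" where
  "diff_x v = (\<lambda>(x, y). vector_derivative (\<lambda>t. v (t, y)) (at x within {0..1}))"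

definition diff_y :: "(real \<times> real \<Rightarrow> real) \<Rightarrow> real \<times> real \<Rightarrow> real" where
  "diff_y v = (\<lambda>(x, y). vector_derivative (\<lambda>t. v (x, t)) (at y within {0..1}))"

definition pd :: "nat \<Rightarrow> nat \<Rightarrow> (real \<times> real \<Rightarrow> real) \<Rightarrow> real \<times> real \<Rightarrow> real" where
  "pd i j v = (diff_x ^^ i) ((diff_y ^^ j) v)"

text \<open>\<open>C_closed k v\<close>: the function \<open>v\<close> is \<open>k\<close> times continuously differentiable on the
  closed unit square. The last clause says that the order of differentiation is immaterial.\<close>

definition C_closed :: "nat \<Rightarrow> (real \<times> real \<Rightarrow> real) \<Rightarrow> bool" where
  "C_closed k v \<longleftrightarrow>
     (\<forall>i j. i + j \<le> k \<longrightarrow> continuous_on closed_unit_square (pd i j v)) \<and>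
     (\<forall>i j. i + j < k \<longrightarrow> (\<forall>(x, y) \<in> closed_unit_square.
        ((\<lambda>t. pd i j v (t, y)) has_real_derivative pd (Suc i) j v (x, y)) (at x within {0..1}) \<and>
        ((\<lambda>t. pd i j v (x, t)) has_real_derivative pd i (Suc j) v (x, y)) (at y within {0..1})))"

definition C_inf_closed :: "(real \<times> real \<Rightarrow> real) \<Rightarrow> bool" where
  "C_inf_closed v \<longleftrightarrow> (\<forall>k. C_closed k v)"

text \<open>Norms and semi-norms. The derivatives are classical ones and need to exist almost everywhere
  only. For the functions considered (\<open>C^3\<close> functions and their differences
  with piecewise biquadratic functions) all integrands are bounded and measurable.
  If the function is moreover \<open>C^(k-1)\<close> on \<open>D\<close> and piecewise smooth there, the classical
  derivatives are the weak ones.\<close>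

definition L2_norm_on :: "(real \<times> real) set \<Rightarrow> (real \<times> real \<Rightarrow> real) \<Rightarrow> real" where
  "L2_norm_on D v = sqrt (LINT z:D|lebesgue. (v z)\<^sup>2)"

definition H_seminorm_on :: "nat \<Rightarrow> (real \<times> real) set \<Rightarrow> (real \<times> real \<Rightarrow> real) \<Rightarrow> real" where
  "H_seminorm_on k D v = sqrt (\<Sum>i\<le>k. (L2_norm_on D (pd i (k - i) v))\<^sup>2)"


section \<open>The boundary value problem and the solution decomposition\<close>

definition solves_bvp ::
  "real \<Rightarrow> (real \<times> real \<Rightarrow> real) \<Rightarrow> (real \<times> real \<Rightarrow> real) \<Rightarrow> (real \<times> real \<Rightarrow> real) \<Rightarrow> bool" where
  "solves_bvp \<epsilon> c f u \<longleftrightarrow> C_closed 3 u \<and>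
     (\<forall>z \<in> unit_square. - \<epsilon> * (pd 2 0 u z + pd 0 2 u z) + c z * u z = f z) \<and>
     (\<forall>z \<in> closed_unit_square - unit_square. u z = 0)"

definition smooth_part_bound :: "real \<Rightarrow> real \<Rightarrow> (real \<times> real \<Rightarrow> real) \<Rightarrow> bool" where
  "smooth_part_bound A \<epsilon> S \<longleftrightarrow> C_closed 3 S \<and>
     (\<forall>i j. i + j \<le> 3 \<longrightarrow> (\<forall>z \<in> closed_unit_square.
        \<bar>pd i j S z\<bar> \<le> A * (1 + \<epsilon> powr (1 - real (i + j) / 2))))"

text \<open>Layers at the horizontal edges; \<open>\<delta> y\<close> is the distance of \<open>(x, y)\<close> to the edge.\<close>

definition h_layer_bound ::
  "real \<Rightarrow> real \<Rightarrow> real \<Rightarrow> (real \<Rightarrow> real) \<Rightarrow> (real \<times> real \<Rightarrow> real) \<Rightarrow> bool" where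
  "h_layer_bound A cst \<epsilon> \<delta> E \<longleftrightarrow> C_closed 3 E \<and>
     (\<forall>i j. i + j \<le> 3 \<longrightarrow> (\<forall>(x, y) \<in> closed_unit_square.
        \<bar>pd i j E (x, y)\<bar> \<le> A * (1 + \<epsilon> powr (1 - real i / 2)) * \<epsilon> powr (- real j / 2)
                              * exp (- cst * \<delta> y / sqrt \<epsilon>)))"

text \<open>Layers at the vertical edges; \<open>\<delta> x\<close> is the distance of \<open>(x, y)\<close> to the edge.\<close>

definition v_layer_bound ::
  "real \<Rightarrow> real \<Rightarrow> real \<Rightarrow> (real \<Rightarrow> real) \<Rightarrow> (real \<times> real \<Rightarrow> real) \<Rightarrow> bool" where
  "v_layer_bound A cst \<epsilon> \<delta> E \<longleftrightarrow> C_closed 3 E \<and>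
     (\<forall>i j. i + j \<le> 3 \<longrightarrow> (\<forall>(x, y) \<in> closed_unit_square.
        \<bar>pd i j E (x, y)\<bar> \<le> A * (1 + \<epsilon> powr (1 - real j / 2)) * \<epsilon> powr (- real i / 2)
                              * exp (- cst * \<delta> x / sqrt \<epsilon>)))"

text \<open>Corner layers; \<open>\<delta>\<^sub>1 x + \<delta>\<^sub>2 y\<close> is the sum of the distances to the two edges at the corner.\<close>

definition corner_layer_bound ::
  "real \<Rightarrow> real \<Rightarrow> real \<Rightarrow> (real \<Rightarrow> real) \<Rightarrow> (real \<Rightarrow> real) \<Rightarrow> (real \<times> real \<Rightarrow> real) \<Rightarrow> bool" where
  "corner_layer_bound A cst \<epsilon> \<delta>\<^sub>1 \<delta>\<^sub>2 E \<longleftrightarrow> C_closed 3 E \<and>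
     (\<forall>i j. i + j \<le> 3 \<longrightarrow> (\<forall>(x, y) \<in> closed_unit_square.
        \<bar>pd i j E (x, y)\<bar> \<le> A * \<epsilon> powr (- real (i + j) / 2)
                              * exp (- cst * (\<delta>\<^sub>1 x + \<delta>\<^sub>2 y) / sqrt \<epsilon>)))"

definition solution_decomposition where
  "solution_decomposition A cst \<epsilon> u S E1 E2 E3 E4 E12 E23 E34 E41 \<longleftrightarrow>
     (\<forall>z \<in> closed_unit_square.
        u z = S z + (E1 z + E2 z + E3 z + E4 z) + E12 z + E23 z + E34 z + E41 z) \<and>
     smooth_part_bound A \<epsilon> S \<and>
     h_layer_bound A cst \<epsilon> (\<lambda>y. y) E1 \<and>
     v_layer_bound A cst \<epsilon> (\<lambda>x. x) E2 \<and>
     h_layer_bound A cst \<epsilon> (\<lambda>y. 1 - y) E3 \<and>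
     v_layer_bound A cst \<epsilon> (\<lambda>x. 1 - x) E4 \<and>
     corner_layer_bound A cst \<epsilon> (\<lambda>x. x) (\<lambda>y. y) E12 \<and>
     corner_layer_bound A cst \<epsilon> (\<lambda>x. x) (\<lambda>y. 1 - y) E23 \<and>
     corner_layer_bound A cst \<epsilon> (\<lambda>x. 1 - x) (\<lambda>y. 1 - y) E34 \<and>
     corner_layer_bound A cst \<epsilon> (\<lambda>x. 1 - x) (\<lambda>y. y) E41"


section \<open>Shishkin mesh and macro-elements\<close>

definition transition_point :: "real \<Rightarrow> real \<Rightarrow> real \<Rightarrow> nat \<Rightarrow> real" where
  "transition_point lam0 cst \<epsilon> N = min (1 / 4) (lam0 * sqrt \<epsilon> / cst * ln (real N))"

definition mesh_point :: "real \<Rightarrow> nat \<Rightarrow> nat \<Rightarrow> real" where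
  "mesh_point lam N i =
     (let h = 4 * lam / real N; H = 2 * (1 - 2 * lam) / real N in
      if i \<le> N div 4 then real i * h
      else if i \<le> 3 * N div 4 then lam + real (i - N div 4) * H
      else (1 - lam) + real (i - 3 * N div 4) * h)"

text \<open>A pair \<open>(a, b)\<close> of reals stands for the interval \<open>[a, b]\<close>.
  \<open>fine_macros\<close> are the one-dimensional macro-intervals (two mesh intervals each) in
  \<open>[0, lam]\<close> and \<open>[1 - lam, 1]\<close>; \<open>coarse_cells\<close> are the mesh intervals in \<open>[lam, 1 - lam]\<close>.
  The macro-elements are the products of two such intervals, except that coarse times coarse
  gives the mesh elements in the closure of \<open>\<Omega>\<^sub>0\<close>.\<close>

type_synonym itv = "real \<times> real"

definition fine_macros :: "real \<Rightarrow> nat \<Rightarrow> itv set" where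
  "fine_macros lam N = {(mesh_point lam N (i - 1), mesh_point lam N (i + 1)) | i.
     odd i \<and> (i + 1 \<le> N div 4 \<or> 3 * N div 4 \<le> i - 1 \<and> i + 1 \<le> N)}"

definition coarse_cells :: "real \<Rightarrow> nat \<Rightarrow> itv set" where
  "coarse_cells lam N = {(mesh_point lam N i, mesh_point lam N (i + 1)) | i.
     N div 4 \<le> i \<and> i + 1 \<le> 3 * N div 4}"

definition macro_elements :: "real \<Rightarrow> nat \<Rightarrow> (itv \<times> itv) set" where
  "macro_elements lam N =
     fine_macros lam N \<times> fine_macros lam N \<union>
     coarse_cells lam N \<times> fine_macros lam N \<union>
     fine_macros lam N \<times> coarse_cells lam N"

fun ends :: "itv \<Rightarrow> real set" where
  "ends (a, b) = {a, b}"

fun nodes3 :: "itv \<Rightarrow> real set" where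
  "nodes3 (a, b) = {a, (a + b) / 2, b}"

fun rect :: "itv \<Rightarrow> itv \<Rightarrow> (real \<times> real) set" where
  "rect (a, b) (a', b') = {a..b} \<times> {a'..b'}"

fun open_rect :: "itv \<Rightarrow> itv \<Rightarrow> (real \<times> real) set" where
  "open_rect (a, b) (a', b') = {a<..<b} \<times> {a'<..<b'}"


section \<open>One-dimensional basis functions\<close>

text \<open>Only the values on \<open>[a, b]\<close> are specified, and only they are used.\<close>

definition C1_pw_quadratic :: "real \<Rightarrow> real \<Rightarrow> (real \<Rightarrow> real) \<Rightarrow> bool" where
  "C1_pw_quadratic a b v \<longleftrightarrow>
     (\<exists>v'. continuous_on {a..b} v' \<and>
        (\<forall>x \<in> {a..b}. (v has_real_derivative v' x) (at x within {a..b}))) \<and>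
     (\<exists>\<alpha> \<beta> \<gamma>. \<forall>x \<in> {a..(a + b) / 2}. v x = \<alpha> + \<beta> * x + \<gamma> * x\<^sup>2) \<and>
     (\<exists>\<alpha> \<beta> \<gamma>. \<forall>x \<in> {(a + b) / 2..b}. v x = \<alpha> + \<beta> * x + \<gamma> * x\<^sup>2)"

definition is_phi :: "real \<Rightarrow> real \<Rightarrow> real \<Rightarrow> (real \<Rightarrow> real) \<Rightarrow> bool" where
  "is_phi a b e v \<longleftrightarrow> C1_pw_quadratic a b v \<and>
     (\<forall>k \<in> {a, b}. v k = of_bool (k = e) \<and> (v has_real_derivative 0) (at k within {a..b}))"

definition is_psi :: "real \<Rightarrow> real \<Rightarrow> real \<Rightarrow> (real \<Rightarrow> real) \<Rightarrow> bool" where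
  "is_psi a b e v \<longleftrightarrow> C1_pw_quadratic a b v \<and>
     (\<forall>k \<in> {a, b}. v k = 0 \<and> (v has_real_derivative of_bool (k = e)) (at k within {a..b}))"

fun phi :: "itv \<Rightarrow> real \<Rightarrow> real \<Rightarrow> real" where
  "phi (a, b) e = (SOME v. is_phi a b e v)"

fun psi :: "itv \<Rightarrow> real \<Rightarrow> real \<Rightarrow> real" where
  "psi (a, b) e = (SOME v. is_psi a b e v)"

fun lagrange :: "itv \<Rightarrow> real \<Rightarrow> real \<Rightarrow> real" where
  "lagrange (a, b) \<xi> x = (\<Prod>k \<in> nodes3 (a, b) - {\<xi>}. (x - k) / (\<xi> - k))"

definition is_dual :: "real \<Rightarrow> real \<Rightarrow> real \<Rightarrow> (real \<Rightarrow> real) \<Rightarrow> bool" where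
  "is_dual a b e d \<longleftrightarrow>
     (\<exists>\<alpha> \<beta>. \<forall>x. d x = \<alpha> * (psi (a, b) a x + psi (a, b) b x) +
                      \<beta> * (((x - (a + b) / 2) / ((b - a) / 2))\<^sup>2 - 1 / 6)) \<and>
     (\<forall>k \<in> {a, b}.
        integral {a..b} (\<lambda>x. vector_derivative (psi (a, b) k) (at x within {a..b}) * d x)
          = of_bool (k = e))"

fun dual :: "itv \<Rightarrow> real \<Rightarrow> real \<Rightarrow> real" where
  "dual (a, b) e = (SOME d. is_dual a b e d)"

declare phi.simps [simp del] psi.simps [simp del] dual.simps [simp del]

text \<open>The three specifications have solutions, which are unique on \<open>[a, b]\<close>:
  \<open>pwq a b v0 v1 d0 d1\<close> is the \<open>C\<^sup>1\<close> piecewise quadratic function with values \<open>v0\<close>, \<open>v1\<close> and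
  slopes \<open>d0\<close>, \<open>d1\<close> at \<open>a\<close>, \<open>b\<close>, and \<open>pwq'\<close> is its derivative.\<close>

definition pwq :: "real \<Rightarrow> real \<Rightarrow> real \<Rightarrow> real \<Rightarrow> real \<Rightarrow> real \<Rightarrow> real \<Rightarrow> real" where
  "pwq a b v0 v1 d0 d1 x =
     (let r = (b - a) / 2 in
      if x \<le> (a + b) / 2
      then v0 + d0 * (x - a) + ((v1 - v0) / (2 * r\<^sup>2) - (3 * d0 + d1) / (4 * r)) * (x - a)\<^sup>2
      else v1 - d1 * (b - x) - ((v1 - v0) / (2 * r\<^sup>2) - (3 * d1 + d0) / (4 * r)) * (b - x)\<^sup>2)"

definition pwq' :: "real \<Rightarrow> real \<Rightarrow> real \<Rightarrow> real \<Rightarrow> real \<Rightarrow> real \<Rightarrow> real \<Rightarrow> real" where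
  "pwq' a b v0 v1 d0 d1 x =
     (let r = (b - a) / 2 in
      if x \<le> (a + b) / 2
      then d0 + 2 * ((v1 - v0) / (2 * r\<^sup>2) - (3 * d0 + d1) / (4 * r)) * (x - a)
      else d1 + 2 * ((v1 - v0) / (2 * r\<^sup>2) - (3 * d1 + d0) / (4 * r)) * (b - x))"

lemma pwq_deriv:
  assumes "a < b"
  shows "(pwq a b v0 v1 d0 d1 has_real_derivative pwq' a b v0 v1 d0 d1 x) (at x within T)"
proof -
  define r where "r = (b - a) / 2"
  define m where "m = (a + b) / 2"
  have r: "r > 0" "b = a + 2 * r" "m = a + r" using assms by (auto simp: r_def m_def field_simps)
  define L where "L x = v0 + d0 * (x - a) + ((v1 - v0) / (2 * r\<^sup>2) - (3 * d0 + d1) / (4 * r)) * (x - a)\<^sup>2" for x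
  define L' where "L' x = d0 + 2 * ((v1 - v0) / (2 * r\<^sup>2) - (3 * d0 + d1) / (4 * r)) * (x - a)" for x
  define R where "R x = v1 - d1 * (b - x) - ((v1 - v0) / (2 * r\<^sup>2) - (3 * d1 + d0) / (4 * r)) * (b - x)\<^sup>2" for x
  define R' where "R' x = d1 + 2 * ((v1 - v0) / (2 * r\<^sup>2) - (3 * d1 + d0) / (4 * r)) * (b - x)" for x
  have quadL: "((\<lambda>x. A + D * (x - a) + G * (x - a)\<^sup>2) has_real_derivative D + 2 * G * (x - a)) (at x within S)"
    for A D G x S by (auto intro!: derivative_eq_intros simp: algebra_simps)
  have quadR: "((\<lambda>x. A - D * (b - x) - G * (b - x)\<^sup>2) has_real_derivative D + 2 * G * (b - x)) (at x within S)"
    for A D G x S by (auto intro!: derivative_eq_intros simp: algebra_simps)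
  have LD: "(L has_real_derivative L' x) (at x within S)" for x S
    unfolding L_def L'_def by (rule quadL)
  have RD: "(R has_real_derivative R' x) (at x within S)" for x S
    unfolding R_def R'_def by (rule quadR)
  have eq: "L m = R m" using r(1) by (simp add: L_def R_def r(2,3) field_simps power2_eq_square)
  have eq': "L' m = R' m" using r(1) by (simp add: L'_def R'_def r(2,3) field_simps power2_eq_square)
  have "((\<lambda>x. if x \<in> {..m} then L x else R x) has_vector_derivative
      (if x \<in> {..m} then L' x else R' x)) (at x within UNIV)"
    by (rule has_vector_derivative_If_within_closures [where T = "{m<..}"])
      (use eq eq' LD RD in \<open>auto simp: has_real_derivative_iff_has_vector_derivative [symmetric]\<close>)
  then have "((\<lambda>x. if x \<in> {..m} then L x else R x) has_real_derivative
      (if x \<in> {..m} then L' x else R' x)) (at x)"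
    by (simp add: has_real_derivative_iff_has_vector_derivative)
  moreover have "(\<lambda>x. if x \<in> {..m} then L x else R x) = pwq a b v0 v1 d0 d1"
    by (rule ext) (simp add: pwq_def Let_def L_def R_def r_def m_def)
  moreover have "(if x \<in> {..m} then L' x else R' x) = pwq' a b v0 v1 d0 d1 x"
    by (simp add: pwq'_def Let_def L'_def R'_def r_def m_def)
  ultimately show ?thesis by (simp add: has_field_derivative_at_within)
qed

lemma pwq'_continuous:
  assumes "a < b"
  shows "continuous_on T (pwq' a b v0 v1 d0 d1)"
proof -
  define r where "r = (b - a) / 2"
  define m where "m = (a + b) / 2"
  have r: "r > 0" "b = a + 2 * r" "m = a + r" using assms by (auto simp: r_def m_def field_simps)
  have "continuous_on T (\<lambda>x. if x \<le> m
      then d0 + 2 * ((v1 - v0) / (2 * r\<^sup>2) - (3 * d0 + d1) / (4 * r)) * (x - a)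
      else d1 + 2 * ((v1 - v0) / (2 * r\<^sup>2) - (3 * d1 + d0) / (4 * r)) * (b - x))"
    using r(1) by (intro continuous_on_cases_1 continuous_intros)
      (simp add: r(2,3) field_simps power2_eq_square)
  moreover have "pwq' a b v0 v1 d0 d1 = (\<lambda>x. if x \<le> m
      then d0 + 2 * ((v1 - v0) / (2 * r\<^sup>2) - (3 * d0 + d1) / (4 * r)) * (x - a)
      else d1 + 2 * ((v1 - v0) / (2 * r\<^sup>2) - (3 * d1 + d0) / (4 * r)) * (b - x))"
    by (rule ext) (simp add: pwq'_def Let_def r_def m_def)
  ultimately show ?thesis by simp
qed

lemma pwq_spec:
  assumes "a < b"
  shows "C1_pw_quadratic a b (pwq a b v0 v1 d0 d1)"
    and "pwq a b v0 v1 d0 d1 a = v0" and "pwq a b v0 v1 d0 d1 b = v1"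
    and "pwq' a b v0 v1 d0 d1 a = d0" and "pwq' a b v0 v1 d0 d1 b = d1"
proof -
  define r where "r = (b - a) / 2"
  define p where "p = ((v1 - v0) / (2 * r\<^sup>2) - (3 * d0 + d1) / (4 * r))"
  define q where "q = ((v1 - v0) / (2 * r\<^sup>2) - (3 * d1 + d0) / (4 * r))"
  have r: "r > 0" "b = a + 2 * r" using assms by (auto simp: r_def field_simps)
  have e: "pwq a b v0 v1 d0 d1 x = (if x \<le> (a + b) / 2
      then v0 + d0 * (x - a) + p * (x - a)\<^sup>2 else v1 - d1 * (b - x) - q * (b - x)\<^sup>2)" for x
    by (simp add: pwq_def Let_def r_def p_def q_def)
  have mid: "v0 + d0 * (x - a) + p * (x - a)\<^sup>2 = v1 - d1 * (b - x) - q * (b - x)\<^sup>2"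
    if "x = (a + b) / 2" for x
    using r(1) by (simp add: that p_def q_def r(2) field_simps power2_eq_square)
  have 1: "\<exists>\<alpha> \<beta> \<gamma>. \<forall>x \<in> {a..(a + b) / 2}. pwq a b v0 v1 d0 d1 x = \<alpha> + \<beta> * x + \<gamma> * x\<^sup>2"
    by (rule exI [of _ "v0 - d0 * a + p * a\<^sup>2"], rule exI [of _ "d0 - 2 * p * a"], rule exI [of _ p])
      (auto simp: e algebra_simps power2_eq_square)
  have 2: "\<exists>\<alpha> \<beta> \<gamma>. \<forall>x \<in> {(a + b) / 2..b}. pwq a b v0 v1 d0 d1 x = \<alpha> + \<beta> * x + \<gamma> * x\<^sup>2"
  proof (rule exI [of _ "v1 - d1 * b - q * b\<^sup>2"], rule exI [of _ "d1 + 2 * q * b"],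
      rule exI [of _ "- q"], rule ballI)
    fix x assume "x \<in> {(a + b) / 2..b}"
    then have "pwq a b v0 v1 d0 d1 x = v1 - d1 * (b - x) - q * (b - x)\<^sup>2"
      using mid [of x] by (auto simp: e)
    then show "pwq a b v0 v1 d0 d1 x = (v1 - d1 * b - q * b\<^sup>2) + (d1 + 2 * q * b) * x + - q * x\<^sup>2"
      by (simp add: algebra_simps power2_eq_square)
  qed
  show "C1_pw_quadratic a b (pwq a b v0 v1 d0 d1)"
    unfolding C1_pw_quadratic_def
    using 1 2 pwq_deriv [OF assms] pwq'_continuous [OF assms] by blast
  show "pwq a b v0 v1 d0 d1 a = v0" "pwq a b v0 v1 d0 d1 b = v1"
    "pwq' a b v0 v1 d0 d1 a = d0" "pwq' a b v0 v1 d0 d1 b = d1"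
    using assms by (simp_all add: pwq_def pwq'_def Let_def)
qed

lemma real_derivative_unique_Icc:
  assumes "p < q" "x \<in> {p..q}"
    and "(v has_real_derivative D) (at x within {p..q})"
    and "(v has_real_derivative D') (at x within {p..q})"
  shows "D = D'"
  using vector_derivative_unique_within_closed_interval [of p q x v D D'] assms
  by (simp add: has_real_derivative_iff_has_vector_derivative)

lemma C1_pw_quadratic_unique:
  assumes ab: "a < b" and v: "C1_pw_quadratic a b v"
    and d0: "(v has_real_derivative d0) (at a within {a..b})"
    and d1: "(v has_real_derivative d1) (at b within {a..b})"
    and x: "x \<in> {a..b}"
  shows "v x = pwq a b (v a) (v b) d0 d1 x"
proof -
  define r where "r = (b - a) / 2"
  define m where "m = (a + b) / 2"
  have r: "r > 0" "b = a + 2 * r" "m = a + r" using ab by (auto simp: r_def m_def field_simps)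
  obtain v' \<alpha> \<beta> \<gamma> \<alpha>' \<beta>' \<gamma>' where
    v': "\<And>x. x \<in> {a..b} \<Longrightarrow> (v has_real_derivative v' x) (at x within {a..b})" and
    l: "\<And>x. x \<in> {a..m} \<Longrightarrow> v x = \<alpha> + \<beta> * x + \<gamma> * x\<^sup>2" and
    u: "\<And>x. x \<in> {m..b} \<Longrightarrow> v x = \<alpha>' + \<beta>' * x + \<gamma>' * x\<^sup>2"
    using v unfolding C1_pw_quadratic_def m_def by blast
  have L: "(v has_real_derivative \<beta> + 2 * \<gamma> * x) (at x within {a..m})" if "x \<in> {a..m}" for x
    by (rule has_field_derivative_transform_within [where d = 1 and f = "\<lambda>x. \<alpha> + \<beta> * x + \<gamma> * x\<^sup>2"])
       (use that in \<open>auto simp: l intro!: derivative_eq_intros\<close>)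
  have U: "(v has_real_derivative \<beta>' + 2 * \<gamma>' * x) (at x within {m..b})" if "x \<in> {m..b}" for x
    by (rule has_field_derivative_transform_within [where d = 1 and f = "\<lambda>x. \<alpha>' + \<beta>' * x + \<gamma>' * x\<^sup>2"])
       (use that in \<open>auto simp: u intro!: derivative_eq_intros\<close>)
  have am: "a < m" "m < b" using r by auto
  have sub: "(v has_real_derivative D) (at x within {a..m})" "(v has_real_derivative D) (at x within {m..b})"
    if "(v has_real_derivative D) (at x within {a..b})" for D x
    by (rule DERIV_subset [OF that], use am in auto)+
  have e1: "d0 = \<beta> + 2 * \<gamma> * a"
    by (rule real_derivative_unique_Icc [OF am(1) _ sub(1) [OF d0] L]) (use am in auto)
  have e2: "d1 = \<beta>' + 2 * \<gamma>' * b"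
    by (rule real_derivative_unique_Icc [OF am(2) _ sub(2) [OF d1] U]) (use am in auto)
  have e3: "v' m = \<beta> + 2 * \<gamma> * m"
    by (rule real_derivative_unique_Icc [OF am(1) _ sub(1) [OF v'] L]) (use am in auto)
  have e4: "v' m = \<beta>' + 2 * \<gamma>' * m"
    by (rule real_derivative_unique_Icc [OF am(2) _ sub(2) [OF v'] U]) (use am in auto)
  have e5: "\<alpha> + \<beta> * m + \<gamma> * m\<^sup>2 = \<alpha>' + \<beta>' * m + \<gamma>' * m\<^sup>2"
    using l [of m] u [of m] am by simp
  have va: "v a = \<alpha> + \<beta> * a + \<gamma> * a\<^sup>2" and vb: "v b = \<alpha>' + \<beta>' * b + \<gamma>' * b\<^sup>2"
    using l [of a] u [of b] am by simp_all
  have s1: "d0 + 2 * \<gamma> * r = d1 - 2 * \<gamma>' * r"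
    using e1 e2 e3 e4 by (simp add: r(2,3) algebra_simps)
  have s2: "v a + d0 * r + \<gamma> * r\<^sup>2 = v b - d1 * r + \<gamma>' * r\<^sup>2"
  proof -
    have "v a + d0 * r + \<gamma> * r\<^sup>2 = \<alpha> + \<beta> * (a + r) + \<gamma> * (a + r)\<^sup>2"
      unfolding va e1 by (simp add: algebra_simps power2_eq_square)
    moreover have "v b - d1 * r + \<gamma>' * r\<^sup>2 = \<alpha>' + \<beta>' * (b - r) + \<gamma>' * (b - r)\<^sup>2"
      unfolding vb e2 by (simp add: algebra_simps power2_eq_square)
    moreover have "a + r = m" "b - r = m" using r by auto
    ultimately show ?thesis using e5 by simp
  qed
  have s1': "\<gamma>' * r = (d1 - d0) / 2 - \<gamma> * r" using s1 by (simp add: field_simps)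
  then have "\<gamma>' * r\<^sup>2 = ((d1 - d0) / 2 - \<gamma> * r) * r" by (simp add: power2_eq_square flip: mult.assoc)
  then have "\<gamma>' * r\<^sup>2 = (d1 * r - d0 * r) / 2 - \<gamma> * r\<^sup>2"
    by (simp add: algebra_simps power2_eq_square diff_divide_distrib)
  with s2 have "\<gamma> * r\<^sup>2 = (v b - v a) / 2 - (3 * (d0 * r) + d1 * r) / 4"
    by (simp add: field_simps)
  then have "\<gamma> = ((v b - v a) / 2 - (3 * (d0 * r) + d1 * r) / 4) / r\<^sup>2"
    using r(1) by (simp add: nonzero_eq_divide_eq)
  also have "\<dots> = (v b - v a) / (2 * r\<^sup>2) - (3 * d0 + d1) / (4 * r)"
    using r(1) by (simp add: field_simps power2_eq_square)
  finally have g: "\<gamma> = (v b - v a) / (2 * r\<^sup>2) - (3 * d0 + d1) / (4 * r)" .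
  have g': "\<gamma>' = - ((v b - v a) / (2 * r\<^sup>2) - (3 * d1 + d0) / (4 * r))"
  proof -
    have "\<gamma>' = (d1 - d0) / (2 * r) - \<gamma>" using s1' r(1) by (simp add: field_simps)
    moreover have "(d1 - d0) / (2 * r) = (2 * d1 - 2 * d0) / (4 * r)"
      using r(1) by (simp add: field_simps)
    ultimately show ?thesis unfolding g by (simp add: diff_divide_distrib add_divide_distrib)
  qed
  show ?thesis
  proof (cases "x \<le> m")
    case True
    have "v x = v a + d0 * (x - a) + \<gamma> * (x - a)\<^sup>2"
      using l [of x] x True unfolding va e1 by (simp add: algebra_simps power2_eq_square)
    then show ?thesis using True by (simp add: pwq_def Let_def g r_def m_def)
  next
    case False
    have "v x = v b - d1 * (b - x) + \<gamma>' * (b - x)\<^sup>2"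
      using u [of x] x False unfolding vb e2 by (simp add: algebra_simps power2_eq_square)
    moreover have "(v b - v a) / (2 * r\<^sup>2) - (3 * d1 + d0) / (4 * r) = - \<gamma>'"
      unfolding g' by simp
    ultimately show ?thesis
      using False unfolding pwq_def Let_def r_def [symmetric] m_def [symmetric] by simp
  qed
qed

lemma phi_explicit:
  assumes "a < b"
  shows "is_phi a b e (phi (a, b) e)"
    and "x \<in> {a..b} \<Longrightarrow> phi (a, b) e x = pwq a b (of_bool (a = e)) (of_bool (b = e)) 0 0 x"
proof -
  have "is_phi a b e (pwq a b (of_bool (a = e)) (of_bool (b = e)) 0 0)"
    using pwq_spec [OF assms, of "of_bool (a = e)" "of_bool (b = e)" 0 0]
      pwq_deriv [OF assms, of "of_bool (a = e)" "of_bool (b = e)" 0 0]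
    unfolding is_phi_def by (metis insertE singletonD)
  then show *: "is_phi a b e (phi (a, b) e)" unfolding phi.simps by (rule someI [where P = "is_phi a b e"])
  show "phi (a, b) e x = pwq a b (of_bool (a = e)) (of_bool (b = e)) 0 0 x" if "x \<in> {a..b}"
    using * C1_pw_quadratic_unique [OF assms _ _ _ that, of "phi (a, b) e" 0 0]
    unfolding is_phi_def by simp
qed

lemma psi_explicit:
  assumes "a < b"
  shows "is_psi a b e (psi (a, b) e)"
    and "x \<in> {a..b} \<Longrightarrow> psi (a, b) e x = pwq a b 0 0 (of_bool (a = e)) (of_bool (b = e)) x"
proof -
  have "is_psi a b e (pwq a b 0 0 (of_bool (a = e)) (of_bool (b = e)))"
    using pwq_spec [OF assms, of 0 0 "of_bool (a = e)" "of_bool (b = e)"]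
      pwq_deriv [OF assms, of 0 0 "of_bool (a = e)" "of_bool (b = e)"]
    unfolding is_psi_def by (metis insertE singletonD)
  then show *: "is_psi a b e (psi (a, b) e)" unfolding psi.simps by (rule someI [where P = "is_psi a b e"])
  show "psi (a, b) e x = pwq a b 0 0 (of_bool (a = e)) (of_bool (b = e)) x" if "x \<in> {a..b}"
    using * C1_pw_quadratic_unique [OF assms _ _ _ that, of "psi (a, b) e"
        "of_bool (a = e)" "of_bool (b = e)"]
    unfolding is_psi_def by simp
qed

lemma psi_dual_integral:
  assumes "a < b" "k \<in> {a, b}"
  shows "integral {a..b} (\<lambda>x. vector_derivative (psi (a, b) k) (at x within {a..b}) *
      (\<alpha> * (psi (a, b) a x + psi (a, b) b x) +
       \<beta> * (((x - (a + b) / 2) / ((b - a) / 2))\<^sup>2 - 1 / 6)))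
    = \<alpha> * ((b - a) / 2)\<^sup>2 * (if k = a then 1 else - 1) / 12 + \<beta> * ((b - a) / 2) / 6"
proof -
  define r where "r = (b - a) / 2"
  define m where "m = (a + b) / 2"
  have r: "r > 0" "b = a + 2 * r" "m = a + r" using assms by (auto simp: r_def m_def field_simps)
  define d0 d1 :: real where "d0 = of_bool (a = k)" and "d1 = of_bool (b = k)"
  have vd: "vector_derivative (psi (a, b) k) (at x within {a..b}) = pwq' a b 0 0 d0 d1 x"
    if "x \<in> {a..b}" for x
  proof -
    have "(psi (a, b) k has_real_derivative pwq' a b 0 0 d0 d1 x) (at x within {a..b})"
      by (rule has_field_derivative_transform_within [OF pwq_deriv [OF assms(1)], where d = 1])
        (use that psi_explicit(2) [OF assms(1)] in \<open>auto simp: d0_def d1_def\<close>)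
    then show ?thesis
      using that assms(1) vector_derivative_within_cbox [of a b x "psi (a, b) k"]
      by (simp add: has_real_derivative_iff_has_vector_derivative)
  qed
  define F where "F x = vector_derivative (psi (a, b) k) (at x within {a..b}) *
      (\<alpha> * (psi (a, b) a x + psi (a, b) b x) + \<beta> * (((x - m) / r)\<^sup>2 - 1 / 6))" for x
  define c c' where "c = 2 * ((3 * d0 + d1) / (4 * r))" and "c' = 2 * ((3 * d1 + d0) / (4 * r))"
  have Fl: "F x = (d0 - c * (x - a)) * (\<alpha> * ((x - a) - (x - a)\<^sup>2 / r) +
      \<beta> * ((x - a)\<^sup>2 / r\<^sup>2 - 2 * (x - a) / r + 5 / 6))" if "x \<in> {a..m}" for x
  proof -
    have xab: "x \<in> {a..b}" "x \<le> (a + b) / 2" using that r by (auto simp: m_def)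
    have 1: "pwq' a b 0 0 d0 d1 x = d0 - c * (x - a)"
      using xab by (simp add: pwq'_def Let_def c_def flip: r_def)
    have 2: "psi (a, b) a x + psi (a, b) b x = (x - a) - (x - a)\<^sup>2 / r"
      unfolding psi_explicit(2) [OF assms(1) xab(1)] pwq_def Let_def r_def [symmetric]
      using xab r(1) assms(1) by (simp add: field_simps)
    have 3: "((x - m) / r)\<^sup>2 - 1 / 6 = (x - a)\<^sup>2 / r\<^sup>2 - 2 * (x - a) / r + 5 / 6"
      using r(1) by (simp add: r(3) field_simps power2_eq_square)
    show ?thesis unfolding F_def vd [OF xab(1)] 1 2 3 ..
  qed
  have Fr: "F x = (d1 - c' * (b - x)) * (- \<alpha> * ((b - x) - (b - x)\<^sup>2 / r) +
      \<beta> * ((b - x)\<^sup>2 / r\<^sup>2 - 2 * (b - x) / r + 5 / 6))" if "x \<in> {m<..b}" for x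
  proof -
    have xab: "x \<in> {a..b}" "\<not> x \<le> (a + b) / 2" using that r by (auto simp: m_def)
    have 1: "pwq' a b 0 0 d0 d1 x = d1 - c' * (b - x)"
      using xab by (simp add: pwq'_def Let_def c'_def flip: r_def)
    have 2: "psi (a, b) a x + psi (a, b) b x = - ((b - x) - (b - x)\<^sup>2 / r)"
      unfolding psi_explicit(2) [OF assms(1) xab(1)] pwq_def Let_def r_def [symmetric]
      using xab r(1) assms(1) by (simp add: field_simps)
    have 3: "((x - m) / r)\<^sup>2 - 1 / 6 = (b - x)\<^sup>2 / r\<^sup>2 - 2 * (b - x) / r + 5 / 6"
      using r(1) by (simp add: r(2,3) field_simps power2_eq_square)
    show ?thesis unfolding F_def vd [OF xab(1)] 1 2 3 minus_mult_commute ..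
  qed
  define G where "G d c \<alpha> t =
     d * \<alpha> * (t\<^sup>2 / 2 - t ^ 3 / (3 * r)) + d * \<beta> * (t ^ 3 / (3 * r\<^sup>2) - t\<^sup>2 / r + 5 * t / 6)
     - c * \<alpha> * (t ^ 3 / 3 - t ^ 4 / (4 * r)) - c * \<beta> * (t ^ 4 / (4 * r\<^sup>2) - 2 * t ^ 3 / (3 * r) + 5 * t\<^sup>2 / 12)"
    for d c \<alpha> t
  have GD: "(G d c \<alpha> has_real_derivative
      (d - c * t) * (\<alpha> * (t - t\<^sup>2 / r) + \<beta> * (t\<^sup>2 / r\<^sup>2 - 2 * t / r + 5 / 6))) (at t)" for d c \<alpha> t
  proof -
    define k1 k2 k3 k4 where "k1 = d * \<beta> * 5 / 6"
      and "k2 = d * \<alpha> / 2 - d * \<beta> / r - c * \<beta> * 5 / 12"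
      and "k3 = d * \<beta> / (3 * r\<^sup>2) - d * \<alpha> / (3 * r) - c * \<alpha> / 3 + 2 * c * \<beta> / (3 * r)"
      and "k4 = c * \<alpha> / (4 * r) - c * \<beta> / (4 * r\<^sup>2)"
    have "((\<lambda>t. k1 * t + k2 * t ^ 2 + k3 * t ^ 3 + k4 * t ^ 4) has_real_derivative
        k1 + 2 * k2 * t + 3 * k3 * t\<^sup>2 + 4 * k4 * t ^ 3) (at t)"
      by (auto intro!: derivative_eq_intros simp: algebra_simps)
    moreover have "G d c \<alpha> = (\<lambda>t. k1 * t + k2 * t ^ 2 + k3 * t ^ 3 + k4 * t ^ 4)"
      unfolding G_def k1_def k2_def k3_def k4_def
      by (rule ext) (simp add: algebra_simps diff_divide_distrib add_divide_distrib)
    moreover have "k1 + 2 * k2 * t + 3 * k3 * t\<^sup>2 + 4 * k4 * t ^ 3 =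
        (d - c * t) * (\<alpha> * (t - t\<^sup>2 / r) + \<beta> * (t\<^sup>2 / r\<^sup>2 - 2 * t / r + 5 / 6))"
      using r(1) unfolding k1_def k2_def k3_def k4_def
      by (simp add: field_simps power2_eq_square power3_eq_cube)
    ultimately show ?thesis by simp
  qed
  have hl: "(F has_integral G d0 c \<alpha> (m - a) - G d0 c \<alpha> (a - a)) {a..m}"
  proof (rule fundamental_theorem_of_calculus)
    fix x assume x: "x \<in> {a..m}"
    have "((\<lambda>x. G d0 c \<alpha> (x - a)) has_real_derivative F x) (at x)"
      unfolding Fl [OF x] by (rule DERIV_chain2 [OF GD, THEN DERIV_cong]) (auto intro!: derivative_eq_intros)
    then show "((\<lambda>x. G d0 c \<alpha> (x - a)) has_vector_derivative F x) (at x within {a..m})"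
      by (simp add: has_field_derivative_at_within flip: has_real_derivative_iff_has_vector_derivative)
  qed (use r in auto)
  define R where "R x = (d1 - c' * (b - x)) * (- \<alpha> * ((b - x) - (b - x)\<^sup>2 / r) +
      \<beta> * ((b - x)\<^sup>2 / r\<^sup>2 - 2 * (b - x) / r + 5 / 6))" for x
  have "(R has_integral - G d1 c' (- \<alpha>) (b - b) - - G d1 c' (- \<alpha>) (b - m)) {m..b}"
  proof (rule fundamental_theorem_of_calculus)
    fix x assume x: "x \<in> {m..b}"
    have "((\<lambda>x. - G d1 c' (- \<alpha>) (b - x)) has_real_derivative R x) (at x)"
      unfolding R_def
      by (rule derivative_eq_intros DERIV_chain2 [OF GD] refl)+ simp
    then show "((\<lambda>x. - G d1 c' (- \<alpha>) (b - x)) has_vector_derivative R x) (at x within {m..b})"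
      by (simp add: has_field_derivative_at_within flip: has_real_derivative_iff_has_vector_derivative)
  qed (use r in auto)
  then have hr: "(F has_integral - G d1 c' (- \<alpha>) (b - b) - - G d1 c' (- \<alpha>) (b - m)) {m..b}"
    by (rule has_integral_spike_finite [of "{m}", rotated 2]) (auto simp: Fr R_def)
  have "(F has_integral (G d0 c \<alpha> (m - a) - G d0 c \<alpha> (a - a)) +
      (- G d1 c' (- \<alpha>) (b - b) - - G d1 c' (- \<alpha>) (b - m))) {a..b}"
    by (rule has_integral_combine [OF _ _ hl hr]) (use r in auto)
  also have "(G d0 c \<alpha> (m - a) - G d0 c \<alpha> (a - a)) +
      (- G d1 c' (- \<alpha>) (b - b) - - G d1 c' (- \<alpha>) (b - m))
     = \<alpha> * r\<^sup>2 * (d0 - d1) / 12 + \<beta> * r * (d0 + d1) / 6"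
    using r(1) unfolding G_def c_def c'_def r(2,3)
    by (simp add: field_simps power2_eq_square power3_eq_cube power4_eq_xxxx)
  also have "\<dots> = \<alpha> * r\<^sup>2 * (if k = a then 1 else - 1) / 12 + \<beta> * r / 6"
    using assms by (auto simp: d0_def d1_def)
  finally show ?thesis
    unfolding F_def r_def m_def by (rule integral_unique)
qed

lemma dual_explicit:
  assumes "a < b" "e \<in> {a, b}"
  shows "is_dual a b e (dual (a, b) e)"
    and "dual (a, b) e = (\<lambda>x. (if e = a then 6 else - 6) / ((b - a) / 2)\<^sup>2 * (psi (a, b) a x + psi (a, b) b x) +
            3 / ((b - a) / 2) * (((x - (a + b) / 2) / ((b - a) / 2))\<^sup>2 - 1 / 6))"
proof -
  define r where "r = (b - a) / 2"
  have r: "r > 0" using assms by (simp add: r_def)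
  let ?d = "\<lambda>\<alpha> \<beta> x. \<alpha> * (psi (a, b) a x + psi (a, b) b x) +
            \<beta> * (((x - (a + b) / 2) / ((b - a) / 2))\<^sup>2 - 1 / 6)"
  have "is_dual a b e (?d ((if e = a then 6 else - 6) / r\<^sup>2) (3 / r))"
    unfolding is_dual_def
  proof (intro conjI ballI)
    show "\<exists>\<alpha> \<beta>. \<forall>x. ?d ((if e = a then 6 else - 6) / r\<^sup>2) (3 / r) x = ?d \<alpha> \<beta> x"
      by blast
    fix k assume k: "k \<in> {a, b}"
    show "integral {a..b} (\<lambda>x. vector_derivative (psi (a, b) k) (at x within {a..b}) *
        ?d ((if e = a then 6 else - 6) / r\<^sup>2) (3 / r) x) = of_bool (k = e)"
      by (rule trans [OF psi_dual_integral [OF assms(1) k]]) (use k r assms in \<open>auto simp flip: r_def\<close>)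
  qed
  then show *: "is_dual a b e (dual (a, b) e)" unfolding dual.simps by (rule someI [where P = "is_dual a b e"])
  then obtain \<alpha> \<beta> where d: "dual (a, b) e = ?d \<alpha> \<beta>"
    unfolding is_dual_def by blast
  have "\<alpha> * r\<^sup>2 * (if k = a then 1 else - 1) / 12 + \<beta> * r / 6 = of_bool (k = e)" if "k \<in> {a, b}" for k
  proof -
    have I: "integral {a..b} (\<lambda>x. vector_derivative (psi (a, b) k) (at x within {a..b}) * ?d \<alpha> \<beta> x)
        = of_bool (k = e)"
      using * that unfolding is_dual_def d by blast
    show ?thesis
      using trans [OF sym [OF psi_dual_integral [OF assms(1) that]] I] unfolding r_def .
  qed
  from this [of a] this [of b] have "\<beta> * r = 3" "\<alpha> * r\<^sup>2 = (if e = a then 6 else - 6)"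
    using assms by (auto split: if_splits)
  then have "\<beta> = 3 / r" "\<alpha> = (if e = a then 6 else - 6) / r\<^sup>2"
    using r by (auto simp: field_simps)
  then show "dual (a, b) e = ?d ((if e = a then 6 else - 6) / ((b - a) / 2)\<^sup>2) (3 / ((b - a) / 2))"
    unfolding d r_def by simp
qed


section \<open>The quasi-interpolant\<close>

definition nodal_interp :: "(real \<times> real \<Rightarrow> real) \<Rightarrow> itv \<Rightarrow> itv \<Rightarrow> real \<times> real \<Rightarrow> real" where
  "nodal_interp u J K = (\<lambda>(x, y).
     \<Sum>\<xi> \<in> nodes3 J. \<Sum>\<eta> \<in> nodes3 K. u (\<xi>, \<eta>) * lagrange J \<xi> x * lagrange K \<eta> y)"

text \<open>\<open>HEdge J g\<close> is the edge \<open>J \<times> {g}\<close>, and \<open>VEdge e K\<close> is the edge \<open>{e} \<times> K\<close>.\<close>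

datatype edge = HEdge itv real | VEdge real itv

fun edge_points :: "edge \<Rightarrow> (real \<times> real) set" where
  "edge_points (HEdge (a, b) g) = {a..b} \<times> {g}"
| "edge_points (VEdge e (a, b)) = {e} \<times> {a..b}"

definition corner_macro_edges :: "real \<Rightarrow> nat \<Rightarrow> edge set" where
  "corner_macro_edges lam N =
     {HEdge J g | J K g. J \<in> fine_macros lam N \<and> K \<in> fine_macros lam N \<and> g \<in> ends K} \<union>
     {VEdge e K | J K e. J \<in> fine_macros lam N \<and> K \<in> fine_macros lam N \<and> e \<in> ends J}"

definition edge_assignment :: "real \<Rightarrow> nat \<Rightarrow> (real \<times> real \<Rightarrow> edge) \<Rightarrow> bool" where
  "edge_assignment lam N \<sigma> \<longleftrightarrow>
     (\<forall>J \<in> fine_macros lam N. \<forall>K \<in> fine_macros lam N. \<forall>X \<in> ends J \<times> ends K.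
        \<sigma> X \<in> corner_macro_edges lam N \<and> X \<in> edge_points (\<sigma> X))"

fun twist_coeff :: "(real \<times> real \<Rightarrow> real) \<Rightarrow> edge \<Rightarrow> real \<times> real \<Rightarrow> real" where
  "twist_coeff u (HEdge J g) X =
     integral {fst J..snd J} (\<lambda>x. pd 1 1 u (x, g) * dual J (fst X) x)"
| "twist_coeff u (VEdge e K) X =
     integral {fst K..snd K} (\<lambda>y. pd 1 1 u (e, y) * dual K (snd X) y)"

definition corner_interp ::
  "(real \<times> real \<Rightarrow> edge) \<Rightarrow> (real \<times> real \<Rightarrow> real) \<Rightarrow> itv \<Rightarrow> itv \<Rightarrow> real \<times> real \<Rightarrow> real" where
  "corner_interp \<sigma> u J K = (\<lambda>(x, y).
     \<Sum>e \<in> ends J. \<Sum>g \<in> ends K.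
       u (e, g) * phi J e x * phi K g y +
       pd 1 0 u (e, g) * psi J e x * phi K g y +
       pd 0 1 u (e, g) * phi J e x * psi K g y +
       twist_coeff u (\<sigma> (e, g)) (e, g) * psi J e x * psi K g y)"

text \<open>Slope used at \<open>(\<xi>, \<eta>)\<close>, where \<open>\<xi>\<close> is a node of the coarse interval \<open>J\<close>. At the interface with
  \<open>\<Omega>\<^sub>0\<close> the nodal interpolant is the one on the adjacent mesh element in the closure of \<open>\<Omega>\<^sub>0\<close>;
  the derivative of that polynomial is its one-sided derivative from within \<open>\<Omega>\<^sub>0\<close>.\<close>

definition normal_slope ::
  "real \<Rightarrow> nat \<Rightarrow> (real \<times> real \<Rightarrow> real) \<Rightarrow> itv \<Rightarrow> real \<Rightarrow> real \<Rightarrow> real" where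
  "normal_slope lam N u J \<xi> \<eta> =
     (let p = N div 4; q = 3 * N div 4 in
      if \<eta> = lam then
        deriv (\<lambda>y. nodal_interp u J (mesh_point lam N p, mesh_point lam N (p + 1)) (\<xi>, y)) \<eta>
      else if \<eta> = 1 - lam then
        deriv (\<lambda>y. nodal_interp u J (mesh_point lam N (q - 1), mesh_point lam N q) (\<xi>, y)) \<eta>
      else pd 0 1 u (\<xi>, \<eta>))"

definition h_edge_interp ::
  "real \<Rightarrow> nat \<Rightarrow> (real \<times> real \<Rightarrow> real) \<Rightarrow> itv \<Rightarrow> itv \<Rightarrow> real \<times> real \<Rightarrow> real" where
  "h_edge_interp lam N u J K = (\<lambda>(x, y).
     \<Sum>\<xi> \<in> nodes3 J. \<Sum>\<eta> \<in> ends K.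
       lagrange J \<xi> x * (u (\<xi>, \<eta>) * phi K \<eta> y + normal_slope lam N u J \<xi> \<eta> * psi K \<eta> y))"

definition v_edge_interp ::
  "real \<Rightarrow> nat \<Rightarrow> (real \<times> real \<Rightarrow> real) \<Rightarrow> itv \<Rightarrow> itv \<Rightarrow> real \<times> real \<Rightarrow> real" where
  "v_edge_interp lam N u J K = (\<lambda>(x, y). h_edge_interp lam N (\<lambda>(y, x). u (x, y)) K J (y, x))"

text \<open>The local definitions are put together on the open (macro-)elements, which are pairwise
  disjoint; on the null set formed by their edges the value is irrelevant (here it is 0).
  The local formulas have equal traces on common edges, except that at the four corners of
  \<open>\<Omega>\<^sub>0\<close> the nodal derivatives used on either side differ in general, so that there may be a jump
  across the eight macro-element edges that end in such a corner and separate a corner region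
  from an edge region. The \<open>H\<^sup>1\<close> semi-norm of the error is therefore understood elementwise.\<close>

definition quasi_interp ::
  "real \<Rightarrow> nat \<Rightarrow> (real \<times> real \<Rightarrow> edge) \<Rightarrow> (real \<times> real \<Rightarrow> real) \<Rightarrow> real \<times> real \<Rightarrow> real" where
  "quasi_interp lam N \<sigma> u z =
     (\<Sum>J \<in> coarse_cells lam N. \<Sum>K \<in> coarse_cells lam N.
        indicator (open_rect J K) z * nodal_interp u J K z) +
     (\<Sum>J \<in> fine_macros lam N. \<Sum>K \<in> fine_macros lam N.
        indicator (open_rect J K) z * corner_interp \<sigma> u J K z) +
     (\<Sum>J \<in> coarse_cells lam N. \<Sum>K \<in> fine_macros lam N.
        indicator (open_rect J K) z * h_edge_interp lam N u J K z) +
     (\<Sum>J \<in> fine_macros lam N. \<Sum>K \<in> coarse_cells lam N.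
        indicator (open_rect J K) z * v_edge_interp lam N u J K z)"

definition macro_H2_error ::
  "real \<Rightarrow> nat \<Rightarrow> (real \<times> real \<Rightarrow> real) \<Rightarrow> real" where
  "macro_H2_error lam N w =
     sqrt (\<Sum>(J, K) \<in> macro_elements lam N. (H_seminorm_on 2 (rect J K) w)\<^sup>2)"

definition Omega1 :: "real \<Rightarrow> (real \<times> real) set" where
  "Omega1 lam = {lam<..<1 - lam} \<times> {0<..<lam}"

definition Omega2 :: "real \<Rightarrow> (real \<times> real) set" where
  "Omega2 lam = {0<..<lam} \<times> {lam<..<1 - lam}"

definition Omega3 :: "real \<Rightarrow> (real \<times> real) set" where
  "Omega3 lam = {lam<..<1 - lam} \<times> {1 - lam<..<1}"

definition Omega4 :: "real \<Rightarrow> (real \<times> real) set" where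
  "Omega4 lam = {1 - lam<..<1} \<times> {lam<..<1 - lam}"

end

theory Submission
  imports Defs
begin

text \<open>On every macro-element the error is split into one-dimensional interpolation errors: the
  Lagrange and Hermite operators reproduce quadratic polynomials and are stable, so Taylor expansion
  bounds their errors by third derivatives times powers of the mesh width. In the refined regions the
  mesh width is of order \<open>\<surd>\<epsilon> ln N / N\<close>, which compensates the negative powers of \<open>\<surd>\<epsilon>\<close> in the
  derivatives of the layers, and in \<open>\<Omega>\<^sub>0\<close> the layers themselves are of order \<open>N\<^sup>-\<^sup>3\<close>. At the
  interface, replacing the normal derivative and the dual functional by the exact derivatives
  only causes errors of the same order. The pointwise bounds are squared and integrated; the
  exponential decay gives the additional factor \<open>\<surd>\<epsilon>\<close> for the layers. For the improved bounds the
  error of the smooth part is instead bounded by integrals of its third derivatives over the mesh cells,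
  which are summed up to the \<open>H\<^sup>3\<close> semi-norm.\<close>

text \<open>Write s for the square root of epsilon. The obstacle is that u has only three
  derivatives and that third derivatives of S may be as large as 1/s. A product of one-dimensional
  errors of full order would need mixed derivatives beyond the third, so the tensor product error is
  mostly written as the error in one variable plus the interpolant in that variable of the error in
  the other one; stability then bounds the outer operator. Pointwise, S yields only order N^-2
  through its bounded second derivatives. Its error along the coarse direction is therefore carried
  as a separate term and is improved only where third derivatives are controlled in L2. Remainders
  are measured by the oscillation of the highest derivative used. A supremum bound and, via
  Cauchy-Schwarz, an integral can both supply it, so the Lagrange operator needs a single error
  lemma for the two kinds of estimates. All estimates are pointwise off the mesh lines, a null set.
  There the derivatives of the quasi-interpolant are explicit, and its possible jumps across edges
  do not matter. The case lambda = 1/4 is not excluded: it forces N to be bounded and is absorbed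
  into the constant.\<close>

text \<open>\<open>lag k a b f\<close> is the \<open>k\<close>-th derivative of the quadratic Lagrange interpolant of \<open>f\<close>, and
  \<open>her k a b f g\<close> is that of the \<open>C\<^sup>1\<close> piecewise quadratic function with the end values of \<open>f\<close> and the
  end slopes of \<open>g\<close>.\<close>

definition lag :: "nat \<Rightarrow> real \<Rightarrow> real \<Rightarrow> (real \<Rightarrow> real) \<Rightarrow> real \<Rightarrow> real" where
  "lag k a b f x =
     (let r = (b - a) / 2; m = (a + b) / 2; t = (x - m) / r in
      if k = 0 then f a * (t * (t - 1) / 2) + f m * (1 - t\<^sup>2) + f b * (t * (t + 1) / 2)
      else if k = 1 then (f a * (t - 1 / 2) - f m * (2 * t) + f b * (t + 1 / 2)) / r
      else if k = 2 then (f a - 2 * f m + f b) / r\<^sup>2 else 0)"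

definition her :: "nat \<Rightarrow> real \<Rightarrow> real \<Rightarrow> (real \<Rightarrow> real) \<Rightarrow> (real \<Rightarrow> real) \<Rightarrow> real \<Rightarrow> real" where
  "her k a b f g x =
     (if k = 0 then pwq a b (f a) (f b) (g a) (g b) x
      else if k = 1 then pwq' a b (f a) (f b) (g a) (g b) x
      else if k = 2 then
        (let r = (b - a) / 2 in
         if x \<le> (a + b) / 2
         then 2 * ((f b - f a) / (2 * r\<^sup>2) - (3 * g a + g b) / (4 * r))
         else - 2 * ((f b - f a) / (2 * r\<^sup>2) - (3 * g b + g a) / (4 * r)))
      else 0)"

section \<open>Linearity, differentiation and stability of the one-dimensional operators\<close>

lemma lag_add: "lag k a b (\<lambda>t. f t + g t) x = lag k a b f x + lag k a b g x"
  unfolding lag_def Let_def by (auto simp: algebra_simps add_divide_distrib diff_divide_distrib)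

lemma lag_diff: "lag k a b (\<lambda>t. f t - g t) x = lag k a b f x - lag k a b g x"
  unfolding lag_def Let_def by (auto simp: algebra_simps add_divide_distrib diff_divide_distrib)

lemma lag_cong:
  "f a = g a \<Longrightarrow> f ((a + b) / 2) = g ((a + b) / 2) \<Longrightarrow> f b = g b \<Longrightarrow> lag k a b f x = lag k a b g x"
  unfolding lag_def Let_def by auto

lemma her_add:
  "her k a b (\<lambda>t. f t + f' t) (\<lambda>t. g t + g' t) x = her k a b f g x + her k a b f' g' x"
  unfolding her_def Let_def pwq_def pwq'_def
  by (auto simp: algebra_simps add_divide_distrib diff_divide_distrib)

lemma her_diff:
  "her k a b (\<lambda>t. f t - f' t) (\<lambda>t. g t - g' t) x = her k a b f g x - her k a b f' g' x"
  unfolding her_def Let_def pwq_def pwq'_def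
  by (auto simp: algebra_simps add_divide_distrib diff_divide_distrib)

lemma her_cong:
  "f a = f' a \<Longrightarrow> f b = f' b \<Longrightarrow> g a = g' a \<Longrightarrow> g b = g' b \<Longrightarrow> her k a b f g x = her k a b f' g' x"
  unfolding her_def Let_def by auto

lemma nat_le_2_cases: "(k::nat) \<le> 2 \<Longrightarrow> k = 0 \<or> k = 1 \<or> k = 2"
  by auto

lemma lag_deriv:
  assumes "a < b" "k < 2"
  shows "(lag k a b f has_real_derivative lag (Suc k) a b f x) (at x within X)"
proof -
  define r m where "r = (b - a) / 2" and "m = (a + b) / 2"
  have r: "r > 0" using assms by (simp add: r_def)
  have "k = 0 \<or> k = 1" using assms by auto
  then show ?thesis
    unfolding lag_def Let_def r_def [symmetric] m_def [symmetric]
    by (elim disjE)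
      (use r in \<open>auto intro!: derivative_eq_intros simp: divide_simps power2_eq_square\<close>,
       simp_all add: algebra_simps)
qed

text \<open>The slope of a piecewise quadratic has a kink at the midpoint, so for
  \<open>k = 1\<close> the derivative exists only off it. Midpoints of macro-intervals are mesh
  points, hence avoided almost everywhere.\<close>

lemma her_deriv:
  assumes "a < b" "k < 2" "x \<noteq> (a + b) / 2"
  shows "(her k a b f g has_real_derivative her (Suc k) a b f g x) (at x within X)"
proof -
  have "k = 0 \<or> k = 1" using assms by auto
  then show ?thesis
  proof
    assume k: "k = 0"
    show ?thesis using pwq_deriv [OF assms(1), of "f a" "f b" "g a" "g b" x X]
      unfolding k her_def by simp
  next
    assume k: "k = 1"
    define m where "m = (a + b) / 2"
    consider "x < m" | "x > m" using assms(3) unfolding m_def by linarith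
    then have "(her k a b f g has_real_derivative her (Suc k) a b f g x) (at x)"
    proof cases
      case 1
      show ?thesis
        apply (rule has_field_derivative_transform_within_open [where S = "{..<m}" and
          f = "\<lambda>x. g a + 2 * ((f b - f a) / (2 * ((b - a) / 2)\<^sup>2) - (3 * g a + g b) / (4 * ((b - a) / 2))) * (x - a)"])
        using 1 by (auto simp: k her_def pwq'_def Let_def m_def intro!: derivative_eq_intros)
    next
      case 2
      show ?thesis
        apply (rule has_field_derivative_transform_within_open [where S = "{m<..}" and
          f = "\<lambda>x. g b + 2 * ((f b - f a) / (2 * ((b - a) / 2)\<^sup>2) - (3 * g b + g a) / (4 * ((b - a) / 2))) * (b - x)"])
        using 2 by (auto simp: k her_def pwq'_def Let_def m_def intro!: derivative_eq_intros)
    qed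
    then show ?thesis by (rule has_field_derivative_at_within)
  qed
qed

lemma abs_triangle3: "\<bar>x + y + z\<bar> \<le> \<bar>x\<bar> + \<bar>y\<bar> + \<bar>z :: real\<bar>"
  by linarith

text \<open>In the variable t in [-1,1] the basis functions and their derivatives are bounded, and
  each derivative costs 1 / r = 2 / (b - a). The constant is dictated by \<open>k = 2\<close>, where
  4 M / r^2 = 16 M / (b - a)^2.\<close>

lemma lag_stable:
  assumes "a < b" "x \<in> {a..b}" "\<bar>f a\<bar> \<le> M" "\<bar>f ((a + b) / 2)\<bar> \<le> M" "\<bar>f b\<bar> \<le> M"
  shows "\<bar>lag k a b f x\<bar> \<le> 16 * M / (b - a) ^ k"
proof -
  define r where "r = (b - a) / 2"
  define t where "t = (x - (a + b) / 2) / r"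
  have r: "r > 0" "b - a = 2 * r" using assms by (auto simp: r_def)
  have t: "\<bar>t\<bar> \<le> 1"
  proof -
    have "\<bar>x - (a + b) / 2\<bar> \<le> r" using assms(2) unfolding r_def abs_le_iff by (simp add: field_simps)
    then show ?thesis using r unfolding t_def by simp
  qed
  have M: "M \<ge> 0" using assms(3) by linarith
  have mm: "\<bar>u * c\<bar> \<le> M * C" if "\<bar>u\<bar> \<le> M" "\<bar>c\<bar> \<le> C" for u c C
    using that unfolding abs_mult by (intro mult_mono) auto
  consider "k = 0" | "k = 1" | "k = 2" | "k > 2" by linarith
  then show ?thesis
  proof cases
    case 1
    have tt: "t * t \<le> 1" "0 \<le> t * t" using t by (auto simp: abs_le_iff abs_square_le_1 simp flip: power2_eq_square)
    have t': "- 1 \<le> t" "t \<le> 1" using t by auto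
    have "\<bar>t * (t - 1) / 2\<bar> \<le> 1" "\<bar>1 - t\<^sup>2\<bar> \<le> 1" "\<bar>t * (t + 1) / 2\<bar> \<le> 1"
      unfolding power2_eq_square abs_le_iff ring_distribs using t' tt by (intro conjI; simp add: field_simps; linarith?)+
    then have "\<bar>f a * (t * (t - 1) / 2)\<bar> \<le> M * 1" "\<bar>f ((a + b) / 2) * (1 - t\<^sup>2)\<bar> \<le> M * 1"
      "\<bar>f b * (t * (t + 1) / 2)\<bar> \<le> M * 1" using assms by (blast intro: mm)+
    then show ?thesis using M unfolding 1 lag_def Let_def r_def [symmetric] t_def [symmetric]
      by simp
  next
    case 2
    have tt: "\<bar>t - 1 / 2\<bar> \<le> 3 / 2" "\<bar>2 * t\<bar> \<le> 2" "\<bar>t + 1 / 2\<bar> \<le> 3 / 2" using t by linarith+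
    have "\<bar>f a * (t - 1 / 2)\<bar> \<le> M * (3/2)" "\<bar>f ((a + b) / 2) * (2 * t)\<bar> \<le> M * 2"
      "\<bar>f b * (t + 1 / 2)\<bar> \<le> M * (3/2)" using assms(3-5) tt by (blast intro: mm)+
    \<comment> \<open>The triangle inequality gives 5 M; 8 M is taken so that division by r produces
      the common constant 16.\<close>
    then have "\<bar>f a * (t - 1 / 2) - f ((a + b) / 2) * (2 * t) + f b * (t + 1 / 2)\<bar> \<le> 8 * M"
      using M by linarith
    then have "\<bar>(f a * (t - 1 / 2) - f ((a + b) / 2) * (2 * t) + f b * (t + 1 / 2)) / r\<bar> \<le> 8 * M / r"
      using r by (simp add: divide_right_mono)
    then show ?thesis using r unfolding 2 lag_def Let_def r_def [symmetric] t_def [symmetric] by simp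
  next
    case 3
    have "\<bar>f a - 2 * f ((a + b) / 2) + f b\<bar> \<le> 4 * M" using assms by linarith
    then have "\<bar>(f a - 2 * f ((a + b) / 2) + f b) / r\<^sup>2\<bar> \<le> 4 * M / r\<^sup>2"
      using r by (simp add: divide_right_mono)
    then show ?thesis using r unfolding 3 lag_def Let_def r_def [symmetric] t_def [symmetric]
      by (simp add: power_mult_distrib)
  next
    case 4
    then show ?thesis using M r by (simp add: lag_def)
  qed
qed

text \<open>By scaling, end slopes count with a factor of the interval length. This is what later
  compensates the power of the mesh width that is lost in the error of a slope.\<close>

lemma her_stable:
  assumes "a < b" "x \<in> {a..b}" "\<bar>f a\<bar> \<le> M" "\<bar>f b\<bar> \<le> M" "\<bar>g a\<bar> \<le> M'" "\<bar>g b\<bar> \<le> M'"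
  shows "\<bar>her k a b f g x\<bar> \<le> 8 * (M + (b - a) * M') / (b - a) ^ k"
proof -
  define r where "r = (b - a) / 2"
  have r: "r > 0" "b - a = 2 * r" using assms by (auto simp: r_def)
  have M: "M \<ge> 0" "M' \<ge> 0" using assms(3,5) by linarith+
  \<comment> \<open>\<open>c (g a) (g b)\<close> is the quadratic coefficient on the left half, and
    \<open>- c (g b) (g a)\<close> is the one on the right half.\<close>
  define c where "c g0 g1 = (f b - f a) / (2 * r\<^sup>2) - (3 * g0 + g1) / (4 * r)" for g0 g1
  have c: "\<bar>c g0 g1\<bar> \<le> M / r\<^sup>2 + M' / r" if "\<bar>g0\<bar> \<le> M'" "\<bar>g1\<bar> \<le> M'" for g0 g1
  proof -
    have "\<bar>f b - f a\<bar> \<le> 2 * M" "\<bar>3 * g0 + g1\<bar> \<le> 4 * M'" using assms that by linarith+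
    then have "\<bar>f b - f a\<bar> / (2 * r\<^sup>2) \<le> 2 * M / (2 * r\<^sup>2)" "\<bar>3 * g0 + g1\<bar> / (4 * r) \<le> 4 * M' / (4 * r)"
      using r by (intro divide_right_mono; simp)+
    moreover have "\<bar>c g0 g1\<bar> \<le> \<bar>f b - f a\<bar> / (2 * r\<^sup>2) + \<bar>3 * g0 + g1\<bar> / (4 * r)"
      unfolding c_def using r abs_triangle_ineq4 [of "(f b - f a) / (2 * r\<^sup>2)" "(3 * g0 + g1) / (4 * r)"]
      by (simp add: abs_divide)
    ultimately show ?thesis using r by simp
  qed
  let ?X = "M / r\<^sup>2 + M' / r"
  have X: "?X \<ge> 0" using M r by simp
  have cz1: "\<bar>c g0 g1 * z\<bar> \<le> ?X * r" if "\<bar>g0\<bar> \<le> M'" "\<bar>g1\<bar> \<le> M'" "\<bar>z\<bar> \<le> r" for g0 g1 z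
    using c [OF that(1,2)] that(3) X unfolding abs_mult by (intro mult_mono) auto
  have cz2: "\<bar>c g0 g1 * z\<^sup>2\<bar> \<le> ?X * r\<^sup>2" if "\<bar>g0\<bar> \<le> M'" "\<bar>g1\<bar> \<le> M'" "\<bar>z\<bar> \<le> r" for g0 g1 z
    using c [OF that(1,2)] power_mono [OF that(3), of 2] X unfolding abs_mult by (intro mult_mono) auto
  have gz: "\<bar>g0 * z\<bar> \<le> M' * r" if "\<bar>g0\<bar> \<le> M'" "\<bar>z\<bar> \<le> r" for g0 z
    using that unfolding abs_mult by (intro mult_mono) (use M in auto)
  have Xr: "?X * r\<^sup>2 = M + M' * r" "?X * r = M / r + M'"
    using r by (auto simp: field_simps power2_eq_square)
  have zl: "\<bar>x - a\<bar> \<le> r" if "x \<le> (a + b) / 2" using that assms(2) by (auto simp: r_def field_simps)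
  have zr: "\<bar>b - x\<bar> \<le> r" if "\<not> x \<le> (a + b) / 2" using that assms(2) by (auto simp: r_def field_simps)
  consider "k = 0" | "k = 1" | "k = 2" | "k > 2" by linarith
  then show ?thesis
  proof cases
    case 1
    have "her k a b f g x = f a + g a * (x - a) + c (g a) (g b) * (x - a)\<^sup>2" if "x \<le> (a + b) / 2"
      using that unfolding 1 her_def pwq_def Let_def r_def [symmetric] c_def by (simp only: if_True simp_thms)
    moreover have "her k a b f g x = f b + - (g b * (b - x)) + - (c (g b) (g a) * (b - x)\<^sup>2)"
      if "\<not> x \<le> (a + b) / 2"
      using that unfolding 1 her_def pwq_def Let_def r_def [symmetric] c_def
      by (simp only: if_False if_True simp_thms diff_conv_add_uminus)
    moreover have "\<bar>f a + g a * (x - a) + c (g a) (g b) * (x - a)\<^sup>2\<bar> \<le> M + M' * r + ?X * r\<^sup>2"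
      if "x \<le> (a + b) / 2"
      using gz [OF assms(5) zl [OF that]] cz2 [OF assms(5,6) zl [OF that]] assms(3)
      abs_triangle3 [of "f a" "g a * (x - a)" "c (g a) (g b) * (x - a)\<^sup>2"] by linarith
    moreover have "\<bar>f b + - (g b * (b - x)) + - (c (g b) (g a) * (b - x)\<^sup>2)\<bar> \<le> M + M' * r + ?X * r\<^sup>2"
      if "\<not> x \<le> (a + b) / 2"
      using gz [OF assms(6) zr [OF that]] cz2 [OF assms(6,5) zr [OF that]] assms(4)
      abs_triangle3 [of "f b" "- (g b * (b - x))" "- (c (g b) (g a) * (b - x)\<^sup>2)"]
      unfolding abs_minus_cancel by linarith
    ultimately have "\<bar>her k a b f g x\<bar> \<le> M + M' * r + ?X * r\<^sup>2" by metis
    also have "\<dots> \<le> 8 * (M + 2 * r * M')" unfolding Xr using M r by (simp add: algebra_simps)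
    finally show ?thesis using 1 r by simp
  next
    case 2
    have "her k a b f g x = g a + c (g a) (g b) * (x - a) + c (g a) (g b) * (x - a)" if "x \<le> (a + b) / 2"
      using that unfolding 2 her_def pwq'_def Let_def r_def [symmetric] c_def
      by (simp only: if_True if_False simp_thms one_neq_zero mult_2 distrib_right add.assoc)
    moreover have "her k a b f g x = g b + c (g b) (g a) * (b - x) + c (g b) (g a) * (b - x)"
      if "\<not> x \<le> (a + b) / 2"
      using that unfolding 2 her_def pwq'_def Let_def r_def [symmetric] c_def
      by (simp only: if_True if_False simp_thms one_neq_zero mult_2 distrib_right add.assoc)
    moreover have "\<bar>g a + c (g a) (g b) * (x - a) + c (g a) (g b) * (x - a)\<bar> \<le> M' + 2 * (?X * r)"
      if "x \<le> (a + b) / 2"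
      using cz1 [OF assms(5,6) zl [OF that]] assms(5)
      abs_triangle3 [of "g a" "c (g a) (g b) * (x - a)" "c (g a) (g b) * (x - a)"] by linarith
    moreover have "\<bar>g b + c (g b) (g a) * (b - x) + c (g b) (g a) * (b - x)\<bar> \<le> M' + 2 * (?X * r)"
      if "\<not> x \<le> (a + b) / 2"
      using cz1 [OF assms(6,5) zr [OF that]] assms(6)
      abs_triangle3 [of "g b" "c (g b) (g a) * (b - x)" "c (g b) (g a) * (b - x)"] by linarith
    ultimately have "\<bar>her k a b f g x\<bar> \<le> M' + 2 * (?X * r)" by metis
    also have "\<dots> \<le> 8 * (M + 2 * r * M') / (2 * r)"
      unfolding Xr using M r by (simp add: field_simps)
    finally show ?thesis using 2 r by simp
  next
    case 3
    have "\<bar>her k a b f g x\<bar> \<le> 2 * ?X"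
      unfolding 3 her_def Let_def r_def [symmetric] c_def [symmetric]
      using c [OF assms(5,6)] c [OF assms(6,5)] by (auto simp: abs_mult)
    also have "\<dots> \<le> 8 * (M + 2 * r * M') / (2 * r)\<^sup>2"
      using M r by (simp add: field_simps power2_eq_square)
    finally show ?thesis using 3 r by simp
  next
    case 4
    then show ?thesis using M r by (simp add: her_def)
  qed
qed

text \<open>The quadratic is centred at the point of evaluation, so its derivatives there are read
  off from its coefficients. A Taylor polynomial at \<open>z\<close> can then be subtracted without
  changing the error at \<open>z\<close>.\<close>

lemma lag_exact:
  assumes "a < b"
  shows "lag 0 a b (\<lambda>t. c0 + c1 * (t - z) + c2 * (t - z)\<^sup>2) z = c0"
    and "lag 1 a b (\<lambda>t. c0 + c1 * (t - z) + c2 * (t - z)\<^sup>2) z = c1"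
    and "lag 2 a b (\<lambda>t. c0 + c1 * (t - z) + c2 * (t - z)\<^sup>2) z = 2 * c2"
proof -
  define r t where "r = (b - a) / 2" and "t = (z - (a + b) / 2) / r"
  have r: "r > 0" "b = a + 2 * r" using assms by (auto simp: r_def field_simps)
  have z: "z = a + r + r * t" using r(1) unfolding t_def r(2) by (simp add: field_simps)
  have e: "((a + r + r * t) - (a + (a + 2 * r)) / 2) / ((a + 2 * r - a) / 2) = t"
    "(a + 2 * r - a) / 2 = r" "(a + (a + 2 * r)) / 2 = a + r"
    using r(1) by (auto simp: field_simps)
  show "lag 0 a b (\<lambda>t. c0 + c1 * (t - z) + c2 * (t - z)\<^sup>2) z = c0"
    "lag 1 a b (\<lambda>t. c0 + c1 * (t - z) + c2 * (t - z)\<^sup>2) z = c1"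
    "lag 2 a b (\<lambda>t. c0 + c1 * (t - z) + c2 * (t - z)\<^sup>2) z = 2 * c2"
    unfolding lag_def Let_def z r(2) e using r(1)
    by (simp_all add: field_simps power2_eq_square)
qed

lemma her_exact:
  assumes "a < b"
  shows "her 0 a b (\<lambda>t. c0 + c1 * (t - z) + c2 * (t - z)\<^sup>2) (\<lambda>t. c1 + 2 * c2 * (t - z)) z = c0"
    and "her 1 a b (\<lambda>t. c0 + c1 * (t - z) + c2 * (t - z)\<^sup>2) (\<lambda>t. c1 + 2 * c2 * (t - z)) z = c1"
    and "her 2 a b (\<lambda>t. c0 + c1 * (t - z) + c2 * (t - z)\<^sup>2) (\<lambda>t. c1 + 2 * c2 * (t - z)) z = 2 * c2"
proof -
  define r where "r = (b - a) / 2"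
  have r: "r > 0" "b = a + 2 * r" using assms by (auto simp: r_def field_simps)
  define p where "p t = c0 + c1 * (t - z) + c2 * (t - z)\<^sup>2" for t
  define p' where "p' t = c1 + 2 * c2 * (t - z)" for t
  \<comment> \<open>With the minus sign in the formula for the right half, both halves receive the
    coefficient \<open>c2\<close>, so they are the same parabola.\<close>
  have A: "(p b - p a) / (2 * r\<^sup>2) - (3 * p' a + p' b) / (4 * r) = c2"
    using r(1) unfolding r(2) p_def p'_def by (simp add: field_simps power2_eq_square)
  have B: "(p b - p a) / (2 * r\<^sup>2) - (3 * p' b + p' a) / (4 * r) = - c2"
    using r(1) unfolding r(2) p_def p'_def by (simp add: field_simps power2_eq_square)
  have "her 0 a b p p' z = c0" "her 1 a b p p' z = c1" "her 2 a b p p' z = 2 * c2"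
    unfolding her_def pwq_def pwq'_def Let_def r_def [symmetric] A B
    by (auto simp: p_def p'_def algebra_simps power2_eq_square)
  then show "her 0 a b (\<lambda>t. c0 + c1 * (t - z) + c2 * (t - z)\<^sup>2) (\<lambda>t. c1 + 2 * c2 * (t - z)) z = c0"
    "her 1 a b (\<lambda>t. c0 + c1 * (t - z) + c2 * (t - z)\<^sup>2) (\<lambda>t. c1 + 2 * c2 * (t - z)) z = c1"
    "her 2 a b (\<lambda>t. c0 + c1 * (t - z) + c2 * (t - z)\<^sup>2) (\<lambda>t. c1 + 2 * c2 * (t - z)) z = 2 * c2"
    unfolding p_def p'_def by simp_all
qed

section \<open>Taylor expansion and interpolation errors in one variable\<close>

lemma bound_from_deriv:
  fixes g :: "real \<Rightarrow> real"
  assumes "\<And>t. t \<in> {a..b} \<Longrightarrow> (g has_real_derivative g' t) (at t within {a..b})"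
    and "\<And>t. t \<in> {a..b} \<Longrightarrow> \<bar>g' t\<bar> \<le> M" and "z \<in> {a..b}" "t \<in> {a..b}"
  shows "\<bar>g t - g z\<bar> \<le> M * (b - a)"
proof -
  have "norm (g t - g z) \<le> M * norm (t - z)"
    by (rule field_differentiable_bound [of "{a..b}" g g']) (use assms in auto)
  also have "\<dots> \<le> M * (b - a)"
    by (rule mult_left_mono) (use assms abs_ge_zero [THEN order_trans, OF assms(2)[OF assms(3)]] in auto)
  finally show ?thesis by simp
qed

text \<open>Written as a quadratic for every order, with the coefficients above order
  \<open>n\<close> set to 0, so that the exactness of the operators on quadratics applies to all
  orders alike.\<close>

definition taylor :: "(nat \<Rightarrow> real \<Rightarrow> real) \<Rightarrow> nat \<Rightarrow> real \<Rightarrow> real \<Rightarrow> real" where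
  "taylor f n z t = f 0 z + (if n \<ge> 1 then f 1 z else 0) * (t - z) +
     (if n \<ge> 2 then f 2 z / 2 else 0) * (t - z)\<^sup>2"

definition taylor' :: "(nat \<Rightarrow> real \<Rightarrow> real) \<Rightarrow> nat \<Rightarrow> real \<Rightarrow> real \<Rightarrow> real" where
  "taylor' f n z t = (if n \<ge> 1 then f 1 z else 0) + 2 * (if n \<ge> 2 then f 2 z / 2 else 0) * (t - z)"

definition jet1 :: "nat \<Rightarrow> real \<Rightarrow> real \<Rightarrow> (nat \<Rightarrow> real \<Rightarrow> real) \<Rightarrow> bool" where
  "jet1 n a b f \<longleftrightarrow> (\<forall>k<n. \<forall>t\<in>{a..b}. (f k has_real_derivative f (Suc k) t) (at t within {a..b}))"

text \<open>The remainder is expressed by the oscillation \<open>w\<close> of the derivative of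
  order \<open>n\<close>. Later \<open>w\<close> comes either from a supremum bound for the next
  derivative (\<open>jet1_osc\<close>) or from its L2 norm (\<open>osc_le_L2\<close>).\<close>

lemma taylor_remainder:
  assumes "jet1 n a b f" "n \<le> 2" "z \<in> {a..b}" "t \<in> {a..b}"
    and osc: "\<And>t. t \<in> {a..b} \<Longrightarrow> \<bar>f n t - f n z\<bar> \<le> w"
  shows "\<bar>f 0 t - taylor f n z t\<bar> \<le> w * (b - a) ^ n"
    and "n \<ge> 1 \<Longrightarrow> \<bar>f 1 t - taylor' f n z t\<bar> \<le> w * (b - a) ^ (n - 1)"
proof -
  have 0: "\<bar>f 0 t - taylor f n z t\<bar> \<le> w * (b - a) ^ n" if "n = 0"
    using osc [OF assms(4)] that unfolding taylor_def by simp
  have d0: "(f 0 has_real_derivative f 1 t) (at t within {a..b})" if "n \<ge> 1" "t \<in> {a..b}" for t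
    using assms(1) that unfolding jet1_def by (metis One_nat_def less_eq_Suc_le)
  have d1: "(f 1 has_real_derivative f 2 t) (at t within {a..b})" if "n \<ge> 2" "t \<in> {a..b}" for t
    using assms(1) that unfolding jet1_def by (metis One_nat_def Suc_1 Suc_le_eq)
  have dT: "(taylor f n z has_real_derivative taylor' f n z t) (at t within {a..b})" for t
    unfolding taylor_def taylor'_def by (auto intro!: derivative_eq_intros)
  have 1: "\<bar>f 1 t - taylor' f n z t\<bar> \<le> w * (b - a) ^ (n - 1)" if "n \<ge> 1" "t \<in> {a..b}" for t
  proof (cases "n = 1")
    case True
    then show ?thesis using osc [OF that(2)] unfolding taylor'_def by simp
  next
    case False
    then have n: "n = 2" using assms(2) that by auto
    have "((\<lambda>t. f 1 t - taylor' f n z t) has_real_derivative f 2 t - f 2 z) (at t within {a..b})"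
      if "t \<in> {a..b}" for t
      unfolding taylor'_def using d1 [OF _ that] n by (auto intro!: derivative_eq_intros)
    from bound_from_deriv [OF this _ assms(3) that(2), of w] osc
    show ?thesis unfolding n taylor'_def by simp
  qed
  show "\<bar>f 1 t - taylor' f n z t\<bar> \<le> w * (b - a) ^ (n - 1)" if "n \<ge> 1"
    using 1 assms(4) that by blast
  show "\<bar>f 0 t - taylor f n z t\<bar> \<le> w * (b - a) ^ n"
  proof (cases "n = 0")
    case True then show ?thesis by (rule 0)
  next
    case False
    then have n: "n \<ge> 1" by simp
    have "((\<lambda>t. f 0 t - taylor f n z t) has_real_derivative f 1 t - taylor' f n z t) (at t within {a..b})"
      if "t \<in> {a..b}" for t
      using d0 [OF n that] dT by (auto intro!: derivative_eq_intros)
    from bound_from_deriv [OF this 1 [OF n] assms(3,4)]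
    have "\<bar>f 0 t - taylor f n z t - (f 0 z - taylor f n z z)\<bar> \<le> w * (b - a) ^ (n - 1) * (b - a)" .
    moreover have "f 0 z - taylor f n z z = 0" by (simp add: taylor_def)
    moreover have "(b - a) ^ (n - 1) * (b - a) = (b - a) ^ n" using False by (metis mult.commute power_eq_if)
    ultimately show ?thesis by (simp add: mult.assoc)
  qed
qed

text \<open>Subtract the Taylor polynomial at \<open>z\<close>, which the operator reproduces, and
  apply stability to the remainder. For \<open>k > n\<close> the polynomial has no k-th derivative
  at \<open>z\<close>, and the estimate bounds the interpolant alone.\<close>

lemma lag_err:
  assumes ab: "a < b" and z: "z \<in> {a..b}" and n: "n \<le> 2" and j: "jet1 n a b f" and k: "k \<le> 2"
    and osc: "\<And>t. t \<in> {a..b} \<Longrightarrow> \<bar>f n t - f n z\<bar> \<le> w"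
  shows "\<bar>(if k \<le> n then f k z else 0) - lag k a b (f 0) z\<bar> \<le> 16 * w * (b - a) ^ n / (b - a) ^ k"
proof -
  have L: "lag k a b (taylor f n z) z = (if k \<le> n then f k z else 0)"
    using nat_le_2_cases [OF k] unfolding taylor_def
    by (elim disjE) (use lag_exact [OF ab] n in auto)
  have m: "(a + b) / 2 \<in> {a..b}" using ab by simp
  have "\<bar>lag k a b (\<lambda>t. f 0 t - taylor f n z t) z\<bar> \<le> 16 * (w * (b - a) ^ n) / (b - a) ^ k"
    by (rule lag_stable [OF ab z]; rule taylor_remainder(1) [OF j n z _ osc]) (use ab m in auto)
  then show ?thesis unfolding lag_diff L by (simp add: abs_minus_commute mult.assoc)
qed

text \<open>The remainder of the slope is one power of the length worse than that of the value;
  \<open>her_stable\<close> gives this power back, so both contribute equally.\<close>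

lemma her_err:
  assumes ab: "a < b" and z: "z \<in> {a..b}" and n: "1 \<le> n" "n \<le> 2" and j: "jet1 n a b f" and k: "k \<le> 2"
    and osc: "\<And>t. t \<in> {a..b} \<Longrightarrow> \<bar>f n t - f n z\<bar> \<le> w"
  shows "\<bar>(if k \<le> n then f k z else 0) - her k a b (f 0) (f 1) z\<bar> \<le> 16 * w * (b - a) ^ n / (b - a) ^ k"
proof -
  have L: "her k a b (taylor f n z) (taylor' f n z) z = (if k \<le> n then f k z else 0)"
    using nat_le_2_cases [OF k] unfolding taylor_def taylor'_def
    by (elim disjE) (use her_exact [OF ab] n in auto)
  have e: "w * (b - a) ^ n + (b - a) * (w * (b - a) ^ (n - 1)) = 2 * (w * (b - a) ^ n)"
    using n by (cases n) auto
  have "\<bar>her k a b (\<lambda>t. f 0 t - taylor f n z t) (\<lambda>t. f 1 t - taylor' f n z t) z\<bar>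
      \<le> 8 * (w * (b - a) ^ n + (b - a) * (w * (b - a) ^ (n - 1))) / (b - a) ^ k"
    by (rule her_stable [OF ab z]; (rule taylor_remainder(1) [OF j n(2) z _ osc] taylor_remainder(2) [OF j n(2) z _ osc n(1)]))
      (use ab in auto)
  then show ?thesis unfolding her_diff L e by (simp add: abs_minus_commute mult.assoc)
qed

text \<open>In a jet \<open>V\<close>, the function \<open>V i j\<close> is the derivative of \<open>V 0 0\<close> of order \<open>i\<close> in \<open>x\<close> and \<open>j\<close> in \<open>y\<close>.\<close>

definition C3_jet :: "(nat \<Rightarrow> nat \<Rightarrow> real \<Rightarrow> real \<Rightarrow> real) \<Rightarrow> bool" where
  "C3_jet V \<longleftrightarrow>
     (\<forall>i j. i + j \<le> 3 \<longrightarrow> continuous_on closed_unit_square (\<lambda>(x, y). V i j x y)) \<and>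
     (\<forall>i j. i + j < 3 \<longrightarrow> (\<forall>x \<in> {0..1}. \<forall>y \<in> {0..1}.
        ((\<lambda>t. V i j t y) has_real_derivative V (Suc i) j x y) (at x within {0..1}) \<and>
        ((\<lambda>t. V i j x t) has_real_derivative V i (Suc j) x y) (at y within {0..1})))"

definition jet_of :: "(real \<times> real \<Rightarrow> real) \<Rightarrow> nat \<Rightarrow> nat \<Rightarrow> real \<Rightarrow> real \<Rightarrow> real" where
  "jet_of v i j x y = pd i j v (x, y)"

type_synonym jet = "nat \<Rightarrow> nat \<Rightarrow> real \<Rightarrow> real \<Rightarrow> real"

definition jadd :: "jet \<Rightarrow> jet \<Rightarrow> jet" where "jadd V W i j x y = V i j x y + W i j x y"

text \<open>Exchanges the variables together with the orders of differentiation, so that vertical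
  strips and layers reduce to horizontal ones.\<close>

definition jswap :: "jet \<Rightarrow> jet" where "jswap V i j x y = V j i y x"

section \<open>Sums, exchange of variables and uniqueness of jets\<close>

lemma C3_jet_of: "C_closed 3 v \<Longrightarrow> C3_jet (jet_of v)"
  unfolding C_closed_def C3_jet_def jet_of_def by (auto simp: case_prod_eta)

lemma C3_jadd: "C3_jet V \<Longrightarrow> C3_jet W \<Longrightarrow> C3_jet (jadd V W)"
  unfolding C3_jet_def jadd_def
  by (auto intro!: continuous_on_add DERIV_add simp: case_prod_beta)

lemma C3_jswap:
  assumes "C3_jet V"
  shows "C3_jet (jswap V)"
proof -
  have "continuous_on closed_unit_square (\<lambda>(x, y). V j i y x)" if "i + j \<le> 3" for i j
  proof -
    have "continuous_on closed_unit_square ((\<lambda>(x, y). V j i x y) \<circ> prod.swap)"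
      using assms that unfolding C3_jet_def
      by (intro continuous_on_compose continuous_on_swap) (simp add: product_swap add.commute)
    then show ?thesis by (simp add: o_def case_prod_beta)
  qed
  then show ?thesis
    using assms unfolding C3_jet_def jswap_def by (simp add: add.commute)
qed

lemma C3_jet_dx:
  "C3_jet V \<Longrightarrow> i + j < 3 \<Longrightarrow> x \<in> {0..1} \<Longrightarrow> y \<in> {0..1} \<Longrightarrow>
    ((\<lambda>t. V i j t y) has_real_derivative V (Suc i) j x y) (at x within {0..1})"
  unfolding C3_jet_def by blast

lemma C3_jet_dy:
  "C3_jet V \<Longrightarrow> i + j < 3 \<Longrightarrow> x \<in> {0..1} \<Longrightarrow> y \<in> {0..1} \<Longrightarrow>
    ((\<lambda>t. V i j x t) has_real_derivative V i (Suc j) x y) (at y within {0..1})"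
  unfolding C3_jet_def by blast

text \<open>One-sided derivatives on [0,1] are unique, so equality of values passes to the y
  derivatives and then to their x derivatives. It transfers the decomposition of u, which is given
  for values, to all derivatives up to order 3.\<close>

lemma C3_jet_eq:
  assumes V: "C3_jet V" and W: "C3_jet W"
    and eq: "\<And>x y. x \<in> {0..1} \<Longrightarrow> y \<in> {0..1} \<Longrightarrow> V 0 0 x y = W 0 0 x y"
    and "i + j \<le> 3" "x \<in> {0..1}" "y \<in> {0..1}"
  shows "V i j x y = W i j x y"
proof -
  have A: "V 0 j x y = W 0 j x y" if "j \<le> 3" "x \<in> {0..1}" "y \<in> {0..1}" for j x y
    using that
  proof (induction j arbitrary: y)
    case 0 then show ?case using eq by simp
  next
    case (Suc j)
    have "((\<lambda>t. V 0 j x t) has_real_derivative W 0 (Suc j) x y) (at y within {0..1})"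
      by (rule has_field_derivative_transform_within [OF C3_jet_dy [OF W], where d = 1])
        (use Suc in auto)
    then show ?case
      using real_derivative_unique_Icc [of 0 1 y] C3_jet_dy [OF V, of 0 j x y] Suc by auto
  qed
  show ?thesis using assms(4-)
  proof (induction i arbitrary: x)
    case 0 then show ?case using A by simp
  next
    case (Suc i)
    have "((\<lambda>t. V i j t y) has_real_derivative W (Suc i) j x y) (at x within {0..1})"
      by (rule has_field_derivative_transform_within [OF C3_jet_dx [OF W], where d = 1])
        (use Suc in auto)
    then show ?case
      using real_derivative_unique_Icc [of 0 1 x] C3_jet_dx [OF V, of i j x y] Suc by auto
  qed
qed

lemma C3_jet_cont_x:
  assumes "C3_jet V" "i + j \<le> 3" "y \<in> {0..1}" "X \<subseteq> {0..1}"
  shows "continuous_on X (\<lambda>t. V i j t y)"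
proof -
  have "continuous_on X ((\<lambda>(x, y). V i j x y) \<circ> (\<lambda>t. (t, y)))"
    using assms unfolding C3_jet_def
    by (intro continuous_on_compose continuous_intros)
      (rule continuous_on_subset [where s = closed_unit_square], auto)
  then show ?thesis by (simp add: o_def)
qed

lemma C3_jet_cont_y:
  assumes "C3_jet V" "i + j \<le> 3" "x \<in> {0..1}" "X \<subseteq> {0..1}"
  shows "continuous_on X (\<lambda>t. V i j x t)"
proof -
  have "continuous_on X ((\<lambda>(x, y). V i j x y) \<circ> (\<lambda>t. (x, t)))"
    using assms unfolding C3_jet_def
    by (intro continuous_on_compose continuous_intros)
      (rule continuous_on_subset [where s = closed_unit_square], auto)
  then show ?thesis by (simp add: o_def)
qed

lemma C3_jet1_x:
  assumes "C3_jet V" "n + i + j \<le> 3" "y \<in> {0..1}" "{a..b} \<subseteq> {0..1}"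
  shows "jet1 n a b (\<lambda>k t. V (k + i) j t y)"
  unfolding jet1_def
  by (intro allI impI ballI DERIV_subset [OF _ assms(4)])
    (use C3_jet_dx [OF assms(1)] assms in auto)

lemma C3_jet1_y:
  assumes "C3_jet V" "n + i + j \<le> 3" "x \<in> {0..1}" "{a..b} \<subseteq> {0..1}"
  shows "jet1 n a b (\<lambda>k t. V i (k + j) x t)"
  unfolding jet1_def
  by (intro allI impI ballI DERIV_subset [OF _ assms(4)])
    (use C3_jet_dy [OF assms(1)] assms in auto)

text \<open>\<open>G i j\<close> plays the role of the derivatives of \<open>G 0 0\<close>, which is subtracted from the function
  with jet \<open>U\<close>.\<close>

lemma pd_local:
  assumes U: "C3_jet U"
    and box: "0 \<le> a" "b \<le> 1" "0 \<le> c" "d \<le> 1"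
    and w: "\<And>x y. x \<in> {a<..<b} \<Longrightarrow> y \<in> {c<..<d} \<Longrightarrow> w (x, y) = U 0 0 x y - G 0 0 x y"
    and Gx: "\<And>i j x y. i + j < 2 \<Longrightarrow> x \<in> {a<..<b} \<Longrightarrow> y \<in> {c<..<d} \<Longrightarrow>
        ((\<lambda>t. G i j t y) has_real_derivative G (Suc i) j x y) (at x)"
    and Gy: "\<And>i j x y. i + j < 2 \<Longrightarrow> x \<in> {a<..<b} \<Longrightarrow> y \<in> {c<..<d} \<Longrightarrow>
        ((\<lambda>t. G i j x t) has_real_derivative G i (Suc j) x y) (at y)"
    and ij: "i + j \<le> 2" and xy: "x \<in> {a<..<b}" "y \<in> {c<..<d}"
  shows "pd i j w (x, y) = U i j x y - G i j x y"
proof -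
  have Wx: "((\<lambda>t. U i j t y - G i j t y) has_real_derivative U (Suc i) j x y - G (Suc i) j x y) (at x)"
    if "i + j < 2" "x \<in> {a<..<b}" "y \<in> {c<..<d}" for i j x y
  proof (rule DERIV_diff [OF _ Gx [OF that]])
    have "((\<lambda>t. U i j t y) has_real_derivative U (Suc i) j x y) (at x within {0..1})"
      by (rule C3_jet_dx [OF U]) (use that box in auto)
    then show "((\<lambda>t. U i j t y) has_real_derivative U (Suc i) j x y) (at x)"
      using at_within_Icc_at [of 0 x 1] that box by simp
  qed
  have Wy: "((\<lambda>t. U i j x t - G i j x t) has_real_derivative U i (Suc j) x y - G i (Suc j) x y) (at y)"
    if "i + j < 2" "x \<in> {a<..<b}" "y \<in> {c<..<d}" for i j x y
  proof (rule DERIV_diff [OF _ Gy [OF that]])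
    have "((\<lambda>t. U i j x t) has_real_derivative U i (Suc j) x y) (at y within {0..1})"
      by (rule C3_jet_dy [OF U]) (use that box in auto)
    then show "((\<lambda>t. U i j x t) has_real_derivative U i (Suc j) x y) (at y)"
      using at_within_Icc_at [of 0 y 1] that box by simp
  qed
  have vd: "vector_derivative f (at z within {0..1}) = f'"
    if "(f has_real_derivative f') (at z)" "0 < z" "z < 1" for f f' and z :: real
    using that at_within_Icc_at [of 0 z 1]
    by (simp add: vector_derivative_at has_real_derivative_iff_has_vector_derivative)
  \<comment> \<open>\<open>pd\<close> differentiates in y first, so the y derivatives must be known
    on the whole box before x derivatives are taken.\<close>
  have Y: "(diff_y ^^ j) w (x, y) = U 0 j x y - G 0 j x y"
    if "j \<le> 2" "x \<in> {a<..<b}" "y \<in> {c<..<d}" for j x y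
    using that
  proof (induction j arbitrary: y)
    case 0 then show ?case using w by simp
  next
    case (Suc j)
    have "((\<lambda>t. (diff_y ^^ j) w (x, t)) has_real_derivative U 0 (Suc j) x y - G 0 (Suc j) x y) (at y)"
      by (rule has_field_derivative_transform_within_open [OF Wy, where S = "{c<..<d}"])
        (use Suc in auto)
    then show ?case unfolding funpow.simps o_def diff_y_def
      using Suc.prems box by (auto intro!: vd)
  qed
  show ?thesis using ij xy
  proof (induction i arbitrary: x)
    case 0 then show ?case using Y by (simp add: pd_def)
  next
    case (Suc i)
    have "((\<lambda>t. pd i j w (t, y)) has_real_derivative U (Suc i) j x y - G (Suc i) j x y) (at x)"
      by (rule has_field_derivative_transform_within_open [OF Wx, where S = "{a<..<b}"])
        (use Suc in auto)
    then show ?case using Suc.prems box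
      unfolding pd_def funpow.simps o_def by (subst diff_x_def) (auto intro!: vd)
  qed
qed

section \<open>Oscillation, L2 norms and moving windows\<close>

lemma osc_le_L2:
  fixes g :: "real \<Rightarrow> real"
  assumes ab: "a < b" and d: "\<And>t. t \<in> {a..b} \<Longrightarrow> (g has_real_derivative g' t) (at t within {a..b})"
    and c: "continuous_on {a..b} g'" and tz: "t \<in> {a..b}" "z \<in> {a..b}"
  shows "\<bar>g t - g z\<bar> \<le> sqrt ((b - a) * integral {a..b} (\<lambda>t. (g' t)\<^sup>2))"
proof -
  define I where "I = integral {a..b} (\<lambda>t. \<bar>g' t\<bar>)"
  have ia: "(\<lambda>t. \<bar>g' t\<bar>) integrable_on {a..b}" "(\<lambda>t. (g' t)\<^sup>2) integrable_on {a..b}"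
    by (intro integrable_continuous_interval continuous_intros c)+
  have le: "\<bar>g q - g p\<bar> \<le> I" if "p \<le> q" "p \<in> {a..b}" "q \<in> {a..b}" for p q
  proof -
    have sub: "{p..q} \<subseteq> {a..b}" using that by auto
    have hi: "(g' has_integral (g q - g p)) {p..q}"
      by (rule fundamental_theorem_of_calculus [OF that(1)])
        (use DERIV_subset [OF d sub] sub in \<open>auto simp flip: has_real_derivative_iff_has_vector_derivative\<close>)
    have "\<bar>integral {p..q} g'\<bar> \<le> integral {p..q} (\<lambda>t. \<bar>g' t\<bar>)"
      using integral_norm_bound_integral [of g' "{p..q}" "\<lambda>t. \<bar>g' t\<bar>"] hi
        integrable_on_subinterval [OF ia(1) sub] by auto
    also have "\<dots> \<le> I" unfolding I_def
      by (rule integral_subset_le [OF sub integrable_on_subinterval [OF ia(1) sub] ia(1)]) auto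
    finally show ?thesis using hi by (simp add: integral_unique)
  qed
  have "\<bar>g t - g z\<bar> \<le> I"
    using le [of t z] le [of z t] tz by (cases "t \<le> z") (auto simp: abs_minus_commute)
  moreover have "I\<^sup>2 \<le> (b - a) * integral {a..b} (\<lambda>t. (g' t)\<^sup>2)"
  proof -
    \<comment> \<open>Cauchy-Schwarz, obtained by integrating the square of the difference between
      the absolute derivative and its mean value.\<close>
    have "0 \<le> integral {a..b} (\<lambda>t. (\<bar>g' t\<bar> - I / (b - a))\<^sup>2)"
      by (rule integral_nonneg) (auto intro!: integrable_continuous_interval continuous_intros c)
    also have "(\<lambda>t. (\<bar>g' t\<bar> - I / (b - a))\<^sup>2) =
        (\<lambda>t. (g' t)\<^sup>2 - (2 * I / (b - a)) * \<bar>g' t\<bar> + (I / (b - a))\<^sup>2)"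
      by (auto simp: power2_eq_square algebra_simps)
    also have "integral {a..b} \<dots> = integral {a..b} (\<lambda>t. (g' t)\<^sup>2) - (2 * I / (b - a)) * I + (I / (b - a))\<^sup>2 * (b - a)"
      unfolding I_def
      by (subst Henstock_Kurzweil_Integration.integral_add Henstock_Kurzweil_Integration.integral_diff integral_mult_right,
          (intro integrable_continuous_interval continuous_intros c)+)+ (use ab in simp)
    also have "\<dots> = integral {a..b} (\<lambda>t. (g' t)\<^sup>2) - I\<^sup>2 / (b - a)"
    proof -
      have "- (2 * I / D) * I + (I / D)\<^sup>2 * D = - (I\<^sup>2 / D)" if "D > 0" for D
        using that by (simp add: power2_eq_square field_simps)
      from this [of "b - a"] ab show ?thesis by simp
    qed
    finally show ?thesis using ab by (simp add: field_simps)
  qed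
  ultimately show ?thesis by (meson order_trans real_le_rsqrt)
qed

text \<open>Bridge to nonnegative integrals, where no integrability has to be carried through sums
  and Fubini. The end points, a null set, are dropped to match the open cells.\<close>

lemma ennreal_integral_square:
  fixes g :: "real \<Rightarrow> real"
  assumes "continuous_on {a..b} g"
  shows "ennreal (integral {a..b} (\<lambda>t. (g t)\<^sup>2)) =
    (\<integral>\<^sup>+ t. indicator {a<..<b} t * ennreal ((g t)\<^sup>2) \<partial>lborel)"
proof -
  have si: "set_integrable lborel {a..b} (\<lambda>t. (g t)\<^sup>2)"
    by (intro borel_integrable_atLeastAtMost' continuous_intros assms)
  then have "integral {a..b} (\<lambda>t. (g t)\<^sup>2) = (LINT t:{a..b}|lborel. (g t)\<^sup>2)"
    using set_borel_integral_eq_integral(2) by metis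
  also have "ennreal \<dots> = (\<integral>\<^sup>+ t. ennreal (indicator {a..b} t *\<^sub>R (g t)\<^sup>2) \<partial>lborel)"
    unfolding set_lebesgue_integral_def
    by (rule nn_integral_eq_integral [symmetric]) (use si in \<open>auto simp: set_integrable_def\<close>)
  also have "\<dots> = (\<integral>\<^sup>+ t. indicator {a<..<b} t * ennreal ((g t)\<^sup>2) \<partial>lborel)"
  proof (rule nn_integral_cong_AE)
    have "AE t in lborel. t \<noteq> a" "AE t in lborel. t \<noteq> b" by (auto intro: AE_lborel_singleton)
    then show "AE t in lborel. ennreal (indicator {a..b} t *\<^sub>R (g t)\<^sup>2) =
        indicator {a<..<b} t * ennreal ((g t)\<^sup>2)"
      by eventually_elim (auto simp: indicator_def)
  qed
  finally show ?thesis .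
qed

lemma L2_norm_on_square_le:
  assumes "(\<integral>\<^sup>+ z. indicator D z * ennreal ((v z)\<^sup>2) \<partial>lebesgue) \<le> ennreal X" "X \<ge> 0"
  shows "(L2_norm_on D v)\<^sup>2 \<le> X"
proof -
  define f where "f = (\<lambda>z. indicator D z *\<^sub>R (v z)\<^sup>2)"
  have f0: "f z \<ge> 0" for z by (simp add: f_def)
  have "(L2_norm_on D v)\<^sup>2 = integral\<^sup>L lebesgue f"
    unfolding L2_norm_on_def set_lebesgue_integral_def f_def
    by (intro real_sqrt_pow2 integral_nonneg_AE) auto
  also have "\<dots> \<le> X"
  proof (cases "integrable lebesgue f")
    case True
    have "ennreal (integral\<^sup>L lebesgue f) = (\<integral>\<^sup>+ z. ennreal (f z) \<partial>lebesgue)"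
      using True f0 by (intro nn_integral_eq_integral [symmetric]) auto
    also have "\<dots> = (\<integral>\<^sup>+ z. indicator D z * ennreal ((v z)\<^sup>2) \<partial>lebesgue)"
      by (intro nn_integral_cong) (auto simp: f_def indicator_def)
    also have "\<dots> \<le> ennreal X" by (rule assms)
    finally show ?thesis using assms(2) by simp
  next
    \<comment> \<open>A function that is not integrable has the default integral 0, so the upper
      bound holds without a measurability proof for \<open>v\<close>.\<close>
    case False then show ?thesis using assms(2) by (simp add: not_integrable_integral_eq)
  qed
  finally show ?thesis .
qed

text \<open>Bounds that are given for \<open>L2_norm_on\<close> have to be turned into bounds for
  nonnegative integrals. This direction needs genuine integrability, supplied by continuity on the
  compact square.\<close>

lemma L2_norm_on_square_eq:
  assumes c: "continuous_on closed_unit_square v" and D: "D \<in> sets borel" "D \<subseteq> closed_unit_square"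
  shows "(\<integral>\<^sup>+ z. indicator D z * ennreal ((v z)\<^sup>2) \<partial>lborel) = ennreal ((L2_norm_on D v)\<^sup>2)"
proof -
  define f where "f = (\<lambda>z. indicator D z *\<^sub>R (v z)\<^sup>2)"
  have cs: "compact closed_unit_square" by (intro compact_Times compact_Icc)
  have "set_integrable lborel closed_unit_square (\<lambda>z. (v z)\<^sup>2)"
    unfolding set_integrable_def using cs
    by (rule borel_integrable_compact) (intro continuous_intros c)
  then have "set_integrable lborel D (\<lambda>z. (v z)\<^sup>2)"
    by (rule set_integrable_subset) (use D in auto)
  then have fi: "integrable lborel f" unfolding f_def set_integrable_def .
  have "(L2_norm_on D v)\<^sup>2 = integral\<^sup>L lebesgue f"
    unfolding L2_norm_on_def set_lebesgue_integral_def f_def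
    by (intro real_sqrt_pow2 integral_nonneg_AE) auto
  also have "\<dots> = integral\<^sup>L lborel f"
    using borel_measurable_integrable [OF fi] by (rule integral_completion)
  also have "ennreal \<dots> = (\<integral>\<^sup>+ z. ennreal (f z) \<partial>lborel)"
    by (intro nn_integral_eq_integral [symmetric] fi) (auto simp: f_def)
  also have "\<dots> = (\<integral>\<^sup>+ z. indicator D z * ennreal ((v z)\<^sup>2) \<partial>lborel)"
    by (intro nn_integral_cong) (auto simp: f_def indicator_def)
  finally show ?thesis by simp
qed

text \<open>Integral of \<open>F\<close> along the horizontal line over all points within distance
  \<open>H\<close>. It dominates the integral over the cell through \<open>(x, y)\<close> without
  depending on the cell, which avoids summing over the mesh.\<close>

definition window_x :: "real \<Rightarrow> (real \<times> real \<Rightarrow> ennreal) \<Rightarrow> real \<times> real \<Rightarrow> ennreal" where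
  "window_x H F = (\<lambda>(x, y). \<integral>\<^sup>+ t. indicator {t. \<bar>t - x\<bar> \<le> H} t * F (t, y) \<partial>lborel)"

definition window_y :: "real \<Rightarrow> (real \<times> real \<Rightarrow> ennreal) \<Rightarrow> real \<times> real \<Rightarrow> ennreal" where
  "window_y H F = (\<lambda>(x, y). \<integral>\<^sup>+ t. indicator {t. \<bar>t - y\<bar> \<le> H} t * F (x, t) \<partial>lborel)"

lemma measurable_strip: "(\<lambda>(x::real, t). indicator {t. \<bar>t - x\<bar> \<le> H} t :: ennreal) \<in> borel_measurable (borel \<Otimes>\<^sub>M borel)"
proof -
  have "(\<lambda>(x::real, t). indicator {t. \<bar>t - x\<bar> \<le> H} t :: ennreal) = (\<lambda>p. indicator {p. \<bar>snd p - fst p\<bar> \<le> H} p)"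
    by (auto simp: fun_eq_iff indicator_def)
  moreover have "{p. \<bar>snd p - fst p\<bar> \<le> H} \<in> sets (borel \<Otimes>\<^sub>M borel)"
    unfolding borel_prod by (intro borel_closed closed_Collect_le continuous_intros)
  ultimately show ?thesis by simp
qed

lemma window_measurable:
  assumes F: "F \<in> borel_measurable borel"
  shows "window_x H F \<in> borel_measurable borel" "window_y H F \<in> borel_measurable borel"
proof -
  have [measurable]: "F \<in> borel_measurable (borel \<Otimes>\<^sub>M borel)" using F by (simp add: borel_prod)
  have m1: "(\<lambda>p. indicator {t. \<bar>t - x p\<bar> \<le> H} (s p) :: ennreal) \<in> borel_measurable M"
    if [measurable]: "x \<in> borel_measurable M" "s \<in> borel_measurable M" for x s and M :: "'z measure"
    using measurable_compose [OF measurable_Pair [OF that] measurable_strip] by simp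
  have "(\<lambda>p. \<integral>\<^sup>+ t. indicator {t. \<bar>t - fst p\<bar> \<le> H} t * F (t, snd p) \<partial>lborel) \<in> borel_measurable (borel \<Otimes>\<^sub>M borel)"
    by (rule lborel.borel_measurable_nn_integral)
      (auto simp: case_prod_beta intro!: borel_measurable_times_ennreal m1 measurable_compose [OF measurable_Pair F [folded borel_prod]])
  then show "window_x H F \<in> borel_measurable borel"
    unfolding window_x_def borel_prod by (simp add: case_prod_beta)
  have "(\<lambda>p. \<integral>\<^sup>+ t. indicator {t. \<bar>t - snd p\<bar> \<le> H} t * F (fst p, t) \<partial>lborel) \<in> borel_measurable (borel \<Otimes>\<^sub>M borel)"
    by (rule lborel.borel_measurable_nn_integral)
      (auto simp: case_prod_beta intro!: borel_measurable_times_ennreal m1 measurable_compose [OF measurable_Pair F [folded borel_prod]])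
  then show "window_y H F \<in> borel_measurable borel"
    unfolding window_y_def borel_prod by (simp add: case_prod_beta)
qed

lemma nn_integral_strip:
  assumes "H \<ge> 0"
  shows "(\<integral>\<^sup>+ x. indicator {t. \<bar>t - x\<bar> \<le> H} t \<partial>lborel) = ennreal (2 * H)"
proof -
  have "(\<lambda>x. indicator {t. \<bar>t - x\<bar> \<le> H} t :: ennreal) = indicator {t - H..t + H}"
    by (auto simp: fun_eq_iff indicator_def)
  then show ?thesis using assms by simp
qed

lemma nn_integral_lborel_prod:
  assumes "f \<in> borel_measurable borel"
  shows "(\<integral>\<^sup>+ z. f z \<partial>lborel) = (\<integral>\<^sup>+ x. \<integral>\<^sup>+ y. f (x, y) \<partial>lborel \<partial>(lborel :: real measure))"
    and "(\<integral>\<^sup>+ z. f z \<partial>lborel) = (\<integral>\<^sup>+ y. \<integral>\<^sup>+ x. f (x, y) \<partial>lborel \<partial>(lborel :: real measure))"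
proof -
  have m: "f \<in> borel_measurable (lborel \<Otimes>\<^sub>M lborel)" using assms by (simp add: lborel_prod)
  then have m': "case_prod (curry f) \<in> borel_measurable (lborel \<Otimes>\<^sub>M lborel)" by simp
  show 1: "(\<integral>\<^sup>+ z. f z \<partial>lborel) = (\<integral>\<^sup>+ x. \<integral>\<^sup>+ y. f (x, y) \<partial>lborel \<partial>(lborel :: real measure))"
    using lborel.nn_integral_fst [OF m] by (simp add: lborel_prod)
  show "(\<integral>\<^sup>+ z. f z \<partial>lborel) = (\<integral>\<^sup>+ y. \<integral>\<^sup>+ x. f (x, y) \<partial>lborel \<partial>(lborel :: real measure))"
    unfolding 1 using lborel_pair.Fubini' [OF m'] by simp
qed

text \<open>By Tonelli every point t is counted for the x with distance at most \<open>H\<close>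
  from it, an interval of length 2 H. This replaces the summation of cell integrals to a global norm
  and gains one power of \<open>H\<close>.\<close>

lemma nn_integral_window:
  assumes F: "F \<in> borel_measurable borel" and H: "H \<ge> 0"
  shows "(\<integral>\<^sup>+ z. window_x H F z \<partial>lborel) = ennreal (2 * H) * (\<integral>\<^sup>+ z. F z \<partial>lborel)"
    and "(\<integral>\<^sup>+ z. window_y H F z \<partial>lborel) = ennreal (2 * H) * (\<integral>\<^sup>+ z. F z \<partial>lborel)"
proof -
  have strip: "(\<lambda>(x, t). indicator {t. \<bar>t - x\<bar> \<le> H} t * f t) \<in> borel_measurable (lborel \<Otimes>\<^sub>M lborel)"
    if "f \<in> borel_measurable borel" for f :: "real \<Rightarrow> ennreal"
  proof -
    have "(\<lambda>p. (case p of (x, t) \<Rightarrow> indicator {t. \<bar>t - x\<bar> \<le> H} t) * f (snd p)) \<in> borel_measurable (borel \<Otimes>\<^sub>M borel)"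
      by (intro borel_measurable_times_ennreal measurable_strip measurable_compose [OF measurable_snd that])
    then show ?thesis by (simp add: case_prod_beta lborel_prod borel_prod)
  qed
  have Fm: "(\<lambda>t. F (t, y)) \<in> borel_measurable borel" "(\<lambda>t. F (y, t)) \<in> borel_measurable borel" for y
    using F by (auto intro!: measurable_compose [OF _ F [folded borel_prod]])
  have ex: "(\<integral>\<^sup>+ x. \<integral>\<^sup>+ t. indicator {t. \<bar>t - x\<bar> \<le> H} t * f t \<partial>lborel \<partial>lborel) = ennreal (2 * H) * (\<integral>\<^sup>+ t. f t \<partial>lborel)"
    if [measurable]: "f \<in> borel_measurable borel" for f :: "real \<Rightarrow> ennreal"
  proof -
    have "(\<integral>\<^sup>+ x. \<integral>\<^sup>+ t. indicator {t. \<bar>t - x\<bar> \<le> H} t * f t \<partial>lborel \<partial>lborel) =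
        (\<integral>\<^sup>+ t. \<integral>\<^sup>+ x. indicator {t. \<bar>t - x\<bar> \<le> H} t * f t \<partial>lborel \<partial>lborel)"
      by (rule lborel_pair.Fubini' [OF strip [OF that], symmetric])
    also have "\<dots> = (\<integral>\<^sup>+ t. f t * ennreal (2 * H) \<partial>lborel)"
    proof (rule nn_integral_cong)
      fix t
      have "(\<lambda>x. indicator {t. \<bar>t - x\<bar> \<le> H} t :: ennreal) = indicator {t - H..t + H}"
        by (auto simp: fun_eq_iff indicator_def)
      then have "(\<lambda>x. indicator {t. \<bar>t - x\<bar> \<le> H} t :: ennreal) \<in> borel_measurable lborel" by simp
      then show "(\<integral>\<^sup>+ x. indicator {t. \<bar>t - x\<bar> \<le> H} t * f t \<partial>lborel) = f t * ennreal (2 * H)"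
        using H by (subst mult.commute, subst nn_integral_cmult) (auto simp: nn_integral_strip)
    qed
    also have "\<dots> = ennreal (2 * H) * (\<integral>\<^sup>+ t. f t \<partial>lborel)"
      by (subst mult.commute, rule nn_integral_cmult) simp
    finally show ?thesis .
  qed
  have Gm: "(\<lambda>y. \<integral>\<^sup>+ x. F (x, y) \<partial>lborel) \<in> borel_measurable lborel"
    "(\<lambda>y. \<integral>\<^sup>+ x. F (y, x) \<partial>lborel) \<in> borel_measurable lborel"
    using measurable_compose [OF measurable_Pair [OF measurable_snd measurable_fst] F [folded borel_prod]]
      measurable_compose [OF measurable_Pair [OF measurable_fst measurable_snd] F [folded borel_prod]]
    by (auto intro!: lborel.borel_measurable_nn_integral simp: case_prod_beta cong: measurable_cong_sets)
  show "(\<integral>\<^sup>+ z. window_x H F z \<partial>lborel) = ennreal (2 * H) * (\<integral>\<^sup>+ z. F z \<partial>lborel)"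
    unfolding nn_integral_lborel_prod(2) [OF window_measurable(1) [OF F]] nn_integral_lborel_prod(2) [OF F]
    unfolding window_x_def by (simp add: ex [OF Fm(1)]) (rule nn_integral_cmult [OF Gm(1)])
  show "(\<integral>\<^sup>+ z. window_y H F z \<partial>lborel) = ennreal (2 * H) * (\<integral>\<^sup>+ z. F z \<partial>lborel)"
    unfolding nn_integral_lborel_prod(1) [OF window_measurable(2) [OF F]] nn_integral_lborel_prod(1) [OF F]
    unfolding window_y_def by (simp add: ex [OF Fm(2)]) (rule nn_integral_cmult [OF Gm(2)])
qed

section \<open>The quasi-interpolant expressed by the one-dimensional operators\<close>

lemma nodes_distinct:
  assumes "(a::real) < b"
  shows "a \<noteq> (a + b) / 2" "(a + b) / 2 \<noteq> b" "a \<noteq> b" "(a + b) / 2 \<noteq> a" "b \<noteq> (a + b) / 2" "b \<noteq> a"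
  using assms by (auto simp: field_simps)

lemma sum_lagrange:
  assumes "a < b"
  shows "(\<Sum>\<xi>\<in>nodes3 (a, b). f \<xi> * lagrange (a, b) \<xi> x) = lag 0 a b f x"
proof -
  define r m where "r = (b - a) / 2" and "m = (a + b) / 2"
  define t where "t = (x - m) / r"
  have r: "r > 0" "b = a + 2 * r" "m = a + r" using assms by (auto simp: r_def m_def field_simps)
  have x: "x = a + r + r * t" using r(1) unfolding t_def r(3) by (simp add: field_simps)
  note nd = nodes_distinct [OF assms, folded m_def]
  have l: "lagrange (a, b) a x = t * (t - 1) / 2" "lagrange (a, b) m x = 1 - t\<^sup>2"
    "lagrange (a, b) b x = t * (t + 1) / 2"
  proof -
    have s: "{a, m, b} - {a} = {m, b}" "{a, m, b} - {m} = {a, b}" "{a, m, b} - {b} = {a, m}"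
      using nd by auto
    show "lagrange (a, b) a x = t * (t - 1) / 2" "lagrange (a, b) m x = 1 - t\<^sup>2"
      "lagrange (a, b) b x = t * (t + 1) / 2"
      unfolding lagrange.simps nodes3.simps m_def [symmetric] s
      using nd r(1) by (simp_all add: x r(2,3) power2_eq_square divide_simps) (simp_all add: algebra_simps)
  qed
  have "(\<Sum>\<xi>\<in>nodes3 (a, b). f \<xi> * lagrange (a, b) \<xi> x) =
      f a * lagrange (a, b) a x + f m * lagrange (a, b) m x + f b * lagrange (a, b) b x"
    unfolding nodes3.simps m_def [symmetric] using nd by (simp del: lagrange.simps)
  then show ?thesis unfolding l lag_def Let_def r_def [symmetric] m_def [symmetric] t_def by simp
qed

lemma lag_node:
  assumes "a < b" "\<xi> \<in> nodes3 (a, b)"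
  shows "lag 0 a b f \<xi> = f \<xi>"
proof -
  define r where "r = (b - a) / 2"
  define m where "m = (a + b) / 2"
  have r: "r > 0" "b = a + 2 * r" "m = a + r" using assms by (auto simp: r_def m_def field_simps)
  have "\<xi> = a \<or> \<xi> = m \<or> \<xi> = b" using assms by (auto simp: m_def)
  then show ?thesis unfolding lag_def Let_def r_def [symmetric] m_def [symmetric]
    using r(1) by (auto simp: r(2,3))
qed

lemma sum_phi_psi:
  assumes "a < b" "x \<in> {a..b}"
  shows "(\<Sum>e\<in>ends (a, b). f e * phi (a, b) e x + g e * psi (a, b) e x) = her 0 a b f g x"
proof -
  have "(\<Sum>e\<in>ends (a, b). f e * phi (a, b) e x + g e * psi (a, b) e x) =
     f a * pwq a b 1 0 0 0 x + g a * pwq a b 0 0 1 0 x + (f b * pwq a b 0 1 0 0 x + g b * pwq a b 0 0 0 1 x)"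
    using assms by (simp add: phi_explicit(2) psi_explicit(2))
  also have "\<dots> = pwq a b (f a) (f b) (g a) (g b) x"
    unfolding pwq_def Let_def
    by (simp add: algebra_simps add_divide_distrib diff_divide_distrib)
  finally show ?thesis by (simp add: her_def)
qed

lemma nodal_interp_eq:
  assumes "a < b" "c < d"
  shows "nodal_interp u (a, b) (c, d) (x, y) = lag 0 a b (\<lambda>\<xi>. lag 0 c d (\<lambda>\<eta>. u (\<xi>, \<eta>)) y) x"
proof -
  have "nodal_interp u (a, b) (c, d) (x, y) = (\<Sum>\<xi>\<in>nodes3 (a, b).
      (\<Sum>\<eta>\<in>nodes3 (c, d). u (\<xi>, \<eta>) * lagrange (c, d) \<eta> y) * lagrange (a, b) \<xi> x)"
    unfolding nodal_interp_def by (simp add: sum_distrib_right sum_distrib_left mult_ac del: nodes3.simps lagrange.simps)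
  then show ?thesis unfolding sum_lagrange [OF assms(2)] sum_lagrange [OF assms(1)] .
qed

text \<open>Grouping by the basis functions in x: the Hermite interpolants in y of u and of u_x are
  the values and slopes of the outer interpolant, and the twist coefficients are the slopes
  prescribed for u_x.\<close>

lemma corner_interp_eq:
  assumes "a < b" "c < d" "x \<in> {a..b}" "y \<in> {c..d}"
  shows "corner_interp \<sigma> u (a, b) (c, d) (x, y) =
     her 0 a b (\<lambda>e. her 0 c d (\<lambda>g. u (e, g)) (\<lambda>g. pd 0 1 u (e, g)) y)
               (\<lambda>e. her 0 c d (\<lambda>g. pd 1 0 u (e, g)) (\<lambda>g. twist_coeff u (\<sigma> (e, g)) (e, g)) y) x"
  unfolding sum_phi_psi [OF assms(1,3), symmetric] sum_phi_psi [OF assms(2,4), symmetric] corner_interp_def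
  by (simp add: sum_distrib_right sum_distrib_left sum.distrib [symmetric] algebra_simps del: ends.simps twist_coeff.simps)

lemma h_edge_interp_eq:
  assumes "a < b" "c < d" "y \<in> {c..d}"
  shows "h_edge_interp lam N u (a, b) (c, d) (x, y) =
     lag 0 a b (\<lambda>\<xi>. her 0 c d (\<lambda>\<eta>. u (\<xi>, \<eta>)) (\<lambda>\<eta>. normal_slope lam N u (a, b) \<xi> \<eta>) y) x"
  unfolding sum_lagrange [OF assms(1), symmetric] sum_phi_psi [OF assms(2,3), symmetric] h_edge_interp_def
  by (simp add: sum_distrib_right sum_distrib_left mult_ac del: ends.simps nodes3.simps lagrange.simps)

text \<open>At a node of the x interval the interpolation in x is the identity, so the slope at the
  interface is a purely one-dimensional quantity.\<close>

lemma deriv_nodal_interp: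
  assumes "a < b" "c < d" "\<xi> \<in> nodes3 (a, b)"
  shows "deriv (\<lambda>y. nodal_interp u (a, b) (c, d) (\<xi>, y)) \<eta> = lag 1 c d (\<lambda>\<eta>. u (\<xi>, \<eta>)) \<eta>"
  unfolding nodal_interp_eq [OF assms(1,2)] lag_node [OF assms(1,3)]
  using lag_deriv [OF assms(2), of 0] by (auto intro: DERIV_imp_deriv)

text \<open>The sum of the two psi functions is odd about the midpoint and integrates to 0; the
  quadratic part contributes 3 / r times r / 3. Integral 1 means that averaging against the dual
  function preserves constants.\<close>

lemma integral_dual:
  assumes "a < b" "e \<in> {a, b}"
  shows "(dual (a, b) e has_integral 1) {a..b}"
    and "x \<in> {a..b} \<Longrightarrow> \<bar>dual (a, b) e x\<bar> \<le> 400 / (b - a)"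
    and "continuous_on {a..b} (dual (a, b) e)"
proof -
  define r where "r = (b - a) / 2"
  define m where "m = (a + b) / 2"
  define s :: real where "s = (if e = a then 6 else - 6)"
  have r: "r > 0" "b = a + 2 * r" "m = a + r" using assms by (auto simp: r_def m_def field_simps)
  define D where "D x = s / r\<^sup>2 * her 0 a b (\<lambda>_. 0) (\<lambda>_. 1) x + 3 / r * (((x - m) / r)\<^sup>2 - 1 / 6)" for x
  have D: "dual (a, b) e x = D x" if "x \<in> {a..b}" for x
  proof -
    have "psi (a, b) a x + psi (a, b) b x = her 0 a b (\<lambda>_. 0) (\<lambda>_. 1) x"
      using sum_phi_psi [OF assms(1) that, of "\<lambda>_. 0" "\<lambda>_. 1"] assms(1) by simp
    then show ?thesis unfolding dual_explicit(2) [OF assms] D_def r_def m_def s_def by simp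
  qed
  have c: "continuous_on {a..b} D"
  proof -
    have "continuous_on {a..b} (pwq a b 0 0 1 1)"
      by (rule DERIV_continuous_on) (rule pwq_deriv [OF assms(1)])
    then show ?thesis unfolding D_def her_def using r by (auto intro!: continuous_intros)
  qed
  then show "continuous_on {a..b} (dual (a, b) e)"
    by (rule continuous_on_eq) (simp add: D)
  have hl: "her 0 a b (\<lambda>_. 0) (\<lambda>_. 1) x = (x - a) - (x - a)\<^sup>2 / r" if "x \<le> m" for x
    using that r(1) unfolding her_def pwq_def Let_def m_def r_def [symmetric] by simp
  have hr: "her 0 a b (\<lambda>_. 0) (\<lambda>_. 1) x = - ((b - x) - (b - x)\<^sup>2 / r)" if "x \<ge> m" for x
  proof (cases "x = m")
    case True
    have "her 0 a b (\<lambda>_. 0) (\<lambda>_. 1) m = 0" unfolding hl [OF order_refl] using r(1) by (simp add: r(3) power2_eq_square)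
    moreover have "(b - m) - (b - m)\<^sup>2 / r = 0" using r(1) by (simp add: r(2,3) power2_eq_square)
    ultimately show ?thesis using True by simp
  next
    case False
    then show ?thesis
    using that r(1) unfolding her_def pwq_def Let_def m_def r_def [symmetric] by simp
  qed
  have i1: "(her 0 a b (\<lambda>_. 0) (\<lambda>_. 1) has_integral ((m - a)\<^sup>2 / 2 - (m - a) ^ 3 / (3 * r)) - ((a - a)\<^sup>2 / 2 - (a - a) ^ 3 / (3 * r))) {a..m}"
  proof (rule fundamental_theorem_of_calculus)
    fix x assume "x \<in> {a..m}"
    then show "((\<lambda>x. (x - a)\<^sup>2 / 2 - (x - a) ^ 3 / (3 * r)) has_vector_derivative her 0 a b (\<lambda>_. 0) (\<lambda>_. 1) x) (at x within {a..m})"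
      using r(1) hl [of x] unfolding has_real_derivative_iff_has_vector_derivative [symmetric]
      by (auto intro!: derivative_eq_intros)
  qed (use r in auto)
  have i2: "(her 0 a b (\<lambda>_. 0) (\<lambda>_. 1) has_integral ((b - b)\<^sup>2 / 2 - (b - b) ^ 3 / (3 * r)) - ((b - m)\<^sup>2 / 2 - (b - m) ^ 3 / (3 * r))) {m..b}"
  proof (rule fundamental_theorem_of_calculus)
    fix x assume "x \<in> {m..b}"
    then show "((\<lambda>x. (b - x)\<^sup>2 / 2 - (b - x) ^ 3 / (3 * r)) has_vector_derivative her 0 a b (\<lambda>_. 0) (\<lambda>_. 1) x) (at x within {m..b})"
      using r(1) hr [of x] unfolding has_real_derivative_iff_has_vector_derivative [symmetric]
      by (auto intro!: derivative_eq_intros)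
  qed (use r in auto)
  have "(her 0 a b (\<lambda>_. 0) (\<lambda>_. 1) has_integral 0) {a..b}"
    using has_integral_combine [OF _ _ i1 i2] r by (simp add: algebra_simps)
  moreover have "((\<lambda>x. ((x - m) / r)\<^sup>2 - 1 / 6) has_integral
      ((b - m) ^ 3 / (3 * r\<^sup>2) - b / 6) - ((a - m) ^ 3 / (3 * r\<^sup>2) - a / 6)) {a..b}"
  proof (rule fundamental_theorem_of_calculus)
    fix x show "((\<lambda>x. (x - m) ^ 3 / (3 * r\<^sup>2) - x / 6) has_vector_derivative ((x - m) / r)\<^sup>2 - 1 / 6) (at x within {a..b})"
      using r(1) unfolding has_real_derivative_iff_has_vector_derivative [symmetric]
      by (auto intro!: derivative_eq_intros simp: field_simps power2_eq_square)
  qed (use assms in auto)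
  moreover have "((b - m) ^ 3 / (3 * r\<^sup>2) - b / 6) - ((a - m) ^ 3 / (3 * r\<^sup>2) - a / 6) = r / 3"
    using r(1) unfolding r(2,3) by (simp add: field_simps power2_eq_square power3_eq_cube)
  ultimately have "(D has_integral s / r\<^sup>2 * 0 + 3 / r * (r / 3)) {a..b}"
    unfolding D_def by (intro has_integral_add has_integral_mult_right) simp_all
  then have "(D has_integral 1) {a..b}" using r(1) by simp
  then show "(dual (a, b) e has_integral 1) {a..b}"
    by (rule has_integral_eq [rotated]) (simp add: D)
  show "\<bar>dual (a, b) e x\<bar> \<le> 400 / (b - a)" if x: "x \<in> {a..b}"
  proof -
    have "\<bar>her 0 a b (\<lambda>_. 0) (\<lambda>_. 1) x\<bar> \<le> 8 * (0 + (b - a) * 1) / (b - a) ^ 0"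
      by (rule her_stable [OF assms(1) x]) auto
    then have "\<bar>her 0 a b (\<lambda>_. 0) (\<lambda>_. 1) x\<bar> \<le> 16 * r" unfolding r(2) by simp
    moreover have "\<bar>s / r\<^sup>2\<bar> \<le> 6 / r\<^sup>2" unfolding s_def using r(1) by (simp add: abs_divide)
    ultimately have 1: "\<bar>s / r\<^sup>2 * her 0 a b (\<lambda>_. 0) (\<lambda>_. 1) x\<bar> \<le> 6 / r\<^sup>2 * (16 * r)"
      unfolding abs_mult using r(1) by (intro mult_mono) auto
    have "\<bar>(x - m) / r\<bar> \<le> 1" using x r by (auto simp: abs_le_iff field_simps)
    then have "((x - m) / r)\<^sup>2 \<le> 1" by (simp add: abs_square_le_1)
    moreover have "0 \<le> ((x - m) / r)\<^sup>2" by simp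
    ultimately have "\<bar>((x - m) / r)\<^sup>2 - 1 / 6\<bar> \<le> 1" by linarith
    then have 2: "\<bar>3 / r * (((x - m) / r)\<^sup>2 - 1 / 6)\<bar> \<le> 3 / r * 1"
      unfolding abs_mult using r(1) by (intro mult_mono) auto
    \<comment> \<open>The two parts add up to 99 / r, where r is half the length, well below 400 /
      (2 r).\<close>
    have "\<bar>D x\<bar> \<le> 6 / r\<^sup>2 * (16 * r) + 3 / r * 1" unfolding D_def using 1 2 by linarith
    also have "\<dots> \<le> 400 / (2 * r)" using r(1) by (simp add: field_simps power2_eq_square)
    finally show ?thesis unfolding D [OF x] using r(2) by simp
  qed
qed

text \<open>Since the dual function has integral 1, \<open>k\<close> can be moved under the
  integral. Its supremum bound times the length of the interval gives 400.\<close>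

lemma integral_dual_approx:
  assumes "a < b" "e \<in> {a, b}" and c: "continuous_on {a..b} f"
    and w: "\<And>x. x \<in> {a..b} \<Longrightarrow> \<bar>f x - k\<bar> \<le> w"
  shows "\<bar>integral {a..b} (\<lambda>x. f x * dual (a, b) e x) - k\<bar> \<le> 400 * w"
proof -
  note d = integral_dual [OF assms(1,2)]
  have hi: "((\<lambda>x. (f x - k) * dual (a, b) e x) has_integral
      integral {a..b} (\<lambda>x. f x * dual (a, b) e x) - k * 1) {a..b}"
    unfolding left_diff_distrib
    by (intro has_integral_diff has_integral_mult_right d(1) integrable_integral
        integrable_continuous_interval continuous_intros c d(3))
  have "w \<ge> 0" using w [of a] assms(1) by auto
  have "norm (integral {a..b} (\<lambda>x. f x * dual (a, b) e x) - k * 1) \<le> (w * (400 / (b - a))) * measure lborel {a..b}"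
  proof (intro has_integral_bound_real [OF _ finite.emptyI hi])
    fix x assume "x \<in> {a..b} - {}"
    then show "norm ((f x - k) * dual (a, b) e x) \<le> w * (400 / (b - a))"
      unfolding real_norm_def abs_mult using \<open>w \<ge> 0\<close> by (intro mult_mono w d(2)) auto
  qed (use assms(1) \<open>w \<ge> 0\<close> in auto)
  then show ?thesis using assms(1) by simp
qed

subsection \<open>Mesh\<close>

locale mesh =
  fixes N :: nat and lam :: real
  assumes N: "8 dvd N" "0 < N" and lam: "0 < lam" "lam \<le> 1 / 4"
begin

abbreviation "mp \<equiv> mesh_point lam N"
abbreviation "fine_itvs \<equiv> fine_macros lam N"
abbreviation "coarse_itvs \<equiv> coarse_cells lam N"

definition h where "h = 4 * lam / real N"
definition H where "H = 2 * (1 - 2 * lam) / real N"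

lemma N_ge: "N \<ge> 8" using N by (auto elim: dvdE)

lemma hH: "0 < h" "0 < H" "h \<le> 1 / real N" "1 / real N \<le> H" "H \<le> 2 / real N"
  using N(2) lam by (auto simp: h_def H_def field_simps)

lemma quarter: "even (N div 4)" "even (3 * N div 4)" "4 * (N div 4) = N" "3 * N div 4 = 3 * (N div 4)" "N div 4 \<ge> 2"
proof -
  obtain k where "N = 8 * k" using N(1) by (auto elim: dvdE)
  then show "even (N div 4)" "even (3 * N div 4)" "4 * (N div 4) = N" "3 * N div 4 = 3 * (N div 4)" "N div 4 \<ge> 2"
    using N(2) by auto
qed

lemma mp_eq:
  "mp i = (if i \<le> N div 4 then real i * h
      else if i \<le> 3 * N div 4 then lam + (real i - real (N div 4)) * H
      else (1 - lam) + (real i - real (3 * N div 4)) * h)"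
  unfolding mesh_point_def Let_def h_def H_def by (auto simp: of_nat_diff)

lemma quarter_h: "real (N div 4) * h = lam" "2 * real (N div 4) * H = 1 - 2 * lam"
proof -
  have "real N = 4 * real (N div 4)" using quarter(3) by (metis of_nat_mult of_nat_numeral)
  then show "real (N div 4) * h = lam" "2 * real (N div 4) * H = 1 - 2 * lam"
    using quarter(5) unfolding h_def H_def by (auto simp: field_simps)
qed

lemma mp_step:
  "i < N div 4 \<Longrightarrow> mp (Suc i) = mp i + h"
  "N div 4 \<le> i \<Longrightarrow> i < 3 * N div 4 \<Longrightarrow> mp (Suc i) = mp i + H"
  "3 * N div 4 \<le> i \<Longrightarrow> mp (Suc i) = mp i + h"
proof -
  have q: "real (3 * N div 4) = 3 * real (N div 4)" "N div 4 < 3 * N div 4" using quarter by auto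
  show "i < N div 4 \<Longrightarrow> mp (Suc i) = mp i + h"
    unfolding mp_eq by (auto simp: algebra_simps)
  show "N div 4 \<le> i \<Longrightarrow> i < 3 * N div 4 \<Longrightarrow> mp (Suc i) = mp i + H"
    using quarter_h q unfolding mp_eq
    by (cases "i = N div 4") (auto simp: algebra_simps)
  show "3 * N div 4 \<le> i \<Longrightarrow> mp (Suc i) = mp i + h"
    using quarter_h q unfolding mp_eq
    by (cases "i = 3 * N div 4") (auto simp: algebra_simps)
qed

lemma mp_vals: "mp 0 = 0" "mp (N div 4) = lam" "mp (3 * N div 4) = 1 - lam" "mp N = 1"
proof -
  have q: "N div 4 < 3 * N div 4" "3 * N div 4 < N" using quarter N(2) by linarith+
  have "real (4 * (N div 4)) = real N" using quarter(3) by simp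
  then have q': "real (3 * N div 4) = 3 * real (N div 4)" "real N = 4 * real (N div 4)"
    unfolding quarter(4) by simp_all
  note q = q q'
  show "mp 0 = 0" "mp (N div 4) = lam" unfolding mp_eq using quarter_h by auto
  show "mp (3 * N div 4) = 1 - lam" unfolding mp_eq using quarter_h q by (auto simp: algebra_simps)
  show "mp N = 1" unfolding mp_eq using quarter_h q by (auto simp: algebra_simps)
qed

lemma mp_strict_mono: "strict_mono mp"
proof (rule strict_monoI_Suc)
  fix i show "mp i < mp (Suc i)"
    using mp_step [of i] hH by (cases "i < N div 4"; cases "i < 3 * N div 4") auto
qed

lemma mp_less: "mp i < mp j \<longleftrightarrow> i < j" and mp_le: "mp i \<le> mp j \<longleftrightarrow> i \<le> j" and mp_inj: "mp i = mp j \<longleftrightarrow> i = j"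
  using mp_strict_mono by (auto simp: strict_mono_less strict_mono_less_eq strict_mono_eq)

text \<open>Indexing by the even left end instead of the odd midpoint avoids truncated
  subtraction.\<close>

lemma fine_iff:
  "J \<in> fine_itvs \<longleftrightarrow> (\<exists>p. even p \<and> J = (mp p, mp (p + 2)) \<and> (p + 2 \<le> N div 4 \<or> 3 * N div 4 \<le> p \<and> p + 2 \<le> N))"
proof
  assume "J \<in> fine_itvs"
  then obtain i where "odd i" "J = (mp (i - 1), mp (i + 1))" "i + 1 \<le> N div 4 \<or> 3 * N div 4 \<le> i - 1 \<and> i + 1 \<le> N"
    unfolding fine_macros_def by blast
  then show "\<exists>p. even p \<and> J = (mp p, mp (p + 2)) \<and> (p + 2 \<le> N div 4 \<or> 3 * N div 4 \<le> p \<and> p + 2 \<le> N)"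
    by (intro exI [of _ "i - 1"]) (auto elim!: oddE)
next
  assume "\<exists>p. even p \<and> J = (mp p, mp (p + 2)) \<and> (p + 2 \<le> N div 4 \<or> 3 * N div 4 \<le> p \<and> p + 2 \<le> N)"
  then obtain p where "even p" "J = (mp p, mp (p + 2))" "p + 2 \<le> N div 4 \<or> 3 * N div 4 \<le> p \<and> p + 2 \<le> N"
    by blast
  then show "J \<in> fine_itvs" unfolding fine_macros_def
    by (intro CollectI exI [of _ "p + 1"]) auto
qed

lemma coarse_iff:
  "J \<in> coarse_itvs \<longleftrightarrow> (\<exists>p. J = (mp p, mp (p + 1)) \<and> N div 4 \<le> p \<and> p + 1 \<le> 3 * N div 4)"
  unfolding coarse_cells_def by auto

lemma fineD:
  assumes "(a, b) \<in> fine_itvs"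
  shows "a < b" "b - a = 2 * h" "(0 \<le> a \<and> b \<le> lam) \<or> (1 - lam \<le> a \<and> b \<le> 1)" "0 \<le> a" "b \<le> 1"
proof -
  obtain p where p: "even p" "a = mp p" "b = mp (p + 2)" "p + 2 \<le> N div 4 \<or> 3 * N div 4 \<le> p \<and> p + 2 \<le> N"
    using assms unfolding fine_iff by auto
  show "a < b" unfolding p by (simp add: mp_less)
  have "mp (Suc (Suc p)) = mp p + h + h" using mp_step [of p] mp_step [of "Suc p"] p(4) by auto
  then show "b - a = 2 * h" unfolding p by simp
  show 1: "(0 \<le> a \<and> b \<le> lam) \<or> (1 - lam \<le> a \<and> b \<le> 1)"
    using p(4) mp_le [of 0 p] mp_le [of "p + 2" N] mp_le [of "p + 2" "N div 4"] mp_le [of "3 * N div 4" p]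
    unfolding p(2,3) mp_vals by auto
  then show "0 \<le> a" "b \<le> 1" using lam by auto
qed

lemma coarseD:
  assumes "(a, b) \<in> coarse_itvs"
  shows "a < b" "b - a = H" "lam \<le> a" "b \<le> 1 - lam" "0 \<le> a" "b \<le> 1"
proof -
  obtain p where p: "a = mp p" "b = mp (p + 1)" "N div 4 \<le> p" "p + 1 \<le> 3 * N div 4"
    using assms unfolding coarse_iff by auto
  show "a < b" unfolding p by (simp add: mp_less)
  show "b - a = H" unfolding p using mp_step(2) [of p] p by auto
  show "lam \<le> a" "b \<le> 1 - lam"
    using mp_le [of "N div 4" p] mp_le [of "p + 1" "3 * N div 4"] p unfolding mp_vals by auto
  then show "0 \<le> a" "b \<le> 1" using lam by auto
qed

lemma interface_cells:
  "(lam, mp (N div 4 + 1)) \<in> coarse_itvs" "(mp (3 * N div 4 - 1), 1 - lam) \<in> coarse_itvs"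
proof -
  have q: "N div 4 + 1 \<le> 3 * N div 4" using quarter by auto
  show "(lam, mp (N div 4 + 1)) \<in> coarse_itvs"
    unfolding coarse_iff using q mp_vals(2) by (intro exI [of _ "N div 4"]) auto
  show "(mp (3 * N div 4 - 1), 1 - lam) \<in> coarse_itvs"
    unfolding coarse_iff using q mp_vals(3) by (intro exI [of _ "3 * N div 4 - 1"]) auto
qed

text \<open>Macro-intervals start at even indices, so two of them cannot overlap by a single mesh
  interval; fine and coarse cells are separated by the transition points.\<close>

lemma cells_unique:
  assumes "(a, b) \<in> fine_itvs \<union> coarse_itvs" "(a', b') \<in> fine_itvs \<union> coarse_itvs" "x \<in> {a<..<b}" "x \<in> {a'<..<b'}"
  shows "(a, b) = (a', b')"
proof -
  have ex: "\<exists>p q. a = mp p \<and> b = mp q \<and> (even p \<and> q = p + 2 \<and> (q \<le> N div 4 \<or> 3 * N div 4 \<le> p) \<or> q = p + 1 \<and> N div 4 \<le> p \<and> q \<le> 3 * N div 4)"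
    if "(a, b) \<in> fine_itvs \<union> coarse_itvs" for a b
    using that unfolding Un_iff fine_iff coarse_iff by blast
  obtain p q where p: "a = mp p" "b = mp q" "even p \<and> q = p + 2 \<and> (q \<le> N div 4 \<or> 3 * N div 4 \<le> p) \<or> q = p + 1 \<and> N div 4 \<le> p \<and> q \<le> 3 * N div 4"
    using ex [OF assms(1)] by blast
  obtain p' q' where p': "a' = mp p'" "b' = mp q'" "even p' \<and> q' = p' + 2 \<and> (q' \<le> N div 4 \<or> 3 * N div 4 \<le> p') \<or> q' = p' + 1 \<and> N div 4 \<le> p' \<and> q' \<le> 3 * N div 4"
    using ex [OF assms(2)] by blast
  have "mp p < mp q'" "mp p' < mp q" using assms(3,4) unfolding p p' by auto
  then have l: "p < q'" "p' < q" by (auto simp: mp_less)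
  have "p = p' \<and> q = q'"
  proof (cases "q = p + 1")
    case True
    then show ?thesis using p(3) p'(3) l by auto
  next
    case False
    then have e: "even p" "q = p + 2" using p(3) by auto
    show ?thesis
    proof (cases "q' = p' + 1")
      case True then show ?thesis using p(3) p'(3) l e by auto
    next
      case False
      then have e': "even p'" "q' = p' + 2" using p'(3) by auto
      have "p \<noteq> p' + 1" "p' \<noteq> p + 1" using e e' by auto
      then have "p = p'" using l e e' by linarith
      then show ?thesis using e e' by simp
    qed
  qed
  then show ?thesis unfolding p p' by simp
qed

lemma fine_not_coarse: "J \<in> fine_itvs \<Longrightarrow> J \<notin> coarse_itvs"
  using fineD coarseD lam by (metis (no_types, opaque_lifting) add_diff_cancel_left' linorder_not_less order_le_less_trans prod.exhaust_sel)

lemma cells_cover: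
  assumes "0 < x" "x < 1" "x \<notin> mp ` {0..N}"
  shows "\<exists>a b. (a, b) \<in> fine_itvs \<union> coarse_itvs \<and> x \<in> {a<..<b}"
proof -
  define p where "p = (GREATEST p. p \<le> N \<and> mp p < x)"
  have p: "p \<le> N \<and> mp p < x" unfolding p_def
    by (rule GreatestI_nat [of "\<lambda>p. p \<le> N \<and> mp p < x" 0 N]) (use assms in \<open>auto simp: mp_vals\<close>)
  have pN: "p < N" using p assms(2) mp_vals(4) by (metis less_le_not_le linorder_le_less_linear order_antisym_conv order_less_asym)
  have "\<not> (Suc p \<le> N \<and> mp (Suc p) < x)"
    using Greatest_le_nat [of "\<lambda>p. p \<le> N \<and> mp p < x" "Suc p" N] unfolding p_def [symmetric] by auto
  then have "mp (Suc p) \<ge> x" using pN by auto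
  moreover have "mp (Suc p) \<noteq> x" using assms(3) pN by auto
  ultimately have s: "mp p < x" "x < mp (Suc p)" using p by auto
  show ?thesis
  proof (cases "N div 4 \<le> p \<and> p < 3 * N div 4")
    case True
    then have "(mp p, mp (Suc p)) \<in> coarse_itvs" unfolding coarse_iff by auto
    then show ?thesis using s by auto
  next
    case False
    \<comment> \<open>Rounding the index down to an even one gives the left end of the
      macro-interval. As 8 divides N, the transition points have even index, so it does not cross
      them.\<close>
    define q where "q = 2 * (p div 2)"
    have q: "even q" "q \<le> p" "p \<le> q + 1" unfolding q_def by auto
    obtain k where k: "N = 8 * k" using N(1) by (auto elim: dvdE)
    have "q + 2 \<le> N div 4 \<or> 3 * N div 4 \<le> q \<and> q + 2 \<le> N"
    proof (cases "p < N div 4")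
      case True
      then have "p div 2 < k" using k by auto
      then show ?thesis unfolding q_def k by simp
    next
      case F: False
      then have "3 * k \<le> p div 2" "p div 2 < 4 * k" using False pN k by auto
      then show ?thesis unfolding q_def k by simp
    qed
    then have "(mp q, mp (q + 2)) \<in> fine_itvs" using q unfolding fine_iff by auto
    moreover have "mp q \<le> mp p" "mp (Suc p) \<le> mp (q + 2)" using q by (auto simp: mp_le)
    ultimately show ?thesis using s by (intro exI [of _ "mp q"] exI [of _ "mp (q + 2)"]) auto
  qed
qed

lemma finite_cells: "finite fine_itvs" "finite coarse_itvs"
proof -
  have "fine_itvs \<subseteq> (\<lambda>p. (mp p, mp (p + 2))) ` {0..N}" unfolding fine_iff [abs_def] subset_iff
    using quarter by (auto simp: fine_iff)
  then show "finite fine_itvs" by (rule finite_subset) simp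
  have "coarse_itvs \<subseteq> (\<lambda>p. (mp p, mp (p + 1))) ` {0..N}"
    using quarter by (auto simp: coarse_iff)
  then show "finite coarse_itvs" by (rule finite_subset) simp
qed

text \<open>A mesh point of even index is never the midpoint of a macro-interval. Hence an edge
  assigned to a vertex really ends there, as needed for the choice of the dual function.\<close>

lemma fine_point_end:
  assumes "(a, b) \<in> fine_itvs" "(a', b') \<in> fine_itvs" "e \<in> {a, b}" "a' \<le> e" "e \<le> b'"
  shows "e \<in> {a', b'}"
proof -
  obtain p where p: "even p" "a = mp p" "b = mp (p + 2)" using assms(1) unfolding fine_iff by auto
  obtain p' where p': "even p'" "a' = mp p'" "b' = mp (p' + 2)" using assms(2) unfolding fine_iff by auto
  obtain q where q: "even q" "e = mp q" using p assms(3) that [of p] that [of "p + 2"] by auto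
  have "p' \<le> q" "q \<le> p' + 2" using assms(4,5) unfolding q p' mp_le by auto
  moreover have "q \<noteq> p' + 1" using q(1) p'(1) by auto
  ultimately have "q = p' \<or> q = p' + 2" by linarith
  then show ?thesis unfolding q p' by auto
qed

text \<open>Off the mesh lines the kinks of the Hermite interpolants are thus avoided as
  well.\<close>

lemma midpoint_fine: "(a, b) \<in> fine_itvs \<Longrightarrow> (a + b) / 2 \<in> mp ` {0..N}"
proof -
  assume A: "(a, b) \<in> fine_itvs"
  then obtain p where p: "a = mp p" "b = mp (p + 2)" "p + 2 \<le> N div 4 \<or> 3 * N div 4 \<le> p \<and> p + 2 \<le> N"
    unfolding fine_iff by auto
  have "mp (Suc p) = a + h" using p mp_step(1,3) [of p] by auto
  moreover have "(a + b) / 2 = a + h" using fineD(2) [OF A] by (simp add: field_simps)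
  ultimately show ?thesis using p(3) quarter by (intro image_eqI [of _ _ "Suc p"]) auto
qed

text \<open>The open cells are disjoint, so exactly one of the indicators in the definition is
  nonzero at such a point.\<close>

lemma quasi_interp_cell:
  assumes "J \<in> fine_itvs \<union> coarse_itvs" "K \<in> fine_itvs \<union> coarse_itvs" "z \<in> open_rect J K"
  shows "quasi_interp lam N \<sigma> u z =
     (if J \<in> fine_itvs then if K \<in> fine_itvs then corner_interp \<sigma> u J K z else v_edge_interp lam N u J K z
      else if K \<in> fine_itvs then h_edge_interp lam N u J K z else nodal_interp u J K z)"
proof -
  obtain a b c d where JK: "J = (a, b)" "K = (c, d)" by (cases J; cases K) auto
  have ind: "indicator (open_rect J' K') z = (if J' = J then if K' = K then 1 else 0 else (0::real))"
    if J': "J' \<in> fine_itvs \<union> coarse_itvs" and K': "K' \<in> fine_itvs \<union> coarse_itvs" for J' K'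
  proof (cases "z \<in> open_rect J' K'")
    case True
    obtain a' b' c' d' where JK': "J' = (a', b')" "K' = (c', d')" by (cases J'; cases K') auto
    have "J = J'" "K = K'"
      using cells_unique [of a b a' b' "fst z"] cells_unique [of c d c' d' "snd z"] assms J' K' True
      unfolding JK JK' by auto
    then show ?thesis using True by simp
  next
    case False then show ?thesis using assms(3) by auto
  qed
  have S: "(\<Sum>J'\<in>X. \<Sum>K'\<in>Y. indicator (open_rect J' K') z * f J' K') = (if J \<in> X then if K \<in> Y then f J K else 0 else 0)"
    if "X \<in> {fine_itvs, coarse_itvs}" "Y \<in> {fine_itvs, coarse_itvs}" for X Y and f :: "itv \<Rightarrow> itv \<Rightarrow> real"
  proof -
    have "(\<Sum>J'\<in>X. \<Sum>K'\<in>Y. indicator (open_rect J' K') z * f J' K') =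
        (\<Sum>J'\<in>X. \<Sum>K'\<in>Y. if J' = J then if K' = K then f J K else 0 else 0)"
      by (intro sum.cong refl) (use ind that in auto)
    also have "\<dots> = (\<Sum>J'\<in>X. if J' = J then \<Sum>K'\<in>Y. if K' = K then f J K else 0 else 0)"
      by (intro sum.cong refl) auto
    finally show ?thesis using that finite_cells by auto
  qed
  show ?thesis unfolding quasi_interp_def
    using S [of coarse_itvs coarse_itvs] S [of fine_itvs fine_itvs] S [of coarse_itvs fine_itvs] S [of fine_itvs coarse_itvs]
      fine_not_coarse [of J] fine_not_coarse [of K] assms(1,2)
    by auto
qed

lemma AE_off_mesh: "AE z in lborel. fst z \<notin> mp ` {0..N} \<and> snd z \<notin> mp ` {0..N}"
proof -
  define E where "E = mp ` {0..N}"
  have E: "E \<in> null_sets lborel" by (rule finite_imp_null_set_lborel) (simp add: E_def)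
  have Em: "E \<in> sets borel" using E by auto
  have m: "E \<times> (UNIV :: real set) \<in> sets borel" "(UNIV :: real set) \<times> E \<in> sets borel"
    using pair_measureI [OF Em, of "UNIV :: real set" borel] pair_measureI [of "UNIV :: real set" borel, OF _ Em]
    unfolding borel_prod by auto
  have i: "indicator (E \<times> UNIV) (x, y) = (indicator E x :: ennreal)" "indicator (UNIV \<times> E) (x, y) = (indicator E y :: ennreal)"
    for x y :: real by (auto simp: indicator_def)
  have e: "(\<integral>\<^sup>+ x. indicator E x \<partial>lborel) = 0" using null_setsD1 [OF E] Em by simp
  have n1: "E \<times> (UNIV :: real set) \<in> null_sets lborel" "(UNIV :: real set) \<times> E \<in> null_sets lborel"
    using m nn_integral_lborel_prod(2) [of "indicator (E \<times> UNIV)"] nn_integral_lborel_prod(1) [of "indicator (UNIV \<times> E)"]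
    by (auto simp: i e)
  show ?thesis
    using AE_not_in [OF n1(1)] AE_not_in [OF n1(2)]
    by eventually_elim (auto simp: E_def mem_Times_iff)
qed

end

section \<open>Interpolation errors from supremum bounds\<close>

text \<open>The case of order 0 for the Hermite operator: there are no derivatives to compare the
  slopes with, so they enter only through their size. It is used for the second y derivative of u,
  which can be differentiated in x just once.\<close>

lemma her_err0:
  assumes ab: "a < b" and z: "z \<in> {a..b}"
    and osc: "\<And>t. t \<in> {a..b} \<Longrightarrow> \<bar>f t - f z\<bar> \<le> w" and g: "\<And>t. t \<in> {a..b} \<Longrightarrow> \<bar>g t\<bar> \<le> D"
  shows "\<bar>f z - her 0 a b f g z\<bar> \<le> 8 * (w + (b - a) * D)"
proof -
  have "\<bar>her 0 a b (\<lambda>t. f t - f z) (\<lambda>t. g t - 0) z\<bar> \<le> 8 * (w + (b - a) * D) / (b - a) ^ 0"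
    by (rule her_stable [OF ab z]) (use osc g ab in auto)
  moreover have "her 0 a b (\<lambda>t. f z) (\<lambda>t. 0) z = f z"
    using her_exact(1) [OF ab, of "f z" 0 z 0] by simp
  ultimately show ?thesis unfolding her_diff by (simp add: abs_minus_commute)
qed

lemma jet1_osc:
  assumes "jet1 (Suc n) a b f" "\<And>t. t \<in> {a..b} \<Longrightarrow> \<bar>f (Suc n) t\<bar> \<le> M" "z \<in> {a..b}" "t \<in> {a..b}"
  shows "\<bar>f n t - f n z\<bar> \<le> M * (b - a)"
  using bound_from_deriv [of a b "f n" "f (Suc n)" M z t] assms unfolding jet1_def by auto

lemma jet1_less: "jet1 (Suc n) a b f \<Longrightarrow> jet1 n a b f"
  unfolding jet1_def by auto

lemma lag_err_sup:
  assumes ab: "a < b" and z: "z \<in> {a..b}" and n: "n \<le> 2" and j: "jet1 (Suc n) a b f" and k: "k \<le> 2"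
    and M: "\<And>t. t \<in> {a..b} \<Longrightarrow> \<bar>f (Suc n) t\<bar> \<le> M"
  shows "\<bar>(if k \<le> n then f k z else 0) - lag k a b (f 0) z\<bar> \<le> 16 * M * (b - a) ^ (Suc n) / (b - a) ^ k"
proof -
  have "\<bar>(if k \<le> n then f k z else 0) - lag k a b (f 0) z\<bar> \<le> 16 * (M * (b - a)) * (b - a) ^ n / (b - a) ^ k"
    by (rule lag_err [OF ab z n jet1_less [OF j] k]) (rule jet1_osc [OF j M z])
  moreover have "16 * (M * (b - a)) * (b - a) ^ n = 16 * M * (b - a) ^ Suc n" by simp
  ultimately show ?thesis by (simp only:)
qed

lemma her_err_sup:
  assumes ab: "a < b" and z: "z \<in> {a..b}" and n: "1 \<le> n" "n \<le> 2" and j: "jet1 (Suc n) a b f" and k: "k \<le> 2"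
    and M: "\<And>t. t \<in> {a..b} \<Longrightarrow> \<bar>f (Suc n) t\<bar> \<le> M"
  shows "\<bar>(if k \<le> n then f k z else 0) - her k a b (f 0) (f 1) z\<bar> \<le> 16 * M * (b - a) ^ (Suc n) / (b - a) ^ k"
proof -
  have "\<bar>(if k \<le> n then f k z else 0) - her k a b (f 0) (f 1) z\<bar> \<le> 16 * (M * (b - a)) * (b - a) ^ n / (b - a) ^ k"
    by (rule her_err [OF ab z n jet1_less [OF j] k]) (rule jet1_osc [OF j M z])
  moreover have "16 * (M * (b - a)) * (b - a) ^ n = 16 * M * (b - a) ^ Suc n" by simp
  ultimately show ?thesis by (simp only:)
qed

lemma lag_err_x:
  assumes R: "C3_jet R" and n: "n \<le> 2" "Suc n + j \<le> 3" and k: "k \<le> 2" and ab: "a < b" "{a..b} \<subseteq> {0..1}"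
    and x: "x \<in> {a..b}" and y: "y \<in> {0..1}"
    and M: "\<And>t. t \<in> {a..b} \<Longrightarrow> \<bar>R (Suc n) j t y\<bar> \<le> M"
  shows "\<bar>(if k \<le> n then R k j x y else 0) - lag k a b (\<lambda>\<xi>. R 0 j \<xi> y) x\<bar> \<le> 16 * M * (b - a) ^ (Suc n) / (b - a) ^ k"
  using lag_err_sup [OF ab(1) x n(1) C3_jet1_x [OF R, of "Suc n" 0 j y a b, simplified] k, of M] M n ab y
  by (auto simp del: power_Suc)

lemma lag_err_y:
  assumes R: "C3_jet R" and n: "n \<le> 2" "Suc n + i \<le> 3" and k: "k \<le> 2" and cd: "c < d" "{c..d} \<subseteq> {0..1}"
    and y: "y \<in> {c..d}" and x: "x \<in> {0..1}"
    and M: "\<And>t. t \<in> {c..d} \<Longrightarrow> \<bar>R i (Suc n) x t\<bar> \<le> M"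
  shows "\<bar>(if k \<le> n then R i k x y else 0) - lag k c d (\<lambda>\<eta>. R i 0 x \<eta>) y\<bar> \<le> 16 * M * (d - c) ^ (Suc n) / (d - c) ^ k"
  using lag_err_sup [OF cd(1) y n(1) C3_jet1_y [OF R, of "Suc n" i 0 x c d, simplified] k, of M] M n cd x
  by (auto simp del: power_Suc)

lemma her_err_x:
  assumes R: "C3_jet R" and n: "1 \<le> n" "n \<le> 2" "Suc n + j \<le> 3" and k: "k \<le> 2" and ab: "a < b" "{a..b} \<subseteq> {0..1}"
    and x: "x \<in> {a..b}" and y: "y \<in> {0..1}"
    and M: "\<And>t. t \<in> {a..b} \<Longrightarrow> \<bar>R (Suc n) j t y\<bar> \<le> M"
  shows "\<bar>(if k \<le> n then R k j x y else 0) - her k a b (\<lambda>\<xi>. R 0 j \<xi> y) (\<lambda>\<xi>. R 1 j \<xi> y) x\<bar> \<le> 16 * M * (b - a) ^ (Suc n) / (b - a) ^ k"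
  using her_err_sup [OF ab(1) x n(1,2) C3_jet1_x [OF R, of "Suc n" 0 j y a b, simplified] k, of M] M n ab y
  by (auto simp del: power_Suc)

lemma her_err_y:
  assumes R: "C3_jet R" and n: "1 \<le> n" "n \<le> 2" "Suc n + i \<le> 3" and k: "k \<le> 2" and cd: "c < d" "{c..d} \<subseteq> {0..1}"
    and y: "y \<in> {c..d}" and x: "x \<in> {0..1}"
    and M: "\<And>t. t \<in> {c..d} \<Longrightarrow> \<bar>R i (Suc n) x t\<bar> \<le> M"
  shows "\<bar>(if k \<le> n then R i k x y else 0) - her k c d (\<lambda>\<eta>. R i 0 x \<eta>) (\<lambda>\<eta>. R i 1 x \<eta>) y\<bar> \<le> 16 * M * (d - c) ^ (Suc n) / (d - c) ^ k"
  using her_err_sup [OF cd(1) y n(1,2) C3_jet1_y [OF R, of "Suc n" i 0 x c d, simplified] k, of M] M n cd x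
  by (auto simp del: power_Suc)

lemma nodes_sub: "(a::real) < b \<Longrightarrow> \<xi> \<in> nodes3 (a, b) \<Longrightarrow> \<xi> \<in> {a..b}"
  by auto

lemma lag_stable_nodes:
  assumes "a < b" "x \<in> {a..b}" "\<And>\<xi>. \<xi> \<in> nodes3 (a, b) \<Longrightarrow> \<bar>f \<xi>\<bar> \<le> M"
  shows "\<bar>lag k a b f x\<bar> \<le> 16 * M / (b - a) ^ k"
  by (rule lag_stable) (use assms in auto)

subsection \<open>Local interpolation errors\<close>

text \<open>\<open>R\<close> is interpolated, while for \<open>Z\<close> only stability is used. The
  error splits into the x error of \<open>R\<close> and the x interpolant of what goes wrong in y.
  The x error is kept apart because for values it is only of order N^-2 and must be accessible for
  the improved L2 bound.\<close>

lemma strip_local: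
  assumes R: "C3_jet R" and ab: "a < b" "{a..b} \<subseteq> {0..1}" and cd: "c < d" "{c..d} \<subseteq> {0..1}"
    and x: "x \<in> {a..b}" and y: "y \<in> {c..d}"
    and M3: "\<And>p q. p \<in> {a..b} \<Longrightarrow> q \<in> {c..d} \<Longrightarrow> \<bar>R 0 3 p q\<bar> \<le> M3"
    and z0: "\<And>p q. p \<in> {a..b} \<Longrightarrow> q \<in> {c..d} \<Longrightarrow> \<bar>Z 0 0 p q\<bar> \<le> z0"
    and z1: "\<And>p q. p \<in> {a..b} \<Longrightarrow> q \<in> {c..d} \<Longrightarrow> \<bar>Z 0 1 p q\<bar> \<le> z1"
    and U: "\<And>i j p q. i + j \<le> 2 \<Longrightarrow> p \<in> {a..b} \<Longrightarrow> q \<in> {c..d} \<Longrightarrow> U i j p q = R i j p q + (Z i j p q :: real)"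
    and g: "\<And>\<xi> \<eta>. \<xi> \<in> nodes3 (a, b) \<Longrightarrow> \<eta> \<in> {c, d} \<Longrightarrow> \<bar>g \<xi> \<eta> - U 0 1 \<xi> \<eta>\<bar> \<le> \<tau>"
    and ij: "i + j \<le> 2"
  shows "\<bar>U i j x y - lag i a b (\<lambda>\<xi>. her j c d (\<lambda>\<eta>. U 0 0 \<xi> \<eta>) (\<lambda>\<eta>. g \<xi> \<eta>) y) x
      - (R i j x y - lag i a b (\<lambda>\<xi>. R 0 j \<xi> y) x)\<bar>
    \<le> \<bar>Z i j x y\<bar> + 16 * ((16 * M3 * (d - c) ^ 3 + 8 * (z0 + (d - c) * z1) + 8 * ((d - c) * \<tau>)) / (d - c) ^ j) / (b - a) ^ i"
proof -
  have j2: "j \<le> 2" using ij by simp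
  \<comment> \<open>\<open>B\<close> is the Hermite error of \<open>R\<close>, \<open>P\<close> the
    Hermite interpolant of the small part, and \<open>T\<close> the effect of inexact
    slopes.\<close>
  define B where "B \<xi> = R 0 j \<xi> y - her j c d (\<lambda>\<eta>. R 0 0 \<xi> \<eta>) (\<lambda>\<eta>. R 0 1 \<xi> \<eta>) y" for \<xi>
  define P where "P \<xi> = her j c d (\<lambda>\<eta>. Z 0 0 \<xi> \<eta>) (\<lambda>\<eta>. Z 0 1 \<xi> \<eta>) y" for \<xi>
  define T where "T \<xi> = her j c d (\<lambda>\<eta>. 0) (\<lambda>\<eta>. g \<xi> \<eta> - U 0 1 \<xi> \<eta>) y" for \<xi>
  have dec: "her j c d (\<lambda>\<eta>. U 0 0 \<xi> \<eta>) (\<lambda>\<eta>. g \<xi> \<eta>) y = R 0 j \<xi> y - (B \<xi> - P \<xi> - T \<xi>)" if "\<xi> \<in> {a..b}" for \<xi>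
  proof -
    have "her j c d (\<lambda>\<eta>. U 0 0 \<xi> \<eta>) (\<lambda>\<eta>. g \<xi> \<eta>) y =
        her j c d (\<lambda>\<eta>. R 0 0 \<xi> \<eta> + Z 0 0 \<xi> \<eta> + 0) (\<lambda>\<eta>. R 0 1 \<xi> \<eta> + Z 0 1 \<xi> \<eta> + (g \<xi> \<eta> - U 0 1 \<xi> \<eta>)) y"
      by (rule her_cong) (use U that cd(1) in auto)
    then show ?thesis unfolding her_add B_def P_def T_def by simp
  qed
  have ends: "c \<in> {c..d}" "d \<in> {c..d}" using cd by auto
  have bB: "\<bar>B \<xi>\<bar> \<le> 16 * M3 * (d - c) ^ 3 / (d - c) ^ j" if "\<xi> \<in> {a..b}" for \<xi>
    using her_err_y [OF R, of 2 0 j c d y \<xi> M3] j2 cd y that ab(2) M3 [OF that]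
    unfolding B_def by (auto simp: eval_nat_numeral)
  have bP: "\<bar>P \<xi>\<bar> \<le> 8 * (z0 + (d - c) * z1) / (d - c) ^ j" if "\<xi> \<in> {a..b}" for \<xi>
    unfolding P_def by (rule her_stable [OF cd(1) y]) (use z0 z1 that ends in auto)
  have bT: "\<bar>T \<xi>\<bar> \<le> 8 * (0 + (d - c) * \<tau>) / (d - c) ^ j" if "\<xi> \<in> nodes3 (a, b)" for \<xi>
    unfolding T_def by (rule her_stable [OF cd(1) y]) (use g that in auto)
  have L: "lag i a b (\<lambda>\<xi>. her j c d (\<lambda>\<eta>. U 0 0 \<xi> \<eta>) (\<lambda>\<eta>. g \<xi> \<eta>) y) x =
      lag i a b (\<lambda>\<xi>. R 0 j \<xi> y) x - lag i a b (\<lambda>\<xi>. B \<xi> - P \<xi> - T \<xi>) x"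
    unfolding lag_diff [symmetric] by (rule lag_cong) (use dec ab(1) in auto)
  let ?K = "(16 * M3 * (d - c) ^ 3 + 8 * (z0 + (d - c) * z1) + 8 * ((d - c) * \<tau>)) / (d - c) ^ j"
  have "\<bar>lag i a b (\<lambda>\<xi>. B \<xi> - P \<xi> - T \<xi>) x\<bar> \<le> 16 * ?K / (b - a) ^ i"
  proof (rule lag_stable_nodes [OF ab(1) x])
    fix \<xi> assume n: "\<xi> \<in> nodes3 (a, b)"
    note m = nodes_sub [OF ab(1) n]
    have "\<bar>B \<xi> - P \<xi> - T \<xi>\<bar> \<le> 16 * M3 * (d - c) ^ 3 / (d - c) ^ j + 8 * (z0 + (d - c) * z1) / (d - c) ^ j
        + 8 * (0 + (d - c) * \<tau>) / (d - c) ^ j"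
      using bB [OF m] bP [OF m] bT [OF n] by linarith
    then show "\<bar>B \<xi> - P \<xi> - T \<xi>\<bar> \<le> ?K" by (simp add: add_divide_distrib)
  qed
  then show ?thesis unfolding L using U [OF ij x y] by linarith
qed

text \<open>The expansion in x uses second derivatives for \<open>R 0 0\<close>, since third x
  derivatives may be of size 1/s in the application. For \<open>R 0 2\<close> only one further
  derivative exists.\<close>

lemma lag_x_errors:
  assumes R: "C3_jet R" and ab: "a < b" "{a..b} \<subseteq> {0..1}"
    and x: "x \<in> {a..b}" and y: "y \<in> {0..1}"
    and M0: "\<And>p. p \<in> {a..b} \<Longrightarrow> \<bar>R 2 0 p y\<bar> \<le> M0"
    and M1: "\<And>p. p \<in> {a..b} \<Longrightarrow> \<bar>R 2 1 p y\<bar> \<le> M1"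
    and M2: "\<And>p. p \<in> {a..b} \<Longrightarrow> \<bar>R 1 2 p y\<bar> \<le> M2"
  shows "\<bar>R 0 0 x y - lag 0 a b (\<lambda>\<xi>. R 0 0 \<xi> y) x\<bar> \<le> 16 * M0 * (b - a)\<^sup>2"
    and "\<bar>R 1 0 x y - lag 1 a b (\<lambda>\<xi>. R 0 0 \<xi> y) x\<bar> \<le> 16 * M0 * (b - a)"
    and "\<bar>R 2 0 x y - lag 2 a b (\<lambda>\<xi>. R 0 0 \<xi> y) x\<bar> \<le> 17 * M0"
    and "\<bar>R 0 1 x y - lag 0 a b (\<lambda>\<xi>. R 0 1 \<xi> y) x\<bar> \<le> 16 * M1 * (b - a)\<^sup>2"
    and "\<bar>R 1 1 x y - lag 1 a b (\<lambda>\<xi>. R 0 1 \<xi> y) x\<bar> \<le> 16 * M1 * (b - a)"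
    and "\<bar>R 0 2 x y - lag 0 a b (\<lambda>\<xi>. R 0 2 \<xi> y) x\<bar> \<le> 16 * M2 * (b - a)"
proof -
  have h0: "\<And>t. t \<in> {a..b} \<Longrightarrow> \<bar>R (Suc 1) 0 t y\<bar> \<le> M0" using M0 by (simp add: numeral_2_eq_2)
  have h1: "\<And>t. t \<in> {a..b} \<Longrightarrow> \<bar>R (Suc 1) 1 t y\<bar> \<le> M1" using M1 by (simp add: numeral_2_eq_2)
  have h2: "\<And>t. t \<in> {a..b} \<Longrightarrow> \<bar>R (Suc 0) 2 t y\<bar> \<le> M2" using M2 by simp
  note e0 = lag_err_x [OF R _ _ _ ab x y h0] and e1 = lag_err_x [OF R _ _ _ ab x y h1]
    and e2 = lag_err_x [OF R _ _ _ ab x y h2]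
  have ab': "b - a > 0" using ab by simp
  have p: "(b - a) ^ Suc 1 / (b - a) ^ 1 = b - a" "(b - a) ^ Suc 1 / (b - a) ^ 2 = 1"
    using ab' by (simp_all add: power2_eq_square)
  show "\<bar>R 0 0 x y - lag 0 a b (\<lambda>\<xi>. R 0 0 \<xi> y) x\<bar> \<le> 16 * M0 * (b - a)\<^sup>2"
    using e0 [of 0] by (simp add: power2_eq_square)
  show "\<bar>R 1 0 x y - lag 1 a b (\<lambda>\<xi>. R 0 0 \<xi> y) x\<bar> \<le> 16 * M0 * (b - a)"
    using e0 [of 1] ab' by (simp add: power2_eq_square)
  show "\<bar>R 0 1 x y - lag 0 a b (\<lambda>\<xi>. R 0 1 \<xi> y) x\<bar> \<le> 16 * M1 * (b - a)\<^sup>2"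
    using e1 [of 0] by (simp add: power2_eq_square)
  show "\<bar>R 1 1 x y - lag 1 a b (\<lambda>\<xi>. R 0 1 \<xi> y) x\<bar> \<le> 16 * M1 * (b - a)"
    using e1 [of 1] ab' by (simp add: power2_eq_square)
  show "\<bar>R 0 2 x y - lag 0 a b (\<lambda>\<xi>. R 0 2 \<xi> y) x\<bar> \<le> 16 * M2 * (b - a)"
    using e2 [of 0] by simp
  \<comment> \<open>Here the order of differentiation exceeds the order of expansion, so the error
    lemma bounds the interpolant; adding \<open>R 2 0\<close> itself gives 17.\<close>
  have "\<bar>lag 2 a b (\<lambda>\<xi>. R 0 0 \<xi> y) x\<bar> \<le> 16 * M0"
    using e0 [of 2] ab' by (simp add: power2_eq_square)
  then show "\<bar>R 2 0 x y - lag 2 a b (\<lambda>\<xi>. R 0 0 \<xi> y) x\<bar> \<le> 17 * M0"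
    using M0 [OF x] by linarith
qed

text \<open>Second derivatives of the smooth part are bounded uniformly while third ones are not,
  whence order 2. The x error contributes 16 and the x interpolant of the y error 16 * 16, together
  below 300.\<close>

lemma core_smooth_local:
  assumes S: "C3_jet S" and ab: "a < b" "{a..b} \<subseteq> {0..1}" and cd: "c < d" "{c..d} \<subseteq> {0..1}"
    and x: "x \<in> {a..b}" and y: "y \<in> {c..d}" and H: "b - a = H" "d - c = H"
    and M: "\<And>i j p q. i + j = 2 \<Longrightarrow> p \<in> {a..b} \<Longrightarrow> q \<in> {c..d} \<Longrightarrow> \<bar>S i j p q\<bar> \<le> M"
    and ij: "i + j \<le> 1"
  shows "\<bar>S i j x y - lag i a b (\<lambda>\<xi>. lag j c d (\<lambda>\<eta>. S 0 0 \<xi> \<eta>) y) x\<bar> \<le> 300 * M * H\<^sup>2 / H ^ (i + j)"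
proof -
  have Hp: "H > 0" using ab H by simp
  have M0: "M \<ge> 0" using M [of 2 0 x y] x y by auto
  have y1: "y \<in> {0..1}" using y cd by auto
  have "\<bar>S i j x y - lag i a b (\<lambda>\<xi>. S 0 j \<xi> y) x\<bar> \<le> 16 * M * H\<^sup>2 / H ^ (i + j)"
  proof (cases "j = 0")
    case True
    then show ?thesis
      using lag_err_x [OF S, of 1 0 i a b x y M] ij ab x y1 M [of 2 0 _ y] y unfolding H
      by (auto simp: numeral_2_eq_2)
  next
    case False
    then have j: "j = 1" "i = 0" using ij by auto
    show ?thesis
      using lag_err_x [OF S, of 0 1 0 a b x y M] ab x y1 M [of 1 1 _ y] y Hp unfolding H j
      by (auto simp: power2_eq_square)
  qed
  moreover have "\<bar>lag i a b (\<lambda>\<xi>. S 0 j \<xi> y - lag j c d (\<lambda>\<eta>. S 0 0 \<xi> \<eta>) y) x\<bar> \<le> 16 * (16 * M * H\<^sup>2 / H ^ j) / H ^ i"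
    unfolding H(1) [symmetric]
  proof (rule lag_stable_nodes [OF ab(1) x])
    fix \<xi> assume "\<xi> \<in> nodes3 (a, b)"
    note m = nodes_sub [OF ab(1) this]
    show "\<bar>S 0 j \<xi> y - lag j c d (\<lambda>\<eta>. S 0 0 \<xi> \<eta>) y\<bar> \<le> 16 * M * (b - a)\<^sup>2 / (b - a) ^ j"
      using lag_err_y [OF S, of 1 0 j c d y \<xi> M] ij cd y m ab(2) M [of 0 2 \<xi>] unfolding H
      by (auto simp: numeral_2_eq_2)
  qed
  moreover have "16 * (16 * M * H\<^sup>2 / H ^ j) / H ^ i = 256 * M * H\<^sup>2 / H ^ (i + j)"
    by (simp add: power_add mult_ac)
  ultimately have "\<bar>S i j x y - lag i a b (\<lambda>\<xi>. lag j c d (\<lambda>\<eta>. S 0 0 \<xi> \<eta>) y) x\<bar> \<le>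
      16 * M * H\<^sup>2 / H ^ (i + j) + 256 * M * H\<^sup>2 / H ^ (i + j)"
    unfolding lag_diff by linarith
  also have "\<dots> \<le> 300 * M * H\<^sup>2 / H ^ (i + j)"
    unfolding add_divide_distrib [symmetric] using M0 Hp by (intro divide_right_mono) auto
  finally show ?thesis .
qed

text \<open>First the x error with exact data, then the y errors \<open>Q0\<close> of the values and
  \<open>Q1\<close> of the slopes, and finally the twist error \<open>T\<close>. \<open>Q1\<close>
  and \<open>T\<close> are one power of r worse, which \<open>her_stable\<close> compensates. The
  constants add up to 16 + 8 * (16 + 17 + 3200) = 25880.\<close>

lemma corner_local:
  assumes U: "C3_jet U" and ab: "a < b" "{a..b} \<subseteq> {0..1}" and cd: "c < d" "{c..d} \<subseteq> {0..1}"
    and x: "x \<in> {a..b}" and y: "y \<in> {c..d}" and r: "b - a = r" "d - c = r"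
    and D: "\<And>i j p q. i + j = 3 \<Longrightarrow> p \<in> {a..b} \<Longrightarrow> q \<in> {c..d} \<Longrightarrow> \<bar>U i j p q\<bar> \<le> D"
    and tw: "\<And>e g. e \<in> {a, b} \<Longrightarrow> g \<in> {c, d} \<Longrightarrow> \<bar>tw e g - U 1 1 e g\<bar> \<le> 400 * (r * D)"
    and ij: "i + j \<le> 2"
  shows "\<bar>U i j x y - her i a b (\<lambda>e. her j c d (\<lambda>g. U 0 0 e g) (\<lambda>g. U 0 1 e g) y)
      (\<lambda>e. her j c d (\<lambda>g. U 1 0 e g) (\<lambda>g. tw e g) y) x\<bar> \<le> 30000 * D * r ^ 3 / r ^ (i + j)"
proof -
  have rp: "r > 0" using ab r by simp
  have D0: "D \<ge> 0" using D [of 3 0 x y] x y by auto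
  have y1: "y \<in> {0..1}" using y cd by auto
  have ends: "a \<in> {a..b}" "b \<in> {a..b}" "c \<in> {c..d}" "d \<in> {c..d}" using ab cd by auto
  have P: "\<bar>U i j x y - her i a b (\<lambda>e. U 0 j e y) (\<lambda>e. U 1 j e y) x\<bar> \<le> 16 * D * r ^ 3 / r ^ (i + j)"
  proof -
    consider "j = 0" | "j = 1" "i \<le> 1" | "j = 2" "i = 0" using ij by linarith
    then show ?thesis
    proof cases
      case 1
      then show ?thesis
        using her_err_x [OF U, of 2 0 i a b x y D] ij ab x y1 D [of 3 0 _ y] y unfolding r
        by (auto simp: eval_nat_numeral)
    next
      case 2
      have "\<bar>U i j x y - her i a b (\<lambda>e. U 0 j e y) (\<lambda>e. U 1 j e y) x\<bar> \<le> 16 * D * r ^ 2 / r ^ i"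
        using her_err_x [OF U, of 1 1 i a b x y D] 2 ab x y1 D [of 2 1 _ y] y unfolding r
        by (auto simp: eval_nat_numeral)
      also have "\<dots> = 16 * D * r ^ 3 / r ^ (i + j)" using 2 rp by (simp add: power2_eq_square power3_eq_cube)
      finally show ?thesis .
    next
      case 3
      \<comment> \<open>Only one x derivative of \<open>U 0 2\<close> is available, so its
        oscillation and the size of the slopes \<open>U 1 2\<close> have to suffice.\<close>
      have "\<bar>U 0 2 t y - U 0 2 x y\<bar> \<le> D * r" if "t \<in> {a..b}" for t
        using jet1_osc [of 0 a b "\<lambda>k t. U k 2 t y" D x t] C3_jet1_x [OF U, of 1 0 2 y a b] y1 ab D [of 1 2 _ y] y x that
        unfolding r by auto
      then have "\<bar>U 0 2 x y - her 0 a b (\<lambda>e. U 0 2 e y) (\<lambda>e. U 1 2 e y) x\<bar> \<le> 8 * (D * r + (b - a) * D)"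
        by (rule her_err0 [OF ab(1) x]) (use D [of 1 2 _ y] y in auto)
      also have "\<dots> = 16 * D * r ^ 3 / r ^ (i + j)" unfolding r using 3 rp by (simp add: power2_eq_square power3_eq_cube)
      finally show ?thesis using 3 by simp
    qed
  qed
  define Q0 where "Q0 e = U 0 j e y - her j c d (\<lambda>g. U 0 0 e g) (\<lambda>g. U 0 1 e g) y" for e
  define Q1 where "Q1 e = U 1 j e y - her j c d (\<lambda>g. U 1 0 e g) (\<lambda>g. U 1 1 e g) y" for e
  define T where "T e = her j c d (\<lambda>g. 0) (\<lambda>g. tw e g - U 1 1 e g) y" for e
  have tw': "her j c d (\<lambda>g. U 1 0 e g) (\<lambda>g. tw e g) y = U 1 j e y - (Q1 e - T e)" for e
    using her_add [of j c d "\<lambda>g. U 1 0 e g" "\<lambda>g. 0" "\<lambda>g. U 1 1 e g" "\<lambda>g. tw e g - U 1 1 e g" y]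
    unfolding Q1_def T_def by simp
  have bQ0: "\<bar>Q0 e\<bar> \<le> 16 * D * r ^ 3 / r ^ j" if "e \<in> {a..b}" for e
    using her_err_y [OF U, of 2 0 j c d y e D] ij cd y that ab(2) D [of 0 3 e] unfolding r Q0_def
    by (auto simp: eval_nat_numeral)
  have bQ1: "\<bar>Q1 e\<bar> \<le> 17 * D * r ^ 2 / r ^ j" if e: "e \<in> {a..b}" for e
  proof -
    have 1: "\<bar>(if j \<le> 1 then U 1 j e y else 0) - her j c d (\<lambda>g. U 1 0 e g) (\<lambda>g. U 1 1 e g) y\<bar> \<le> 16 * D * r ^ 2 / r ^ j"
      using her_err_y [OF U, of 1 1 j c d y e D] ij cd y that ab(2) D [of 1 2 e] unfolding r
      by (simp add: eval_nat_numeral)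
    have 2: "0 \<le> D * r ^ 2 / r ^ j" using D0 rp by simp
    show ?thesis
    proof (cases "j \<le> 1")
      case True then show ?thesis using 1 2 unfolding Q1_def by simp
    next
      case False
      then have "j = 2" using ij by auto
      then show ?thesis using 1 D [of 1 2 e y] e y rp unfolding Q1_def by simp
    qed
  qed
  have bT: "\<bar>T e\<bar> \<le> 3200 * D * r ^ 2 / r ^ j" if "e \<in> {a, b}" for e
  proof -
    have "\<bar>T e\<bar> \<le> 8 * (0 + (d - c) * (400 * (r * D))) / (d - c) ^ j"
      unfolding T_def by (rule her_stable [OF cd(1) y]) (use tw that in auto)
    then show ?thesis unfolding r by (simp add: power2_eq_square mult_ac)
  qed
  have "\<bar>her i a b Q0 (\<lambda>e. Q1 e - T e) x\<bar> \<le> 8 * (16 * D * r ^ 3 / r ^ j + (b - a) * (3217 * D * r ^ 2 / r ^ j)) / (b - a) ^ i"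
  proof (rule her_stable [OF ab(1) x])
    have "\<bar>Q1 e - T e\<bar> \<le> 3217 * D * r ^ 2 / r ^ j" if "e \<in> {a, b}" for e
      using bQ1 [of e] bT [OF that] that ends by auto
    then show "\<bar>Q1 a - T a\<bar> \<le> 3217 * D * r ^ 2 / r ^ j" "\<bar>Q1 b - T b\<bar> \<le> 3217 * D * r ^ 2 / r ^ j" by auto
  qed (use bQ0 ends in auto)
  also have "\<dots> = 25864 * (D * r ^ 3 / r ^ (i + j))"
    unfolding r using rp by (simp add: power_add power2_eq_square power3_eq_cube field_simps)
  finally have 3: "\<bar>her i a b Q0 (\<lambda>e. Q1 e - T e) x\<bar> \<le> 25864 * (D * r ^ 3 / r ^ (i + j))" .
  have "her i a b (\<lambda>e. her j c d (\<lambda>g. U 0 0 e g) (\<lambda>g. U 0 1 e g) y)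
      (\<lambda>e. her j c d (\<lambda>g. U 1 0 e g) (\<lambda>g. tw e g) y) x =
      her i a b (\<lambda>e. U 0 j e y - Q0 e) (\<lambda>e. U 1 j e y - (Q1 e - T e)) x"
    unfolding tw' by (simp add: Q0_def)
  then have e: "U i j x y - her i a b (\<lambda>e. her j c d (\<lambda>g. U 0 0 e g) (\<lambda>g. U 0 1 e g) y)
      (\<lambda>e. her j c d (\<lambda>g. U 1 0 e g) (\<lambda>g. tw e g) y) x =
      U i j x y - her i a b (\<lambda>e. U 0 j e y) (\<lambda>e. U 1 j e y) x + her i a b Q0 (\<lambda>e. Q1 e - T e) x"
    unfolding her_diff by simp
  have "0 \<le> D * r ^ 3 / r ^ (i + j)" using D0 rp by simp
  then have "16 * (D * r ^ 3 / r ^ (i + j)) + 25864 * (D * r ^ 3 / r ^ (i + j)) \<le> 30000 * (D * r ^ 3 / r ^ (i + j))" by simp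
  then show ?thesis unfolding e using P 3 by (simp add: mult.assoc)
qed

subsection \<open>The Shishkin mesh\<close>

text \<open>Lets (ln N)^3 / N^3 be absorbed into N^-2, and s (ln N)^3 into a constant.\<close>

lemma ln_cube_le: "1 \<le> x \<Longrightarrow> ln x ^ 3 \<le> 27 * (x::real)"
proof -
  assume x: "1 \<le> x"
  then have "ln x = 3 * ln (root 3 x)" by (simp add: ln_root)
  also have "\<dots> \<le> 3 * root 3 x" using x ln_bound [of "root 3 x"] by simp
  finally have "ln x ^ 3 \<le> (3 * root 3 x) ^ 3" using x by (intro power_mono) auto
  also have "\<dots> = 27 * x" using x by (simp add: power_mult_distrib)
  finally show ?thesis .
qed

text \<open>Here \<open>s\<close> is \<open>\<surd>\<epsilon>\<close> and \<open>3 * k\<close> is \<open>c\<^sup>\<star>\<close>; the estimates only need a third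
  of the exponential decay, the rest absorbs powers of \<open>N\<close>. All constants of the mesh are collected in \<open>G\<close>.\<close>

locale shishkin = mesh +
  fixes s k G :: real
  assumes s: "0 < s" "s \<le> 1" and k: "0 < k" and G: "1 \<le> G"
    and sN: "s * real N \<le> G"
    and h_le: "h * real N \<le> G * s * ln (real N)"
    and h_ge: "s * ln (real N) \<le> G * real N * h"
    and sL: "s * ln (real N) ^ 3 \<le> G"
    and osc: "exp (12 * k * h / s) \<le> G"
    and t2: "exp (- (2 * k) * lam / s) * real N ^ 2 \<le> G"
    and t3: "exp (- (3 * k) * lam / s) * real N ^ 3 \<le> G"
begin

abbreviation "n \<equiv> real N"
abbreviation "L \<equiv> ln (real N)"

text \<open>The decay from two opposite edges at once, so that both layers are handled by a single
  function.\<close>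

definition ex :: "real \<Rightarrow> real" where
  "ex t = exp (- (3 * k) * t / s) + exp (- (3 * k) * (1 - t) / s)"

text \<open>The third of the decay rate that is left when the other two thirds are spent on a factor
  N^-2. Its integral over [0,1] is of order s.\<close>

definition rho :: "real \<Rightarrow> real" where
  "rho t = exp (- k * t / s) + exp (- k * (1 - t) / s)"

lemma n8: "n \<ge> 8" using N_ge by simp

lemma L1: "L \<ge> 1"
proof -
  have "exp 1 \<le> (3::real)" by (rule exp_le)
  then have "exp 1 \<le> n" using n8 by linarith
  then show ?thesis using n8 by (simp add: ln_ge_iff)
qed

lemma Ln: "L \<le> n" using ln_le_minus_one [of n] n8 by linarith

lemma sLs: "s * L \<le> G" "s * L\<^sup>2 \<le> G"
proof -
  have "L \<le> L ^ 3" "L ^ 2 \<le> L ^ 3" using L1 power_increasing [of 1 3 L] power_increasing [of 2 3 L] by auto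
  then have "s * L \<le> s * L ^ 3" "s * L\<^sup>2 \<le> s * L ^ 3" using s by (auto intro: mult_left_mono)
  then show "s * L \<le> G" "s * L\<^sup>2 \<le> G" using sL by linarith+
qed

lemma ex_bounds: "0 < ex t" "t \<in> {0..1} \<Longrightarrow> ex t \<le> rho t" "0 < rho t" "t \<in> {0..1} \<Longrightarrow> rho t \<le> 2"
proof -
  show "0 < ex t" "0 < rho t" unfolding ex_def rho_def by (intro add_pos_pos exp_gt_zero)+
  show "ex t \<le> rho t" if "t \<in> {0..1}"
    unfolding ex_def rho_def using that s k
    by (intro add_mono) (auto intro!: divide_right_mono mult_right_mono)
  show "rho t \<le> 2" if "t \<in> {0..1}"
  proof -
    have "exp (- k * t / s) \<le> 1" "exp (- k * (1 - t) / s) \<le> 1"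
      using that s k by (auto simp: divide_nonpos_pos mult_nonneg_nonneg)
    then show ?thesis unfolding rho_def by linarith
  qed
qed

lemma ex_le2: "t \<in> {0..1} \<Longrightarrow> ex t \<le> 2"
  using ex_bounds(2,4) [of t] by simp

text \<open>The distance 4 h is two macro widths: one from the point to a vertex of its
  macro-element, one along the edge assigned to that vertex, which may lie outside the
  macro-element.\<close>

lemma ex_osc:
  assumes "\<bar>t - t'\<bar> \<le> 4 * h"
  shows "ex t' \<le> G * ex t"
proof -
  have A: "exp (- (3 * k) * t' / s) \<le> G * exp (- (3 * k) * t / s)" if "t - t' \<le> 4 * h" for t t'
  proof -
    have "- (3 * k) * t' / s \<le> 12 * k * h / s + - (3 * k) * t / s"
    proof -
      have "3 * k * (t - t') \<le> 3 * k * (4 * h)" using that k by (intro mult_left_mono) auto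
      then have "- (3 * k) * t' \<le> 12 * k * h + - (3 * k) * t" by (simp add: algebra_simps)
      then show ?thesis unfolding add_divide_distrib [symmetric] using s by (intro divide_right_mono) auto
    qed
    then have "exp (- (3 * k) * t' / s) \<le> exp (12 * k * h / s) * exp (- (3 * k) * t / s)"
      unfolding exp_add [symmetric] by simp
    also have "\<dots> \<le> G * exp (- (3 * k) * t / s)" using osc by (intro mult_right_mono) auto
    finally show ?thesis .
  qed
  show ?thesis unfolding ex_def distrib_left
    by (intro add_mono A) (use assms in auto)
qed

text \<open>Away from the edges the whole decay is worth N^-3; alternatively two thirds are worth
  N^-2, and the rest is kept for integration.\<close>

lemma ex_trans:
  assumes "t \<in> {lam..1 - lam}"
  shows "ex t \<le> 2 * G / n ^ 3" "ex t \<le> G / n\<^sup>2 * rho t"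
proof -
  have n0: "n > 0" using n8 by simp
  have e3: "exp (- (3 * k) * p / s) \<le> G / n ^ 3" if "p \<ge> lam" for p
  proof -
    have "- (3 * k) * p / s \<le> - (3 * k) * lam / s"
      using that s k by (intro divide_right_mono) auto
    then have "exp (- (3 * k) * p / s) * n ^ 3 \<le> exp (- (3 * k) * lam / s) * n ^ 3"
      by (intro mult_right_mono) auto
    then have "exp (- (3 * k) * p / s) * n ^ 3 \<le> G" using t3 by linarith
    then show ?thesis using n0 by (simp only: pos_le_divide_eq zero_less_power)
  qed
  then show "ex t \<le> 2 * G / n ^ 3"
    using e3 [of t] e3 [of "1 - t"] assms unfolding ex_def atLeastAtMost_iff mult_2 distrib_right add_divide_distrib
    by linarith
  have e2: "exp (- (3 * k) * p / s) \<le> G / n\<^sup>2 * exp (- k * p / s)" if "p \<ge> lam" for p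
  proof -
    have "- (2 * k) * p / s \<le> - (2 * k) * lam / s"
      using that s k by (intro divide_right_mono) auto
    then have "exp (- (2 * k) * p / s) * n\<^sup>2 \<le> exp (- (2 * k) * lam / s) * n\<^sup>2"
      by (intro mult_right_mono) auto
    then have "exp (- (2 * k) * p / s) * n\<^sup>2 \<le> G" using t2 by linarith
    then have "exp (- (2 * k) * p / s) \<le> G / n\<^sup>2" using n0 by (simp only: pos_le_divide_eq zero_less_power)
    then have "exp (- (2 * k) * p / s) * exp (- k * p / s) \<le> G / n\<^sup>2 * exp (- k * p / s)"
      by (rule mult_right_mono) simp
    moreover have "- (2 * k) * p / s + - k * p / s = - (3 * k) * p / s"
      unfolding add_divide_distrib [symmetric] by (simp add: algebra_simps)
    ultimately show ?thesis unfolding exp_add [symmetric] by (simp only:)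
  qed
  show "ex t \<le> G / n\<^sup>2 * rho t"
    using e2 [of t] e2 [of "1 - t"] assms unfolding ex_def rho_def distrib_left by simp
qed

text \<open>The order of magnitude of the interpolation error for the derivatives of order \<open>m\<close>
  outside \<open>\<Omega>\<^sub>0\<close>, where \<open>e\<close> is the size of the layer functions.\<close>

definition tgt :: "nat \<Rightarrow> real \<Rightarrow> real" where
  "tgt m e = (if m = 0 then L ^ 3 / n ^ 3 else (1 + L ^ (3 - m) * e) / (s ^ m * n ^ (3 - m)))"

lemma tgt_nonneg: "e \<ge> 0 \<Longrightarrow> 0 \<le> tgt m e"
  using L1 s unfolding tgt_def by auto

lemma tgt_ge: "e \<ge> 0 \<Longrightarrow> 1 / (s ^ m * n ^ (3 - m)) \<le> tgt m e"
  using L1 s n8 unfolding tgt_def by (auto intro!: divide_right_mono)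

text \<open>For \<open>m = 0\<close> the definition drops the layer function. There 1 + L^3 e is at
  most 5 L^3, because \<open>e <= 4\<close> and \<open>L >= 1\<close>.\<close>

lemma tgt_le:
  assumes "0 \<le> e" "e \<le> 4"
  shows "(1 + L ^ (3 - m) * e) / (s ^ m * n ^ (3 - m)) \<le> 5 * tgt m e"
proof (cases "m = 0")
  case True
  have "L ^ 3 \<ge> 1" using L1 by simp
  moreover have "L ^ 3 * e \<le> L ^ 3 * 4" using assms L1 by (intro mult_left_mono) auto
  ultimately have "1 + L ^ 3 * e \<le> 5 * L ^ 3" by linarith
  then have "(1 + L ^ 3 * e) / n ^ 3 \<le> 5 * L ^ 3 / n ^ 3" by (intro divide_right_mono) auto
  then show ?thesis using True unfolding tgt_def by simp
next
  case False
  have "0 \<le> tgt m e" using assms L1 s unfolding tgt_def by auto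
  then have "tgt m e \<le> 5 * tgt m e" by linarith
  then show ?thesis using False unfolding tgt_def by (simp only: if_False)
qed

lemma h_bounds: "2 * h \<le> 2 * G * s * L / n" "1 / (2 * h) \<le> G * n / s" "2 * h / s \<le> 2 * G"
proof -
  have n0: "n > 0" using n8 by simp
  show 1: "2 * h \<le> 2 * G * s * L / n" using h_le n0 by (simp add: field_simps)
  have "s \<le> s * L" using L1 s by simp
  also have "\<dots> \<le> G * n * (2 * h)" 
  proof -
    have "G * n * h \<le> G * n * (2 * h)" using hH G n0 by (intro mult_left_mono) auto
    then show ?thesis using h_ge by linarith
  qed
  finally show "1 / (2 * h) \<le> G * n / s" using s hH by (simp add: field_simps)
  have "2 * h / s \<le> 2 * G * (L / n)" using 1 s n0 by (simp add: field_simps)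
  also have "\<dots> \<le> 2 * G * 1" using G Ln n0 by (intro mult_left_mono) auto
  finally show "2 * h / s \<le> 2 * G" by simp
qed

lemma pow_cases: "i + j \<le> (2::nat) \<Longrightarrow> (i = 0 \<and> j = 0) \<or> (i = 1 \<and> j = 0) \<or> (i = 2 \<and> j = 0) \<or> (i = 0 \<and> j = 1) \<or> (i = 1 \<and> j = 1) \<or> (i = 0 \<and> j = 2)"
  by auto

text \<open>The third derivative is of size (s^2 + G e) / s^3, where s^2 stems from the smooth part.
  The fine width, of order s L / n, cancels s^-3, and n^i stands for i divisions by the coarse
  width. The corner regions use the case \<open>i = 0\<close>.\<close>

lemma layer_scale:
  assumes ij: "i + j \<le> 2" and e: "0 \<le> e" "e \<le> 4"
  shows "n ^ i * (1 / s ^ 3 * (s\<^sup>2 + G * e) * (2 * h) ^ 3) / (2 * h) ^ j \<le> 40 * G ^ 6 * tgt (i + j) e"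
proof -
  have n0: "n > 0" using n8 by simp
  have L0: "L > 0" using L1 by simp
  define X where "X = s\<^sup>2 + G * e"
  have X: "X \<ge> 0" unfolding X_def using G e by simp
  define T where "T = L ^ (3 - j) * s ^ i"
  let ?m = "i + j"
  have "n ^ i * (1 / s ^ 3 * X * (2 * h) ^ 3) / (2 * h) ^ j = n ^ i * (1 / s ^ 3 * X) * (2 * h) ^ (3 - j)"
    using hH ij by (simp add: power_diff)
  also have "\<dots> \<le> n ^ i * (1 / s ^ 3 * X) * (2 * G * s * L / n) ^ (3 - j)"
    using h_bounds(1) hH X s by (intro mult_left_mono power_mono) auto
  also have "\<dots> = (2 * G) ^ (3 - j) * (T * X / (s ^ ?m * n ^ (3 - ?m)))"
    using pow_cases [OF ij] s n0 unfolding T_def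
    by (elim disjE) (simp_all add: field_simps eval_nat_numeral)
  also have "\<dots> \<le> (2 * G) ^ 3 * (T * X / (s ^ ?m * n ^ (3 - ?m)))"
    using G X s L0 unfolding T_def by (intro mult_right_mono power_increasing) auto
  also have "\<dots> \<le> (2 * G) ^ 3 * (G ^ 3 * (1 + L ^ (3 - ?m) * e) / (s ^ ?m * n ^ (3 - ?m)))"
  proof (intro mult_left_mono divide_right_mono)
    \<comment> \<open>The layer part uses the boundedness of (s L)^i; the smooth part uses s L^3 <=
      G.\<close>
    have T1: "T \<le> G\<^sup>2 * L ^ (3 - ?m)"
    proof -
      have "T = (s * L) ^ i * L ^ (3 - ?m)"
        using pow_cases [OF ij] unfolding T_def
        by (elim disjE) (simp_all add: eval_nat_numeral)
      also have "\<dots> \<le> G ^ i * L ^ (3 - ?m)" using sLs s L0 by (intro mult_right_mono power_mono) auto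
      also have "\<dots> \<le> G\<^sup>2 * L ^ (3 - ?m)" using G ij L0 by (intro mult_right_mono power_increasing) auto
      finally show ?thesis .
    qed
    have "L ^ (3 - j) \<le> L ^ 3" using L1 by (intro power_increasing) auto
    moreover have "s ^ i * s\<^sup>2 \<le> s" using s by (metis linorder_not_less mult_left_le one_add_one order_less_imp_le power_add power_le_one_iff power_one_right mult_le_one power2_eq_square mult.assoc mult_left_le_one_le zero_le_power power_le_one)
    ultimately have T2: "T * s\<^sup>2 \<le> L ^ 3 * s"
      unfolding T_def mult.assoc using L0 s by (intro mult_mono) auto
    have "T * X = T * s\<^sup>2 + G * (T * e)" unfolding X_def by (simp add: algebra_simps)
    also have "\<dots> \<le> G + G * (G\<^sup>2 * L ^ (3 - ?m) * e)"
      using T1 T2 sL e G by (intro add_mono mult_left_mono mult_right_mono) (auto simp: mult.commute)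
    also have "\<dots> \<le> G ^ 3 + G ^ 3 * (L ^ (3 - ?m) * e)"
      using G self_le_power [of G 3] by (simp add: eval_nat_numeral mult.assoc)
    finally show "T * X \<le> G ^ 3 * (1 + L ^ (3 - ?m) * e)" by (simp add: algebra_simps)
  qed (use s G in auto)
  also have "\<dots> = 8 * G ^ 6 * ((1 + L ^ (3 - ?m) * e) / (s ^ ?m * n ^ (3 - ?m)))"
    by (simp add: eval_nat_numeral)
  also have "\<dots> \<le> 8 * G ^ 6 * (5 * tgt ?m e)"
    using G by (intro mult_left_mono tgt_le e) auto
  finally show ?thesis unfolding X_def by simp
qed

text \<open>Contribution of functions of size N^-3 whose derivative costs 1/s. Multiplied by the
  fine width the derivative is no larger than the value, as 2 h / s <= 2 G.\<close>

lemma small_scale: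
  assumes ij: "i + j \<le> 2" and e: "0 \<le> e"
  shows "n ^ i * (1 / n ^ 3 + 2 * h * (1 / (s * n ^ 3))) / (2 * h) ^ j \<le> 3 * G ^ 3 * tgt (i + j) e"
proof -
  have n0: "n > 0" using n8 by simp
  let ?m = "i + j"
  have d: "1 / (2 * h) ^ j \<le> (G * n / s) ^ j"
    using power_mono [OF h_bounds(2), of j] hH by (simp add: power_one_over)
  have "n ^ i * (1 / n ^ 3 + 2 * h * (1 / (s * n ^ 3))) / (2 * h) ^ j =
      n ^ i / n ^ 3 * (1 + 2 * h / s) * (1 / (2 * h) ^ j)"
    using s n0 hH by (simp add: field_simps)
  also have "\<dots> \<le> n ^ i / n ^ 3 * (3 * G) * (G * n / s) ^ j"
    using d h_bounds(3) G hH s n0 by (intro mult_mono) auto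
  also have "\<dots> = 3 * G * G ^ j * (s ^ i * (1 / (s ^ ?m * n ^ (3 - ?m))))"
    using pow_cases [OF ij] s n0
    by (elim disjE) (simp_all add: field_simps eval_nat_numeral)
  also have "\<dots> \<le> 3 * G * G\<^sup>2 * (1 * (1 / (s ^ ?m * n ^ (3 - ?m))))"
    using G s ij n0 by (intro mult_mono power_increasing power_le_one) auto
  also have "\<dots> \<le> 3 * G * G\<^sup>2 * (1 * tgt ?m e)"
    using G s by (intro mult_left_mono tgt_ge e) auto
  finally show ?thesis by (simp add: eval_nat_numeral)
qed

text \<open>Contribution of a slope error 1 / (s n^2) at the interface. For values it is of order L
  / n^3, one of the reasons for a logarithm in the case \<open>m = 0\<close> of
  \<open>tgt\<close>.\<close>

lemma slope_scale:
  assumes ij: "i + j \<le> 2" and e: "0 \<le> e"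
  shows "n ^ i * (2 * h * (1 / (s * n\<^sup>2))) / (2 * h) ^ j \<le> 2 * G\<^sup>2 * tgt (i + j) e"
proof -
  have n0: "n > 0" using n8 by simp
  let ?m = "i + j" and ?b = "1 / (s ^ (i + j) * n ^ (3 - (i + j)))"
  have b: "?b \<le> tgt ?m e" "?b \<ge> 0" using tgt_ge [OF e, of ?m] s by auto
  note tn = tgt_nonneg [OF e, of ?m]
  have GG: "1 \<le> G * G" "G \<le> G * G" using G by (auto simp: mult_ge1_I)
  consider "j = 0" | "j = 1" | "j = 2" using ij by linarith
  then show ?thesis
  proof cases
    case 1
    have "n ^ i * (2 * h * (1 / (s * n\<^sup>2))) / (2 * h) ^ j \<le> n ^ i * (2 * G * s * L / n * (1 / (s * n\<^sup>2)))"
      unfolding 1 power_0 div_by_1 using h_bounds(1) s by (intro mult_left_mono mult_right_mono) auto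
    also have "\<dots> = 2 * G * (L * s ^ i) * ?b"
      using 1 pow_cases [OF ij] s n0 by (elim disjE) (simp_all add: field_simps eval_nat_numeral)
    also have "\<dots> \<le> 2 * G\<^sup>2 * tgt ?m e"
    proof (cases "i = 0")
      case True
      have "L \<le> L ^ 3" using self_le_power [OF L1, of 3] by simp
      then have "L / n ^ 3 \<le> tgt 0 e" unfolding tgt_def by (auto intro: divide_right_mono)
      moreover have "0 \<le> tgt 0 e" unfolding tgt_def using L1 by simp
      ultimately have "2 * G * (L / n ^ 3) \<le> 2 * G\<^sup>2 * tgt 0 e"
        using GG G L1 by (intro mult_mono) (auto simp: power2_eq_square)
      then show ?thesis using True 1 by simp
    next
      case False
      have "L * s ^ i \<le> L * s" using False s L1 power_decreasing [of 1 i s] by (intro mult_left_mono) auto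
      then have "L * s ^ i \<le> G" using sLs by (simp add: mult.commute)
      then have "2 * G * (L * s ^ i) * ?b \<le> 2 * G * G * tgt ?m e"
        using G b L1 s by (intro mult_mono) auto
      then show ?thesis by (simp add: power2_eq_square)
    qed
    finally show ?thesis .
  next
    case 2
    have "n ^ i * (2 * h * (1 / (s * n\<^sup>2))) / (2 * h) ^ j = s ^ i * ?b"
      using 2 pow_cases [OF ij] s n0 hH by (elim disjE) (simp_all add: field_simps eval_nat_numeral)
    also have "\<dots> \<le> 1 * tgt ?m e" using b s by (intro mult_mono power_le_one) auto
    also have "\<dots> \<le> 2 * G\<^sup>2 * tgt ?m e" using GG b tn by (intro mult_right_mono) (auto simp: power2_eq_square)
    finally show ?thesis .
  next
    case 3
    have i0: "i = 0" using 3 ij by simp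
    have "n ^ i * (2 * h * (1 / (s * n\<^sup>2))) / (2 * h) ^ j = 1 / (2 * h) * (1 / (s * n\<^sup>2))"
      using 3 i0 hH by (simp add: power2_eq_square)
    also have "\<dots> \<le> G * n / s * (1 / (s * n\<^sup>2))"
      using h_bounds(2) s by (intro mult_right_mono) auto
    also have "\<dots> = G * ?b" using 3 i0 s n0 by (simp add: field_simps eval_nat_numeral)
    also have "\<dots> \<le> 2 * G\<^sup>2 * tgt ?m e" using GG b G tn by (intro mult_mono) (auto simp: power2_eq_square)
    finally show ?thesis .
  qed
qed

text \<open>For \<open>i + j > 0\<close> the x error of \<open>R\<close> is itself of the order
  \<open>tgt\<close>, with the help of s n <= G where no power of 1/s is present, and is absorbed.
  For \<open>i + j = 0\<close> it is only of order N^-2 and remains as a separate term.\<close>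

lemma strip_bound:
  assumes R: "C3_jet R" and ab: "(a, b) \<in> coarse_itvs" and cd: "(c, d) \<in> fine_itvs"
    and x: "x \<in> {a..b}" and y: "y \<in> {c..d}" and M: "M \<ge> 0" and e: "0 \<le> e" "e \<le> 4"
    and M0: "\<And>p. p \<in> {a..b} \<Longrightarrow> \<bar>R 2 0 p y\<bar> \<le> M"
    and M1: "\<And>p. p \<in> {a..b} \<Longrightarrow> \<bar>R 2 1 p y\<bar> \<le> M / s"
    and M2: "\<And>p. p \<in> {a..b} \<Longrightarrow> \<bar>R 1 2 p y\<bar> \<le> M / s\<^sup>2"
    and M3: "\<And>p q. p \<in> {a..b} \<Longrightarrow> q \<in> {c..d} \<Longrightarrow> \<bar>R 0 3 p q\<bar> \<le> M * (1 / s ^ 3 * (s\<^sup>2 + G * e))"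
    and Z: "\<And>i j p q. i + j \<le> 2 \<Longrightarrow> p \<in> {a..b} \<Longrightarrow> q \<in> {c..d} \<Longrightarrow> \<bar>Z i j p q\<bar> \<le> M / (s ^ (i + j) * n ^ 3)"
    and U: "\<And>i j p q. i + j \<le> 2 \<Longrightarrow> p \<in> {a..b} \<Longrightarrow> q \<in> {c..d} \<Longrightarrow> U i j p q = R i j p q + (Z i j p q :: real)"
    and g: "\<And>\<xi> \<eta>. \<xi> \<in> nodes3 (a, b) \<Longrightarrow> \<eta> \<in> {c, d} \<Longrightarrow> \<bar>g \<xi> \<eta> - U 0 1 \<xi> \<eta>\<bar> \<le> M / (s * n\<^sup>2)"
    and ij: "i + j \<le> 2"
  shows "\<bar>U i j x y - lag i a b (\<lambda>\<xi>. her j c d (\<lambda>\<eta>. U 0 0 \<xi> \<eta>) (\<lambda>\<eta>. g \<xi> \<eta>) y) x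
      - (if i + j = 0 then R 0 0 x y - lag 0 a b (\<lambda>\<xi>. R 0 0 \<xi> y) x else 0)\<bar>
    \<le> 20000 * G ^ 6 * M * tgt (i + j) e"
    and "\<bar>R 0 0 x y - lag 0 a b (\<lambda>\<xi>. R 0 0 \<xi> y) x\<bar> \<le> 64 * M / n\<^sup>2"
proof -
  have n0: "n > 0" using n8 by simp
  note A = coarseD [OF ab] and F = fineD [OF cd]
  have sub: "{a..b} \<subseteq> {0..1}" "{c..d} \<subseteq> {0..1}" using A F by auto
  have y1: "y \<in> {0..1}" using y sub by auto
  have Hn: "H \<le> 2 / n" "1 / H \<le> n"
    using hH(2,4,5) n0 by (auto simp: pos_divide_le_eq pos_le_divide_eq mult.commute)
  note LX = lag_x_errors [OF R A(1) sub(1) x y1 M0 M1 M2, unfolded A(2)]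
  let ?t = "tgt (i + j) e"
  have t0: "?t \<ge> 0" by (rule tgt_nonneg [OF e(1)])
  have G1: "1 \<le> G ^ p" for p using G by simp
  have sn: "1 / n \<le> G / (s * n\<^sup>2)" "1 \<le> G / (s * n)" using sN s n0 by (auto simp: field_simps power2_eq_square)
  have "\<bar>R 0 0 x y - lag 0 a b (\<lambda>\<xi>. R 0 0 \<xi> y) x\<bar> \<le> 16 * M * H\<^sup>2" by (rule LX(1)) auto
  also have "\<dots> \<le> 16 * M * (2 / n)\<^sup>2" using Hn M hH by (intro mult_left_mono power_mono) auto
  finally show "\<bar>R 0 0 x y - lag 0 a b (\<lambda>\<xi>. R 0 0 \<xi> y) x\<bar> \<le> 64 * M / n\<^sup>2" by (simp add: power_divide)
  have LA: "\<bar>R i j x y - lag i a b (\<lambda>\<xi>. R 0 j \<xi> y) x\<bar> \<le> 64 * G\<^sup>2 * M * ?t" if m: "i + j \<noteq> 0"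
  proof -
    let ?b = "1 / (s ^ (i + j) * n ^ (3 - (i + j)))"
    have MH: "16 * M * H \<le> 32 * M / n" using mult_left_mono [OF Hn(1), of "16 * M"] M by simp
    have MH1: "16 * (M / s) * H \<le> 32 * M / (s * n)" "16 * (M / s\<^sup>2) * H \<le> 32 * M / (s\<^sup>2 * n)"
      using mult_left_mono [OF Hn(1), of "16 * (M / s)"] mult_left_mono [OF Hn(1), of "16 * (M / s\<^sup>2)"] M s by auto
    have MH2: "16 * (M / s) * H\<^sup>2 \<le> 64 * M / (s * n\<^sup>2)"
      using mult_left_mono [OF power_mono [OF Hn(1), of 2], of "16 * (M / s)"] M s hH by (auto simp: power_divide)
    have *: "\<bar>R i j x y - lag i a b (\<lambda>\<xi>. R 0 j \<xi> y) x\<bar> \<le> 64 * G\<^sup>2 * M * ?b"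
    proof -
      have G2: "G \<le> G\<^sup>2" "1 \<le> G\<^sup>2" using G by (auto simp: self_le_power)
      have mm: "u \<le> 64 * G\<^sup>2 * M * ?b" if "u \<le> c * M * ?b" "c \<le> 64 * G\<^sup>2" for c u
      proof -
        have "c * M * ?b \<le> 64 * G\<^sup>2 * M * ?b" using that M s n0 by (intro mult_right_mono) auto
        then show ?thesis using that by linarith
      qed
      from pow_cases [OF ij] m
      consider "i = 1" "j = 0" | "i = 2" "j = 0" | "i = 0" "j = 1" | "i = 1" "j = 1" | "i = 0" "j = 2" by blast
      then show ?thesis
      proof cases
        case 1
        have "M / n \<le> M * (G / (s * n\<^sup>2))" using mult_left_mono [OF sn(1) M] by simp
        then have "32 * (M / n) \<le> 32 * (M * (G / (s * n\<^sup>2)))" by (rule mult_left_mono) simp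
        then have "32 * M / n \<le> (32 * G) * M * ?b" using 1 by (simp add: mult_ac)
        with LX(2) MH show ?thesis using 1 G2 by (intro mm [of _ "32 * G"]) auto
      next
        case 2
        have "1 \<le> G / (s\<^sup>2 * n)" 
        proof -
          have "s\<^sup>2 * n \<le> s * n" using s n0 by (simp add: power2_eq_square)
          then have "1 * (s\<^sup>2 * n) \<le> G" using sN by linarith
          then show ?thesis using s n0 by (simp only: pos_le_divide_eq zero_less_power mult_pos_pos)
        qed
        then have "M * 1 \<le> M * (G / (s\<^sup>2 * n))" using M by (rule mult_left_mono)
        then have "17 * (M * 1) \<le> 17 * (M * (G / (s\<^sup>2 * n)))" by (rule mult_left_mono) simp
        then have "17 * M \<le> (17 * G) * M * ?b" using 2 by (simp add: mult_ac)
        with LX(3) show ?thesis using 2 G2 by (intro mm [of _ "17 * G"]) auto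
      next
        case 3
        with LX(4) MH2 show ?thesis using G2 by (intro mm [of _ 64]) auto
      next
        case 4
        have "1 / (s * n) \<le> 1 / (s\<^sup>2 * n)" using s n0 by (simp add: field_simps power2_eq_square)
        then have "32 * M * (1 / (s * n)) \<le> 32 * M * (1 / (s\<^sup>2 * n))" using M by (intro mult_left_mono) auto
        with LX(5) MH1(1) show ?thesis using 4 G2 by (intro mm [of _ 32]) (auto simp: eval_nat_numeral)
      next
        case 5
        with LX(6) MH1(2) show ?thesis using G2 by (intro mm [of _ 32]) (auto simp: power2_eq_square)
      qed
    qed
    also have "\<dots> \<le> 64 * G\<^sup>2 * M * ?t" using tgt_ge [OF e(1), of "i + j"] G M by (intro mult_left_mono) auto
    finally show ?thesis .
  qed
  have M3': "\<bar>R 0 3 p q\<bar> \<le> M * (1 / s ^ 3 * (s\<^sup>2 + G * e))" if "p \<in> {a..b}" "q \<in> {c..d}" for p q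
    using M3 that .
  have z0: "\<bar>Z 0 0 p q\<bar> \<le> M / n ^ 3" "\<bar>Z 0 1 p q\<bar> \<le> M / (s * n ^ 3)" if "p \<in> {a..b}" "q \<in> {c..d}" for p q
    using Z [of 0 0 p q] Z [of 0 1 p q] that by auto
  let ?K = "16 * (M * (1 / s ^ 3 * (s\<^sup>2 + G * e))) * (2 * h) ^ 3 + 8 * (M / n ^ 3 + 2 * h * (M / (s * n ^ 3)))
     + 8 * (2 * h * (M / (s * n\<^sup>2)))"
  have K0: "0 \<le> 16 * (?K / (2 * h) ^ j)" using M s G e hH by simp
  have "\<bar>U i j x y - lag i a b (\<lambda>\<xi>. her j c d (\<lambda>\<eta>. U 0 0 \<xi> \<eta>) (\<lambda>\<eta>. g \<xi> \<eta>) y) x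
      - (R i j x y - lag i a b (\<lambda>\<xi>. R 0 j \<xi> y) x)\<bar>
    \<le> \<bar>Z i j x y\<bar> + 16 * (?K / (2 * h) ^ j) / H ^ i"
    by (rule strip_local [OF R A(1) sub(1) F(1) sub(2) x y M3' z0 U g ij, unfolded A(2) F(2)]) auto
  also have "16 * (?K / (2 * h) ^ j) / H ^ i = 16 * (?K / (2 * h) ^ j) * (1 / H) ^ i" by (simp add: power_one_over)
  also have "\<dots> \<le> 16 * (?K / (2 * h) ^ j) * n ^ i"
    by (rule mult_left_mono [OF power_mono [OF Hn(2)] K0]) (use hH in simp)
  also have "\<dots> = M * (256 * (n ^ i * (1 / s ^ 3 * (s\<^sup>2 + G * e) * (2 * h) ^ 3) / (2 * h) ^ j)
     + 128 * (n ^ i * (1 / n ^ 3 + 2 * h * (1 / (s * n ^ 3))) / (2 * h) ^ j)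
     + 128 * (n ^ i * (2 * h * (1 / (s * n\<^sup>2))) / (2 * h) ^ j))"
    by (simp add: algebra_simps add_divide_distrib)
  also have "\<dots> \<le> M * (256 * (40 * G ^ 6 * ?t) + 128 * (3 * G ^ 3 * ?t) + 128 * (2 * G\<^sup>2 * ?t))"
    using layer_scale [OF ij e] small_scale [OF ij e(1)] slope_scale [OF ij e(1)] M
    by (intro mult_left_mono add_mono) auto
  finally have 1: "\<bar>U i j x y - lag i a b (\<lambda>\<xi>. her j c d (\<lambda>\<eta>. U 0 0 \<xi> \<eta>) (\<lambda>\<eta>. g \<xi> \<eta>) y) x
      - (R i j x y - lag i a b (\<lambda>\<xi>. R 0 j \<xi> y) x)\<bar>
    \<le> \<bar>Z i j x y\<bar> + M * (256 * (40 * G ^ 6 * ?t) + 128 * (3 * G ^ 3 * ?t) + 128 * (2 * G\<^sup>2 * ?t))" by simp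
  have 2: "\<bar>Z i j x y\<bar> \<le> M * ?t"
  proof -
    have "s ^ (i + j) * n ^ (3 - (i + j)) \<le> s ^ (i + j) * n ^ 3" using s n8 by (intro mult_left_mono power_increasing) auto
    then have "1 / (s ^ (i + j) * n ^ 3) \<le> 1 / (s ^ (i + j) * n ^ (3 - (i + j)))"
      using s n0 by (intro divide_left_mono) auto
    then have "1 / (s ^ (i + j) * n ^ 3) \<le> ?t" using tgt_ge [OF e(1), of "i + j"] by linarith
    then have "M * (1 / (s ^ (i + j) * n ^ 3)) \<le> M * ?t" using M by (rule mult_left_mono)
    then show ?thesis using Z [OF ij x y] by simp
  qed
  have P: "0 \<le> M * ?t" using M t0 by simp
  have g6: "G ^ 3 * (M * ?t) \<le> G ^ 6 * (M * ?t)" "G\<^sup>2 * (M * ?t) \<le> G ^ 6 * (M * ?t)" "M * ?t \<le> G ^ 6 * (M * ?t)"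
    using mult_right_mono [OF power_increasing [of 3 6 G] P] mult_right_mono [OF power_increasing [of 2 6 G] P]
      mult_right_mono [OF G1 [of 6] P] G by auto
  \<comment> \<open>The terms sum to 10240 + 384 + 256 + 64 + 1 times the largest power of G, which
    explains 20000.\<close>
  have e1: "M * (256 * (40 * G ^ 6 * ?t) + 128 * (3 * G ^ 3 * ?t) + 128 * (2 * G\<^sup>2 * ?t)) =
      10240 * (G ^ 6 * (M * ?t)) + 384 * (G ^ 3 * (M * ?t)) + 256 * (G\<^sup>2 * (M * ?t))"
    "64 * G\<^sup>2 * M * ?t = 64 * (G\<^sup>2 * (M * ?t))" "20000 * G ^ 6 * M * ?t = 20000 * (G ^ 6 * (M * ?t))"
    by (simp_all add: algebra_simps)
  show "\<bar>U i j x y - lag i a b (\<lambda>\<xi>. her j c d (\<lambda>\<eta>. U 0 0 \<xi> \<eta>) (\<lambda>\<eta>. g \<xi> \<eta>) y) x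
      - (if i + j = 0 then R 0 0 x y - lag 0 a b (\<lambda>\<xi>. R 0 0 \<xi> y) x else 0)\<bar>
    \<le> 20000 * G ^ 6 * M * ?t"
  proof (cases "i + j = 0")
    case True
    then have "i = 0" "j = 0" by auto
    then show ?thesis using 1 2 g6 P unfolding e1 by simp
  next
    case False
    then have e0: "(if i + j = 0 then R 0 0 x y - lag 0 a b (\<lambda>\<xi>. R 0 0 \<xi> y) x else 0) = 0" by (rule if_not_P)
    show ?thesis using 1 2 g6 P LA [OF False] unfolding e1 e0 by linarith
  qed
qed

end

section \<open>Derivatives of the error on the cells\<close>

lemma lag_param:
  assumes "\<And>\<xi>. \<xi> \<in> nodes3 (a, b) \<Longrightarrow> (F \<xi> has_real_derivative F' \<xi>) (at t within X)"
  shows "((\<lambda>t. lag i a b (\<lambda>\<xi>. F \<xi> t) x) has_real_derivative lag i a b F' x) (at t within X)"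
proof -
  consider "i = 0" | "i = 1" | "i = 2" | "i > 2" by linarith
  then show ?thesis
    by cases (simp_all only: lag_def Let_def if_True if_False simp_thms one_neq_zero zero_neq_numeral one_eq_numeral_iff
        numeral_eq_one_iff num.distinct zero_neq_one numeral_neq_zero,
      (auto intro!: DERIV_add DERIV_diff DERIV_cmult DERIV_cmult_right DERIV_cdivide assms)+)
qed

lemma her_param:
  assumes "\<And>\<xi>. (F \<xi> has_real_derivative F' \<xi>) (at t)" "\<And>\<xi>. (K \<xi> has_real_derivative K' \<xi>) (at t)"
  shows "((\<lambda>t. her i a b (\<lambda>\<xi>. F \<xi> t) (\<lambda>\<xi>. K \<xi> t) x) has_real_derivative her i a b F' K' x) (at t)"
proof -
  define P where "P v0 v1 d0 d1 = her i a b (\<lambda>t. if t = a then v0 else v1) (\<lambda>t. if t = a then d0 else d1) x" for v0 v1 d0 d1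
  show ?thesis
  proof (cases "a = b")
    \<comment> \<open>The representation below prescribes the data at the two ends independently,
      which requires different ends. For \<open>a = b\<close> division by r = 0 yields 0, and only
      the terms with value and slope survive.\<close>
    case True
    have e: "her i a a f g x = (if i = 0 then f a + g a * (x - a) else if i = 1 then g a else 0)" for f g
      unfolding her_def pwq_def pwq'_def Let_def by (auto simp: algebra_simps)
    show ?thesis unfolding True [symmetric] e
      using assms by (auto intro!: derivative_eq_intros)
  next
    case False
    have lin: "her i a b f g x = f a * P 1 0 0 0 + f b * P 0 1 0 0 + g a * P 0 0 1 0 + g b * P 0 0 0 1" for f g
      unfolding P_def her_def pwq_def pwq'_def Let_def using False
      by (simp add: algebra_simps add_divide_distrib diff_divide_distrib)
    show ?thesis unfolding lin [of "\<lambda>\<xi>. F \<xi> _"] lin [of F']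
      by (intro DERIV_add DERIV_cmult_right assms)
  qed
qed

context mesh
begin

lemma open_cell_subset:
  assumes "(a, b) \<in> fine_itvs \<union> coarse_itvs"
  shows "a < b" "0 \<le> a" "b \<le> 1" "{a..b} \<subseteq> {0..1}"
  using assms fineD [of a b] coarseD [of a b] by auto

text \<open>\<open>pd_local\<close> needs an open box on which the Hermite interpolant is smooth,
  that is, half of a macro-interval.\<close>

lemma half_cell:
  fixes a b x :: real
  assumes "a < b" "x \<in> {a<..<b}" "x \<noteq> (a + b) / 2"
  obtains a' b' where "x \<in> {a'<..<b'}" "a \<le> a'" "b' \<le> b" "\<And>t. t \<in> {a'<..<b'} \<Longrightarrow> t \<noteq> (a + b) / 2"
proof (cases "x < (a + b) / 2")
  case True then show ?thesis using assms by (intro that [of a "(a + b) / 2"]) auto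
next
  case False then show ?thesis using assms by (intro that [of "(a + b) / 2" b]) auto
qed

lemma off_midpoint: "(a, b) \<in> fine_itvs \<Longrightarrow> x \<notin> mp ` {0..N} \<Longrightarrow> x \<noteq> (a + b) / 2"
  using midpoint_fine by metis

text \<open>Differentiating the tensor product raises the order of the operator in the respective
  variable: the outer one by \<open>lag_deriv\<close>, the inner one by
  \<open>lag_param\<close>.\<close>

lemma pd_core:
  assumes u: "C_closed 3 u" and J: "(a, b) \<in> coarse_itvs" and K: "(c, d) \<in> coarse_itvs"
    and x: "x \<in> {a<..<b}" and y: "y \<in> {c<..<d}" and ij: "i + j \<le> 2"
  shows "pd i j (\<lambda>z. u z - quasi_interp lam N \<sigma> u z) (x, y) =
    jet_of u i j x y - lag i a b (\<lambda>\<xi>. lag j c d (\<lambda>\<eta>. jet_of u 0 0 \<xi> \<eta>) y) x"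
proof -
  note A = coarseD [OF J] and B = coarseD [OF K]
  show ?thesis
  proof (rule pd_local [OF C3_jet_of [OF u] A(5,6) B(5,6) _ _ _ ij x y, where
      G = "\<lambda>i j x y. lag i a b (\<lambda>\<xi>. lag j c d (\<lambda>\<eta>. jet_of u 0 0 \<xi> \<eta>) y) x"])
    fix x y assume "x \<in> {a<..<b}" "y \<in> {c<..<d}"
    then show "u (x, y) - quasi_interp lam N \<sigma> u (x, y) = jet_of u 0 0 x y - lag 0 a b (\<lambda>\<xi>. lag 0 c d (\<lambda>\<eta>. jet_of u 0 0 \<xi> \<eta>) y) x"
      using quasi_interp_cell [of "(a, b)" "(c, d)" "(x, y)" \<sigma> u] J K fine_not_coarse
      by (auto simp: nodal_interp_eq A(1) B(1) jet_of_def pd_def)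
  next
    fix i j :: nat and x y assume "i + j < 2"
    then show "((\<lambda>t. lag i a b (\<lambda>\<xi>. lag j c d (\<lambda>\<eta>. jet_of u 0 0 \<xi> \<eta>) y) t) has_real_derivative
        lag (Suc i) a b (\<lambda>\<xi>. lag j c d (\<lambda>\<eta>. jet_of u 0 0 \<xi> \<eta>) y) x) (at x)"
      "((\<lambda>t. lag i a b (\<lambda>\<xi>. lag j c d (\<lambda>\<eta>. jet_of u 0 0 \<xi> \<eta>) t) x) has_real_derivative
        lag i a b (\<lambda>\<xi>. lag (Suc j) c d (\<lambda>\<eta>. jet_of u 0 0 \<xi> \<eta>) y) x) (at y)"
      by (auto intro!: lag_deriv A(1) B(1) lag_param)
  qed
qed

lemma pd_h_strip:
  assumes u: "C_closed 3 u" and J: "(a, b) \<in> coarse_itvs" and K: "(c, d) \<in> fine_itvs"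
    and x: "x \<in> {a<..<b}" and y: "y \<in> {c<..<d}" "y \<notin> mp ` {0..N}" and ij: "i + j \<le> 2"
  shows "pd i j (\<lambda>z. u z - quasi_interp lam N \<sigma> u z) (x, y) =
    jet_of u i j x y - lag i a b (\<lambda>\<xi>. her j c d (\<lambda>\<eta>. jet_of u 0 0 \<xi> \<eta>) (\<lambda>\<eta>. normal_slope lam N u (a, b) \<xi> \<eta>) y) x"
proof -
  note A = coarseD [OF J] and B = fineD [OF K]
  obtain c' d' where cd: "y \<in> {c'<..<d'}" "c \<le> c'" "d' \<le> d" "\<And>t. t \<in> {c'<..<d'} \<Longrightarrow> t \<noteq> (c + d) / 2"
    using half_cell [OF B(1) y(1) off_midpoint [OF K y(2)]] by blast
  have cd': "0 \<le> c'" "d' \<le> 1" using cd B by auto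
  show ?thesis
  proof (rule pd_local [OF C3_jet_of [OF u] A(5,6) cd' _ _ _ ij x cd(1), where
      G = "\<lambda>i j x y. lag i a b (\<lambda>\<xi>. her j c d (\<lambda>\<eta>. jet_of u 0 0 \<xi> \<eta>) (\<lambda>\<eta>. normal_slope lam N u (a, b) \<xi> \<eta>) y) x"])
    fix x y assume "x \<in> {a<..<b}" "y \<in> {c'<..<d'}"
    then show "u (x, y) - quasi_interp lam N \<sigma> u (x, y) = jet_of u 0 0 x y -
        lag 0 a b (\<lambda>\<xi>. her 0 c d (\<lambda>\<eta>. jet_of u 0 0 \<xi> \<eta>) (\<lambda>\<eta>. normal_slope lam N u (a, b) \<xi> \<eta>) y) x"
      using quasi_interp_cell [of "(a, b)" "(c, d)" "(x, y)" \<sigma> u] J K fine_not_coarse cd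
      by (auto simp: h_edge_interp_eq A(1) B(1) jet_of_def pd_def)
  next
    fix i j :: nat and x y assume "i + j < 2" "y \<in> {c'<..<d'}"
    then show "((\<lambda>t. lag i a b (\<lambda>\<xi>. her j c d (\<lambda>\<eta>. jet_of u 0 0 \<xi> \<eta>) (\<lambda>\<eta>. normal_slope lam N u (a, b) \<xi> \<eta>) y) t) has_real_derivative
        lag (Suc i) a b (\<lambda>\<xi>. her j c d (\<lambda>\<eta>. jet_of u 0 0 \<xi> \<eta>) (\<lambda>\<eta>. normal_slope lam N u (a, b) \<xi> \<eta>) y) x) (at x)"
      "((\<lambda>t. lag i a b (\<lambda>\<xi>. her j c d (\<lambda>\<eta>. jet_of u 0 0 \<xi> \<eta>) (\<lambda>\<eta>. normal_slope lam N u (a, b) \<xi> \<eta>) t) x) has_real_derivative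
        lag i a b (\<lambda>\<xi>. her (Suc j) c d (\<lambda>\<eta>. jet_of u 0 0 \<xi> \<eta>) (\<lambda>\<eta>. normal_slope lam N u (a, b) \<xi> \<eta>) y) x) (at y)"
      using cd(4) [of y] by (auto intro!: lag_deriv her_deriv A(1) B(1) lag_param)
  qed
qed

text \<open>Stated for the exchanged jet at \<open>(y, x)\<close>, so that the estimates for
  horizontal strips apply directly.\<close>

lemma pd_v_strip:
  assumes u: "C_closed 3 u" and J: "(a, b) \<in> fine_itvs" and K: "(c, d) \<in> coarse_itvs"
    and x: "x \<in> {a<..<b}" "x \<notin> mp ` {0..N}" and y: "y \<in> {c<..<d}" and ij: "i + j \<le> 2"
  shows "pd i j (\<lambda>z. u z - quasi_interp lam N \<sigma> u z) (x, y) =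
    jswap (jet_of u) j i y x - lag j c d (\<lambda>\<eta>. her i a b (\<lambda>\<xi>. jswap (jet_of u) 0 0 \<eta> \<xi>)
      (\<lambda>\<xi>. normal_slope lam N (\<lambda>(y, x). u (x, y)) (c, d) \<eta> \<xi>) x) y"
proof -
  note A = fineD [OF J] and B = coarseD [OF K]
  let ?g = "\<lambda>\<eta> \<xi>. normal_slope lam N (\<lambda>(y, x). u (x, y)) (c, d) \<eta> \<xi>"
  obtain a' b' where ab: "x \<in> {a'<..<b'}" "a \<le> a'" "b' \<le> b" "\<And>t. t \<in> {a'<..<b'} \<Longrightarrow> t \<noteq> (a + b) / 2"
    using half_cell [OF A(1) x(1) off_midpoint [OF J x(2)]] by blast
  have ab': "0 \<le> a'" "b' \<le> 1" using ab A by auto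
  have "pd i j (\<lambda>z. u z - quasi_interp lam N \<sigma> u z) (x, y) =
    jet_of u i j x y - lag j c d (\<lambda>\<eta>. her i a b (\<lambda>\<xi>. jswap (jet_of u) 0 0 \<eta> \<xi>) (?g \<eta>) x) y"
  proof (rule pd_local [OF C3_jet_of [OF u] ab' B(5,6) _ _ _ ij ab(1) y, where
      G = "\<lambda>i j x y. lag j c d (\<lambda>\<eta>. her i a b (\<lambda>\<xi>. jswap (jet_of u) 0 0 \<eta> \<xi>) (?g \<eta>) x) y"])
    fix x y assume xy: "x \<in> {a'<..<b'}" "y \<in> {c<..<d}"
    show "u (x, y) - quasi_interp lam N \<sigma> u (x, y) = jet_of u 0 0 x y -
        lag 0 c d (\<lambda>\<eta>. her 0 a b (\<lambda>\<xi>. jswap (jet_of u) 0 0 \<eta> \<xi>) (?g \<eta>) x) y"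
      using quasi_interp_cell [of "(a, b)" "(c, d)" "(x, y)" \<sigma> u] J K fine_not_coarse ab xy
      by (auto simp: v_edge_interp_def h_edge_interp_eq A(1) B(1) jswap_def jet_of_def pd_def)
  next
    fix i j :: nat and x y assume "i + j < 2" "x \<in> {a'<..<b'}"
    then show "((\<lambda>t. lag j c d (\<lambda>\<eta>. her i a b (\<lambda>\<xi>. jswap (jet_of u) 0 0 \<eta> \<xi>) (?g \<eta>) t) y) has_real_derivative
        lag j c d (\<lambda>\<eta>. her (Suc i) a b (\<lambda>\<xi>. jswap (jet_of u) 0 0 \<eta> \<xi>) (?g \<eta>) x) y) (at x)"
      "((\<lambda>t. lag j c d (\<lambda>\<eta>. her i a b (\<lambda>\<xi>. jswap (jet_of u) 0 0 \<eta> \<xi>) (?g \<eta>) x) t) has_real_derivative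
        lag (Suc j) c d (\<lambda>\<eta>. her i a b (\<lambda>\<xi>. jswap (jet_of u) 0 0 \<eta> \<xi>) (?g \<eta>) x) y) (at y)"
      using ab(4) [of x] by (auto intro!: lag_deriv her_deriv A(1) B(1) lag_param)
  qed
  then show ?thesis by (simp add: jswap_def)
qed

lemma pd_corner:
  assumes u: "C_closed 3 u" and J: "(a, b) \<in> fine_itvs" and K: "(c, d) \<in> fine_itvs"
    and x: "x \<in> {a<..<b}" "x \<notin> mp ` {0..N}" and y: "y \<in> {c<..<d}" "y \<notin> mp ` {0..N}" and ij: "i + j \<le> 2"
  shows "pd i j (\<lambda>z. u z - quasi_interp lam N \<sigma> u z) (x, y) =
    jet_of u i j x y - her i a b (\<lambda>e. her j c d (\<lambda>g. jet_of u 0 0 e g) (\<lambda>g. jet_of u 0 1 e g) y)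
      (\<lambda>e. her j c d (\<lambda>g. jet_of u 1 0 e g) (\<lambda>g. twist_coeff u (\<sigma> (e, g)) (e, g)) y) x"
proof -
  note A = fineD [OF J] and B = fineD [OF K]
  let ?t = "\<lambda>e g. twist_coeff u (\<sigma> (e, g)) (e, g)"
  obtain a' b' where ab: "x \<in> {a'<..<b'}" "a \<le> a'" "b' \<le> b" "\<And>t. t \<in> {a'<..<b'} \<Longrightarrow> t \<noteq> (a + b) / 2"
    using half_cell [OF A(1) x(1) off_midpoint [OF J x(2)]] by blast
  obtain c' d' where cd: "y \<in> {c'<..<d'}" "c \<le> c'" "d' \<le> d" "\<And>t. t \<in> {c'<..<d'} \<Longrightarrow> t \<noteq> (c + d) / 2"
    using half_cell [OF B(1) y(1) off_midpoint [OF K y(2)]] by blast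
  have abcd: "0 \<le> a'" "b' \<le> 1" "0 \<le> c'" "d' \<le> 1" using ab A cd B by auto
  show ?thesis
  proof (rule pd_local [OF C3_jet_of [OF u] abcd _ _ _ ij ab(1) cd(1), where
      G = "\<lambda>i j x y. her i a b (\<lambda>e. her j c d (\<lambda>g. jet_of u 0 0 e g) (\<lambda>g. jet_of u 0 1 e g) y)
      (\<lambda>e. her j c d (\<lambda>g. jet_of u 1 0 e g) (?t e) y) x"])
    fix x y assume xy: "x \<in> {a'<..<b'}" "y \<in> {c'<..<d'}"
    show "u (x, y) - quasi_interp lam N \<sigma> u (x, y) = jet_of u 0 0 x y -
        her 0 a b (\<lambda>e. her 0 c d (\<lambda>g. jet_of u 0 0 e g) (\<lambda>g. jet_of u 0 1 e g) y)
      (\<lambda>e. her 0 c d (\<lambda>g. jet_of u 1 0 e g) (?t e) y) x"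
      using quasi_interp_cell [of "(a, b)" "(c, d)" "(x, y)" \<sigma> u] J K ab cd xy
      by (auto simp: corner_interp_eq A(1) B(1) jet_of_def) (simp add: pd_def)
  next
    fix i j :: nat and x y assume "i + j < 2" "x \<in> {a'<..<b'}" "y \<in> {c'<..<d'}"
    then show "((\<lambda>t. her i a b (\<lambda>e. her j c d (\<lambda>g. jet_of u 0 0 e g) (\<lambda>g. jet_of u 0 1 e g) y)
      (\<lambda>e. her j c d (\<lambda>g. jet_of u 1 0 e g) (?t e) y) t) has_real_derivative
        her (Suc i) a b (\<lambda>e. her j c d (\<lambda>g. jet_of u 0 0 e g) (\<lambda>g. jet_of u 0 1 e g) y)
      (\<lambda>e. her j c d (\<lambda>g. jet_of u 1 0 e g) (?t e) y) x) (at x)"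
      "((\<lambda>t. her i a b (\<lambda>e. her j c d (\<lambda>g. jet_of u 0 0 e g) (\<lambda>g. jet_of u 0 1 e g) t)
      (\<lambda>e. her j c d (\<lambda>g. jet_of u 1 0 e g) (?t e) t) x) has_real_derivative
        her i a b (\<lambda>e. her (Suc j) c d (\<lambda>g. jet_of u 0 0 e g) (\<lambda>g. jet_of u 0 1 e g) y)
      (\<lambda>e. her (Suc j) c d (\<lambda>g. jet_of u 1 0 e g) (?t e) y) x) (at y)"
      using ab(4) [of x] cd(4) [of y] by (auto intro!: her_deriv A(1) B(1) her_param)
  qed
qed

lemma normal_slope_eq:
  assumes "(a, b) \<in> coarse_itvs" "\<xi> \<in> nodes3 (a, b)"
  shows "normal_slope lam N u (a, b) \<xi> \<eta> =
    (if \<eta> = lam then lag 1 lam (mp (N div 4 + 1)) (\<lambda>\<eta>. u (\<xi>, \<eta>)) \<eta>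
     else if \<eta> = 1 - lam then lag 1 (mp (3 * N div 4 - 1)) (1 - lam) (\<lambda>\<eta>. u (\<xi>, \<eta>)) \<eta>
     else pd 0 1 u (\<xi>, \<eta>))"
  unfolding normal_slope_def Let_def mp_vals
    deriv_nodal_interp [OF coarseD(1) [OF assms(1)] coarseD(1) [OF interface_cells(1)] assms(2)]
    deriv_nodal_interp [OF coarseD(1) [OF assms(1)] coarseD(1) [OF interface_cells(2)] assms(2)] ..

text \<open>The coefficient is an average of u_xy with total weight 1 along an edge of length 2 h
  that ends at the vertex, and there u_xy varies by at most 2 h D.\<close>

lemma twist_error:
  assumes u: "C_closed 3 u" and sg: "edge_assignment lam N \<sigma>"
    and J: "(a, b) \<in> fine_itvs" and K: "(c, d) \<in> fine_itvs" and e: "e \<in> {a, b}" and g: "g \<in> {c, d}"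
    and D: "\<And>i j p q. i + j = 3 \<Longrightarrow> p \<in> {0..1} \<Longrightarrow> q \<in> {0..1} \<Longrightarrow> \<bar>p - e\<bar> \<le> 2 * h \<Longrightarrow> \<bar>q - g\<bar> \<le> 2 * h \<Longrightarrow> \<bar>jet_of u i j p q\<bar> \<le> D"
  shows "\<bar>twist_coeff u (\<sigma> (e, g)) (e, g) - jet_of u 1 1 e g\<bar> \<le> 400 * ((2 * h) * D)"
proof -
  note U = C3_jet_of [OF u]
  have eg: "e \<in> {0..1}" "g \<in> {0..1}" using e g fineD [OF J] fineD [OF K] by auto
  have "\<forall>X\<in>ends (a, b) \<times> ends (c, d). \<sigma> X \<in> corner_macro_edges lam N \<and> X \<in> edge_points (\<sigma> X)"
    using sg J K unfolding edge_assignment_def by blast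
  then have X: "\<sigma> (e, g) \<in> corner_macro_edges lam N" "(e, g) \<in> edge_points (\<sigma> (e, g))"
    using e g by auto
  then consider a' b' where "\<sigma> (e, g) = HEdge (a', b') g" "(a', b') \<in> fine_itvs" "a' \<le> e" "e \<le> b'"
    | a' b' where "\<sigma> (e, g) = VEdge e (a', b')" "(a', b') \<in> fine_itvs" "a' \<le> g" "g \<le> b'"
    unfolding corner_macro_edges_def by auto
  then show ?thesis
  proof cases
    case 1
    note F = fineD [OF 1(2)]
    have e': "e \<in> {a', b'}" by (rule fine_point_end [OF J 1(2) e 1(3,4)])
    have sub: "{a'..b'} \<subseteq> {0..1}" using F by auto
    have osc: "\<bar>jet_of u 1 1 t g - jet_of u 1 1 e g\<bar> \<le> D * (b' - a')" if t: "t \<in> {a'..b'}" for t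
    proof (rule bound_from_deriv [where g = "\<lambda>t. jet_of u 1 1 t g" and g' = "\<lambda>t. jet_of u 2 1 t g"])
      fix t assume t: "t \<in> {a'..b'}"
      show "((\<lambda>t. jet_of u 1 1 t g) has_real_derivative jet_of u 2 1 t g) (at t within {a'..b'})"
        using C3_jet_dx [OF U, of 1 1 t g] t sub eg
        by (intro DERIV_subset [OF _ sub]) (auto simp: numeral_2_eq_2)
      show "\<bar>jet_of u 2 1 t g\<bar> \<le> D"
        using t 1 F sub eg hH by (intro D) (auto simp: abs_le_iff)
    qed (use t 1 in auto)
    have "\<bar>integral {a'..b'} (\<lambda>x. jet_of u 1 1 x g * dual (a', b') e x) - jet_of u 1 1 e g\<bar> \<le> 400 * (D * (b' - a'))"
      by (rule integral_dual_approx [OF F(1) e' C3_jet_cont_x [OF U _ eg(2) sub] osc]) auto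
    then show ?thesis unfolding 1 F(2) by (simp add: jet_of_def mult_ac)
  next
    case 2
    note F = fineD [OF 2(2)]
    have g': "g \<in> {a', b'}" by (rule fine_point_end [OF K 2(2) g 2(3,4)])
    have sub: "{a'..b'} \<subseteq> {0..1}" using F by auto
    have osc: "\<bar>jet_of u 1 1 e t - jet_of u 1 1 e g\<bar> \<le> D * (b' - a')" if t: "t \<in> {a'..b'}" for t
    proof (rule bound_from_deriv [where g = "\<lambda>t. jet_of u 1 1 e t" and g' = "\<lambda>t. jet_of u 1 2 e t"])
      fix t assume t: "t \<in> {a'..b'}"
      show "((\<lambda>t. jet_of u 1 1 e t) has_real_derivative jet_of u 1 2 e t) (at t within {a'..b'})"
        using C3_jet_dy [OF U, of 1 1 e t] t sub eg
        by (intro DERIV_subset [OF _ sub]) (auto simp: numeral_2_eq_2)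
      show "\<bar>jet_of u 1 2 e t\<bar> \<le> D"
        using t 2 F sub eg hH by (intro D) (auto simp: abs_le_iff)
    qed (use t 2 in auto)
    have "\<bar>integral {a'..b'} (\<lambda>y. jet_of u 1 1 e y * dual (a', b') g y) - jet_of u 1 1 e g\<bar> \<le> 400 * (D * (b' - a'))"
      by (rule integral_dual_approx [OF F(1) g' C3_jet_cont_y [OF U _ eg(1) sub] osc]) auto
    then show ?thesis unfolding 2 F(2) by (simp add: jet_of_def mult_ac)
  qed
qed

end

section \<open>Layer bounds and the errors in the subregions\<close>

context shishkin
begin

text \<open>\<open>EH\<close> collects the layers at the two horizontal edges, \<open>EV\<close> those at the two vertical edges, and
  \<open>Q\<close> the corner layers.\<close>

definition layers :: "real \<Rightarrow> jet \<Rightarrow> jet \<Rightarrow> jet \<Rightarrow> jet \<Rightarrow> bool" where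
  "layers M S EH EV Q \<longleftrightarrow> C3_jet S \<and> C3_jet EH \<and> C3_jet EV \<and> C3_jet Q \<and> 0 \<le> M \<and>
     (\<forall>i j. \<forall>x\<in>{0..1}. \<forall>y\<in>{0..1}. i + j \<le> 3 \<longrightarrow>
        \<bar>S i j x y\<bar> \<le> M * (if i + j = 3 then 1 / s else 1) \<and>
        \<bar>EH i j x y\<bar> \<le> M * (if i = 3 then 1 / s else 1) / s ^ j * ex y \<and>
        \<bar>EV i j x y\<bar> \<le> M * (if j = 3 then 1 / s else 1) / s ^ i * ex x \<and>
        \<bar>Q i j x y\<bar> \<le> M / s ^ (i + j) * (ex x * ex y))"

lemma layers_swap: "layers M S EH EV Q \<Longrightarrow> layers M (jswap S) (jswap EV) (jswap EH) (jswap Q)"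
proof -
  assume A: "layers M S EH EV Q"
  have B: "\<bar>S j i y x\<bar> \<le> M * (if i + j = 3 then 1 / s else 1) \<and>
        \<bar>EV j i y x\<bar> \<le> M * (if i = 3 then 1 / s else 1) / s ^ j * ex y \<and>
        \<bar>EH j i y x\<bar> \<le> M * (if j = 3 then 1 / s else 1) / s ^ i * ex x \<and>
        \<bar>Q j i y x\<bar> \<le> M / s ^ (i + j) * (ex x * ex y)"
    if "x \<in> {0..1}" "y \<in> {0..1}" "i + j \<le> 3" for i j x y
  proof -
    have "j + i \<le> 3" using that by simp
    then have "\<bar>S j i y x\<bar> \<le> M * (if j + i = 3 then 1 / s else 1) \<and>
        \<bar>EH j i y x\<bar> \<le> M * (if j = 3 then 1 / s else 1) / s ^ i * ex x \<and>
        \<bar>EV j i y x\<bar> \<le> M * (if i = 3 then 1 / s else 1) / s ^ j * ex y \<and>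
        \<bar>Q j i y x\<bar> \<le> M / s ^ (j + i) * (ex y * ex x)"
      using A that unfolding layers_def by blast
    then show ?thesis unfolding add.commute [of j i] mult.commute [of "ex y"] by blast
  qed
  have "C3_jet S" "C3_jet EH" "C3_jet EV" "C3_jet Q" "0 \<le> M" using A unfolding layers_def by auto
  then show ?thesis unfolding layers_def
    apply (intro conjI allI ballI impI C3_jswap)
    apply (simp_all only: jswap_def)
    using B by blast+
qed

lemma layersD:
  assumes "layers M S EH EV Q"
  shows "C3_jet S" "C3_jet EH" "0 \<le> M"
    and "i + j \<le> 2 \<Longrightarrow> x \<in> {0..1} \<Longrightarrow> y \<in> {0..1} \<Longrightarrow> \<bar>S i j x y\<bar> \<le> M"
    and "i + j = 3 \<Longrightarrow> x \<in> {0..1} \<Longrightarrow> y \<in> {0..1} \<Longrightarrow> \<bar>S i j x y\<bar> \<le> M / s"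
    and "i + j \<le> 3 \<Longrightarrow> i \<le> 2 \<Longrightarrow> x \<in> {0..1} \<Longrightarrow> y \<in> {0..1} \<Longrightarrow> \<bar>EH i j x y\<bar> \<le> M / s ^ j * ex y"
    and "i + j \<le> 3 \<Longrightarrow> x \<in> {0..1} \<Longrightarrow> y \<in> {0..1} \<Longrightarrow> \<bar>EH i j x y\<bar> \<le> M / s ^ (i + j) * ex y"
    and "i + j \<le> 3 \<Longrightarrow> j \<le> 2 \<Longrightarrow> x \<in> {0..1} \<Longrightarrow> y \<in> {0..1} \<Longrightarrow> \<bar>EV i j x y\<bar> \<le> M / s ^ i * ex x"
    and "i + j \<le> 3 \<Longrightarrow> x \<in> {0..1} \<Longrightarrow> y \<in> {0..1} \<Longrightarrow> \<bar>EV i j x y\<bar> \<le> M / s ^ (i + j) * ex x"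
    and "i + j \<le> 3 \<Longrightarrow> x \<in> {0..1} \<Longrightarrow> y \<in> {0..1} \<Longrightarrow> \<bar>Q i j x y\<bar> \<le> M / s ^ (i + j) * (ex x * ex y)"
proof -
  show C: "C3_jet S" "C3_jet EH" "0 \<le> M" using assms unfolding layers_def by auto
  have B: "\<bar>S i j x y\<bar> \<le> M * (if i + j = 3 then 1 / s else 1)"
     "\<bar>EH i j x y\<bar> \<le> M * (if i = 3 then 1 / s else 1) / s ^ j * ex y"
     "\<bar>EV i j x y\<bar> \<le> M * (if j = 3 then 1 / s else 1) / s ^ i * ex x"
     "\<bar>Q i j x y\<bar> \<le> M / s ^ (i + j) * (ex x * ex y)"
    if "i + j \<le> 3" "x \<in> {0..1}" "y \<in> {0..1}" for i j x y
    using assms that unfolding layers_def by blast+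
  show "i + j \<le> 2 \<Longrightarrow> x \<in> {0..1} \<Longrightarrow> y \<in> {0..1} \<Longrightarrow> \<bar>S i j x y\<bar> \<le> M" using B(1) [of i j x y] by simp
  show "i + j = 3 \<Longrightarrow> x \<in> {0..1} \<Longrightarrow> y \<in> {0..1} \<Longrightarrow> \<bar>S i j x y\<bar> \<le> M / s" using B(1) [of i j x y] by simp
  show "i + j \<le> 3 \<Longrightarrow> i \<le> 2 \<Longrightarrow> x \<in> {0..1} \<Longrightarrow> y \<in> {0..1} \<Longrightarrow> \<bar>EH i j x y\<bar> \<le> M / s ^ j * ex y"
    using B(2) [of i j x y] by simp
  show "i + j \<le> 3 \<Longrightarrow> j \<le> 2 \<Longrightarrow> x \<in> {0..1} \<Longrightarrow> y \<in> {0..1} \<Longrightarrow> \<bar>EV i j x y\<bar> \<le> M / s ^ i * ex x"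
    using B(3) [of i j x y] by simp
  show "i + j \<le> 3 \<Longrightarrow> x \<in> {0..1} \<Longrightarrow> y \<in> {0..1} \<Longrightarrow> \<bar>Q i j x y\<bar> \<le> M / s ^ (i + j) * (ex x * ex y)"
    using B(4) .
  \<comment> \<open>A tangential derivative of a layer never costs more than 1/s each, so the
    isotropic bound with s^(i+j) is a weakening.\<close>
  have scale: "M * (if i = 3 then 1 / s else 1) / s ^ j * ex t \<le> M / s ^ (i + j) * ex t" if "i \<le> 3" for i j t
  proof (rule mult_right_mono)
    have "(if i = 3 then 1 / s else 1) \<le> 1 / s ^ i"
      using s that power_le_one [of s i] power_decreasing [of 1 3 s] by (auto simp: field_simps)
    then have "M * (if i = 3 then 1 / s else 1) / s ^ j \<le> M * (1 / s ^ i) / s ^ j"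
      using C s by (intro divide_right_mono mult_left_mono) auto
    then show "M * (if i = 3 then 1 / s else 1) / s ^ j \<le> M / s ^ (i + j)" by (simp add: power_add)
  qed (use ex_bounds(1) [of t] in simp)
  show "i + j \<le> 3 \<Longrightarrow> x \<in> {0..1} \<Longrightarrow> y \<in> {0..1} \<Longrightarrow> \<bar>EH i j x y\<bar> \<le> M / s ^ (i + j) * ex y"
    using order_trans [OF B(2) scale] by simp
  show "i + j \<le> 3 \<Longrightarrow> x \<in> {0..1} \<Longrightarrow> y \<in> {0..1} \<Longrightarrow> \<bar>EV i j x y\<bar> \<le> M / s ^ (i + j) * ex x"
    using order_trans [OF B(3) scale [of j i]] by (simp add: add.commute)
qed

text \<open>Away from the vertical edges both the vertical layers and the corner layers contain the
  factor \<open>ex x\<close>, which is at most 2 G / n^3. In the corner layers \<open>ex y\<close>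
  adds a factor of at most 2.\<close>

lemma layer_sum_bound:
  assumes lay: "layers M S EH EV Q" and ij: "i + j \<le> 3" and xy: "x \<in> {0..1}" "y \<in> {0..1}"
  shows "x \<in> {lam..1 - lam} \<Longrightarrow> \<bar>EV i j x y + Q i j x y\<bar> \<le> 6 * G * M / (s ^ (i + j) * n ^ 3)"
    and "x \<in> {lam..1 - lam} \<Longrightarrow> y \<in> {lam..1 - lam} \<Longrightarrow> \<bar>EH i j x y + EV i j x y + Q i j x y\<bar> \<le> 8 * G * M / (s ^ (i + j) * n ^ 3)"
proof -
  note D = layersD [OF lay]
  have Ms: "0 \<le> M / s ^ (i + j)" using D(3) s by simp
  define P where "P = M / s ^ (i + j) * (2 * G / n ^ 3)"
  have V: "\<bar>EV i j x y\<bar> \<le> P" if "x \<in> {lam..1 - lam}"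
    using D(9) [OF ij xy] mult_left_mono [OF ex_trans(1) [OF that] Ms] unfolding P_def by (rule order_trans)
  have H: "\<bar>EH i j x y\<bar> \<le> P" if "y \<in> {lam..1 - lam}"
    using D(7) [OF ij xy] mult_left_mono [OF ex_trans(1) [OF that] Ms] unfolding P_def by (rule order_trans)
  have Q: "\<bar>Q i j x y\<bar> \<le> 2 * P" if "x \<in> {lam..1 - lam}"
  proof -
    have "ex x * ex y \<le> 2 * G / n ^ 3 * 2"
      using ex_trans(1) [OF that] ex_le2 [OF xy(2)] ex_bounds(1) [of x] ex_bounds(1) [of y] by (intro mult_mono) auto
    from order_trans [OF D(10) [OF ij xy] mult_left_mono [OF this Ms]] show ?thesis by (simp add: P_def mult_ac)
  qed
  have e: "6 * G * M / (s ^ (i + j) * n ^ 3) = 3 * P" "8 * G * M / (s ^ (i + j) * n ^ 3) = 4 * P"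
    unfolding P_def by simp_all
  show "\<bar>EV i j x y + Q i j x y\<bar> \<le> 6 * G * M / (s ^ (i + j) * n ^ 3)" if "x \<in> {lam..1 - lam}"
    unfolding e using V [OF that] Q [OF that] by linarith
  show "\<bar>EH i j x y + EV i j x y + Q i j x y\<bar> \<le> 8 * G * M / (s ^ (i + j) * n ^ 3)"
    if "x \<in> {lam..1 - lam}" "y \<in> {lam..1 - lam}"
    unfolding e using V [OF that(1)] H [OF that(2)] Q [OF that(1)] by linarith
qed

lemma H_inverse: "1 / H \<le> n" "H \<le> 2 / n"
  using hH(2,4,5) n8 by (auto simp: pos_divide_le_eq pos_le_divide_eq mult.commute)

text \<open>The smooth part gives 1/n, which s n <= G converts into 1 / (s n^2). The layers need no
  expansion: on the coarse cell they are of order N^-3, so their derivative and, by stability, that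
  of their interpolant are small separately.\<close>

lemma slope_error:
  assumes lay: "layers M S EH EV Q"
    and U: "\<And>i j p q. i + j \<le> 3 \<Longrightarrow> p \<in> {0..1} \<Longrightarrow> q \<in> {0..1} \<Longrightarrow> U i j p q = S i j p q + (EH i j p q + EV i j p q + Q i j p q)"
    and cd: "(c, d) \<in> coarse_itvs" and \<xi>: "\<xi> \<in> {lam..1 - lam}" and \<eta>: "\<eta> \<in> {c..d}"
  shows "\<bar>lag 1 c d (\<lambda>\<eta>. U 0 0 \<xi> \<eta>) \<eta> - U 0 1 \<xi> \<eta>\<bar> \<le> 400 * G ^ 3 * M / (s * n\<^sup>2)"
proof -
  note D = layersD [OF lay] and A = coarseD [OF cd]
  have n0: "n > 0" using n8 by simp
  have sub: "{c..d} \<subseteq> {0..1}" "{c..d} \<subseteq> {lam..1 - lam}" using A by auto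
  have x1: "\<xi> \<in> {0..1}" using \<xi> lam by auto
  define V where "V i j p q = EH i j p q + EV i j p q + Q i j p q" for i j p q
  have Vb: "\<bar>V i j \<xi> q\<bar> \<le> 8 * G * M / (s ^ (i + j) * n ^ 3)" if "i + j \<le> 3" "q \<in> {c..d}" for i j q
    unfolding V_def by (rule layer_sum_bound(2) [OF lay that(1) x1 _ \<xi>]) (use that sub in auto)
  have 1: "\<bar>S 0 1 \<xi> \<eta> - lag 1 c d (\<lambda>\<eta>. S 0 0 \<xi> \<eta>) \<eta>\<bar> \<le> 32 * M / n"
  proof -
    have "\<bar>S 0 1 \<xi> \<eta> - lag 1 c d (\<lambda>\<eta>. S 0 0 \<xi> \<eta>) \<eta>\<bar> \<le> 16 * M * H"
      using lag_err_y [OF D(1), of 1 0 1 c d \<eta> \<xi> M] A sub \<eta> x1 D(4) [of 0 2 \<xi>] hH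
      by (auto simp: numeral_2_eq_2)
    also have "\<dots> \<le> 16 * M * (2 / n)" using H_inverse D(3) by (intro mult_left_mono) auto
    finally show ?thesis by simp
  qed
  have 2: "\<bar>lag 1 c d (\<lambda>\<eta>. V 0 0 \<xi> \<eta>) \<eta>\<bar> \<le> 128 * G * M / n\<^sup>2"
  proof -
    have "\<bar>lag 1 c d (\<lambda>\<eta>. V 0 0 \<xi> \<eta>) \<eta>\<bar> \<le> 16 * (8 * G * M / n ^ 3) / (d - c) ^ 1"
      by (rule lag_stable_nodes [OF A(1) \<eta>]) (use Vb [of 0 0] nodes_sub [OF A(1)] in auto)
    also have "\<dots> = 128 * G * M / n ^ 3 * (1 / H)" unfolding A(2) by simp
    also have "\<dots> \<le> 128 * G * M / n ^ 3 * n" using H_inverse G D(3) by (intro mult_left_mono) auto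
    finally show ?thesis using n0 by (simp add: power2_eq_square power3_eq_cube)
  qed
  have 3: "\<bar>V 0 1 \<xi> \<eta>\<bar> \<le> 8 * G * M / (s * n ^ 3)" using Vb [of 0 1] \<eta> by simp
  have "lag 1 c d (\<lambda>\<eta>. U 0 0 \<xi> \<eta>) \<eta> = lag 1 c d (\<lambda>\<eta>. S 0 0 \<xi> \<eta> + V 0 0 \<xi> \<eta>) \<eta>"
    by (rule lag_cong) (use U [of 0 0 \<xi>] x1 sub A(1) in \<open>auto simp: V_def\<close>)
  moreover have "U 0 1 \<xi> \<eta> = S 0 1 \<xi> \<eta> + V 0 1 \<xi> \<eta>" using U [of 0 1 \<xi> \<eta>] x1 \<eta> sub by (auto simp: V_def)
  ultimately have "\<bar>lag 1 c d (\<lambda>\<eta>. U 0 0 \<xi> \<eta>) \<eta> - U 0 1 \<xi> \<eta>\<bar> \<le> 32 * M / n + 128 * G * M / n\<^sup>2 + 8 * G * M / (s * n ^ 3)"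
    using 1 2 3 unfolding lag_add by linarith
  also have "\<dots> \<le> 32 * (G * M / (s * n\<^sup>2)) + 128 * (G * M / (s * n\<^sup>2)) + 8 * (G * M / (s * n\<^sup>2))"
  proof -
    have GM: "0 \<le> G * M" using G D(3) by simp
    have "1 / n \<le> G / (s * n\<^sup>2)" using sN s n0 by (simp add: field_simps power2_eq_square)
    then have "M * (1 / n) \<le> M * (G / (s * n\<^sup>2))" using D(3) by (rule mult_left_mono)
    moreover have "1 / n\<^sup>2 \<le> 1 / (s * n\<^sup>2)" using s n0 by (simp add: field_simps)
    then have "G * M * (1 / n\<^sup>2) \<le> G * M * (1 / (s * n\<^sup>2))" using GM by (rule mult_left_mono)
    moreover have "1 / (s * n ^ 3) \<le> 1 / (s * n\<^sup>2)"
      using s n8 power_increasing [of 2 3 n] by (intro divide_left_mono mult_left_mono) auto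
    then have "G * M * (1 / (s * n ^ 3)) \<le> G * M * (1 / (s * n\<^sup>2))" using GM by (rule mult_left_mono)
    moreover have "32 * M / n = 32 * (M * (1 / n))" "128 * G * M / n\<^sup>2 = 128 * (G * M * (1 / n\<^sup>2))"
      "8 * G * M / (s * n ^ 3) = 8 * (G * M * (1 / (s * n ^ 3)))"
      "M * (G / (s * n\<^sup>2)) = G * M / (s * n\<^sup>2)" "G * M * (1 / (s * n\<^sup>2)) = G * M / (s * n\<^sup>2)" by simp_all
    ultimately show ?thesis by linarith
  qed
  also have "\<dots> = 168 * (G * M / (s * n\<^sup>2))" by simp
  also have "\<dots> \<le> 400 * (G ^ 3 * M / (s * n\<^sup>2))"
  proof -
    have "G \<le> G ^ 3" using G by (simp add: self_le_power)
    then have "G * M / (s * n\<^sup>2) \<le> G ^ 3 * M / (s * n\<^sup>2)" using D(3) s by (intro divide_right_mono mult_right_mono) auto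
    moreover have "0 \<le> G * M / (s * n\<^sup>2)" using G D(3) s by simp
    ultimately show ?thesis by (intro mult_mono) auto
  qed
  finally show ?thesis by (simp add: mult.assoc)
qed

text \<open>Across a horizontal strip only the layers at the horizontal edges vary fast without
  being small, so they are interpolated together with S. The vertical and corner layers are of order
  N^-3 here and play the part of \<open>Z\<close>.\<close>

lemma strip_region:
  assumes lay: "layers M S EH EV Q"
    and U: "\<And>i j p q. i + j \<le> 3 \<Longrightarrow> p \<in> {0..1} \<Longrightarrow> q \<in> {0..1} \<Longrightarrow> U i j p q = S i j p q + (EH i j p q + EV i j p q + Q i j p q)"
    and ab: "(a, b) \<in> coarse_itvs" and cd: "(c, d) \<in> fine_itvs"
    and x: "x \<in> {a..b}" and y: "y \<in> {c..d}"
    and g: "\<And>\<xi> \<eta>. \<xi> \<in> nodes3 (a, b) \<Longrightarrow> g \<xi> \<eta> =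
      (if \<eta> = lam then lag 1 lam (mp (N div 4 + 1)) (\<lambda>\<eta>. U 0 0 \<xi> \<eta>) \<eta>
       else if \<eta> = 1 - lam then lag 1 (mp (3 * N div 4 - 1)) (1 - lam) (\<lambda>\<eta>. U 0 0 \<xi> \<eta>) \<eta>
       else U 0 1 \<xi> \<eta>)"
    and ij: "i + j \<le> 2"
  shows "\<bar>U i j x y - lag i a b (\<lambda>\<xi>. her j c d (\<lambda>\<eta>. U 0 0 \<xi> \<eta>) (\<lambda>\<eta>. g \<xi> \<eta>) y) x
      - (if i + j = 0 then S 0 0 x y + EH 0 0 x y - lag 0 a b (\<lambda>\<xi>. S 0 0 \<xi> y + EH 0 0 \<xi> y) x else 0)\<bar>
    \<le> 10 ^ 7 * G ^ 9 * M * tgt (i + j) (ex x + ex y)"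
    and "\<bar>S 0 0 x y + EH 0 0 x y - lag 0 a b (\<lambda>\<xi>. S 0 0 \<xi> y + EH 0 0 \<xi> y) x\<bar> \<le> 10 ^ 7 * G ^ 9 * M / n\<^sup>2"
proof -
  note D = layersD [OF lay] and A = coarseD [OF ab] and F = fineD [OF cd]
  have n0: "n > 0" using n8 by simp
  have sub: "{a..b} \<subseteq> {0..1}" "{c..d} \<subseteq> {0..1}" "{a..b} \<subseteq> {lam..1 - lam}" using A F by auto
  have x1: "x \<in> {0..1}" "y \<in> {0..1}" using x y sub by auto
  define e where "e = ex x + ex y"
  have e: "0 \<le> e" "e \<le> 4" "ex y \<le> e" unfolding e_def
    using ex_bounds(1) [of x] ex_bounds(1) [of y] ex_le2 x1 by (auto intro: add_nonneg_nonneg less_imp_le)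
       (use ex_le2 [OF x1(1)] ex_le2 [OF x1(2)] in linarith)
  \<comment> \<open>\<open>K\<close> covers the slope error at the interface and dominates all other
    bounds. With the constant of \<open>strip_bound\<close> it gives 20000 * 400 = 8 * 10^6 and the
    power G^9.\<close>
  define K where "K = 400 * G ^ 3 * M"
  have G3: "1 \<le> G ^ 3" "G \<le> G ^ 3" using G by (auto simp: self_le_power)
  have GM: "M \<le> G ^ 3 * M" "G * M \<le> G ^ 3 * M" using G3 D(3) mult_right_mono [OF G3(1) D(3)] mult_right_mono [OF G3(2) D(3)] by auto
  have "0 \<le> G ^ 3 * M" using GM D(3) by linarith
  then have K: "400 * M \<le> K" "400 * (G * M) \<le> K" "0 \<le> K" unfolding K_def using GM by (auto simp: mult.assoc)
  have y2: "ex y \<le> 2" by (rule ex_le2 [OF x1(2)])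
  have Mex: "M * ex y \<le> 2 * M" using mult_left_mono [OF y2 D(3)] by simp
  define R where "R = jadd S EH"
  have R: "C3_jet R" unfolding R_def by (rule C3_jadd [OF D(1,2)])
  have RE: "R i j p q = S i j p q + EH i j p q" for i j p q by (simp add: R_def jadd_def)
  define Z where "Z i j p q = EV i j p q + Q i j p q" for i j p q
  have M0: "\<bar>R 2 0 p y\<bar> \<le> K" if "p \<in> {a..b}" for p
    using D(4) [of 2 0 p y] D(6) [of 2 0 p y] that sub x1 Mex K D(3) unfolding RE by auto
  have M1: "\<bar>R 2 1 p y\<bar> \<le> K / s" if "p \<in> {a..b}" for p
  proof -
    have "\<bar>S 2 1 p y\<bar> \<le> M / s" using D(5) [of 2 1 p y] that sub x1 by auto
    moreover have "\<bar>EH 2 1 p y\<bar> \<le> M / s * ex y" using D(6) [of 2 1 p y] that sub x1 by auto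
    moreover have "M / s * ex y \<le> 2 * M / s" using divide_right_mono [OF Mex, of s] s by simp
    moreover have "M / s + 2 * M / s \<le> K / s"
      unfolding add_divide_distrib [symmetric] using K D(3) s by (intro divide_right_mono) auto
    ultimately show ?thesis unfolding RE by linarith
  qed
  have M2: "\<bar>R 1 2 p y\<bar> \<le> K / s\<^sup>2" if "p \<in> {a..b}" for p
  proof -
    have "\<bar>S 1 2 p y\<bar> \<le> M / s" using D(5) [of 1 2 p y] that sub x1 by auto
    moreover have "M / s \<le> M / s\<^sup>2" using s D(3) by (intro divide_left_mono) (auto simp: power2_eq_square)
    moreover have "\<bar>EH 1 2 p y\<bar> \<le> M / s\<^sup>2 * ex y" using D(6) [of 1 2 p y] that sub x1 by auto
    moreover have "M / s\<^sup>2 * ex y \<le> 2 * M / s\<^sup>2" using divide_right_mono [OF Mex, of "s\<^sup>2"] s by simp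
    moreover have "M / s\<^sup>2 + 2 * M / s\<^sup>2 \<le> K / s\<^sup>2"
      unfolding add_divide_distrib [symmetric] using K D(3) s by (intro divide_right_mono) auto
    ultimately show ?thesis unfolding RE by linarith
  qed
  have M3: "\<bar>R 0 3 p q\<bar> \<le> K * (1 / s ^ 3 * (s\<^sup>2 + G * e))" if "p \<in> {a..b}" "q \<in> {c..d}" for p q
  proof -
    have pq: "p \<in> {0..1}" "q \<in> {0..1}" using that sub by auto
    have "\<bar>y - q\<bar> \<le> 4 * h" using that y F(2) hH by (auto simp: abs_le_iff)
    then have "ex q \<le> G * ex y" by (rule ex_osc)
    also have "\<dots> \<le> G * e" using e G by (intro mult_left_mono) auto
    finally have q: "ex q \<le> G * e" .
    have "\<bar>S 0 3 p q\<bar> \<le> M * (1 / s ^ 3 * s\<^sup>2)" using D(5) [of 0 3 p q] pq s by (simp add: power2_eq_square power3_eq_cube)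
    moreover have "\<bar>EH 0 3 p q\<bar> \<le> M * (1 / s ^ 3 * ex q)" using D(6) [of 0 3 p q] pq by simp
    moreover have "M * (1 / s ^ 3 * ex q) \<le> M * (1 / s ^ 3 * (G * e))" using q D(3) s by (intro mult_left_mono) auto
    ultimately have "\<bar>R 0 3 p q\<bar> \<le> M * (1 / s ^ 3 * s\<^sup>2) + M * (1 / s ^ 3 * (G * e))" unfolding RE by linarith
    also have "\<dots> = M * (1 / s ^ 3 * (s\<^sup>2 + G * e))" by (simp add: algebra_simps)
    also have "\<dots> \<le> K * (1 / s ^ 3 * (s\<^sup>2 + G * e))" using K D(3) e s G by (intro mult_right_mono) auto
    finally show ?thesis .
  qed
  have Zb: "\<bar>Z i j p q\<bar> \<le> K / (s ^ (i + j) * n ^ 3)" if "i + j \<le> 2" "p \<in> {a..b}" "q \<in> {c..d}" for i j p q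
  proof -
    have "\<bar>Z i j p q\<bar> \<le> 6 * G * M / (s ^ (i + j) * n ^ 3)"
      unfolding Z_def by (rule layer_sum_bound(1) [OF lay]) (use that sub in auto)
    also have "\<dots> \<le> K / (s ^ (i + j) * n ^ 3)" using K s by (intro divide_right_mono) (auto simp: mult.assoc)
    finally show ?thesis .
  qed
  have UZ: "U i j p q = R i j p q + Z i j p q" if "i + j \<le> 2" "p \<in> {a..b}" "q \<in> {c..d}" for i j p q
    using U [of i j p q] that sub by (auto simp: RE Z_def)
  have gb: "\<bar>g \<xi> \<eta> - U 0 1 \<xi> \<eta>\<bar> \<le> K / (s * n\<^sup>2)" if \<xi>: "\<xi> \<in> nodes3 (a, b)" for \<xi> \<eta>
  proof -
    have m: "\<xi> \<in> {lam..1 - lam}" using nodes_sub [OF A(1) \<xi>] sub by auto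
    have "0 \<le> K / (s * n\<^sup>2)" using K s by simp
    then show ?thesis unfolding g [OF \<xi>] K_def
      using slope_error [OF lay U interface_cells(1) m, of lam] slope_error [OF lay U interface_cells(2) m, of "1 - lam"]
        coarseD(1) [OF interface_cells(1)] coarseD(1) [OF interface_cells(2)]
      by auto
  qed
  note SB = strip_bound [OF R ab cd x y K(3) e(1,2) M0 M1 M2 M3 Zb UZ gb ij]
  have G69: "20000 * G ^ 6 * K = 8 * 10 ^ 6 * (G ^ 9 * M)" unfolding K_def by (simp add: eval_nat_numeral)
  have "0 \<le> M * G ^ 9" using G D(3) by simp
  then have G9: "0 \<le> M * G ^ 9" "0 \<le> G ^ 9 * M" "M * G ^ 3 \<le> M * G ^ 9"
    using mult_right_mono [OF power_increasing [OF _ G, of 3 9] D(3)] by (auto simp: mult.commute)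
  have "20000 * G ^ 6 * K * tgt (i + j) e \<le> 10 ^ 7 * G ^ 9 * M * tgt (i + j) e"
    unfolding G69 using G9 tgt_nonneg [OF e(1)] by (intro mult_right_mono) auto
  then show "\<bar>U i j x y - lag i a b (\<lambda>\<xi>. her j c d (\<lambda>\<eta>. U 0 0 \<xi> \<eta>) (\<lambda>\<eta>. g \<xi> \<eta>) y) x
      - (if i + j = 0 then S 0 0 x y + EH 0 0 x y - lag 0 a b (\<lambda>\<xi>. S 0 0 \<xi> y + EH 0 0 \<xi> y) x else 0)\<bar>
    \<le> 10 ^ 7 * G ^ 9 * M * tgt (i + j) (ex x + ex y)"
    using SB(1) unfolding RE e_def [symmetric] by linarith
  have "64 * K / n\<^sup>2 \<le> 10 ^ 7 * G ^ 9 * M / n\<^sup>2"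
    using G9 unfolding K_def by (intro divide_right_mono) auto
  then show "\<bar>S 0 0 x y + EH 0 0 x y - lag 0 a b (\<lambda>\<xi>. S 0 0 \<xi> y + EH 0 0 \<xi> y) x\<bar> \<le> 10 ^ 7 * G ^ 9 * M / n\<^sup>2"
    using SB(2) unfolding RE by linarith
qed

text \<open>Writing the bound 1/s of the smooth part as s^2 / s^3 gives all parts of u the common
  factor 1 / s^3.\<close>

lemma third_derivative_bound:
  assumes lay: "layers M S EH EV Q"
    and U: "\<And>i j p q. i + j \<le> 3 \<Longrightarrow> p \<in> {0..1} \<Longrightarrow> q \<in> {0..1} \<Longrightarrow> U i j p q = S i j p q + (EH i j p q + EV i j p q + Q i j p q)"
    and pq: "p \<in> {0..1}" "q \<in> {0..1}" "\<bar>x - p\<bar> \<le> 4 * h" "\<bar>y - q\<bar> \<le> 4 * h" and ij: "i + j = 3"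
  shows "\<bar>U i j p q\<bar> \<le> 3 * M * (1 / s ^ 3 * (s\<^sup>2 + G * (ex x + ex y)))"
proof -
  note D = layersD [OF lay]
  have Ms: "0 \<le> M / s ^ 3" using D(3) s by simp
  have i3: "i + j \<le> 3" using ij by simp
  have S: "\<bar>S i j p q\<bar> \<le> M / s ^ 3 * s\<^sup>2" using D(5) [OF ij pq(1,2)] s by (simp add: power2_eq_square power3_eq_cube)
  have EH: "\<bar>EH i j p q\<bar> \<le> M / s ^ 3 * ex q" and EV: "\<bar>EV i j p q\<bar> \<le> M / s ^ 3 * ex p"
    and Q: "\<bar>Q i j p q\<bar> \<le> M / s ^ 3 * (ex p * ex q)"
    using D(7) [OF i3 pq(1,2)] D(9) [OF i3 pq(1,2)] D(10) [OF i3 pq(1,2)] unfolding ij by auto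
  have "ex p * ex q \<le> ex p * 2" using ex_le2 [OF pq(2)] ex_bounds(1) [of p] by (intro mult_left_mono) auto
  then have "s\<^sup>2 + ex q + ex p + ex p * ex q \<le> 3 * s\<^sup>2 + 3 * ex p + 3 * ex q"
    using ex_bounds(1) [of q] by (smt (verit) zero_le_power2)
  also have "\<dots> \<le> 3 * s\<^sup>2 + 3 * (G * ex x) + 3 * (G * ex y)" using ex_osc [OF pq(3)] ex_osc [OF pq(4)] by linarith
  also have "\<dots> = 3 * (s\<^sup>2 + G * (ex x + ex y))" by (simp add: algebra_simps)
  finally have "M / s ^ 3 * (s\<^sup>2 + ex q + ex p + ex p * ex q) \<le> M / s ^ 3 * (3 * (s\<^sup>2 + G * (ex x + ex y)))"
    using Ms by (rule mult_left_mono)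
  moreover have "\<bar>U i j p q\<bar> \<le> M / s ^ 3 * s\<^sup>2 + M / s ^ 3 * ex q + M / s ^ 3 * ex p + M / s ^ 3 * (ex p * ex q)"
    using S EH EV Q U [OF i3 pq(1,2)] by linarith
  ultimately show ?thesis by (simp add: algebra_simps)
qed

text \<open>Both directions are refined, so u need not be split and its own third derivatives
  suffice. The constants give 30000 * 3 * 40 = 3600000, below 10^7.\<close>

lemma corner_region:
  assumes lay: "layers M S EH EV Q" and u: "C_closed 3 u" and sg: "edge_assignment lam N \<sigma>"
    and U: "\<And>i j p q. i + j \<le> 3 \<Longrightarrow> p \<in> {0..1} \<Longrightarrow> q \<in> {0..1} \<Longrightarrow> jet_of u i j p q = S i j p q + (EH i j p q + EV i j p q + Q i j p q)"
    and ab: "(a, b) \<in> fine_itvs" and cd: "(c, d) \<in> fine_itvs"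
    and x: "x \<in> {a<..<b}" "x \<notin> mp ` {0..N}" and y: "y \<in> {c<..<d}" "y \<notin> mp ` {0..N}" and ij: "i + j \<le> 2"
  shows "\<bar>pd i j (\<lambda>z. u z - quasi_interp lam N \<sigma> u z) (x, y)\<bar> \<le> 10 ^ 7 * G ^ 9 * M * tgt (i + j) (ex x + ex y)"
proof -
  note D = layersD [OF lay] and A = fineD [OF ab] and F = fineD [OF cd]
  have sub: "{a..b} \<subseteq> {0..1}" "{c..d} \<subseteq> {0..1}" using A F by auto
  have xy: "x \<in> {a..b}" "y \<in> {c..d}" using x y by auto
  have x1: "x \<in> {0..1}" "y \<in> {0..1}" using xy sub by auto
  define e where "e = ex x + ex y"
  have e: "0 \<le> e" "e \<le> 4" unfolding e_def
    using ex_bounds(1) [of x] ex_bounds(1) [of y] ex_le2 [OF x1(1)] ex_le2 [OF x1(2)] by linarith+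
  define B where "B = 3 * M * (1 / s ^ 3 * (s\<^sup>2 + G * e))"
  have Bb: "\<bar>jet_of u i j p q\<bar> \<le> B" if "i + j = 3" "p \<in> {0..1}" "q \<in> {0..1}" "\<bar>x - p\<bar> \<le> 4 * h" "\<bar>y - q\<bar> \<le> 4 * h" for i j p q
    unfolding B_def e_def by (rule third_derivative_bound [OF lay U that(2-5) that(1)])
  have tw: "\<bar>twist_coeff u (\<sigma> (e, g)) (e, g) - jet_of u 1 1 e g\<bar> \<le> 400 * ((2 * h) * B)" if "e \<in> {a, b}" "g \<in> {c, d}" for e g
  proof (rule twist_error [OF u sg ab cd that])
    fix i j :: nat and p q assume *: "i + j = 3" "p \<in> {0..1}" "q \<in> {0..1}" "\<bar>p - e\<bar> \<le> 2 * h" "\<bar>q - g\<bar> \<le> 2 * h"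
    have "\<bar>x - e\<bar> \<le> 2 * h" "\<bar>y - g\<bar> \<le> 2 * h" using that xy A(2) F(2) by (auto simp: abs_le_iff)
    then show "\<bar>jet_of u i j p q\<bar> \<le> B" using * by (intro Bb) auto
  qed
  have "\<bar>pd i j (\<lambda>z. u z - quasi_interp lam N \<sigma> u z) (x, y)\<bar> \<le> 30000 * B * (2 * h) ^ 3 / (2 * h) ^ (i + j)"
    unfolding pd_corner [OF u ab cd x y ij]
  proof (rule corner_local [OF C3_jet_of [OF u] A(1) sub(1) F(1) sub(2) xy A(2) F(2) _ tw ij])
    fix i j :: nat and p q assume "i + j = 3" "p \<in> {a..b}" "q \<in> {c..d}"
    then show "\<bar>jet_of u i j p q\<bar> \<le> B" using xy sub A(2) F(2) hH by (intro Bb) (auto simp: abs_le_iff)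
  qed auto
  also have "\<dots> = 90000 * M * (n ^ 0 * (1 / s ^ 3 * (s\<^sup>2 + G * e) * (2 * h) ^ 3) / (2 * h) ^ (i + j))"
    unfolding B_def by simp
  also have "\<dots> \<le> 90000 * M * (40 * G ^ 6 * tgt (i + j) e)"
    using layer_scale [of 0 "i + j" e] ij e D(3) by (intro mult_left_mono) auto
  also have "\<dots> = 3600000 * (G ^ 6 * M * tgt (i + j) e)" by simp
  also have "\<dots> \<le> 10 ^ 7 * (G ^ 9 * M * tgt (i + j) e)"
    using G D(3) tgt_nonneg [OF e(1)] by (intro mult_mono mult_right_mono power_increasing mult_nonneg_nonneg) auto
  finally show ?thesis unfolding e_def by (simp add: mult.assoc)
qed

text \<open>On coarse cells the layers are not interpolated but bounded, and so is their
  interpolant. First derivatives of the layers are estimated by n^-2 and the retained third of the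
  decay, because the factor 1/s can only be compensated by integration.\<close>

lemma core_region:
  assumes lay: "layers M S EH EV Q"
    and U: "\<And>i j p q. i + j \<le> 3 \<Longrightarrow> p \<in> {0..1} \<Longrightarrow> q \<in> {0..1} \<Longrightarrow> U i j p q = S i j p q + (EH i j p q + EV i j p q + Q i j p q)"
    and ab: "(a, b) \<in> coarse_itvs" and cd: "(c, d) \<in> coarse_itvs"
    and x: "x \<in> {a..b}" and y: "y \<in> {c..d}" and ij: "i + j \<le> 1"
  shows "\<bar>U i j x y - lag i a b (\<lambda>\<xi>. lag j c d (\<lambda>\<eta>. U 0 0 \<xi> \<eta>) y) x
     - (S i j x y - lag i a b (\<lambda>\<xi>. lag j c d (\<lambda>\<eta>. S 0 0 \<xi> \<eta>) y) x)\<bar>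
     \<le> 10 ^ 7 * G ^ 9 * M * (if i + j = 0 then 1 / n ^ 3 else 1 / n\<^sup>2 + (rho x + rho y) / (s * n\<^sup>2))" (is "?A \<le> _")
    and "\<bar>S i j x y - lag i a b (\<lambda>\<xi>. lag j c d (\<lambda>\<eta>. S 0 0 \<xi> \<eta>) y) x\<bar> \<le> 10 ^ 7 * G ^ 9 * M / n ^ (2 - (i + j))"
proof -
  note D = layersD [OF lay] and A = coarseD [OF ab] and F = coarseD [OF cd]
  have n0: "n > 0" using n8 by simp
  have sub: "{a..b} \<subseteq> {0..1}" "{c..d} \<subseteq> {0..1}" "{a..b} \<subseteq> {lam..1 - lam}" "{c..d} \<subseteq> {lam..1 - lam}" using A F by auto
  have x1: "x \<in> {0..1}" "y \<in> {0..1}" "x \<in> {lam..1 - lam}" "y \<in> {lam..1 - lam}" using x y sub by auto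
  have GM: "0 \<le> M" "M \<le> G * M" "G * M \<le> G ^ 9 * M" using G D(3) mult_right_mono [of 1 G M]
    by (auto intro!: mult_right_mono simp: self_le_power)
  have GM': "M \<le> M * G ^ 9" "G * M \<le> M * G ^ 9" using GM by (simp_all add: mult.commute)
  have H2: "H\<^sup>2 / H ^ (i + j) = H ^ (2 - (i + j))" using hH ij by (simp add: power_diff)
  have "\<bar>S i j x y - lag i a b (\<lambda>\<xi>. lag j c d (\<lambda>\<eta>. S 0 0 \<xi> \<eta>) y) x\<bar> \<le> 300 * M * H\<^sup>2 / H ^ (i + j)"
    by (rule core_smooth_local [OF D(1) A(1) sub(1) F(1) sub(2) x y A(2) F(2) _ ij])
      (use D(4) sub in auto)
  also have "\<dots> = 300 * M * H ^ (2 - (i + j))" unfolding H2 [symmetric] by simp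
  also have "\<dots> \<le> 300 * M * (2 / n) ^ (2 - (i + j))" using hH H_inverse D(3) by (intro mult_left_mono power_mono) auto
  also have "\<dots> = 300 * M * 2 ^ (2 - (i + j)) / n ^ (2 - (i + j))" by (simp add: power_divide)
  also have "\<dots> \<le> 300 * M * 2 ^ 2 / n ^ (2 - (i + j))" using D(3) by (intro divide_right_mono mult_left_mono power_increasing) auto
  also have "\<dots> \<le> 10 ^ 7 * G ^ 9 * M / n ^ (2 - (i + j))" using GM' GM(1) by (intro divide_right_mono) auto
  finally show "\<bar>S i j x y - lag i a b (\<lambda>\<xi>. lag j c d (\<lambda>\<eta>. S 0 0 \<xi> \<eta>) y) x\<bar> \<le> 10 ^ 7 * G ^ 9 * M / n ^ (2 - (i + j))" .
  define V where "V i j p q = EH i j p q + EV i j p q + Q i j p q" for i j p q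
  have V0: "\<bar>V 0 0 p q\<bar> \<le> 8 * G * M / n ^ 3" if "p \<in> {a..b}" "q \<in> {c..d}" for p q
    using layer_sum_bound(2) [OF lay, of 0 0 p q] that sub unfolding V_def by auto
  have "\<bar>lag i a b (\<lambda>\<xi>. lag j c d (\<lambda>\<eta>. V 0 0 \<xi> \<eta>) y) x\<bar> \<le> 16 * (16 * (8 * G * M / n ^ 3) / (d - c) ^ j) / (b - a) ^ i"
  proof (rule lag_stable_nodes [OF A(1) x])
    fix \<xi> assume "\<xi> \<in> nodes3 (a, b)"
    note m = nodes_sub [OF A(1) this]
    show "\<bar>lag j c d (\<lambda>\<eta>. V 0 0 \<xi> \<eta>) y\<bar> \<le> 16 * (8 * G * M / n ^ 3) / (d - c) ^ j"
      by (rule lag_stable_nodes [OF F(1) y]) (rule V0 [OF m nodes_sub [OF F(1)]])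
  qed
  also have "\<dots> = 2048 * (G * M / n ^ 3) * (1 / H) ^ (i + j)"
    unfolding A(2) F(2) by (simp add: power_one_over power_add)
  also have "\<dots> \<le> 2048 * (G * M / n ^ 3) * n ^ (i + j)"
    using H_inverse hH G D(3) by (intro mult_left_mono power_mono) auto
  finally have lV: "\<bar>lag i a b (\<lambda>\<xi>. lag j c d (\<lambda>\<eta>. V 0 0 \<xi> \<eta>) y) x\<bar> \<le> 2048 * (G * M / n ^ 3) * n ^ (i + j)" .
  have UV: "U i j p q = S i j p q + V i j p q" if "i + j \<le> 3" "p \<in> {a..b}" "q \<in> {c..d}" for i j p q
    using U [OF that(1)] that sub unfolding V_def by auto
  have "lag i a b (\<lambda>\<xi>. lag j c d (\<lambda>\<eta>. U 0 0 \<xi> \<eta>) y) x = lag i a b (\<lambda>\<xi>. lag j c d (\<lambda>\<eta>. S 0 0 \<xi> \<eta> + V 0 0 \<xi> \<eta>) y) x"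
    by (rule lag_cong; rule lag_cong) (use UV [of 0 0] A(1) F(1) in auto)
  then have "?A = \<bar>V i j x y - lag i a b (\<lambda>\<xi>. lag j c d (\<lambda>\<eta>. V 0 0 \<xi> \<eta>) y) x\<bar>"
    using UV [of i j x y] ij x y unfolding lag_add by simp
  then have *: "?A \<le> \<bar>V i j x y\<bar> + 2048 * (G * M / n ^ 3) * n ^ (i + j)" using lV by linarith
  show "?A \<le> 10 ^ 7 * G ^ 9 * M * (if i + j = 0 then 1 / n ^ 3 else 1 / n\<^sup>2 + (rho x + rho y) / (s * n\<^sup>2))"
  proof (cases "i + j = 0")
    case True
    then have "i = 0" "j = 0" by auto
    then have "?A \<le> 8 * (G * M / n ^ 3) + 2048 * (G * M / n ^ 3)" using * V0 [OF x y] by simp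
    also have "\<dots> = 2056 * (G * M) * (1 / n ^ 3)" by simp
    also have "\<dots> \<le> 10 ^ 7 * (G ^ 9 * M) * (1 / n ^ 3)" using GM GM' by (intro mult_right_mono) auto
    finally show ?thesis using True by (simp add: mult.assoc)
  next
    case False
    then have m: "i + j = 1" using ij by linarith
    have i3: "i + j \<le> 3" using m by simp
    have Ms: "0 \<le> M / s" using D(3) s by simp
    have "\<bar>EH i j x y\<bar> \<le> M / s * ex y" "\<bar>EV i j x y\<bar> \<le> M / s * ex x" "\<bar>Q i j x y\<bar> \<le> M / s * (ex x * ex y)"
      using D(7) [OF i3 x1(1,2)] D(9) [OF i3 x1(1,2)] D(10) [OF i3 x1(1,2)] unfolding m by auto
    moreover have "M / s * (ex x * ex y) \<le> M / s * (ex x * 2)"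
      using Ms ex_le2 [OF x1(2)] ex_bounds(1) [of x] by (intro mult_left_mono) auto
    ultimately have "\<bar>V i j x y\<bar> \<le> M / s * ex y + M / s * ex x + M / s * (ex x * 2)" unfolding V_def by linarith
    also have "\<dots> = M / s * (3 * ex x + ex y)" by (simp add: algebra_simps add_divide_distrib [symmetric])
    also have "\<dots> \<le> M / s * (3 * (G / n\<^sup>2 * rho x) + 3 * (G / n\<^sup>2 * rho y))"
      using Ms ex_trans(2) [OF x1(3)] ex_trans(2) [OF x1(4)] ex_bounds(1) [of y] by (intro mult_left_mono) auto
    also have "\<dots> = 3 * (G * M) * ((rho x + rho y) / (s * n\<^sup>2))" by (simp add: algebra_simps add_divide_distrib)
    also have "\<dots> \<le> 10 ^ 7 * (G ^ 9 * M) * ((rho x + rho y) / (s * n\<^sup>2))"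
      using GM ex_bounds(3) [of x] ex_bounds(3) [of y] s by (intro mult_right_mono) auto
    finally have 1: "\<bar>V i j x y\<bar> \<le> 10 ^ 7 * (G ^ 9 * M) * ((rho x + rho y) / (s * n\<^sup>2))" .
    have "2048 * (G * M / n ^ 3) * n ^ (i + j) = 2048 * (G * M) * (1 / n\<^sup>2)"
      unfolding m using n0 by (simp add: power2_eq_square power3_eq_cube)
    also have "\<dots> \<le> 10 ^ 7 * (G ^ 9 * M) * (1 / n\<^sup>2)" using GM GM' by (intro mult_right_mono) auto
    finally have 2: "2048 * (G * M / n ^ 3) * n ^ (i + j) \<le> 10 ^ 7 * (G ^ 9 * M) * (1 / n\<^sup>2)" .
    have "10 ^ 7 * G ^ 9 * M * (if i + j = 0 then 1 / n ^ 3 else 1 / n\<^sup>2 + (rho x + rho y) / (s * n\<^sup>2)) =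
      10 ^ 7 * (G ^ 9 * M) * (1 / n\<^sup>2) + 10 ^ 7 * (G ^ 9 * M) * ((rho x + rho y) / (s * n\<^sup>2))"
      unfolding if_not_P [OF False] by (simp only: distrib_left mult.assoc)
    then show ?thesis using * 1 2 by linarith
  qed
qed

end

subsection \<open>Interpolation errors in the \<open>L\<^sub>2\<close> norm\<close>

text \<open>Extended by 0 outside \<open>D\<close>, so a window may reach across the boundary of
  \<open>D\<close>.\<close>

definition sqr :: "(real \<Rightarrow> real \<Rightarrow> real) \<Rightarrow> (real \<times> real) set \<Rightarrow> real \<times> real \<Rightarrow> ennreal" where
  "sqr V D = (\<lambda>(x, y). indicator D (x, y) * ennreal ((V x y)\<^sup>2))"

lemma sqr_measurable:
  assumes V: "continuous_on closed_unit_square (\<lambda>(x, y). V x y)" and D: "D \<in> sets borel" "D \<subseteq> closed_unit_square"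
  shows "sqr V D \<in> borel_measurable borel"
proof -
  have c: "closed_unit_square \<in> sets borel" by (intro borel_closed closed_Times closed_atLeastAtMost)
  have "continuous_on closed_unit_square (\<lambda>z. (case z of (x, y) \<Rightarrow> V x y)\<^sup>2)"
    by (intro continuous_intros V)
  from borel_measurable_continuous_on_indicator [OF c this]
  have m: "(\<lambda>z. indicator closed_unit_square z *\<^sub>R (case z of (x, y) \<Rightarrow> V x y)\<^sup>2) \<in> borel_measurable borel" .
  have "(\<lambda>z. indicator D z * ennreal (indicator closed_unit_square z *\<^sub>R (case z of (x, y) \<Rightarrow> V x y)\<^sup>2)) \<in> borel_measurable borel"
    using m D by (intro borel_measurable_times_ennreal measurable_compose [OF m] borel_measurable_indicator) auto
  moreover have "(\<lambda>z. indicator D z * ennreal (indicator closed_unit_square z *\<^sub>R (case z of (x, y) \<Rightarrow> V x y)\<^sup>2)) = sqr V D"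
    using D by (auto simp: sqr_def fun_eq_iff indicator_def split: if_splits)
  ultimately show ?thesis by simp
qed

lemma le_window_x:
  assumes "x \<in> {a..b}" "b - a \<le> H" "\<And>t. t \<in> {a<..<b} \<Longrightarrow> f t \<le> F (t, y)"
  shows "(\<integral>\<^sup>+ t. indicator {a<..<b} t * f t \<partial>lborel) \<le> window_x H F (x, y)"
  unfolding window_x_def prod.case
  by (rule nn_integral_mono) (use assms in \<open>auto simp: indicator_def abs_le_iff\<close>)

lemma le_window_y:
  assumes "y \<in> {c..d}" "d - c \<le> H" "\<And>t. t \<in> {c<..<d} \<Longrightarrow> f t \<le> F (x, t)"
  shows "(\<integral>\<^sup>+ t. indicator {c<..<d} t * f t \<partial>lborel) \<le> window_y H F (x, y)"
  unfolding window_y_def prod.case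
  by (rule nn_integral_mono) (use assms in \<open>auto simp: indicator_def abs_le_iff\<close>)

lemma square_sqrt_bound:
  fixes E :: real
  assumes "\<bar>E\<bar> \<le> 16 * sqrt (H * I) * c" "0 \<le> H" "0 \<le> I" "0 \<le> c"
  shows "E\<^sup>2 \<le> 256 * H * c\<^sup>2 * I"
proof -
  have "\<bar>E\<bar>\<^sup>2 \<le> (16 * sqrt (H * I) * c)\<^sup>2" using assms by (intro power_mono) auto
  also have "\<dots> = 256 * H * c\<^sup>2 * I" using assms by (simp add: power_mult_distrib)
  finally show ?thesis by simp
qed

text \<open>\<open>lag_err\<close> with the oscillation supplied by \<open>osc_le_L2\<close>, then
  squared. The integral runs over the single cell and is enlarged to a window afterwards.\<close>

lemma lag_L2:
  assumes ab: "a < b" and z: "z \<in> {a..b}" and n: "n \<le> 2" and j: "jet1 (Suc n) a b f" and k: "k \<le> 2"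
    and c: "continuous_on {a..b} (f (Suc n))"
  shows "ennreal (((if k \<le> n then f k z else 0) - lag k a b (f 0) z)\<^sup>2) \<le>
    ennreal (256 * (b - a) * ((b - a) ^ n / (b - a) ^ k)\<^sup>2) * (\<integral>\<^sup>+ t. indicator {a<..<b} t * ennreal ((f (Suc n) t)\<^sup>2) \<partial>lborel)"
proof -
  define I where "I = integral {a..b} (\<lambda>t. (f (Suc n) t)\<^sup>2)"
  have I: "0 \<le> I" unfolding I_def by (intro integral_nonneg integrable_continuous_interval continuous_intros c) auto
  have osc: "\<bar>f n t - f n z\<bar> \<le> sqrt ((b - a) * I)" if "t \<in> {a..b}" for t
    unfolding I_def by (rule osc_le_L2 [OF ab _ c that z]) (use j in \<open>auto simp: jet1_def\<close>)
  have "\<bar>(if k \<le> n then f k z else 0) - lag k a b (f 0) z\<bar> \<le> 16 * sqrt ((b - a) * I) * (b - a) ^ n / (b - a) ^ k"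
    by (rule lag_err [OF ab z n jet1_less [OF j] k osc])
  then have "((if k \<le> n then f k z else 0) - lag k a b (f 0) z)\<^sup>2 \<le> 256 * (b - a) * ((b - a) ^ n / (b - a) ^ k)\<^sup>2 * I"
    using I ab by (intro square_sqrt_bound) auto
  then have "ennreal (((if k \<le> n then f k z else 0) - lag k a b (f 0) z)\<^sup>2) \<le> ennreal (256 * (b - a) * ((b - a) ^ n / (b - a) ^ k)\<^sup>2 * I)"
    by (rule ennreal_leI)
  also have "\<dots> = ennreal (256 * (b - a) * ((b - a) ^ n / (b - a) ^ k)\<^sup>2) * ennreal I"
    using ab I by (intro ennreal_mult) auto
  also have "ennreal I = (\<integral>\<^sup>+ t. indicator {a<..<b} t * ennreal ((f (Suc n) t)\<^sup>2) \<partial>lborel)"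
    unfolding I_def by (rule ennreal_integral_square [OF c])
  finally show ?thesis .
qed

lemma lag_x_L2:
  assumes S: "C3_jet S" and ab: "a < b" "{a..b} \<subseteq> {0..1}" and x: "x \<in> {a..b}" and y: "y \<in> {0..1}"
    and k: "k \<le> 1" and D: "\<And>t. t \<in> {a<..<b} \<Longrightarrow> (t, y) \<in> D" and H: "b - a = H"
  shows "ennreal ((S k 0 x y - lag k a b (\<lambda>\<xi>. S 0 0 \<xi> y) x)\<^sup>2) \<le> ennreal (256 * H ^ (5 - 2 * k)) * window_x H (sqr (S 3 0) D) (x, y)"
proof -
  have Hp: "H > 0" using ab H by simp
  have "ennreal ((S k 0 x y - lag k a b (\<lambda>\<xi>. S 0 0 \<xi> y) x)\<^sup>2) \<le>
      ennreal (256 * H * (H\<^sup>2 / H ^ k)\<^sup>2) * (\<integral>\<^sup>+ t. indicator {a<..<b} t * ennreal ((S 3 0 t y)\<^sup>2) \<partial>lborel)"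
    using lag_L2 [OF ab(1) x, of 2 "\<lambda>k t. S k 0 t y" k] C3_jet1_x [OF S, of 3 0 0 y a b] C3_jet_cont_x [OF S, of 3 0 y "{a..b}"]
      ab y k unfolding H by (simp add: eval_nat_numeral)
  also have "\<dots> \<le> ennreal (256 * H * (H\<^sup>2 / H ^ k)\<^sup>2) * window_x H (sqr (S 3 0) D) (x, y)"
    by (intro mult_left_mono le_window_x [OF x]) (use D H in \<open>auto simp: sqr_def\<close>)
  also have "256 * H * (H\<^sup>2 / H ^ k)\<^sup>2 = 256 * H ^ (5 - 2 * k)"
  proof -
    have "k = 0 \<or> k = 1" using k by auto
    then show ?thesis using Hp by (auto simp: eval_nat_numeral)
  qed
  finally show ?thesis .
qed

lemma jswap_apply: "jswap V i j x y = V j i y x"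
  by (simp add: jswap_def)

lemma lag_y_L2:
  assumes S: "C3_jet S" and cd: "c < d" "{c..d} \<subseteq> {0..1}" and y: "y \<in> {c..d}" and x: "x \<in> {0..1}"
    and D: "\<And>t. t \<in> {c<..<d} \<Longrightarrow> (x, t) \<in> D" and H: "d - c = H"
  shows "ennreal ((S 0 0 x y - lag 0 c d (\<lambda>\<eta>. S 0 0 x \<eta>) y)\<^sup>2) \<le> ennreal (256 * H ^ 5) * window_y H (sqr (S 0 3) D) (x, y)"
proof -
  have "ennreal ((S 0 0 x y - lag 0 c d (\<lambda>\<eta>. S 0 0 x \<eta>) y)\<^sup>2) \<le>
      ennreal (256 * H * (H\<^sup>2 / H ^ 0)\<^sup>2) * (\<integral>\<^sup>+ t. indicator {c<..<d} t * ennreal ((S 0 3 x t)\<^sup>2) \<partial>lborel)"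
    using lag_L2 [OF cd(1) y, of 2 "\<lambda>k t. S 0 k x t" 0] C3_jet1_y [OF S, of 3 0 0 x c d] C3_jet_cont_y [OF S, of 0 3 x "{c..d}"]
      cd x unfolding H by (simp add: eval_nat_numeral)
  also have "\<dots> \<le> ennreal (256 * H * (H\<^sup>2 / H ^ 0)\<^sup>2) * window_y H (sqr (S 0 3) D) (x, y)"
    by (intro mult_left_mono le_window_y [OF y]) (use D H in \<open>auto simp: sqr_def\<close>)
  also have "256 * H * (H\<^sup>2 / H ^ 0)\<^sup>2 = 256 * H ^ 5" by (simp add: eval_nat_numeral)
  finally show ?thesis .
qed

text \<open>At a fixed point the operator is a three-point functional with coefficients independent
  of the function. Continuity in a parameter and the exchange of the x and y operators follow from
  this.\<close>

lemma lag_linear: "\<exists>p q r. \<forall>g. lag i a b g x = p * g a + q * g ((a + b) / 2) + r * g b"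
proof -
  define r where "r = (b - a) / 2"
  define m where "m = (a + b) / 2"
  define t where "t = (x - m) / r"
  consider "i = 0" | "i = 1" | "i = 2" | "i > 2" by linarith
  then show ?thesis
  proof cases
    case 1
    show ?thesis unfolding 1 lag_def Let_def r_def [symmetric] m_def [symmetric] t_def [symmetric]
      by (rule exI [of _ "t * (t - 1) / 2"], rule exI [of _ "1 - t\<^sup>2"], rule exI [of _ "t * (t + 1) / 2"]) (simp add: mult_ac)
  next
    case 2
    show ?thesis unfolding 2 lag_def Let_def r_def [symmetric] m_def [symmetric] t_def [symmetric]
      by (rule exI [of _ "(t - 1 / 2) / r"], rule exI [of _ "- (2 * t) / r"], rule exI [of _ "(t + 1 / 2) / r"])
        (simp add: add_divide_distrib diff_divide_distrib algebra_simps)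
  next
    case 3
    show ?thesis unfolding 3 lag_def Let_def r_def [symmetric] m_def [symmetric] t_def [symmetric]
      by (rule exI [of _ "1 / r\<^sup>2"], rule exI [of _ "- 2 / r\<^sup>2"], rule exI [of _ "1 / r\<^sup>2"])
        (simp add: add_divide_distrib diff_divide_distrib)
  next
    case 4
    then show ?thesis unfolding lag_def Let_def by (intro exI [of _ 0]) auto
  qed
qed

lemma lag_cont:
  assumes "\<And>\<xi>. \<xi> \<in> nodes3 (a, b) \<Longrightarrow> continuous_on X (F \<xi>)"
  shows "continuous_on X (\<lambda>t. lag i a b (\<lambda>\<xi>. F \<xi> t) x)"
proof -
  have c: "continuous_on X (F a)" "continuous_on X (F ((a + b) / 2))" "continuous_on X (F b)" using assms by auto
  obtain p q r where "\<And>g. lag i a b g x = p * g a + q * g ((a + b) / 2) + r * g b" using lag_linear by blast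
  then show ?thesis by (auto intro!: continuous_intros c)
qed

text \<open>\<open>v\<close> is the y error, so this is the product of both errors. To stay within
  third derivatives, the expansion has order 0 in x and order 1 in y, and only \<open>S 1 2\<close>
  enters. For \<open>k = 1\<close> the statement bounds the derivative of the interpolant of
  \<open>v\<close> alone.\<close>

lemma lag_mixed_L2:
  assumes S: "C3_jet S" and ab: "a < b" "{a..b} \<subseteq> {0..1}" and cd: "c < d" "{c..d} \<subseteq> {0..1}"
    and x: "x \<in> {a..b}" and y: "y \<in> {c..d}" and k: "k \<le> 1" and H: "b - a = H" "d - c = H"
    and D: "{a<..<b} \<times> {c<..<d} \<subseteq> D" "D \<in> sets borel" "D \<subseteq> closed_unit_square"
    and v: "v = (\<lambda>t. S 0 0 t y - lag 0 c d (\<lambda>\<eta>. S 0 0 t \<eta>) y)"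
  shows "ennreal (((if k = 0 then v x else 0) - lag k a b v x)\<^sup>2) \<le>
    ennreal (65536 * H ^ (4 - 2 * k)) * window_x H (window_y H (sqr (S 1 2) D)) (x, y)"
proof -
  have Hp: "H > 0" using ab H by simp
  have y1: "y \<in> {0..1}" using y cd by auto
  have nodes: "\<eta> \<in> {0..1}" if "\<eta> \<in> nodes3 (c, d)" for \<eta> using nodes_sub [OF cd(1) that] cd by auto
  define v' where "v' t = S 1 0 t y - lag 0 c d (\<lambda>\<eta>. S 1 0 t \<eta>) y" for t
  have dv: "(v has_real_derivative v' t) (at t within {a..b})" if "t \<in> {a..b}" for t
  proof -
    have dS: "((\<lambda>t. S 0 0 t q) has_real_derivative S 1 0 t q) (at t within {a..b})" if "q \<in> {0..1}" for q
      using C3_jet_dx [OF S, of 0 0 t q] \<open>t \<in> {a..b}\<close> ab that by (intro DERIV_subset [OF _ ab(2)]) auto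
    show ?thesis unfolding v v'_def
      by (intro DERIV_diff lag_param dS y1 nodes)
  qed
  have cv: "continuous_on {a..b} v'"
    unfolding v'_def by (intro continuous_on_diff lag_cont C3_jet_cont_x [OF S] nodes y1 ab(2)) auto
  have v'b: "ennreal ((v' t)\<^sup>2) \<le> ennreal (256 * H ^ 3) * window_y H (sqr (S 1 2) D) (t, y)" if t: "t \<in> {a<..<b}" for t
  proof -
    have t1: "t \<in> {0..1}" using t ab by auto
    have mem: "(t, q) \<in> D" if "q \<in> {c<..<d}" for q using that t D(1) by blast
    have "ennreal ((v' t)\<^sup>2) \<le> ennreal (256 * H * (H ^ 1 / H ^ 0)\<^sup>2) * (\<integral>\<^sup>+ q. indicator {c<..<d} q * ennreal ((S 1 2 t q)\<^sup>2) \<partial>lborel)"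
      using lag_L2 [OF cd(1) y, of 1 "\<lambda>k q. S 1 k t q" 0] C3_jet1_y [OF S, of 2 1 0 t c d] C3_jet_cont_y [OF S, of 1 2 t "{c..d}"]
        cd t1 unfolding H v'_def by (simp add: eval_nat_numeral)
    also have "\<dots> \<le> ennreal (256 * H * (H ^ 1 / H ^ 0)\<^sup>2) * window_y H (sqr (S 1 2) D) (t, y)"
      by (intro mult_left_mono le_window_y [OF y]) (use mem H in \<open>auto simp: sqr_def\<close>)
    also have "256 * H * (H ^ 1 / H ^ 0)\<^sup>2 = 256 * H ^ 3" by (simp add: eval_nat_numeral)
    finally show ?thesis .
  qed
  define jv where "jv i = (if i = 0 then v else v')" for i :: nat
  have j: "jet1 (Suc 0) a b jv" unfolding jet1_def jv_def using dv by auto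
  have "ennreal (((if k = 0 then v x else 0) - lag k a b v x)\<^sup>2) \<le>
      ennreal (256 * H * (H ^ 0 / H ^ k)\<^sup>2) * (\<integral>\<^sup>+ t. indicator {a<..<b} t * ennreal ((v' t)\<^sup>2) \<partial>lborel)"
    using lag_L2 [OF ab(1) x _ j, of k] k cv unfolding H by (auto simp: jv_def)
  also have "\<dots> \<le> ennreal (256 * H * (H ^ 0 / H ^ k)\<^sup>2) * window_x H (\<lambda>z. ennreal (256 * H ^ 3) * window_y H (sqr (S 1 2) D) z) (x, y)"
    by (intro mult_left_mono le_window_x [OF x] v'b) (use H in auto)
  also have "window_x H (\<lambda>z. ennreal (256 * H ^ 3) * window_y H (sqr (S 1 2) D) z) (x, y) =
      ennreal (256 * H ^ 3) * window_x H (window_y H (sqr (S 1 2) D)) (x, y)"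
  proof -
    have F: "window_y H (sqr (S 1 2) D) \<in> borel_measurable borel"
      using S D by (intro window_measurable sqr_measurable) (auto simp: C3_jet_def)
    have "(\<lambda>t. indicator {t. \<bar>t - x\<bar> \<le> H} t * window_y H (sqr (S 1 2) D) (t, y)) \<in> borel_measurable lborel"
    proof -
      have "{t. \<bar>t - x\<bar> \<le> H} = {x - H..x + H}" by (auto simp: abs_le_iff)
      moreover have "(\<lambda>t. window_y H (sqr (S 1 2) D) (t, y)) \<in> borel_measurable borel"
        by (rule measurable_compose [OF _ F [folded borel_prod]]) auto
      ultimately show ?thesis by auto
    qed
    from nn_integral_cmult [OF this, of "ennreal (256 * H ^ 3)"] show ?thesis
      unfolding window_x_def prod.case by (simp add: mult.left_commute)
  qed
  also have "ennreal (256 * H * (H ^ 0 / H ^ k)\<^sup>2) * (ennreal (256 * H ^ 3) * window_x H (window_y H (sqr (S 1 2) D)) (x, y)) =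
      ennreal (65536 * H ^ (4 - 2 * k)) * window_x H (window_y H (sqr (S 1 2) D)) (x, y)"
  proof -
    have "k = 0 \<or> k = 1" using k by auto
    then have "256 * H * (H ^ 0 / H ^ k)\<^sup>2 * (256 * H ^ 3) = 65536 * H ^ (4 - 2 * k)"
      using Hp by (auto simp: eval_nat_numeral)
    then show ?thesis using Hp unfolding mult.assoc [symmetric] by (simp add: ennreal_mult [symmetric])
  qed
  finally show ?thesis .
qed

lemma lag_commute:
  "lag i a b (\<lambda>\<xi>. lag j c d (\<lambda>\<eta>. f \<xi> \<eta>) y) x = lag j c d (\<lambda>\<eta>. lag i a b (\<lambda>\<xi>. f \<xi> \<eta>) x) y"
proof -
  obtain p q r where 1: "\<And>g. lag i a b g x = p * g a + q * g ((a + b) / 2) + r * g b" using lag_linear by blast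
  obtain p' q' r' where 2: "\<And>g. lag j c d g y = p' * g c + q' * g ((c + d) / 2) + r' * g d" using lag_linear by blast
  show ?thesis unfolding 1 2 by (simp add: algebra_simps)
qed

lemma ennreal_square_sum2:
  "ennreal ((p + q)\<^sup>2) \<le> 2 * (ennreal (p\<^sup>2) + ennreal (q\<^sup>2))"
proof -
  have "(p + q)\<^sup>2 \<le> 2 * (p\<^sup>2 + q\<^sup>2)" using sum_squares_bound [of p q] by (simp add: power2_sum)
  then have "ennreal ((p + q)\<^sup>2) \<le> ennreal (2 * (p\<^sup>2 + q\<^sup>2))" by (rule ennreal_leI)
  then show ?thesis by (simp add: ennreal_mult)
qed

lemma ennreal_square_sum3:
  "ennreal ((p + q + r)\<^sup>2) \<le> 4 * (ennreal (p\<^sup>2) + ennreal (q\<^sup>2) + ennreal (r\<^sup>2))"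
proof -
  have "(p + q + r)\<^sup>2 \<le> 2 * ((p + q)\<^sup>2 + r\<^sup>2)" using sum_squares_bound [of "p + q" r] by (simp add: power2_sum)
  moreover have "(p + q)\<^sup>2 \<le> 2 * (p\<^sup>2 + q\<^sup>2)" using sum_squares_bound [of p q] by (simp add: power2_sum)
  moreover have "A \<le> 4 * (P + Q + R)" if "A \<le> 2 * (B + R)" "B \<le> 2 * (P + Q)" "0 \<le> R" for A B P Q R :: real
    using that by simp
  ultimately have "(p + q + r)\<^sup>2 \<le> 4 * (p\<^sup>2 + q\<^sup>2 + r\<^sup>2)" by (metis zero_le_power2)
  then have "ennreal ((p + q + r)\<^sup>2) \<le> ennreal (4 * (p\<^sup>2 + q\<^sup>2 + r\<^sup>2))" by (rule ennreal_leI)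
  then show ?thesis by (simp add: ennreal_mult)
qed

lemma core_L2:
  assumes S: "C3_jet S" and ab: "a < b" "{a..b} \<subseteq> {0..1}" and cd: "c < d" "{c..d} \<subseteq> {0..1}"
    and x: "x \<in> {a<..<b}" and y: "y \<in> {c<..<d}" and H: "b - a = H" "d - c = H"
    and D: "{a<..<b} \<times> {c<..<d} \<subseteq> D" "D \<in> sets borel" "D \<subseteq> closed_unit_square"
  shows "ennreal ((S 0 0 x y - lag 0 a b (\<lambda>\<xi>. lag 0 c d (\<lambda>\<eta>. S 0 0 \<xi> \<eta>) y) x)\<^sup>2) \<le>
      4 * (ennreal (256 * H ^ 5) * window_x H (sqr (S 3 0) D) (x, y) + ennreal (256 * H ^ 5) * window_y H (sqr (S 0 3) D) (x, y) +
        ennreal (65536 * H ^ 4) * window_x H (window_y H (sqr (S 1 2) D)) (x, y))"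
    and "ennreal ((S 1 0 x y - lag 1 a b (\<lambda>\<xi>. lag 0 c d (\<lambda>\<eta>. S 0 0 \<xi> \<eta>) y) x)\<^sup>2) \<le>
      2 * (ennreal (256 * H ^ 3) * window_x H (sqr (S 3 0) D) (x, y) +
        ennreal (65536 * H ^ 2) * window_x H (window_y H (sqr (S 1 2) D)) (x, y))"
proof -
  have xy: "x \<in> {a..b}" "y \<in> {c..d}" "x \<in> {0..1}" "y \<in> {0..1}" using x y ab cd by auto
  define v where "v = (\<lambda>t. S 0 0 t y - lag 0 c d (\<lambda>\<eta>. S 0 0 t \<eta>) y)"
  have lv: "lag k a b (\<lambda>\<xi>. lag 0 c d (\<lambda>\<eta>. S 0 0 \<xi> \<eta>) y) x = lag k a b (\<lambda>\<xi>. S 0 0 \<xi> y) x - lag k a b v x" for k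
    unfolding v_def lag_diff by simp
  \<comment> \<open>The identity 1 - XY = (1 - X) + (1 - Y) - (1 - X)(1 - Y) for the interpolation
    operators X and Y in the two variables.\<close>
  have e0: "S 0 0 x y - lag 0 a b (\<lambda>\<xi>. lag 0 c d (\<lambda>\<eta>. S 0 0 \<xi> \<eta>) y) x =
      (S 0 0 x y - lag 0 a b (\<lambda>\<xi>. S 0 0 \<xi> y) x) + (S 0 0 x y - lag 0 c d (\<lambda>\<eta>. S 0 0 x \<eta>) y) + - (v x - lag 0 a b v x)"
    unfolding lv by (simp add: v_def)
  have e1: "S 1 0 x y - lag 1 a b (\<lambda>\<xi>. lag 0 c d (\<lambda>\<eta>. S 0 0 \<xi> \<eta>) y) x =
      (S 1 0 x y - lag 1 a b (\<lambda>\<xi>. S 0 0 \<xi> y) x) + - (0 - lag 1 a b v x)"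
    unfolding lv by simp
  have X: "ennreal ((S k 0 x y - lag k a b (\<lambda>\<xi>. S 0 0 \<xi> y) x)\<^sup>2) \<le> ennreal (256 * H ^ (5 - 2 * k)) * window_x H (sqr (S 3 0) D) (x, y)"
    if "k \<le> 1" for k
    by (rule lag_x_L2 [OF S ab xy(1,4) that _ H(1)]) (use D y in auto)
  have Y: "ennreal ((S 0 0 x y - lag 0 c d (\<lambda>\<eta>. S 0 0 x \<eta>) y)\<^sup>2) \<le> ennreal (256 * H ^ 5) * window_y H (sqr (S 0 3) D) (x, y)"
    by (rule lag_y_L2 [OF S cd xy(2,3) _ H(2)]) (use D x in auto)
  note V = lag_mixed_L2 [OF S ab cd xy(1,2) _ H D v_def]
  show "ennreal ((S 0 0 x y - lag 0 a b (\<lambda>\<xi>. lag 0 c d (\<lambda>\<eta>. S 0 0 \<xi> \<eta>) y) x)\<^sup>2) \<le>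
      4 * (ennreal (256 * H ^ 5) * window_x H (sqr (S 3 0) D) (x, y) + ennreal (256 * H ^ 5) * window_y H (sqr (S 0 3) D) (x, y) +
        ennreal (65536 * H ^ 4) * window_x H (window_y H (sqr (S 1 2) D)) (x, y))"
    unfolding e0
    by (rule order_trans [OF ennreal_square_sum3], rule mult_left_mono, intro add_mono)
      (use X [of 0] Y V [of 0] in \<open>simp_all only: power2_minus if_True zero_le simp_thms mult_0_right diff_zero\<close>)
  show "ennreal ((S 1 0 x y - lag 1 a b (\<lambda>\<xi>. lag 0 c d (\<lambda>\<eta>. S 0 0 \<xi> \<eta>) y) x)\<^sup>2) \<le>
      2 * (ennreal (256 * H ^ 3) * window_x H (sqr (S 3 0) D) (x, y) +
        ennreal (65536 * H ^ 2) * window_x H (window_y H (sqr (S 1 2) D)) (x, y))"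
    unfolding e1
    by (rule order_trans [OF ennreal_square_sum2], rule mult_left_mono, intro add_mono)
      (use X [of 1] V [of 1] in simp_all)
qed

lemma window_swap:
  "window_x H F (y, x) = window_y H (\<lambda>(x, y). F (y, x)) (x, y)"
  "window_x H (window_y H F) (y, x) = window_y H (window_x H (\<lambda>(x, y). F (y, x))) (x, y)"
  unfolding window_x_def window_y_def by simp_all

text \<open>The x estimate for the exchanged jet; \<open>lag_commute\<close> restores the order of
  the two interpolations.\<close>

lemma core_L2_y:
  assumes S: "C3_jet S" and ab: "a < b" "{a..b} \<subseteq> {0..1}" and cd: "c < d" "{c..d} \<subseteq> {0..1}"
    and x: "x \<in> {a<..<b}" and y: "y \<in> {c<..<d}" and H: "b - a = H" "d - c = H"
  shows "ennreal ((S 0 1 x y - lag 0 a b (\<lambda>\<xi>. lag 1 c d (\<lambda>\<eta>. S 0 0 \<xi> \<eta>) y) x)\<^sup>2) \<le>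
      2 * (ennreal (256 * H ^ 3) * window_y H (sqr (S 0 3) unit_square) (x, y) +
        ennreal (65536 * H ^ 2) * window_y H (window_x H (sqr (S 2 1) unit_square)) (x, y))"
proof -
  have D: "{c<..<d} \<times> {a<..<b} \<subseteq> unit_square" using ab cd by auto
  have D2: "unit_square \<in> sets borel" "unit_square \<subseteq> closed_unit_square"
    by (intro borel_open open_Times open_greaterThanLessThan) auto
  have sw: "(\<lambda>(x, y). sqr (jswap S i j) unit_square (y, x)) = sqr (S j i) unit_square" for i j
    by (auto simp: sqr_def jswap_def indicator_def fun_eq_iff)
  show ?thesis
    using core_L2(2) [OF C3_jswap [OF S] cd ab y x H(2,1) D D2,
      unfolded window_swap(2) sw, unfolded window_swap(1) sw, unfolded jswap_apply lag_commute [of 1 c d 0 a b]] .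
qed

lemma L2_norm_on_square_le_nn:
  "ennreal ((L2_norm_on D v)\<^sup>2) \<le> (\<integral>\<^sup>+ z. indicator D z * ennreal ((v z)\<^sup>2) \<partial>lborel)"
proof (cases "(\<integral>\<^sup>+ z. indicator D z * ennreal ((v z)\<^sup>2) \<partial>lborel)")
  case (real X)
  then show ?thesis using L2_norm_on_square_le [of D v X] by (auto simp: nn_integral_completion intro: ennreal_leI)
qed simp

section \<open>Error estimates on the cells and their integration\<close>

text \<open>The sums \<open>EH\<close> and \<open>EV\<close> suffice for the basic bounds. The
  single edge layers are kept as well, since the improved L2 bound controls the third tangential
  derivative of each of them only in its own strip.\<close>

locale problem = shishkin +
  fixes M :: real and u :: "real \<times> real \<Rightarrow> real" and \<sigma> and S EH EV Q E1 E2 E3 E4 :: jet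
  assumes lay: "layers M S EH EV Q" and u: "C_closed 3 u" and sg: "edge_assignment lam N \<sigma>"
    and U: "\<And>i j p q. i + j \<le> 3 \<Longrightarrow> p \<in> {0..1} \<Longrightarrow> q \<in> {0..1} \<Longrightarrow>
      jet_of u i j p q = S i j p q + (EH i j p q + EV i j p q + Q i j p q)"
    and E: "C3_jet E1" "C3_jet E2" "C3_jet E3" "C3_jet E4"
    and EH: "\<And>p q. p \<in> {0..1} \<Longrightarrow> q \<in> {0..1} \<Longrightarrow> EH 0 0 p q = E1 0 0 p q + E3 0 0 p q"
    and EV: "\<And>p q. p \<in> {0..1} \<Longrightarrow> q \<in> {0..1} \<Longrightarrow> EV 0 0 p q = E2 0 0 p q + E4 0 0 p q"
    and E1b: "\<And>p q. p \<in> {0..1} \<Longrightarrow> q \<in> {0..1} \<Longrightarrow> \<bar>E1 0 0 p q\<bar> \<le> M * exp (- (3 * k) * q / s)"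
    and E3b: "\<And>p q. p \<in> {0..1} \<Longrightarrow> q \<in> {0..1} \<Longrightarrow> \<bar>E3 0 0 p q\<bar> \<le> M * exp (- (3 * k) * (1 - q) / s)"
    and E2b: "\<And>p q. p \<in> {0..1} \<Longrightarrow> q \<in> {0..1} \<Longrightarrow> \<bar>E2 0 0 p q\<bar> \<le> M * exp (- (3 * k) * p / s)"
    and E4b: "\<And>p q. p \<in> {0..1} \<Longrightarrow> q \<in> {0..1} \<Longrightarrow> \<bar>E4 0 0 p q\<bar> \<le> M * exp (- (3 * k) * (1 - p) / s)"
begin

definition w where "w = (\<lambda>z. u z - quasi_interp lam N \<sigma> u z)"
definition CC where "CC = 10 ^ 7 * G ^ 9 * M"

lemma M0: "0 \<le> M" by (rule layersD(3) [OF lay])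

lemma CC0: "0 \<le> CC" "M * G \<le> CC"
proof -
  show "0 \<le> CC" unfolding CC_def using M0 G by simp
  have "G \<le> G ^ 9" using G by (simp add: self_le_power)
  then have "M * G \<le> M * G ^ 9" using M0 by (rule mult_left_mono)
  moreover have "M * G ^ 9 \<le> 10 ^ 7 * (M * G ^ 9)" using M0 G by simp
  ultimately show "M * G \<le> CC" unfolding CC_def by (simp add: mult_ac)
qed

lemma jet_of_00: "jet_of u 0 0 = (\<lambda>x y. u (x, y))" "jswap (jet_of u) 0 0 = (\<lambda>x y. u (y, x))"
  by (simp_all add: jswap_def jet_of_def pd_def fun_eq_iff)

text \<open>The remaining one-dimensional error along the edge. Pointwise it is only of order N^-2,
  which is why it is separated from all other contributions.\<close>

definition AH where "AH V x y a b = V (0::nat) (0::nat) x y - lag 0 a b (\<lambda>\<xi>. V 0 0 \<xi> (y::real)) x"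

lemma h_strip:
  assumes J: "(a, b) \<in> coarse_itvs" and K: "(c, d) \<in> fine_itvs"
    and x: "x \<in> {a<..<b}" and y: "y \<in> {c<..<d}" "y \<notin> mp ` {0..N}" and ij: "i + j \<le> 2"
  shows "\<bar>pd i j w (x, y) - (if i + j = 0 then AH (\<lambda>i j x y. S i j x y + EH i j x y) x y a b else 0)\<bar>
      \<le> CC * tgt (i + j) (ex x + ex y)"
    and "\<bar>AH (\<lambda>i j x y. S i j x y + EH i j x y) x y a b\<bar> \<le> CC / n\<^sup>2"
proof -
  have xy: "x \<in> {a..b}" "y \<in> {c..d}" using x y by auto
  have g: "normal_slope lam N u (a, b) \<xi> \<eta> =
      (if \<eta> = lam then lag 1 lam (mp (N div 4 + 1)) (\<lambda>\<eta>. jet_of u 0 0 \<xi> \<eta>) \<eta>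
       else if \<eta> = 1 - lam then lag 1 (mp (3 * N div 4 - 1)) (1 - lam) (\<lambda>\<eta>. jet_of u 0 0 \<xi> \<eta>) \<eta>
       else jet_of u 0 1 \<xi> \<eta>)" if "\<xi> \<in> nodes3 (a, b)" for \<xi> \<eta>
    unfolding normal_slope_eq [OF J that] jet_of_00 by (simp add: jet_of_def)
  note R = strip_region [OF lay U J K xy g ij]
  show "\<bar>pd i j w (x, y) - (if i + j = 0 then AH (\<lambda>i j x y. S i j x y + EH i j x y) x y a b else 0)\<bar>
      \<le> CC * tgt (i + j) (ex x + ex y)"
    unfolding w_def pd_h_strip [OF u J K x y ij] AH_def CC_def by (rule R(1))
  show "\<bar>AH (\<lambda>i j x y. S i j x y + EH i j x y) x y a b\<bar> \<le> CC / n\<^sup>2"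
    unfolding AH_def CC_def by (rule R(2))
qed

lemma v_strip:
  assumes J: "(a, b) \<in> fine_itvs" and K: "(c, d) \<in> coarse_itvs"
    and x: "x \<in> {a<..<b}" "x \<notin> mp ` {0..N}" and y: "y \<in> {c<..<d}" and ij: "i + j \<le> 2"
  shows "\<bar>pd i j w (x, y) - (if i + j = 0 then AH (\<lambda>i j x y. jswap S i j x y + jswap EV i j x y) y x c d else 0)\<bar>
      \<le> CC * tgt (i + j) (ex x + ex y)"
    and "\<bar>AH (\<lambda>i j x y. jswap S i j x y + jswap EV i j x y) y x c d\<bar> \<le> CC / n\<^sup>2"
proof -
  have xy: "y \<in> {c..d}" "x \<in> {a..b}" using x y by auto
  have g: "normal_slope lam N (\<lambda>(y, x). u (x, y)) (c, d) \<xi> \<eta> =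
      (if \<eta> = lam then lag 1 lam (mp (N div 4 + 1)) (\<lambda>\<eta>. jswap (jet_of u) 0 0 \<xi> \<eta>) \<eta>
       else if \<eta> = 1 - lam then lag 1 (mp (3 * N div 4 - 1)) (1 - lam) (\<lambda>\<eta>. jswap (jet_of u) 0 0 \<xi> \<eta>) \<eta>
       else jswap (jet_of u) 0 1 \<xi> \<eta>)" if "\<xi> \<in> nodes3 (c, d)" for \<xi> \<eta>
    unfolding normal_slope_eq [OF K that] jet_of_00 by (simp add: jswap_def jet_of_def pd_def diff_x_def diff_y_def)
  have Us: "jswap (jet_of u) i j p q = jswap S i j p q + (jswap EV i j p q + jswap EH i j p q + jswap Q i j p q)"
    if "i + j \<le> 3" "p \<in> {0..1}" "q \<in> {0..1}" for i j p q
    using U [of j i q p] that by (simp add: jswap_def add_ac)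
  have ji: "j + i \<le> 2" using ij by simp
  note R = strip_region [OF layers_swap [OF lay] Us K J xy g ji]
  show "\<bar>pd i j w (x, y) - (if i + j = 0 then AH (\<lambda>i j x y. jswap S i j x y + jswap EV i j x y) y x c d else 0)\<bar>
      \<le> CC * tgt (i + j) (ex x + ex y)"
    using R(1) unfolding w_def pd_v_strip [OF u J K x y ij] AH_def CC_def add.commute [of j i] add.commute [of "ex y"] .
  show "\<bar>AH (\<lambda>i j x y. jswap S i j x y + jswap EV i j x y) y x c d\<bar> \<le> CC / n\<^sup>2"
    unfolding AH_def CC_def by (rule R(2))
qed

lemma corner:
  assumes J: "(a, b) \<in> fine_itvs" and K: "(c, d) \<in> fine_itvs"
    and x: "x \<in> {a<..<b}" "x \<notin> mp ` {0..N}" and y: "y \<in> {c<..<d}" "y \<notin> mp ` {0..N}" and ij: "i + j \<le> 2"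
  shows "\<bar>pd i j w (x, y)\<bar> \<le> CC * tgt (i + j) (ex x + ex y)"
  unfolding w_def CC_def by (rule corner_region [OF lay u sg U J K x y ij])

definition e_core where
  "e_core i j x y a b c d = S i j x y - lag i a b (\<lambda>\<xi>. lag j c d (\<lambda>\<eta>. S 0 0 \<xi> \<eta>) y) x"

lemma core:
  assumes J: "(a, b) \<in> coarse_itvs" and K: "(c, d) \<in> coarse_itvs"
    and x: "x \<in> {a<..<b}" and y: "y \<in> {c<..<d}" and ij: "i + j \<le> 1"
  shows "\<bar>pd i j w (x, y) - e_core i j x y a b c d\<bar>
      \<le> CC * (if i + j = 0 then 1 / n ^ 3 else 1 / n\<^sup>2 + (rho x + rho y) / (s * n\<^sup>2))"
    and "\<bar>e_core i j x y a b c d\<bar> \<le> CC / n ^ (2 - (i + j))"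
proof -
  have xy: "x \<in> {a..b}" "y \<in> {c..d}" using x y by auto
  have ij2: "i + j \<le> 2" using ij by simp
  note R = core_region [OF lay U J K xy ij]
  show "\<bar>pd i j w (x, y) - e_core i j x y a b c d\<bar>
      \<le> CC * (if i + j = 0 then 1 / n ^ 3 else 1 / n\<^sup>2 + (rho x + rho y) / (s * n\<^sup>2))"
    unfolding w_def CC_def pd_core [OF u J K x y ij2] e_core_def by (rule R(1))
  show "\<bar>e_core i j x y a b c d\<bar> \<le> CC / n ^ (2 - (i + j))" unfolding e_core_def CC_def by (rule R(2))
qed

text \<open>The derivatives of the error are bounded by functions of the following kind, where the
  indicator function describes the complement of \<open>\<Omega>\<^sub>0\<close>.\<close>

definition Ist :: "real \<Rightarrow> real" where "Ist t = indicator ({0..lam} \<union> {1 - lam..1}) t"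

definition P :: "real \<Rightarrow> real \<Rightarrow> real \<Rightarrow> real \<Rightarrow> real" where
  "P \<alpha> \<beta> \<gamma> t = \<alpha> * Ist t + \<beta> * rho t + \<gamma>"

lemma P_nonneg: "0 \<le> \<alpha> \<Longrightarrow> 0 \<le> \<beta> \<Longrightarrow> 0 \<le> \<gamma> \<Longrightarrow> 0 \<le> P \<alpha> \<beta> \<gamma> t"
  unfolding P_def Ist_def using ex_bounds(3) [of t] by (auto simp: indicator_def)

lemma P_mono: "\<alpha> \<le> \<alpha>' \<Longrightarrow> \<beta> \<le> \<beta>' \<Longrightarrow> \<gamma> \<le> \<gamma>' \<Longrightarrow> P \<alpha> \<beta> \<gamma> t \<le> P \<alpha>' \<beta>' \<gamma>' t"
  unfolding P_def Ist_def using ex_bounds(3) [of t]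
  by (intro add_mono mult_right_mono) (auto simp: indicator_def)

lemma P_measurable [measurable]: "P \<alpha> \<beta> \<gamma> \<in> borel_measurable borel"
  unfolding P_def Ist_def rho_def by measurable

text \<open>Source of the additional factor s gained by integrating a layer.\<close>

lemma nn_integral_rho: "(\<integral>\<^sup>+ t. indicator {0<..<1} t * ennreal (rho t) \<partial>lborel) \<le> ennreal (2 * s / k)"
proof -
  have "((\<lambda>t. rho t) has_integral ((- s / k * exp (- k * 1 / s) + s / k * exp (- k * (1 - 1) / s)) -
      (- s / k * exp (- k * 0 / s) + s / k * exp (- k * (1 - 0) / s)))) {0..1}"
  proof (rule fundamental_theorem_of_calculus)
    fix t :: real
    show "((\<lambda>t. - s / k * exp (- k * t / s) + s / k * exp (- k * (1 - t) / s)) has_vector_derivative rho t) (at t within {0..1})"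
      unfolding has_real_derivative_iff_has_vector_derivative [symmetric] rho_def
      using s k by (auto intro!: derivative_eq_intros)
  qed simp
  then have hi: "(rho has_integral (2 * s / k * (1 - exp (- k / s)))) {0..1}"
    by (simp add: algebra_simps diff_divide_distrib)
  \<comment> \<open>The conversion to nonnegative integrals is available for squares, so
    \<open>rho\<close> is treated as the square of its root.\<close>
  have c: "continuous_on {0..1} (\<lambda>t. sqrt (rho t))"
    unfolding rho_def using s by (intro continuous_intros) auto
  have "ennreal (2 * s / k * (1 - exp (- k / s))) = (\<integral>\<^sup>+ t. indicator {0<..<1} t * ennreal (rho t) \<partial>lborel)"
    using ennreal_integral_square [OF c] integral_unique [OF hi] ex_bounds(3)
    by (simp add: real_sqrt_pow2 less_imp_le)
  moreover have "2 * s / k * (1 - exp (- k / s)) \<le> 2 * s / k * 1"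
    using s k by (intro mult_left_mono) auto
  ultimately show ?thesis by (metis ennreal_leI mult.right_neutral)
qed

lemma nn_integral_P:
  assumes "0 \<le> \<alpha>" "0 \<le> \<beta>" "0 \<le> \<gamma>"
  shows "(\<integral>\<^sup>+ z. indicator unit_square z * ennreal (P \<alpha> \<beta> \<gamma> (fst z) + P \<alpha> \<beta> \<gamma> (snd z)) \<partial>lborel)
    \<le> ennreal (2 * (\<alpha> * (2 * lam) + \<beta> * (2 * s / k) + \<gamma>))"
proof -
  let ?P = "P \<alpha> \<beta> \<gamma>" and ?i = "indicator {0<..<1} :: real \<Rightarrow> ennreal"
  have P0: "0 \<le> ?P t" for t by (rule P_nonneg [OF assms])
  have I: "(\<integral>\<^sup>+ t. ?i t * ennreal (?P t) \<partial>lborel) \<le> ennreal (\<alpha> * (2 * lam) + \<beta> * (2 * s / k) + \<gamma>)"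
  proof -
    have Im: "Ist \<in> borel_measurable borel" "rho \<in> borel_measurable borel" unfolding Ist_def rho_def by measurable
    have nn: "0 \<le> Ist t" "0 \<le> rho t" for t using ex_bounds(3) [of t] by (auto simp: Ist_def)
    have "(\<integral>\<^sup>+ t. ?i t * ennreal (?P t) \<partial>lborel) =
        (\<integral>\<^sup>+ t. ennreal \<alpha> * (?i t * ennreal (Ist t)) + ennreal \<beta> * (?i t * ennreal (rho t)) + ennreal \<gamma> * ?i t \<partial>lborel)"
    proof (intro nn_integral_cong)
      fix t
      have "ennreal (?P t) = ennreal \<alpha> * ennreal (Ist t) + ennreal \<beta> * ennreal (rho t) + ennreal \<gamma>"
        using assms nn unfolding P_def by (simp add: ennreal_mult [symmetric] flip: ennreal_plus)
      then show "?i t * ennreal (?P t) =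
          ennreal \<alpha> * (?i t * ennreal (Ist t)) + ennreal \<beta> * (?i t * ennreal (rho t)) + ennreal \<gamma> * ?i t"
        by (simp add: indicator_def)
    qed
    also have "\<dots> = ennreal \<alpha> * (\<integral>\<^sup>+ t. ?i t * ennreal (Ist t) \<partial>lborel) +
        ennreal \<beta> * (\<integral>\<^sup>+ t. ?i t * ennreal (rho t) \<partial>lborel) + ennreal \<gamma> * (\<integral>\<^sup>+ t. ?i t \<partial>lborel)"
      using Im by (simp add: nn_integral_add nn_integral_cmult)
    also have "\<dots> \<le> ennreal \<alpha> * ennreal (2 * lam) + ennreal \<beta> * ennreal (2 * s / k) + ennreal \<gamma> * 1"
    proof (intro add_mono mult_left_mono nn_integral_rho)
      have "(\<integral>\<^sup>+ t. ?i t * ennreal (Ist t) \<partial>lborel) \<le> (\<integral>\<^sup>+ t. indicator {0..lam} t + indicator {1 - lam..1} t \<partial>lborel)"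
        by (intro nn_integral_mono) (auto simp: Ist_def indicator_def)
      also have "\<dots> = ennreal (2 * lam)"
        using lam by (subst nn_integral_add) (auto simp: ennreal_plus [symmetric] simp del: ennreal_plus)
      finally show "(\<integral>\<^sup>+ t. ?i t * ennreal (Ist t) \<partial>lborel) \<le> ennreal (2 * lam)" .
    qed auto
    also have "\<dots> = ennreal (\<alpha> * (2 * lam) + \<beta> * (2 * s / k) + \<gamma>)"
    proof -
      have nn: "0 \<le> 2 * lam" "0 \<le> 2 * s / k" using lam s k by auto
      then show ?thesis
        unfolding ennreal_mult [OF assms(1) nn(1), symmetric] ennreal_mult [OF assms(2) nn(2), symmetric] mult_1_right
        using ennreal_plus [OF mult_nonneg_nonneg [OF assms(1) nn(1)] mult_nonneg_nonneg [OF assms(2) nn(2)]]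
          ennreal_plus [OF add_nonneg_nonneg [OF mult_nonneg_nonneg [OF assms(1) nn(1)] mult_nonneg_nonneg [OF assms(2) nn(2)]] assms(3)]
        by (simp only:)
    qed
    finally show ?thesis .
  qed
  have i1: "(\<integral>\<^sup>+ t. ?i t \<partial>lborel) = 1" by simp
  have "(\<integral>\<^sup>+ z. indicator unit_square z * ennreal (?P (fst z) + ?P (snd z)) \<partial>lborel) =
      (\<integral>\<^sup>+ x. \<integral>\<^sup>+ y. indicator unit_square (x, y) * ennreal (?P x + ?P y) \<partial>lborel \<partial>lborel)"
  proof -
    have "(\<lambda>z. indicator unit_square z * ennreal (?P (fst z) + ?P (snd z))) \<in> borel_measurable (borel \<Otimes>\<^sub>M borel)"
      by measurable
    then show ?thesis by (subst nn_integral_lborel_prod(1)) (auto simp: borel_prod)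
  qed
  also have "\<dots> = (\<integral>\<^sup>+ x. ?i x * ennreal (?P x) + ?i x * (\<integral>\<^sup>+ t. ?i t * ennreal (?P t) \<partial>lborel) \<partial>lborel)"
  proof (rule nn_integral_cong)
    fix x
    have "(\<integral>\<^sup>+ y. indicator unit_square (x, y) * ennreal (?P x + ?P y) \<partial>lborel) =
        (\<integral>\<^sup>+ y. (?i x * ennreal (?P x)) * ?i y + ?i x * (?i y * ennreal (?P y)) \<partial>lborel)"
      using P0 by (intro nn_integral_cong) (auto simp: indicator_def ennreal_plus)
    also have "\<dots> = ?i x * ennreal (?P x) * 1 + ?i x * (\<integral>\<^sup>+ t. ?i t * ennreal (?P t) \<partial>lborel)"
      by (simp add: nn_integral_add nn_integral_cmult)
    finally show "(\<integral>\<^sup>+ y. indicator unit_square (x, y) * ennreal (?P x + ?P y) \<partial>lborel) =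
        ?i x * ennreal (?P x) + ?i x * (\<integral>\<^sup>+ t. ?i t * ennreal (?P t) \<partial>lborel)" by simp
  qed
  also have "\<dots> = (\<integral>\<^sup>+ t. ?i t * ennreal (?P t) \<partial>lborel) + (\<integral>\<^sup>+ t. ?i t * ennreal (?P t) \<partial>lborel)"
    by (simp add: nn_integral_add nn_integral_multc)
  also have "\<dots> \<le> ennreal (\<alpha> * (2 * lam) + \<beta> * (2 * s / k) + \<gamma>) + ennreal (\<alpha> * (2 * lam) + \<beta> * (2 * s / k) + \<gamma>)"
    by (intro add_mono I)
  also have "\<dots> = ennreal (2 * (\<alpha> * (2 * lam) + \<beta> * (2 * s / k) + \<gamma>))"
    using assms lam s k by (subst ennreal_plus [symmetric]) auto
  finally show ?thesis .
qed

lemma in_cell_square: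
  assumes "(a, b) \<in> fine_itvs \<union> coarse_itvs" "x \<in> {a<..<b}"
  shows "x \<in> {0<..<1}" "x \<in> {0..1}"
  using open_cell_subset [OF assms(1)] assms(2) by auto

lemma Ist_fine: "(a, b) \<in> fine_itvs \<Longrightarrow> x \<in> {a<..<b} \<Longrightarrow> Ist x = 1"
  using fineD [of a b] unfolding Ist_def indicator_def by auto

text \<open>The cell containing a point is chosen pointwise, so estimates that are uniform over the
  cells integrate without a sum over the mesh.\<close>

lemma AE_square_le:
  assumes "\<And>x y a b c d. (a, b) \<in> fine_itvs \<union> coarse_itvs \<Longrightarrow> (c, d) \<in> fine_itvs \<union> coarse_itvs \<Longrightarrow>
      x \<in> {a<..<b} \<Longrightarrow> x \<notin> mp ` {0..N} \<Longrightarrow> y \<in> {c<..<d} \<Longrightarrow> y \<notin> mp ` {0..N} \<Longrightarrow> f (x, y) \<le> g (x, y)"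
  shows "(\<integral>\<^sup>+ z. indicator unit_square z * f z \<partial>lborel) \<le> (\<integral>\<^sup>+ z. indicator unit_square z * g z \<partial>lborel)"
proof (rule nn_integral_mono_AE)
  show "AE z in lborel. indicator unit_square z * f z \<le> indicator unit_square z * (g z :: ennreal)"
    using AE_off_mesh
  proof eventually_elim
    case (elim z)
    obtain x y where z: "z = (x, y)" by (cases z)
    show ?case
    proof (cases "z \<in> unit_square")
      case True
      then have xy: "0 < x" "x < 1" "0 < y" "y < 1" using z by auto
      obtain a b where "(a, b) \<in> fine_itvs \<union> coarse_itvs" "x \<in> {a<..<b}"
        using cells_cover [OF xy(1,2)] elim z by auto
      moreover obtain c d where "(c, d) \<in> fine_itvs \<union> coarse_itvs" "y \<in> {c<..<d}"
        using cells_cover [OF xy(3,4)] elim z by auto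
      ultimately have "f z \<le> g z" using assms elim z by auto
      then show ?thesis by (intro mult_left_mono) auto
    qed simp
  qed
qed

text \<open>The square of CC / (s^m n^(3-m)), the factor that \<open>CC * tgt m\<close> places in
  front of the layer expression.\<close>

definition q :: "nat \<Rightarrow> real" where "q m = CC\<^sup>2 / (s ^ (2 * m) * n ^ (2 * (3 - m)))"

lemma q0: "0 \<le> q m" unfolding q_def using s by simp

text \<open>The square of \<open>e\<close> is at most 4 times a sum of two values of
  \<open>rho\<close>, so a single power is left for integration. The constant 1 becomes a sum of
  indicators because one coordinate lies in a fine interval.\<close>

lemma tgt_square:
  assumes m: "m \<noteq> 0" and xy: "x \<in> {0..1}" "y \<in> {0..1}" and I: "1 \<le> Ist x + Ist y"
    and v: "\<bar>v\<bar> \<le> CC * tgt m (ex x + ex y)"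
  shows "v\<^sup>2 \<le> P (2 * q m) (8 * q m * L ^ (2 * (3 - m))) 0 x + P (2 * q m) (8 * q m * L ^ (2 * (3 - m))) 0 y"
proof -
  define e where "e = ex x + ex y"
  have e: "0 \<le> e" "e \<le> 4" "e \<le> rho x + rho y" unfolding e_def
    using ex_bounds(1) [of x] ex_bounds(1) [of y] ex_le2 [OF xy(1)] ex_le2 [OF xy(2)] ex_bounds(2) [OF xy(1)] ex_bounds(2) [OF xy(2)] by linarith+
  define l where "l = L ^ (3 - m)"
  have l: "l\<^sup>2 = L ^ (2 * (3 - m))" unfolding l_def by (simp add: power_mult [symmetric] mult.commute)
  have "v\<^sup>2 \<le> (CC * tgt m e)\<^sup>2" using power_mono [OF v, of 2] unfolding e_def by simp
  also have "\<dots> = q m * (1 + l * e)\<^sup>2"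
    using m unfolding tgt_def l_def [symmetric] q_def
    by (simp add: power_mult_distrib power_divide power_mult [symmetric] mult.commute)
  also have "\<dots> \<le> q m * (2 * (Ist x + Ist y) + 8 * l\<^sup>2 * (rho x + rho y))"
  proof (rule mult_left_mono [OF _ q0])
    have "(1 + l * e)\<^sup>2 \<le> 2 * 1 + 2 * (l * e)\<^sup>2" using sum_squares_bound [of 1 "l * e"] by (simp add: power2_sum)
    also have "(l * e)\<^sup>2 \<le> l\<^sup>2 * (4 * (rho x + rho y))"
      unfolding power_mult_distrib power2_eq_square [of e] using e by (intro mult_left_mono mult_mono) auto
    also have "2 * 1 \<le> 2 * (Ist x + Ist y)" using I by simp
    finally show "(1 + l * e)\<^sup>2 \<le> 2 * (Ist x + Ist y) + 8 * l\<^sup>2 * (rho x + rho y)" by (simp add: algebra_simps)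
  qed
  also have "\<dots> = P (2 * q m) (8 * q m * L ^ (2 * (3 - m))) 0 x + P (2 * q m) (8 * q m * L ^ (2 * (3 - m))) 0 y"
    unfolding P_def l [symmetric] by (simp add: algebra_simps)
  finally show ?thesis .
qed

lemma noncore_square:
  assumes J: "(a, b) \<in> fine_itvs \<union> coarse_itvs" and K: "(c, d) \<in> fine_itvs \<union> coarse_itvs"
    and nc: "\<not> ((a, b) \<in> coarse_itvs \<and> (c, d) \<in> coarse_itvs)"
    and x: "x \<in> {a<..<b}" "x \<notin> mp ` {0..N}" and y: "y \<in> {c<..<d}" "y \<notin> mp ` {0..N}"
    and ij: "i + j \<le> 2" "i + j = m" "m \<noteq> 0"
  shows "(pd i j w (x, y))\<^sup>2 \<le> P (2 * q m) (8 * q m * L ^ (2 * (3 - m))) 0 x + P (2 * q m) (8 * q m * L ^ (2 * (3 - m))) 0 y"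
proof -
  have xy: "x \<in> {0..1}" "y \<in> {0..1}" using in_cell_square J K x y by auto
  have Inn: "0 \<le> Ist t" for t by (simp add: Ist_def)
  have I: "1 \<le> Ist x + Ist y"
    using J K nc Ist_fine [OF _ x(1)] Ist_fine [OF _ y(1)] Inn [of x] Inn [of y] by auto
  have "\<bar>pd i j w (x, y)\<bar> \<le> CC * tgt m (ex x + ex y)"
    using J K nc h_strip(1) [OF _ _ x(1) y ij(1)] v_strip(1) [OF _ _ x y(1) ij(1)] corner [OF _ _ x y ij(1)] ij by auto
  from tgt_square [OF ij(3) xy I this] show ?thesis .
qed

lemma lam_le: "2 * lam \<le> G * s * L"
proof -
  have "h * n = 4 * lam" using n8 unfolding h_def by simp
  then show ?thesis using h_le lam by linarith
qed

text \<open>Both the measure 2 lam of the fine intervals and the integral of \<open>rho\<close>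
  carry a factor s; the logarithm in the measure is absorbed by \<open>l\<close>.\<close>

lemma int_scale:
  assumes "0 \<le> \<alpha>" "0 \<le> \<beta>" "\<alpha> \<le> 2 * q m" "\<beta> \<le> c * q m * l" "L \<le> l"
  shows "2 * (\<alpha> * (2 * lam) + \<beta> * (2 * s / k) + \<gamma>) \<le> 4 * (G + c / k) * (q m * l * s) + 2 * \<gamma>"
proof -
  have "\<alpha> * (2 * lam) \<le> (2 * q m) * (G * s * L)" using assms lam_le lam q0 [of m] by (intro mult_mono [of _ _ "2 * lam"]) auto
  also have "\<dots> \<le> (2 * q m) * (G * s * l)" using assms q0 [of m] G s by (intro mult_left_mono) auto
  finally have 1: "\<alpha> * (2 * lam) \<le> 2 * G * (q m * l * s)" by (simp add: mult_ac)
  have "\<beta> * (2 * s / k) \<le> (c * q m * l) * (2 * s / k)" using assms s k by (intro mult_right_mono) auto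
  then have 2: "\<beta> * (2 * s / k) \<le> 2 * (c / k) * (q m * l * s)" by (simp add: mult_ac)
  have "4 * (G + c / k) * (q m * l * s) = 2 * (2 * G * (q m * l * s)) + 2 * (2 * (c / k) * (q m * l * s))"
    by (simp add: algebra_simps)
  then show ?thesis using 1 2 unfolding distrib_left [of 2] by linarith
qed

lemma L_powers: "L \<le> L ^ 4" "L \<le> L\<^sup>2" "1 \<le> L ^ 4" "1 \<le> L ^ 6" "1 \<le> L ^ 3"
  using L1 by (auto simp: self_le_power)

subsection \<open>The error bounds\<close>

lemma pd00: "pd 0 0 v = v" by (simp add: pd_def)

lemma cubic_log: "L ^ 3 / n ^ 3 \<le> 27 * G / n\<^sup>2"
proof -
  have n0: "n > 0" using n8 by simp
  have "L ^ 3 / n ^ 3 \<le> 27 * n / n ^ 3" using ln_cube_le [of n] n8 by (intro divide_right_mono) auto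
  also have "\<dots> = 27 / n\<^sup>2" using n0 by (simp add: power2_eq_square power3_eq_cube)
  also have "\<dots> \<le> 27 * G / n\<^sup>2" using G by (simp add: divide_right_mono)
  finally show ?thesis .
qed

text \<open>\<open>P\<close> takes the terms that are integrated explicitly, and \<open>B\<close>
  those that are known only through integrals of third derivatives. The basic bounds use
  \<open>B = 0\<close>.\<close>

lemma square_le_L2:
  assumes "\<And>x y a b c d. (a, b) \<in> fine_itvs \<union> coarse_itvs \<Longrightarrow> (c, d) \<in> fine_itvs \<union> coarse_itvs \<Longrightarrow>
      x \<in> {a<..<b} \<Longrightarrow> x \<notin> mp ` {0..N} \<Longrightarrow> y \<in> {c<..<d} \<Longrightarrow> y \<notin> mp ` {0..N} \<Longrightarrow>
      ennreal ((v (x, y))\<^sup>2) \<le> ennreal (P \<alpha> \<beta> \<gamma> x + P \<alpha> \<beta> \<gamma> y) + 2 * B (x, y)"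
    and B: "B \<in> borel_measurable borel" "(\<integral>\<^sup>+ z. B z \<partial>lborel) \<le> ennreal b" "0 \<le> b"
    and abg: "0 \<le> \<alpha>" "0 \<le> \<beta>" "0 \<le> \<gamma>"
  shows "(L2_norm_on unit_square v)\<^sup>2 \<le> 2 * (\<alpha> * (2 * lam) + \<beta> * (2 * s / k) + \<gamma>) + 2 * b"
proof -
  let ?i = "indicator unit_square :: real \<times> real \<Rightarrow> ennreal"
  have um: "unit_square \<in> sets borel" by (intro borel_open open_Times open_greaterThanLessThan)
  have Pm: "(\<lambda>z. ennreal (P \<alpha> \<beta> \<gamma> (fst z) + P \<alpha> \<beta> \<gamma> (snd z))) \<in> borel_measurable (borel \<Otimes>\<^sub>M borel)" by measurable
  have "ennreal ((L2_norm_on unit_square v)\<^sup>2) \<le> (\<integral>\<^sup>+ z. ?i z * ennreal ((v z)\<^sup>2) \<partial>lborel)"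
    by (rule L2_norm_on_square_le_nn)
  also have "\<dots> \<le> (\<integral>\<^sup>+ z. ?i z * (ennreal (P \<alpha> \<beta> \<gamma> (fst z) + P \<alpha> \<beta> \<gamma> (snd z)) + 2 * B z) \<partial>lborel)"
    by (rule AE_square_le) (use assms(1) in auto)
  also have "\<dots> = (\<integral>\<^sup>+ z. ?i z * ennreal (P \<alpha> \<beta> \<gamma> (fst z) + P \<alpha> \<beta> \<gamma> (snd z)) \<partial>lborel) + (\<integral>\<^sup>+ z. ?i z * (2 * B z) \<partial>lborel)"
    unfolding distrib_left using Pm B(1) um
    by (intro nn_integral_add borel_measurable_times_ennreal borel_measurable_indicator) (auto simp: borel_prod)
  also have "\<dots> \<le> ennreal (2 * (\<alpha> * (2 * lam) + \<beta> * (2 * s / k) + \<gamma>)) + ennreal (2 * b)"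
  proof (intro add_mono nn_integral_P abg)
    have "(\<integral>\<^sup>+ z. ?i z * (2 * B z) \<partial>lborel) \<le> (\<integral>\<^sup>+ z. 2 * B z \<partial>lborel)"
      by (intro nn_integral_mono) (auto simp: indicator_def)
    also have "\<dots> = 2 * (\<integral>\<^sup>+ z. B z \<partial>lborel)" using B(1) by (intro nn_integral_cmult) auto
    also have "\<dots> \<le> 2 * ennreal b" by (intro mult_left_mono B) auto
    finally show "(\<integral>\<^sup>+ z. ?i z * (2 * B z) \<partial>lborel) \<le> ennreal (2 * b)" using B(3) by (simp add: ennreal_mult)
  qed
  also have "\<dots> = ennreal (2 * (\<alpha> * (2 * lam) + \<beta> * (2 * s / k) + \<gamma>) + 2 * b)"
    using abg lam s k B(3) by (intro ennreal_plus [symmetric]) auto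
  finally have *: "ennreal ((L2_norm_on unit_square v)\<^sup>2) \<le> ennreal (2 * (\<alpha> * (2 * lam) + \<beta> * (2 * s / k) + \<gamma>) + 2 * b)" .
  have "0 \<le> 2 * (\<alpha> * (2 * lam) + \<beta> * (2 * s / k) + \<gamma>) + 2 * b" using abg lam s k B(3) by auto
  then show ?thesis using * by (simp add: ennreal_le_iff)
qed

lemma H1_le:
  assumes "\<And>i j. i + j = 1 \<Longrightarrow> (L2_norm_on unit_square (pd i j v))\<^sup>2 \<le> Y"
  shows "H_seminorm_on 1 unit_square v \<le> sqrt (2 * Y)"
proof -
  have "(\<Sum>i\<le>1. (L2_norm_on unit_square (pd i (1 - i) v))\<^sup>2) \<le> 2 * Y"
    using assms [of 0 1] assms [of 1 0] by simp
  then show ?thesis unfolding H_seminorm_on_def by simp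
qed

text \<open>Every contribution is bounded pointwise by a multiple of N^-2, the logarithmic ones by
  L^3 <= 27 n. The estimate without logarithms yields two of the final bounds.\<close>

theorem error_L2: "L2_norm_on unit_square w \<le> 30 * CC * G / n\<^sup>2"
proof -
  have n0: "n > 0" using n8 by simp
  define p where "p = CC * (1 / n\<^sup>2) + CC * (27 * G / n\<^sup>2)"
  have p0: "0 \<le> p" unfolding p_def using CC0 G by simp
  have 1: "\<bar>w (x, y)\<bar> \<le> p"
    if J: "(a, b) \<in> fine_itvs \<union> coarse_itvs" and K: "(c, d) \<in> fine_itvs \<union> coarse_itvs"
    and x: "x \<in> {a<..<b}" "x \<notin> mp ` {0..N}" and y: "y \<in> {c<..<d}" "y \<notin> mp ` {0..N}" for a b c d x y
  proof -
    have t: "CC * tgt 0 e \<le> CC * (27 * G / n\<^sup>2)" for e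
      using cubic_log CC0 unfolding tgt_def by (intro mult_left_mono) auto
    have "1 / n ^ 3 \<le> L ^ 3 / n ^ 3" using L_powers by (intro divide_right_mono) auto
    then have "1 / n ^ 3 \<le> 27 * G / n\<^sup>2" using cubic_log by linarith
    then have "CC * (1 / n ^ 3) \<le> CC * (27 * G / n\<^sup>2)" using CC0 by (intro mult_left_mono) auto
    moreover have "0 \<le> CC * (1 / n\<^sup>2)" using CC0 by simp
    ultimately show ?thesis
      using J K h_strip [OF _ _ x(1) y, of 0 0] v_strip [OF _ _ x y(1), of 0 0]
        corner [OF _ _ x y, of 0 0] core [OF _ _ x(1) y(1), of 0 0] t [of "ex x + ex y"]
      unfolding p_def by (auto simp: pd00)
  qed
  \<comment> \<open>\<open>P\<close> is evaluated in both variables, so the constant is entered with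
    half its value.\<close>
  have "(L2_norm_on unit_square w)\<^sup>2 \<le> 2 * (0 * (2 * lam) + 0 * (2 * s / k) + p\<^sup>2 / 2) + 2 * 0"
  proof (rule square_le_L2 [where B = "\<lambda>_. 0"])
    fix x y a b c d assume *: "(a, b) \<in> fine_itvs \<union> coarse_itvs" "(c, d) \<in> fine_itvs \<union> coarse_itvs"
      "x \<in> {a<..<b}" "x \<notin> mp ` {0..N}" "y \<in> {c<..<d}" "y \<notin> mp ` {0..N}"
    have "(w (x, y))\<^sup>2 \<le> p\<^sup>2" using power_mono [OF 1 [OF *], of 2] by simp
    then show "ennreal ((w (x, y))\<^sup>2) \<le> ennreal (P 0 0 (p\<^sup>2 / 2) x + P 0 0 (p\<^sup>2 / 2) y) + 2 * 0"
      by (simp add: P_def ennreal_leI)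
  qed auto
  then have "(L2_norm_on unit_square w)\<^sup>2 \<le> p\<^sup>2" by simp
  then have "L2_norm_on unit_square w \<le> p" using p0 by (rule power2_le_imp_le)
  also have "p \<le> 30 * CC * G / n\<^sup>2"
  proof -
    have "CC * 1 \<le> CC * G" using CC0 G by (intro mult_left_mono) auto
    then have "CC * 1 + 27 * (CC * G) \<le> 30 * (CC * G)" using CC0 by linarith
    then have "(CC * 1 + 27 * (CC * G)) / n\<^sup>2 \<le> 30 * (CC * G) / n\<^sup>2" by (intro divide_right_mono) auto
    then show ?thesis unfolding p_def by (simp add: add_divide_distrib mult_ac)
  qed
  finally show ?thesis .
qed

lemma q1: "q 1 = CC\<^sup>2 / (s\<^sup>2 * n ^ 4)" "q 2 = CC\<^sup>2 / (s ^ 4 * n\<^sup>2)"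
  unfolding q_def by (simp_all add: eval_nat_numeral)

lemma rho_sum: "x \<in> {0..1} \<Longrightarrow> y \<in> {0..1} \<Longrightarrow> 0 \<le> rho x + rho y" "x \<in> {0..1} \<Longrightarrow> y \<in> {0..1} \<Longrightarrow> rho x + rho y \<le> 4"
  using ex_bounds(3,4) [of x] ex_bounds(3,4) [of y] by auto

lemma core_rest_square:
  assumes "x \<in> {0..1}" "y \<in> {0..1}"
  shows "(CC * (1 / n\<^sup>2 + (rho x + rho y) / (s * n\<^sup>2)))\<^sup>2 \<le> 2 * CC\<^sup>2 / n ^ 4 + 8 * q 1 * (rho x + rho y)"
proof -
  define r where "r = rho x + rho y"
  have r: "0 \<le> r" "r \<le> 4" unfolding r_def using rho_sum [OF assms] by auto
  have "(1 / n\<^sup>2 + r / (s * n\<^sup>2))\<^sup>2 \<le> 2 * (1 / n\<^sup>2)\<^sup>2 + 2 * (r / (s * n\<^sup>2))\<^sup>2"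
    using sum_squares_bound [of "1 / n\<^sup>2" "r / (s * n\<^sup>2)"] by (simp add: power2_sum)
  also have "\<dots> = 2 / n ^ 4 + 2 * r\<^sup>2 / (s\<^sup>2 * n ^ 4)"
    by (simp add: power_divide power_mult_distrib eval_nat_numeral mult_ac)
  also have "\<dots> \<le> 2 / n ^ 4 + 2 * (4 * r) / (s\<^sup>2 * n ^ 4)"
    using r s by (intro add_left_mono divide_right_mono) (auto simp: power2_eq_square mult_right_mono)
  finally have "CC\<^sup>2 * (1 / n\<^sup>2 + r / (s * n\<^sup>2))\<^sup>2 \<le> CC\<^sup>2 * (2 / n ^ 4 + 2 * (4 * r) / (s\<^sup>2 * n ^ 4))"
    by (rule mult_left_mono) simp
  moreover have "(CC * (1 / n\<^sup>2 + r / (s * n\<^sup>2)))\<^sup>2 = CC\<^sup>2 * (1 / n\<^sup>2 + r / (s * n\<^sup>2))\<^sup>2"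
    by (rule power_mult_distrib)
  moreover have "CC\<^sup>2 * (2 / n ^ 4 + 2 * (4 * r) / (s\<^sup>2 * n ^ 4)) = 2 * CC\<^sup>2 / n ^ 4 + 8 * q 1 * r"
    unfolding q1 by (simp add: distrib_left mult_ac)
  ultimately show ?thesis unfolding r_def by linarith
qed

lemma q1_s: "q 1 * L ^ 4 * s = CC\<^sup>2 * L ^ 4 / (s * n ^ 4)"
  unfolding q1 using s by (simp add: power2_eq_square field_simps)

text \<open>The layer terms of the squared norm integrate to a multiple of L^4 / (s n^4), and the
  weight sqrt s removes s. The smooth error CC / n on the coarse cells does not profit from the
  weight and leaves the term sqrt s / n.\<close>

theorem error_H1: "sqrt s * H_seminorm_on 1 unit_square w \<le> (sqrt (8 * (G + 12 / k)) + 4) * CC * (sqrt s / n + L\<^sup>2 / n\<^sup>2)"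
proof -
  have n0: "n > 0" using n8 by simp
  define Y where "Y = 4 * (G + 12 / k) * (q 1 * L ^ 4 * s) + 2 * (3 * CC\<^sup>2 / n\<^sup>2)"
  have *: "(L2_norm_on unit_square (pd i j w))\<^sup>2 \<le> Y" if ij: "i + j = 1" for i j
  proof -
    let ?P = "P (2 * q 1) (12 * q 1 * L ^ 4) (3 * CC\<^sup>2 / n\<^sup>2)"
    have "(L2_norm_on unit_square (pd i j w))\<^sup>2 \<le> 2 * (2 * q 1 * (2 * lam) + 12 * q 1 * L ^ 4 * (2 * s / k) + 3 * CC\<^sup>2 / n\<^sup>2) + 2 * 0"
    proof (rule square_le_L2 [where B = "\<lambda>_. 0"])
      fix x y a b c d assume J: "(a, b) \<in> fine_itvs \<union> coarse_itvs" and K: "(c, d) \<in> fine_itvs \<union> coarse_itvs"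
      and x: "x \<in> {a<..<b}" "x \<notin> mp ` {0..N}" and y: "y \<in> {c<..<d}" "y \<notin> mp ` {0..N}"
      have xy: "x \<in> {0..1}" "y \<in> {0..1}" using in_cell_square J K x y by auto
      have "(pd i j w (x, y))\<^sup>2 \<le> ?P x + ?P y"
      proof (cases "(a, b) \<in> coarse_itvs \<and> (c, d) \<in> coarse_itvs")
        case False
        have "(pd i j w (x, y))\<^sup>2 \<le> P (2 * q 1) (8 * q 1 * L ^ 4) 0 x + P (2 * q 1) (8 * q 1 * L ^ 4) 0 y"
          using noncore_square [OF J K False x y, of i j 1] ij by simp
        also have "\<dots> \<le> ?P x + ?P y" using q0 [of 1] CC0 by (intro add_mono P_mono) (auto intro!: mult_right_mono)
        finally show ?thesis .
      next
        case True
        then have "\<bar>pd i j w (x, y)\<bar> \<le> CC * (1 / n\<^sup>2 + (rho x + rho y) / (s * n\<^sup>2)) + CC / n"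
          using core [OF _ _ x(1) y(1), of i j] ij by simp
        then have "(pd i j w (x, y))\<^sup>2 \<le> (CC * (1 / n\<^sup>2 + (rho x + rho y) / (s * n\<^sup>2)) + CC / n)\<^sup>2"
          using power_mono [of "\<bar>pd i j w (x, y)\<bar>" _ 2] by simp
        also have "\<dots> \<le> 3 / 2 * (CC * (1 / n\<^sup>2 + (rho x + rho y) / (s * n\<^sup>2)))\<^sup>2 + 3 * (CC / n)\<^sup>2"
        proof -
          \<comment> \<open>The difference of the two sides is 2 (p/2 - r)^2. The weight 3/2 turns 8
            \<open>q 1\<close> into the 12 \<open>q 1\<close> of \<open>?P\<close>.\<close>
          have "(p + r)\<^sup>2 \<le> 3 / 2 * p\<^sup>2 + 3 * r\<^sup>2" for p r :: real
            using zero_le_power2 [of "p / 2 - r"] zero_le_power2 [of p] by (simp add: power2_eq_square algebra_simps)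
          then show ?thesis .
        qed
        also have "\<dots> \<le> 3 / 2 * (2 * CC\<^sup>2 / n ^ 4 + 8 * q 1 * (rho x + rho y)) + 3 * (CC / n)\<^sup>2"
          using core_rest_square [OF xy] by simp
        also have "\<dots> \<le> 6 * CC\<^sup>2 / n\<^sup>2 + 12 * q 1 * (rho x + rho y)"
        proof -
          have "CC\<^sup>2 / n ^ 4 \<le> CC\<^sup>2 / n\<^sup>2" using n8 by (intro divide_left_mono power_increasing) auto
          moreover have "3 / 2 * (2 * CC\<^sup>2 / n ^ 4 + 8 * q 1 * (rho x + rho y)) + 3 * (CC / n)\<^sup>2 =
              3 * (CC\<^sup>2 / n ^ 4) + 12 * q 1 * (rho x + rho y) + 3 * (CC\<^sup>2 / n\<^sup>2)"
            by (simp add: power_divide algebra_simps)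
          moreover have "6 * CC\<^sup>2 / n\<^sup>2 = 6 * (CC\<^sup>2 / n\<^sup>2)" by simp
          ultimately show ?thesis by linarith
        qed
        also have "\<dots> \<le> ?P x + ?P y"
        proof -
          have "12 * q 1 * (rho x + rho y) * 1 \<le> 12 * q 1 * (rho x + rho y) * L ^ 4"
            using q0 [of 1] L_powers rho_sum [OF xy] by (intro mult_left_mono) auto
          moreover have "0 \<le> 2 * q 1 * Ist t" for t using q0 [of 1] by (simp add: Ist_def)
          from this [of x] this [of y] have "0 \<le> 2 * q 1 * Ist x + 2 * q 1 * Ist y" by simp
          ultimately show ?thesis unfolding P_def by (simp add: algebra_simps)
        qed
        finally show ?thesis .
      qed
      then show "ennreal ((pd i j w (x, y))\<^sup>2) \<le> ennreal (?P x + ?P y) + 2 * 0" by (simp add: ennreal_leI)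
    qed (use q0 [of 1] L1 CC0 in auto)
    also have "\<dots> \<le> Y" unfolding Y_def using int_scale [of "2 * q 1" "12 * q 1 * L ^ 4" 1 12 "L ^ 4" "3 * CC\<^sup>2 / n\<^sup>2"] q0 [of 1] L_powers L1 by simp
    finally show ?thesis .
  qed
  have "sqrt s * H_seminorm_on 1 unit_square w \<le> sqrt s * sqrt (2 * Y)"
    using H1_le [OF *] s by (intro mult_left_mono) auto
  also have "\<dots> = sqrt (8 * (G + 12 / k) * (CC\<^sup>2 * L ^ 4 / n ^ 4) + 12 * (CC\<^sup>2 * s / n\<^sup>2))"
  proof -
    have "s * (2 * (4 * g * Z + 2 * (3 * C / m))) = 8 * g * (s * Z) + 12 * (C * s / m)" for g Z C m
      by (simp add: algebra_simps)
    moreover have "s * (CC\<^sup>2 * L ^ 4 / (s * n ^ 4)) = CC\<^sup>2 * L ^ 4 / n ^ 4" using s by simp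
    ultimately show ?thesis unfolding Y_def q1_s real_sqrt_mult [symmetric] by (simp only:)
  qed
  also have "\<dots> \<le> sqrt (8 * (G + 12 / k) * (CC\<^sup>2 * L ^ 4 / n ^ 4)) + sqrt (12 * (CC\<^sup>2 * s / n\<^sup>2))"
    using G k s by (intro sqrt_add_le_add_sqrt) auto
  also have "sqrt (8 * (G + 12 / k) * (CC\<^sup>2 * L ^ 4 / n ^ 4)) = sqrt (8 * (G + 12 / k)) * (CC * (L\<^sup>2 / n\<^sup>2))"
  proof -
    have "CC\<^sup>2 * L ^ 4 / n ^ 4 = (CC * (L\<^sup>2 / n\<^sup>2))\<^sup>2" by (simp add: power_mult_distrib power_divide)
    then show ?thesis using CC0 by (simp add: real_sqrt_mult)
  qed
  also have "sqrt (12 * (CC\<^sup>2 * s / n\<^sup>2)) \<le> 4 * (CC * (sqrt s / n))"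
  proof -
    have "12 * (CC\<^sup>2 * s / n\<^sup>2) \<le> (4 * (CC * (sqrt s / n)))\<^sup>2"
      using s by (simp add: power_mult_distrib power_divide) (intro divide_right_mono mult_right_mono; simp)
    then show ?thesis using CC0 s by (intro real_le_lsqrt) auto
  qed
  also have "sqrt (8 * (G + 12 / k)) * (CC * (L\<^sup>2 / n\<^sup>2)) + 4 * (CC * (sqrt s / n)) \<le>
      (sqrt (8 * (G + 12 / k)) + 4) * CC * (sqrt s / n + L\<^sup>2 / n\<^sup>2)"
  proof -
    have "0 \<le> 4 * (CC * (L\<^sup>2 / n\<^sup>2))" "0 \<le> sqrt (8 * (G + 12 / k)) * (CC * (sqrt s / n))"
      using CC0 s G k by auto
    then show ?thesis by (simp add: algebra_simps)
  qed
  finally show ?thesis by simp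
qed

text \<open>The squared norm is of order q 2 L^2 s = CC^2 L^2 / (s^3 n^2), so the weight s sqrt s
  cancels the powers of s exactly. The factor 3 counts the three second derivatives.\<close>

theorem error_H2: "s * sqrt s * macro_H2_error lam N w \<le> sqrt (12 * (G + 8 / k)) * CC * (L / n)"
proof -
  have move: "X * (g * Z) = g * V" if "X * Z = V" for X g Z V :: real using that by (simp add: mult.left_commute)
  have twelve: "3 * (4 * g * Z) = 12 * g * Z" for g Z :: real by simp
  have n0: "n > 0" using n8 by simp
  let ?P = "P (2 * q 2) (8 * q 2 * L\<^sup>2) 0"
  let ?g = "\<lambda>z. ennreal (?P (fst z) + ?P (snd z))"
  let ?M = "macro_elements lam N"
  define Y where "Y = 2 * (2 * q 2 * (2 * lam) + 8 * q 2 * L\<^sup>2 * (2 * s / k) + 0)"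
  have Y0: "0 \<le> Y" unfolding Y_def using q0 [of 2] lam s k by auto
  have fM: "finite ?M" unfolding macro_elements_def using finite_cells by auto
  have cells: "J \<in> fine_itvs \<union> coarse_itvs" "K \<in> fine_itvs \<union> coarse_itvs" "\<not> (J \<in> coarse_itvs \<and> K \<in> coarse_itvs)"
    if "(J, K) \<in> ?M" for J K
    using that fine_not_coarse [of J] fine_not_coarse [of K] unfolding macro_elements_def by blast+
  have ends: "a \<in> mp ` {0..N} \<and> b \<in> mp ` {0..N}" if "(a, b) \<in> fine_itvs \<union> coarse_itvs" for a b
    using that quarter unfolding Un_iff fine_iff coarse_iff by auto
  have om: "open_rect J K \<in> sets borel" for J K
    by (cases J; cases K) (auto intro!: borel_open open_Times)
  have gm: "?g \<in> borel_measurable borel"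
  proof -
    have "?g \<in> borel_measurable (borel \<Otimes>\<^sub>M borel)" by measurable
    then show ?thesis by (simp add: borel_prod)
  qed
  have cell: "ennreal ((L2_norm_on (rect J K) (pd i (2 - i) w))\<^sup>2) \<le> (\<integral>\<^sup>+ z. indicator (open_rect J K) z * ?g z \<partial>lborel)"
    if JK: "(J, K) \<in> ?M" and i: "i \<le> 2" for J K i
  proof -
    obtain a b c d where ab: "J = (a, b)" and cd: "K = (c, d)" by (cases J; cases K) auto
    note C = cells [OF JK, unfolded ab cd]
    have "(\<integral>\<^sup>+ z. indicator (rect J K) z * ennreal ((pd i (2 - i) w z)\<^sup>2) \<partial>lborel) \<le> (\<integral>\<^sup>+ z. indicator (open_rect J K) z * ?g z \<partial>lborel)"
    proof (rule nn_integral_mono_AE)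
      show "AE z in lborel. indicator (rect J K) z * ennreal ((pd i (2 - i) w z)\<^sup>2) \<le> indicator (open_rect J K) z * ?g z"
        using AE_off_mesh
      proof eventually_elim
        case (elim z)
        obtain x y where z: "z = (x, y)" by (cases z)
        show ?case
        proof (cases "z \<in> rect J K")
          case True
          have "x \<noteq> a" "x \<noteq> b" "y \<noteq> c" "y \<noteq> d"
            using elim ends [OF C(1)] ends [OF C(2)] unfolding z by auto
          moreover have "a \<le> x" "x \<le> b" "c \<le> y" "y \<le> d" using True unfolding z ab cd by auto
          ultimately have x: "x \<in> {a<..<b}" and y: "y \<in> {c<..<d}" by (simp_all add: less_le)
          have "(pd i (2 - i) w (x, y))\<^sup>2 \<le> ?P x + ?P y"
            using noncore_square [OF C x _ y, of i "2 - i" 2] elim i unfolding z by simp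
          then show ?thesis using x y by (auto simp: z ab cd indicator_def intro: ennreal_leI)
        qed simp
      qed
    qed
    then show ?thesis using L2_norm_on_square_le_nn order_trans by blast
  qed
  \<comment> \<open>The open macro-elements are disjoint, so the sum of the integrals is at most one
    integral over the square.\<close>
  have sumI: "(\<Sum>(J, K)\<in>?M. indicator (open_rect J K) z :: ennreal) \<le> indicator unit_square z" for z
  proof (cases "\<exists>J K. (J, K) \<in> ?M \<and> z \<in> open_rect J K")
    case True
    then obtain J K where JK: "(J, K) \<in> ?M" "z \<in> open_rect J K" by blast
    obtain a b c d where abcd: "J = (a, b)" "K = (c, d)" by (cases J; cases K) auto
    have I: "indicator (open_rect J' K') z = (if (J', K') = (J, K) then 1 else 0 :: ennreal)" if M: "(J', K') \<in> ?M" for J' K'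
    proof (cases "z \<in> open_rect J' K'")
      case True
      obtain a' b' c' d' where *: "J' = (a', b')" "K' = (c', d')" by (cases J'; cases K') auto
      have "J' = J" "K' = K"
        using cells_unique [of a b a' b' "fst z"] cells_unique [of c d c' d' "snd z"] cells [OF M] cells [OF JK(1)] True JK(2)
        unfolding abcd * by auto
      then show ?thesis using JK by simp
    next
      case False then show ?thesis using JK(2) by auto
    qed
    have "(\<Sum>(J, K)\<in>?M. indicator (open_rect J K) z :: ennreal) = (\<Sum>p\<in>?M. if p = (J, K) then 1 else 0)"
    proof (rule sum.cong [OF refl])
      fix p assume "p \<in> ?M"
      then show "((case p of (J, K) \<Rightarrow> indicator (open_rect J K) z) :: ennreal) = (if p = (J, K) then 1 else 0)"
        by (cases p) (simp only: prod.case I)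
    qed
    also have "\<dots> = 1" using fM JK by simp
    finally have "(\<Sum>(J, K)\<in>?M. indicator (open_rect J K) z :: ennreal) = 1" .
    moreover have "z \<in> unit_square"
      using JK(2) in_cell_square(1) [of a b "fst z"] in_cell_square(1) [of c d "snd z"] cells [OF JK(1)]
      unfolding abcd by (auto simp: mem_Times_iff)
    ultimately show ?thesis by simp
  next
    case False
    then have "(\<Sum>(J, K)\<in>?M. indicator (open_rect J K) z :: ennreal) = 0" by (auto intro!: sum.neutral simp: indicator_def)
    then show ?thesis by simp
  qed
  have "ennreal (\<Sum>(J, K)\<in>?M. (H_seminorm_on 2 (rect J K) w)\<^sup>2) =
      (\<Sum>(J, K)\<in>?M. \<Sum>i\<le>2. ennreal ((L2_norm_on (rect J K) (pd i (2 - i) w))\<^sup>2))"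
    unfolding H_seminorm_on_def case_prod_beta by (simp add: sum_nonneg)
  also have "\<dots> \<le> (\<Sum>(J, K)\<in>?M. \<Sum>i\<le>(2::nat). \<integral>\<^sup>+ z. indicator (open_rect J K) z * ?g z \<partial>lborel)"
  proof (rule sum_mono)
    fix p assume p: "p \<in> ?M"
    obtain J K where JK: "p = (J, K)" by (cases p)
    show "(case p of (J, K) \<Rightarrow> \<Sum>i\<le>2. ennreal ((L2_norm_on (rect J K) (pd i (2 - i) w))\<^sup>2)) \<le>
        (case p of (J, K) \<Rightarrow> \<Sum>i\<le>(2::nat). \<integral>\<^sup>+ z. indicator (open_rect J K) z * ?g z \<partial>lborel)"
      unfolding JK prod.case using p unfolding JK by (intro sum_mono cell) auto
  qed
  also have "\<dots> = (\<Sum>(J, K)\<in>?M. 3 * (\<integral>\<^sup>+ z. indicator (open_rect J K) z * ?g z \<partial>lborel))"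
    by simp
  also have "\<dots> = 3 * (\<Sum>(J, K)\<in>?M. \<integral>\<^sup>+ z. indicator (open_rect J K) z * ?g z \<partial>lborel)"
    by (simp add: sum_distrib_left case_prod_beta)
  also have "(\<Sum>(J, K)\<in>?M. \<integral>\<^sup>+ z. indicator (open_rect J K) z * ?g z \<partial>lborel) =
      (\<integral>\<^sup>+ z. (\<Sum>(J, K)\<in>?M. indicator (open_rect J K) z * ?g z) \<partial>lborel)"
    unfolding case_prod_beta using gm om
    by (intro nn_integral_sum [symmetric] borel_measurable_times_ennreal borel_measurable_indicator) auto
  also have "\<dots> \<le> (\<integral>\<^sup>+ z. indicator unit_square z * ?g z \<partial>lborel)"
  proof (rule nn_integral_mono)
    fix z
    have "(\<Sum>(J, K)\<in>?M. indicator (open_rect J K) z * ?g z) = (\<Sum>(J, K)\<in>?M. indicator (open_rect J K) z) * ?g z"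
      by (simp add: sum_distrib_right case_prod_beta)
    then show "(\<Sum>(J, K)\<in>?M. indicator (open_rect J K) z * ?g z) \<le> indicator unit_square z * ?g z"
      using mult_right_mono [OF sumI [of z], of "?g z"] by simp
  qed
  also have "\<dots> \<le> ennreal Y" unfolding Y_def by (intro nn_integral_P) (use q0 [of 2] in auto)
  finally have "ennreal (\<Sum>(J, K)\<in>?M. (H_seminorm_on 2 (rect J K) w)\<^sup>2) \<le> 3 * ennreal Y" by (simp add: mult_left_mono)
  then have "ennreal (\<Sum>(J, K)\<in>?M. (H_seminorm_on 2 (rect J K) w)\<^sup>2) \<le> ennreal (3 * Y)"
    using Y0 by (simp add: ennreal_mult)
  then have "(\<Sum>(J, K)\<in>?M. (H_seminorm_on 2 (rect J K) w)\<^sup>2) \<le> 3 * Y" using Y0 by (simp add: ennreal_le_iff)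
  also have "3 * Y \<le> 3 * (4 * (G + 8 / k) * (q 2 * L\<^sup>2 * s))"
    unfolding Y_def using int_scale [of "2 * q 2" "8 * q 2 * L\<^sup>2" 2 8 "L\<^sup>2" 0] q0 [of 2] L_powers by simp
  also have "3 * (4 * (G + 8 / k) * (q 2 * L\<^sup>2 * s)) = 12 * (G + 8 / k) * (q 2 * L\<^sup>2 * s)"
    by (rule twelve)
  finally have Z: "macro_H2_error lam N w \<le> sqrt (12 * (G + 8 / k) * (q 2 * L\<^sup>2 * s))"
    unfolding macro_H2_error_def by (rule real_sqrt_le_mono)
  have ss: "s * sqrt s = sqrt (s ^ 3)"
    using s by (simp add: eval_nat_numeral real_sqrt_mult)
  have "s * sqrt s * macro_H2_error lam N w \<le> sqrt (s ^ 3) * sqrt (12 * (G + 8 / k) * (q 2 * L\<^sup>2 * s))"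
    unfolding ss using Z s by (intro mult_left_mono) auto
  also have "\<dots> = sqrt (12 * (G + 8 / k) * (CC * (L / n))\<^sup>2)"
  proof -
    have "s ^ 3 * (q 2 * L\<^sup>2 * s) = (CC * (L / n))\<^sup>2"
      unfolding q1 using s by (simp add: power_mult_distrib power_divide eval_nat_numeral)
    then have "s ^ 3 * (12 * (G + 8 / k) * (q 2 * L\<^sup>2 * s)) = 12 * (G + 8 / k) * (CC * (L / n))\<^sup>2"
      by (rule move)
    then show ?thesis unfolding real_sqrt_mult [symmetric] by simp
  qed
  also have "\<dots> = sqrt (12 * (G + 8 / k)) * CC * (L / n)"
    using CC0 L1 by (simp add: real_sqrt_mult)
  finally show ?thesis .
qed

section \<open>Improved bounds from third derivatives in L2\<close>

lemma square_meas: "unit_square \<in> sets borel" "unit_square \<subseteq> closed_unit_square"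
  by (auto intro!: borel_open open_Times)

lemma sqr_meas: "C3_jet V \<Longrightarrow> i + j \<le> 3 \<Longrightarrow> D \<in> sets borel \<Longrightarrow> D \<subseteq> closed_unit_square \<Longrightarrow> sqr (V i j) D \<in> borel_measurable borel"
  unfolding C3_jet_def by (intro sqr_measurable) auto

lemma window_bound:
  assumes "F \<in> borel_measurable borel" "(\<integral>\<^sup>+ z. F z \<partial>lborel) \<le> ennreal \<kappa>" "0 \<le> \<kappa>"
  shows "(\<integral>\<^sup>+ z. window_x H F z \<partial>lborel) \<le> ennreal (2 * H * \<kappa>)" "(\<integral>\<^sup>+ z. window_y H F z \<partial>lborel) \<le> ennreal (2 * H * \<kappa>)"
proof -
  have H0: "0 \<le> H" using hH by simp
  have "ennreal (2 * H) * (\<integral>\<^sup>+ z. F z \<partial>lborel) \<le> ennreal (2 * H) * ennreal \<kappa>" by (intro mult_left_mono assms) auto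
  also have "\<dots> = ennreal (2 * H * \<kappa>)" using H0 assms(3) by (simp add: ennreal_mult)
  finally show "(\<integral>\<^sup>+ z. window_x H F z \<partial>lborel) \<le> ennreal (2 * H * \<kappa>)" "(\<integral>\<^sup>+ z. window_y H F z \<partial>lborel) \<le> ennreal (2 * H * \<kappa>)"
    unfolding nn_integral_window [OF assms(1) H0] by auto
qed

lemma nn_integral_scaled:
  assumes "F \<in> borel_measurable borel" "(\<integral>\<^sup>+ z. F z \<partial>lborel) \<le> ennreal \<kappa>" "0 \<le> \<kappa>" "0 \<le> c"
  shows "(\<integral>\<^sup>+ z. ennreal c * F z \<partial>lborel) \<le> ennreal (c * \<kappa>)"
proof -
  have "(\<integral>\<^sup>+ z. ennreal c * F z \<partial>lborel) = ennreal c * (\<integral>\<^sup>+ z. F z \<partial>lborel)" using assms(1) by (intro nn_integral_cmult) auto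
  also have "\<dots> \<le> ennreal c * ennreal \<kappa>" by (intro mult_left_mono assms) auto
  finally show ?thesis using assms by (simp add: ennreal_mult)
qed

lemma nn_integral_plus_le:
  assumes "F \<in> borel_measurable borel" "(\<integral>\<^sup>+ z. F z \<partial>lborel) \<le> ennreal p" "0 \<le> p"
    and "F' \<in> borel_measurable borel" "(\<integral>\<^sup>+ z. F' z \<partial>lborel) \<le> ennreal r" "0 \<le> r"
  shows "(\<integral>\<^sup>+ z. F z + F' z \<partial>lborel) \<le> ennreal (p + r)"
proof -
  have "(\<integral>\<^sup>+ z. F z + F' z \<partial>lborel) = (\<integral>\<^sup>+ z. F z \<partial>lborel) + (\<integral>\<^sup>+ z. F' z \<partial>lborel)"
    using assms by (intro nn_integral_add) auto
  also have "\<dots> \<le> ennreal p + ennreal r" by (intro add_mono assms)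
  finally show ?thesis using assms by (simp add: ennreal_plus)
qed

text \<open>The assumption allows squared third derivatives of size 1/s. The windows then give the
  squared smooth error the order 1 / (s n^4), the same as the layers up to logarithms, and the term
  sqrt s / n disappears.\<close>

theorem error_H1_smooth:
  assumes \<kappa>: "0 \<le> \<kappa>" "\<And>i j. i + j = 3 \<Longrightarrow> (\<integral>\<^sup>+ z. sqr (S i j) unit_square z \<partial>lborel) \<le> ennreal (\<kappa> / s)"
  shows "sqrt s * H_seminorm_on 1 unit_square w \<le> sqrt (8 * (G + 16 / k) * CC\<^sup>2 + 8 * CC\<^sup>2 + 10 ^ 8 * \<kappa>) * (L\<^sup>2 / n\<^sup>2)"
proof -
  have n0: "n > 0" using n8 by simp
  have S: "C3_jet S" by (rule layersD(1) [OF lay])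
  note D = square_meas
  have ks: "0 \<le> \<kappa> / s" using \<kappa> s by simp
  have H0: "0 \<le> H" using hH by simp
  \<comment> \<open>The windows give (512 * 2 + 131072 * 4) H^4, and H <= 2 / n adds a factor 16, in
    total 8404992 < 16 * 10^6.\<close>
  define b where "b = 4 * 10 ^ 6 * (\<kappa> / s) * 4 / n ^ 4"
  define Bx where "Bx = (\<lambda>z. ennreal (512 * H ^ 3) * window_x H (sqr (S 3 0) unit_square) z +
     ennreal (131072 * H\<^sup>2) * window_x H (window_y H (sqr (S 1 2) unit_square)) z)"
  define By where "By = (\<lambda>z. ennreal (512 * H ^ 3) * window_y H (sqr (S 0 3) unit_square) z +
     ennreal (131072 * H\<^sup>2) * window_y H (window_x H (sqr (S 2 1) unit_square)) z)"
  note sm = sqr_meas [OF S _ D]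
  have Bm: "Bx \<in> borel_measurable borel" "By \<in> borel_measurable borel"
    unfolding Bx_def By_def
    by (intro borel_measurable_add borel_measurable_times_ennreal borel_measurable_const window_measurable sm; simp)+
  have bb: "512 * H ^ 3 * (2 * H * (\<kappa> / s)) + 131072 * H\<^sup>2 * (2 * H * (2 * H * (\<kappa> / s))) \<le> b"
  proof -
    have "512 * H ^ 3 * (2 * H * (\<kappa> / s)) + 131072 * H\<^sup>2 * (2 * H * (2 * H * (\<kappa> / s))) = 525312 * (\<kappa> / s) * H ^ 4"
      by (simp add: eval_nat_numeral algebra_simps)
    also have "\<dots> \<le> 525312 * (\<kappa> / s) * (2 / n) ^ 4" using H_inverse hH ks by (intro mult_left_mono power_mono) auto
    also have "\<dots> = 8404992 * (\<kappa> / s) / n ^ 4" by (simp add: power_divide)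
    also have "\<dots> \<le> b" unfolding b_def using ks by (intro divide_right_mono) auto
    finally show ?thesis .
  qed
  have b0: "0 \<le> b" unfolding b_def using \<kappa>(1) s by simp
  have Bb: "(\<integral>\<^sup>+ z. Bx z \<partial>lborel) \<le> ennreal b" "(\<integral>\<^sup>+ z. By z \<partial>lborel) \<le> ennreal b"
  proof -
    have 1: "(\<integral>\<^sup>+ z. Bx z \<partial>lborel) \<le> ennreal (512 * H ^ 3 * (2 * H * (\<kappa> / s)) + 131072 * H\<^sup>2 * (2 * H * (2 * H * (\<kappa> / s))))"
      unfolding Bx_def using H0 \<kappa>(1) s
      by (intro nn_integral_plus_le nn_integral_scaled window_bound borel_measurable_times_ennreal borel_measurable_const window_measurable sm \<kappa>(2)) auto
    have 2: "(\<integral>\<^sup>+ z. By z \<partial>lborel) \<le> ennreal (512 * H ^ 3 * (2 * H * (\<kappa> / s)) + 131072 * H\<^sup>2 * (2 * H * (2 * H * (\<kappa> / s))))"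
      unfolding By_def using H0 \<kappa>(1) s
      by (intro nn_integral_plus_le nn_integral_scaled window_bound borel_measurable_times_ennreal borel_measurable_const window_measurable sm \<kappa>(2)) auto
    show "(\<integral>\<^sup>+ z. Bx z \<partial>lborel) \<le> ennreal b" "(\<integral>\<^sup>+ z. By z \<partial>lborel) \<le> ennreal b"
      using order_trans [OF 1 ennreal_leI [OF bb]] order_trans [OF 2 ennreal_leI [OF bb]] by auto
  qed
  define Y where "Y = 4 * (G + 16 / k) * (q 1 * L ^ 4 * s) + 2 * (2 * CC\<^sup>2 / n ^ 4) + 2 * b"
  have *: "(L2_norm_on unit_square (pd i j w))\<^sup>2 \<le> Y" if ij: "i + j = 1" for i j
  proof -
    let ?P = "P (2 * q 1) (16 * q 1 * L ^ 4) (2 * CC\<^sup>2 / n ^ 4)"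
    define B where "B = (if i = 1 then Bx else By)"
    have "(L2_norm_on unit_square (pd i j w))\<^sup>2 \<le> 2 * (2 * q 1 * (2 * lam) + 16 * q 1 * L ^ 4 * (2 * s / k) + 2 * CC\<^sup>2 / n ^ 4) + 2 * b"
    proof (rule square_le_L2 [where B = B])
      fix x y a b c d assume J: "(a, b) \<in> fine_itvs \<union> coarse_itvs" and K: "(c, d) \<in> fine_itvs \<union> coarse_itvs"
      and x: "x \<in> {a<..<b}" "x \<notin> mp ` {0..N}" and y: "y \<in> {c<..<d}" "y \<notin> mp ` {0..N}"
      have xy: "x \<in> {0..1}" "y \<in> {0..1}" using in_cell_square J K x y by auto
      show "ennreal ((pd i j w (x, y))\<^sup>2) \<le> ennreal (?P x + ?P y) + 2 * B (x, y)"
      proof (cases "(a, b) \<in> coarse_itvs \<and> (c, d) \<in> coarse_itvs")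
        case False
        have "(pd i j w (x, y))\<^sup>2 \<le> P (2 * q 1) (8 * q 1 * L ^ 4) 0 x + P (2 * q 1) (8 * q 1 * L ^ 4) 0 y"
          using noncore_square [OF J K False x y, of i j 1] ij by simp
        also have "\<dots> \<le> ?P x + ?P y" using q0 [of 1] CC0 by (intro add_mono P_mono) (auto intro!: mult_right_mono)
        finally show ?thesis by (intro add_increasing2) (auto intro: ennreal_leI)
      next
        case True
        note ab = coarseD [OF conjunct1 [OF True]] and cd = coarseD [OF conjunct2 [OF True]]
        have sub: "{a..b} \<subseteq> {0..1}" "{c..d} \<subseteq> {0..1}" "{a<..<b} \<times> {c<..<d} \<subseteq> unit_square" using ab cd by auto
        define e where "e = e_core i j x y a b c d"
        define r where "r = pd i j w (x, y) - e"
        have "\<bar>r\<bar> \<le> CC * (1 / n\<^sup>2 + (rho x + rho y) / (s * n\<^sup>2))"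
          using core(1) [OF _ _ x(1) y(1), of i j] True ij unfolding r_def e_def by simp
        then have "r\<^sup>2 \<le> (CC * (1 / n\<^sup>2 + (rho x + rho y) / (s * n\<^sup>2)))\<^sup>2"
          using power_mono [of "\<bar>r\<bar>" _ 2] by simp
        also have "\<dots> \<le> 2 * CC\<^sup>2 / n ^ 4 + 8 * q 1 * (rho x + rho y)" by (rule core_rest_square [OF xy])
        finally have r: "2 * r\<^sup>2 \<le> ?P x + ?P y"
        proof -
          assume *: "r\<^sup>2 \<le> 2 * CC\<^sup>2 / n ^ 4 + 8 * q 1 * (rho x + rho y)"
          have "16 * q 1 * (rho x + rho y) * 1 \<le> 16 * q 1 * (rho x + rho y) * L ^ 4"
            using q0 [of 1] L_powers rho_sum [OF xy] by (intro mult_left_mono) auto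
          moreover have "0 \<le> 2 * q 1 * Ist t" for t using q0 [of 1] by (simp add: Ist_def)
          from this [of x] this [of y] have "0 \<le> 2 * q 1 * Ist x + 2 * q 1 * Ist y" by simp
          ultimately show ?thesis using * unfolding P_def by (simp add: algebra_simps)
        qed
        have e: "ennreal (e\<^sup>2) \<le> B (x, y)"
        proof -
          have c: "2 * (ennreal (256 * H ^ 3) * F + ennreal (65536 * H\<^sup>2) * F') = ennreal (512 * H ^ 3) * F + ennreal (131072 * H\<^sup>2) * F'" for F F'
          proof -
            have "(2::ennreal) * ennreal (256 * H ^ 3) = ennreal (512 * H ^ 3)" "(2::ennreal) * ennreal (65536 * H\<^sup>2) = ennreal (131072 * H\<^sup>2)"
              using H0 by (simp_all add: ennreal_mult [symmetric] flip: ennreal_numeral)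
            then show ?thesis by (simp add: distrib_left mult.assoc [symmetric])
          qed
          have "(i = 1 \<and> j = 0) \<or> (i = 0 \<and> j = 1)" using ij by auto
          then show ?thesis
            using core_L2(2) [OF S ab(1) sub(1) cd(1) sub(2) x(1) y(1) ab(2) cd(2) sub(3) D]
              core_L2_y [OF S ab(1) sub(1) cd(1) sub(2) x(1) y(1) ab(2) cd(2)]
            unfolding e_def e_core_def B_def Bx_def By_def c by auto
        qed
        have "ennreal ((pd i j w (x, y))\<^sup>2) = ennreal ((e + r)\<^sup>2)" unfolding r_def by simp
        also have "\<dots> \<le> 2 * (ennreal (e\<^sup>2) + ennreal (r\<^sup>2))" by (rule ennreal_square_sum2)
        also have "\<dots> = ennreal (2 * r\<^sup>2) + 2 * ennreal (e\<^sup>2)" by (simp add: distrib_left ennreal_mult add.commute)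
        also have "\<dots> \<le> ennreal (?P x + ?P y) + 2 * B (x, y)"
          by (intro add_mono mult_left_mono e ennreal_leI r) auto
        finally show ?thesis .
      qed
    qed (use q0 [of 1] L1 CC0 b0 Bm Bb in \<open>auto simp: B_def\<close>)
    also have "\<dots> \<le> Y" unfolding Y_def using int_scale [of "2 * q 1" "16 * q 1 * L ^ 4" 1 16 "L ^ 4" "2 * CC\<^sup>2 / n ^ 4"] q0 [of 1] L_powers L1 by simp
    finally show ?thesis .
  qed
  have "sqrt s * H_seminorm_on 1 unit_square w \<le> sqrt s * sqrt (2 * Y)"
    using H1_le [OF *] s by (intro mult_left_mono) auto
  also have "\<dots> = sqrt (s * (2 * Y))" by (simp add: real_sqrt_mult)
  also have "\<dots> \<le> sqrt ((8 * (G + 16 / k) * CC\<^sup>2 + 8 * CC\<^sup>2 + 10 ^ 8 * \<kappa>) * (L\<^sup>2 / n\<^sup>2)\<^sup>2)"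
  proof (rule real_sqrt_le_mono)
    have "s * (2 * (4 * g * Z + 2 * (2 * C) + 2 * (4 * 10 ^ 6 * K' * 4 * m))) = 8 * g * (s * Z) + 8 * (s * C) + 64 * 10 ^ 6 * (s * K') * m" for g Z C m K'
      by (simp add: algebra_simps)
    from this [of "G + 16 / k" "CC\<^sup>2 * L ^ 4 / (s * n ^ 4)" "CC\<^sup>2 / n ^ 4" "\<kappa> / s" "1 / n ^ 4"]
    have "s * (2 * Y) = 8 * (G + 16 / k) * (s * (CC\<^sup>2 * L ^ 4 / (s * n ^ 4))) + 8 * (s * (CC\<^sup>2 / n ^ 4)) + 64 * 10 ^ 6 * (s * (\<kappa> / s)) * (1 / n ^ 4)"
      unfolding Y_def q1_s b_def by simp
    also have "s * (CC\<^sup>2 * L ^ 4 / (s * n ^ 4)) = CC\<^sup>2 * L ^ 4 / n ^ 4" using s by simp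
    also have "s * (\<kappa> / s) = \<kappa>" using s by simp
    also have "8 * (G + 16 / k) * (CC\<^sup>2 * L ^ 4 / n ^ 4) + 8 * (s * (CC\<^sup>2 / n ^ 4)) + 64 * 10 ^ 6 * \<kappa> * (1 / n ^ 4)
       \<le> 8 * (G + 16 / k) * (CC\<^sup>2 * L ^ 4 / n ^ 4) + 8 * (CC\<^sup>2 * L ^ 4 / n ^ 4) + 10 ^ 8 * \<kappa> * (L ^ 4 / n ^ 4)"
    proof (intro add_mono mult_left_mono order_refl)
      have "s * (CC\<^sup>2 / n ^ 4) \<le> 1 * (CC\<^sup>2 / n ^ 4)" using s by (intro mult_right_mono) auto
      also have "\<dots> \<le> CC\<^sup>2 * L ^ 4 / n ^ 4" using L_powers by (simp add: divide_right_mono mult_le_cancel_left1)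
      finally show "s * (CC\<^sup>2 / n ^ 4) \<le> CC\<^sup>2 * L ^ 4 / n ^ 4" .
      show "64 * 10 ^ 6 * \<kappa> * (1 / n ^ 4) \<le> 10 ^ 8 * \<kappa> * (L ^ 4 / n ^ 4)"
        using \<kappa> L_powers by (intro mult_mono divide_right_mono) auto
    qed (use G k in auto)
    also have "\<dots> = (8 * (G + 16 / k) * CC\<^sup>2 + 8 * CC\<^sup>2 + 10 ^ 8 * \<kappa>) * (L\<^sup>2 / n\<^sup>2)\<^sup>2"
    proof -
      have e: "L ^ 4 / n ^ 4 = (L\<^sup>2 / n\<^sup>2)\<^sup>2" "CC\<^sup>2 * L ^ 4 / n ^ 4 = CC\<^sup>2 * (L\<^sup>2 / n\<^sup>2)\<^sup>2"
        by (simp_all add: power_divide)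
      show ?thesis unfolding e by (simp only: distrib_right mult.assoc)
    qed
    finally show "s * (2 * Y) \<le> (8 * (G + 16 / k) * CC\<^sup>2 + 8 * CC\<^sup>2 + 10 ^ 8 * \<kappa>) * (L\<^sup>2 / n\<^sup>2)\<^sup>2" .
  qed
  also have "\<dots> = sqrt (8 * (G + 16 / k) * CC\<^sup>2 + 8 * CC\<^sup>2 + 10 ^ 8 * \<kappa>) * (L\<^sup>2 / n\<^sup>2)"
    by (simp add: real_sqrt_mult)
  finally show ?thesis .
qed

text \<open>In a strip, \<open>p\<close> is the error of S along the edge and \<open>r\<close> that
  of the layer at this edge, both known through integrals; \<open>t\<close> belongs to the layer at
  the opposite edge and has a pointwise bound.\<close>

lemma square_three_plus_rest:
  assumes "ennreal (p\<^sup>2) \<le> X1" "ennreal (r\<^sup>2) \<le> X2" "\<bar>t\<bar> \<le> c" "\<bar>v - (p + r + t)\<bar> \<le> d"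
  shows "ennreal (v\<^sup>2) \<le> ennreal (8 * c\<^sup>2 + 2 * d\<^sup>2) + 2 * (4 * (X1 + X2))"
proof -
  have t: "t\<^sup>2 \<le> c\<^sup>2" and d: "(v - (p + r + t))\<^sup>2 \<le> d\<^sup>2"
    using power_mono [OF assms(3), of 2] power_mono [OF assms(4), of 2] by simp_all
  have "ennreal (v\<^sup>2) = ennreal (((p + r + t) + (v - (p + r + t)))\<^sup>2)" by simp
  also have "\<dots> \<le> 2 * (ennreal ((p + r + t)\<^sup>2) + ennreal ((v - (p + r + t))\<^sup>2))" by (rule ennreal_square_sum2)
  also have "\<dots> \<le> 2 * (4 * (ennreal (p\<^sup>2) + ennreal (r\<^sup>2) + ennreal (t\<^sup>2)) + ennreal ((v - (p + r + t))\<^sup>2))"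
    by (intro mult_left_mono add_mono ennreal_square_sum3) auto
  also have "\<dots> \<le> 2 * (4 * (X1 + X2 + ennreal (c\<^sup>2)) + ennreal (d\<^sup>2))"
    by (intro mult_left_mono add_mono assms ennreal_leI t d) auto
  also have "\<dots> = ennreal (8 * c\<^sup>2 + 2 * d\<^sup>2) + 2 * (4 * (X1 + X2))"
  proof -
    have "ennreal (8 * c\<^sup>2 + 2 * d\<^sup>2) = 8 * ennreal (c\<^sup>2) + 2 * ennreal (d\<^sup>2)" by (simp add: ennreal_plus ennreal_mult)
    then show ?thesis by (simp add: distrib_left mult.assoc [symmetric] add_ac)
  qed
  finally show ?thesis .
qed

text \<open>Used for the layer at the opposite edge, which is so small that its value and its
  interpolant may be estimated separately, giving 1 + 16.\<close>

lemma AH_small: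
  assumes "a < b" "x \<in> {a..b}" "\<And>t. t \<in> {a..b} \<Longrightarrow> \<bar>V 0 0 t y\<bar> \<le> m"
  shows "\<bar>AH V x y a b\<bar> \<le> 17 * m"
proof -
  have "\<bar>lag 0 a b (\<lambda>\<xi>. V 0 0 \<xi> y) x\<bar> \<le> 16 * m / (b - a) ^ 0"
    by (rule lag_stable_nodes [OF assms(1,2)]) (use assms nodes_sub in blast)
  then show ?thesis using assms(3) [OF assms(2)] unfolding AH_def by simp
qed

lemma exp_far:
  assumes "lam \<le> t"
  shows "M * exp (- (3 * k) * t / s) \<le> CC / n ^ 3"
proof -
  have n0: "n > 0" using n8 by simp
  have "- (3 * k) * t / s \<le> - (3 * k) * lam / s" using assms s k by (intro divide_right_mono) auto
  then have "exp (- (3 * k) * t / s) * n ^ 3 \<le> exp (- (3 * k) * lam / s) * n ^ 3" by (intro mult_right_mono) auto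
  then have "exp (- (3 * k) * t / s) * n ^ 3 \<le> G" using t3 by linarith
  then have "exp (- (3 * k) * t / s) \<le> G / n ^ 3" using n0 by (simp only: pos_le_divide_eq zero_less_power)
  then have "M * exp (- (3 * k) * t / s) \<le> M * (G / n ^ 3)" using M0 by (rule mult_left_mono)
  also have "\<dots> \<le> CC / n ^ 3" using CC0 by (simp add: divide_right_mono)
  finally show ?thesis .
qed

lemma AH_add: "AH (\<lambda>i j x y. V i j x y + W i j x y) x y a b = AH V x y a b + AH W x y a b"
  unfolding AH_def lag_add by simp

lemma AH_cong:
  assumes "a < b" "x \<in> {a..b}" "\<And>t. t \<in> {a..b} \<Longrightarrow> V 0 0 t y = W 0 0 t y"
  shows "AH V x y a b = AH W x y a b"
  unfolding AH_def using assms by (auto intro!: lag_cong)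

text \<open>Outside the corners the terms of order N^-2 are replaced by integrals of third
  derivatives, for which the windows give a factor H^6. All other contributions are already of order
  L^3 / n^3 pointwise.\<close>

theorem error_L2_smooth:
  assumes \<kappa>: "0 \<le> \<kappa>" "\<And>i j. i + j = 3 \<Longrightarrow> (\<integral>\<^sup>+ z. sqr (S i j) unit_square z \<partial>lborel) \<le> ennreal \<kappa>"
    "(\<integral>\<^sup>+ z. sqr (E1 3 0) (Omega1 lam) z \<partial>lborel) \<le> ennreal \<kappa>" "(\<integral>\<^sup>+ z. sqr (E3 3 0) (Omega3 lam) z \<partial>lborel) \<le> ennreal \<kappa>"
    "(\<integral>\<^sup>+ z. sqr (E2 0 3) (Omega2 lam) z \<partial>lborel) \<le> ennreal \<kappa>" "(\<integral>\<^sup>+ z. sqr (E4 0 3) (Omega4 lam) z \<partial>lborel) \<le> ennreal \<kappa>"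
  shows "L2_norm_on unit_square w \<le> sqrt (2400 * CC\<^sup>2 + 10 ^ 9 * \<kappa>) * (L ^ 3 / n ^ 3)"
proof -
  have n0: "n > 0" using n8 by simp
  have S: "C3_jet S" by (rule layersD(1) [OF lay])
  note D = square_meas
  have O: "Omega1 lam \<in> sets borel" "Omega2 lam \<in> sets borel" "Omega3 lam \<in> sets borel" "Omega4 lam \<in> sets borel"
    "Omega1 lam \<subseteq> closed_unit_square" "Omega2 lam \<subseteq> closed_unit_square" "Omega3 lam \<subseteq> closed_unit_square" "Omega4 lam \<subseteq> closed_unit_square"
    using lam unfolding Omega1_def Omega2_def Omega3_def Omega4_def by (auto intro!: borel_open open_Times)
  have H0: "0 \<le> H" using hH by simp
  \<comment> \<open>The windows sum to 1060864 H^6, and H <= 2 / n adds a factor 64, in total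
    67895296 < 4 * 10^8.\<close>
  define b where "b = 10 ^ 8 * \<kappa> * 4 / n ^ 6"
  let ?c = "ennreal (256 * H ^ 5)"
  define X where "X = (\<lambda>z. ?c * window_x H (sqr (S 3 0) unit_square) z + ?c * window_y H (sqr (S 0 3) unit_square) z +
     ennreal (65536 * H ^ 4) * window_x H (window_y H (sqr (S 1 2) unit_square)) z)"
  define Xe where "Xe = (\<lambda>z. ?c * window_x H (sqr (E1 3 0) (Omega1 lam)) z + ?c * window_x H (sqr (E3 3 0) (Omega3 lam)) z +
     (?c * window_y H (sqr (E2 0 3) (Omega2 lam)) z + ?c * window_y H (sqr (E4 0 3) (Omega4 lam)) z))"
  define B where "B = (\<lambda>z. ennreal 4 * (X z + Xe z))"
  note sm = sqr_meas [OF S _ D] sqr_meas [OF E(1) _ O(1,5)] sqr_meas [OF E(2) _ O(2,6)] sqr_meas [OF E(3) _ O(3,7)] sqr_meas [OF E(4) _ O(4,8)]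
  have Xm: "X \<in> borel_measurable borel" "Xe \<in> borel_measurable borel"
    unfolding X_def Xe_def
    by (intro borel_measurable_add borel_measurable_times_ennreal borel_measurable_const window_measurable sm; simp)+
  have XB: "(\<integral>\<^sup>+ z. X z \<partial>lborel) \<le> ennreal (256 * H ^ 5 * (2 * H * \<kappa>) + 256 * H ^ 5 * (2 * H * \<kappa>) + 65536 * H ^ 4 * (2 * H * (2 * H * \<kappa>)))"
    unfolding X_def using H0 \<kappa>(1)
    by (intro nn_integral_plus_le nn_integral_scaled window_bound borel_measurable_add borel_measurable_times_ennreal borel_measurable_const window_measurable sm \<kappa>) auto
  have XeB: "(\<integral>\<^sup>+ z. Xe z \<partial>lborel) \<le> ennreal (256 * H ^ 5 * (2 * H * \<kappa>) + 256 * H ^ 5 * (2 * H * \<kappa>) + (256 * H ^ 5 * (2 * H * \<kappa>) + 256 * H ^ 5 * (2 * H * \<kappa>)))"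
    unfolding Xe_def using H0 \<kappa>(1)
    by (intro nn_integral_plus_le nn_integral_scaled window_bound borel_measurable_add borel_measurable_times_ennreal borel_measurable_const window_measurable sm \<kappa>) auto
  have Bm: "B \<in> borel_measurable borel" unfolding B_def
    by (intro borel_measurable_times_ennreal borel_measurable_add borel_measurable_const Xm)
  have "(\<integral>\<^sup>+ z. B z \<partial>lborel) \<le> ennreal (4 * ((256 * H ^ 5 * (2 * H * \<kappa>) + 256 * H ^ 5 * (2 * H * \<kappa>) + 65536 * H ^ 4 * (2 * H * (2 * H * \<kappa>))) +
     (256 * H ^ 5 * (2 * H * \<kappa>) + 256 * H ^ 5 * (2 * H * \<kappa>) + (256 * H ^ 5 * (2 * H * \<kappa>) + 256 * H ^ 5 * (2 * H * \<kappa>)))))"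
    unfolding B_def using H0 \<kappa>(1) by (intro nn_integral_scaled nn_integral_plus_le XB XeB Xm borel_measurable_add) auto
  also have "\<dots> \<le> ennreal b"
  proof (rule ennreal_leI)
    have "4 * ((256 * H ^ 5 * (2 * H * \<kappa>) + 256 * H ^ 5 * (2 * H * \<kappa>) + 65536 * H ^ 4 * (2 * H * (2 * H * \<kappa>))) +
     (256 * H ^ 5 * (2 * H * \<kappa>) + 256 * H ^ 5 * (2 * H * \<kappa>) + (256 * H ^ 5 * (2 * H * \<kappa>) + 256 * H ^ 5 * (2 * H * \<kappa>)))) = 1060864 * \<kappa> * H ^ 6"
      by (simp add: eval_nat_numeral algebra_simps)
    also have "\<dots> \<le> 1060864 * \<kappa> * (2 / n) ^ 6" using H_inverse hH \<kappa>(1) by (intro mult_left_mono power_mono) auto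
    also have "\<dots> = 67895296 * \<kappa> / n ^ 6" by (simp add: power_divide)
    also have "\<dots> \<le> b" unfolding b_def using \<kappa>(1) by (intro divide_right_mono) auto
    finally show "4 * ((256 * H ^ 5 * (2 * H * \<kappa>) + 256 * H ^ 5 * (2 * H * \<kappa>) + 65536 * H ^ 4 * (2 * H * (2 * H * \<kappa>))) +
     (256 * H ^ 5 * (2 * H * \<kappa>) + 256 * H ^ 5 * (2 * H * \<kappa>) + (256 * H ^ 5 * (2 * H * \<kappa>) + 256 * H ^ 5 * (2 * H * \<kappa>)))) \<le> b" .
  qed
  finally have Bb: "(\<integral>\<^sup>+ z. B z \<partial>lborel) \<le> ennreal b" .
  have b0: "0 \<le> b" unfolding b_def using \<kappa>(1) by simp
  \<comment> \<open>The pointwise terms give 8 * 17^2 + 2 L^6, at most 2400 L^6; half of it is used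
    for each variable.\<close>
  define g where "g = 1200 * CC\<^sup>2 * L ^ 6 / n ^ 6"
  have g0: "0 \<le> g" unfolding g_def by simp
  have rest: "8 * (17 * (CC / n ^ 3))\<^sup>2 + 2 * (CC * (L ^ 3 / n ^ 3))\<^sup>2 \<le> 2 * g"
  proof -
    have "8 * (17 * (CC / n ^ 3))\<^sup>2 + 2 * (CC * (L ^ 3 / n ^ 3))\<^sup>2 = CC\<^sup>2 / n ^ 6 * (2312 * 1 + 2 * L ^ 6)"
      by (simp add: power_mult_distrib power_divide power_mult [symmetric] algebra_simps add_divide_distrib)
    also have "\<dots> \<le> CC\<^sup>2 / n ^ 6 * (2400 * L ^ 6)" using L_powers by (intro mult_left_mono) auto
    also have "\<dots> = 2 * g" unfolding g_def by simp
    finally show ?thesis .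
  qed
  have Pg: "P 0 0 g x + P 0 0 g y = 2 * g" for x y by (simp add: P_def)
  have "(L2_norm_on unit_square w)\<^sup>2 \<le> 2 * (0 * (2 * lam) + 0 * (2 * s / k) + g) + 2 * b"
  proof (rule square_le_L2 [where B = B])
    fix x y a b c d assume J: "(a, b) \<in> fine_itvs \<union> coarse_itvs" and K: "(c, d) \<in> fine_itvs \<union> coarse_itvs"
    and x: "x \<in> {a<..<b}" "x \<notin> mp ` {0..N}" and y: "y \<in> {c<..<d}" "y \<notin> mp ` {0..N}"
    have xy: "x \<in> {0..1}" "y \<in> {0..1}" using in_cell_square J K x y by auto
    have xy': "x \<in> {a..b}" "y \<in> {c..d}" using x y by auto
    note ja = open_cell_subset [OF J] and kc = open_cell_subset [OF K]
    have fin: "ennreal ((w (x, y))\<^sup>2) \<le> ennreal (P 0 0 g x + P 0 0 g y) + 2 * B (x, y)"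
      if "ennreal (p\<^sup>2) \<le> X (x, y)" "ennreal (r\<^sup>2) \<le> Xe (x, y)" "\<bar>t\<bar> \<le> 17 * (CC / n ^ 3)" "\<bar>w (x, y) - (p + r + t)\<bar> \<le> CC * (L ^ 3 / n ^ 3)" for p r t
    proof -
      have "ennreal ((w (x, y))\<^sup>2) \<le> ennreal (8 * (17 * (CC / n ^ 3))\<^sup>2 + 2 * (CC * (L ^ 3 / n ^ 3))\<^sup>2) + 2 * (4 * (X (x, y) + Xe (x, y)))"
        by (rule square_three_plus_rest [OF that])
      also have "\<dots> \<le> ennreal (P 0 0 g x + P 0 0 g y) + 2 * B (x, y)"
        unfolding Pg B_def by (intro add_mono ennreal_leI rest) simp
      finally show ?thesis .
    qed
    have C0: "0 \<le> CC / n ^ 3" using CC0 by simp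
    consider "(a, b) \<in> coarse_itvs" "(c, d) \<in> coarse_itvs" | "(a, b) \<in> coarse_itvs" "(c, d) \<in> fine_itvs"
      | "(a, b) \<in> fine_itvs" "(c, d) \<in> coarse_itvs" | "(a, b) \<in> fine_itvs" "(c, d) \<in> fine_itvs"
      using J K by blast
    then show "ennreal ((w (x, y))\<^sup>2) \<le> ennreal (P 0 0 g x + P 0 0 g y) + 2 * B (x, y)"
    proof cases
      case 1
      note ab = coarseD [OF 1(1)] and cd = coarseD [OF 1(2)]
      have sub: "{a<..<b} \<times> {c<..<d} \<subseteq> unit_square" using ab cd by auto
      define e where "e = e_core 0 0 x y a b c d"
      have "CC * (1 / n ^ 3) \<le> CC * (L ^ 3 / n ^ 3)" using CC0 L_powers by (intro mult_left_mono divide_right_mono) auto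
      then have r: "\<bar>w (x, y) - e\<bar> \<le> CC * (L ^ 3 / n ^ 3)"
        using core(1) [OF 1 x(1) y(1), of 0 0] unfolding e_def by (simp add: pd00)
      have e: "ennreal (e\<^sup>2) \<le> 4 * X (x, y)"
        using core_L2(1) [OF S ab(1) ja(4) cd(1) kc(4) x(1) y(1) ab(2) cd(2) sub D] unfolding e_def e_core_def X_def .
      have r2: "(w (x, y) - e)\<^sup>2 \<le> (CC * (L ^ 3 / n ^ 3))\<^sup>2" using power_mono [OF r, of 2] by simp
      have "ennreal ((w (x, y))\<^sup>2) = ennreal ((e + (w (x, y) - e))\<^sup>2)" by simp
      also have "\<dots> \<le> 2 * (ennreal (e\<^sup>2) + ennreal ((w (x, y) - e)\<^sup>2))" by (rule ennreal_square_sum2)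
      also have "\<dots> \<le> 2 * (4 * (X (x, y) + Xe (x, y)) + ennreal ((CC * (L ^ 3 / n ^ 3))\<^sup>2))"
      proof (intro mult_left_mono add_mono ennreal_leI r2)
        have "X (x, y) \<le> X (x, y) + Xe (x, y)" by simp
        then have "4 * X (x, y) \<le> 4 * (X (x, y) + Xe (x, y))" by (intro mult_left_mono) auto
        then show "ennreal (e\<^sup>2) \<le> 4 * (X (x, y) + Xe (x, y))" using e by (rule order_trans [rotated])
      qed simp
      also have "\<dots> = ennreal (2 * (CC * (L ^ 3 / n ^ 3))\<^sup>2) + 2 * B (x, y)"
        unfolding B_def by (simp add: distrib_left ennreal_mult add.commute)
      also have "\<dots> \<le> ennreal (P 0 0 g x + P 0 0 g y) + 2 * B (x, y)"
        unfolding Pg using rest by (intro add_mono ennreal_leI order_refl) (smt (verit) zero_le_power2)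
      finally show ?thesis .
    next
      case 2
      note ab = coarseD [OF 2(1)] and cd = fineD [OF 2(2)]
      have A: "AH (\<lambda>i j x y. S i j x y + EH i j x y) x y a b = AH S x y a b + (AH E1 x y a b + AH E3 x y a b)"
      proof -
        have "AH EH x y a b = AH (\<lambda>i j x y. E1 i j x y + E3 i j x y) x y a b"
          by (rule AH_cong [OF ab(1) xy'(1)]) (use EH ja(4) xy in auto)
        then show ?thesis unfolding AH_add by simp
      qed
      have wA: "\<bar>w (x, y) - (AH S x y a b + (AH E1 x y a b + AH E3 x y a b))\<bar> \<le> CC * (L ^ 3 / n ^ 3)"
        using h_strip(1) [OF 2 x(1) y, of 0 0] unfolding A pd00 by (simp add: tgt_def)
      have S1: "ennreal ((AH S x y a b)\<^sup>2) \<le> X (x, y)"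
      proof -
        have "ennreal ((AH S x y a b)\<^sup>2) \<le> ennreal (256 * H ^ (5 - 2 * 0)) * window_x H (sqr (S 3 0) unit_square) (x, y)"
          unfolding AH_def by (rule lag_x_L2 [OF S ab(1) ja(4) xy'(1) xy(2) _ _ ab(2)]) (use ab cd y in auto)
        also have "\<dots> \<le> X (x, y)" unfolding X_def by (simp add: add.assoc)
        finally show ?thesis .
      qed
      show ?thesis
      \<comment> \<open>Only the layer of this strip has a controlled third derivative here; the
        opposite one is handled as a small function. Hence bottom and top strips are distinguished,
        and likewise left and right below.\<close>
      proof (cases "d \<le> lam")
        case True
        have "ennreal ((AH E1 x y a b)\<^sup>2) \<le> ennreal (256 * H ^ (5 - 2 * 0)) * window_x H (sqr (E1 3 0) (Omega1 lam)) (x, y)"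
          unfolding AH_def by (rule lag_x_L2 [OF E(1) ab(1) ja(4) xy'(1) xy(2) _ _ ab(2)]) (use ab cd y True in \<open>auto simp: Omega1_def\<close>)
        also have "\<dots> \<le> Xe (x, y)" unfolding Xe_def by (simp add: add.assoc)
        finally have 1: "ennreal ((AH E1 x y a b)\<^sup>2) \<le> Xe (x, y)" .
        have "\<bar>E3 0 0 p y\<bar> \<le> CC / n ^ 3" if "p \<in> {a..b}" for p
          using E3b [of p y] exp_far [of "1 - y"] that ja(4) xy y True lam by auto
        then have "\<bar>AH E3 x y a b\<bar> \<le> 17 * (CC / n ^ 3)" by (rule AH_small [OF ab(1) xy'(1)])
        with S1 1 show ?thesis by (rule fin) (use wA in \<open>simp add: add.assoc\<close>)
      next
        case False
        then have F: "1 - lam \<le> c" using cd by auto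
        have "ennreal ((AH E3 x y a b)\<^sup>2) \<le> ennreal (256 * H ^ (5 - 2 * 0)) * window_x H (sqr (E3 3 0) (Omega3 lam)) (x, y)"
          unfolding AH_def by (rule lag_x_L2 [OF E(3) ab(1) ja(4) xy'(1) xy(2) _ _ ab(2)]) (use ab cd y F in \<open>auto simp: Omega3_def\<close>)
        also have "\<dots> \<le> Xe (x, y)" unfolding Xe_def by (simp add: add_ac)
        finally have 1: "ennreal ((AH E3 x y a b)\<^sup>2) \<le> Xe (x, y)" .
        have "\<bar>E1 0 0 p y\<bar> \<le> CC / n ^ 3" if "p \<in> {a..b}" for p
          using E1b [of p y] exp_far [of y] that ja(4) xy y F lam by auto
        then have "\<bar>AH E1 x y a b\<bar> \<le> 17 * (CC / n ^ 3)" by (rule AH_small [OF ab(1) xy'(1)])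
        with S1 1 show ?thesis by (rule fin) (use wA in \<open>simp add: add_ac\<close>)
      qed
    next
      case 3
      note ab = fineD [OF 3(1)] and cd = coarseD [OF 3(2)]
      have A: "AH (\<lambda>i j x y. jswap S i j x y + jswap EV i j x y) y x c d =
          AH (jswap S) y x c d + (AH (jswap E2) y x c d + AH (jswap E4) y x c d)"
      proof -
        have "AH (jswap EV) y x c d = AH (\<lambda>i j x y. jswap E2 i j x y + jswap E4 i j x y) y x c d"
          by (rule AH_cong [OF cd(1) xy'(2)]) (use EV kc(4) xy in \<open>auto simp: jswap_def\<close>)
        then show ?thesis unfolding AH_add by simp
      qed
      have wA: "\<bar>w (x, y) - (AH (jswap S) y x c d + (AH (jswap E2) y x c d + AH (jswap E4) y x c d))\<bar> \<le> CC * (L ^ 3 / n ^ 3)"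
        using v_strip(1) [OF 3 x y(1), of 0 0] unfolding A pd00 by (simp add: tgt_def)
      have sw: "AH (jswap V) y x c d = V 0 0 x y - lag 0 c d (\<lambda>\<eta>. V 0 0 x \<eta>) y" for V
        by (simp add: AH_def jswap_def)
      have S1: "ennreal ((AH (jswap S) y x c d)\<^sup>2) \<le> X (x, y)"
      proof -
        have "ennreal ((AH (jswap S) y x c d)\<^sup>2) \<le> ?c * window_y H (sqr (S 0 3) unit_square) (x, y)"
          unfolding sw by (rule lag_y_L2 [OF S cd(1) kc(4) xy'(2) xy(1) _ cd(2)]) (use ab cd x in auto)
        also have "\<dots> \<le> X (x, y)" unfolding X_def by (simp add: add_ac)
        finally show ?thesis .
      qed
      show ?thesis
      proof (cases "b \<le> lam")
        case True
        have "ennreal ((AH (jswap E2) y x c d)\<^sup>2) \<le> ?c * window_y H (sqr (E2 0 3) (Omega2 lam)) (x, y)"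
          unfolding sw by (rule lag_y_L2 [OF E(2) cd(1) kc(4) xy'(2) xy(1) _ cd(2)]) (use ab cd x True in \<open>auto simp: Omega2_def\<close>)
        also have "\<dots> \<le> Xe (x, y)" unfolding Xe_def by (simp add: add_ac)
        finally have 1: "ennreal ((AH (jswap E2) y x c d)\<^sup>2) \<le> Xe (x, y)" .
        have "\<bar>jswap E4 0 0 p x\<bar> \<le> CC / n ^ 3" if "p \<in> {c..d}" for p
          using E4b [of x p] exp_far [of "1 - x"] that kc(4) xy x True lam by (auto simp: jswap_def)
        then have "\<bar>AH (jswap E4) y x c d\<bar> \<le> 17 * (CC / n ^ 3)" by (rule AH_small [OF cd(1) xy'(2)])
        with S1 1 show ?thesis by (rule fin) (use wA in \<open>simp add: add.assoc\<close>)
      next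
        case False
        then have F: "1 - lam \<le> a" using ab by auto
        have "ennreal ((AH (jswap E4) y x c d)\<^sup>2) \<le> ?c * window_y H (sqr (E4 0 3) (Omega4 lam)) (x, y)"
          unfolding sw by (rule lag_y_L2 [OF E(4) cd(1) kc(4) xy'(2) xy(1) _ cd(2)]) (use ab cd x F in \<open>auto simp: Omega4_def\<close>)
        also have "\<dots> \<le> Xe (x, y)" unfolding Xe_def by (simp add: add_ac)
        finally have 1: "ennreal ((AH (jswap E4) y x c d)\<^sup>2) \<le> Xe (x, y)" .
        have "\<bar>jswap E2 0 0 p x\<bar> \<le> CC / n ^ 3" if "p \<in> {c..d}" for p
          using E2b [of x p] exp_far [of x] that kc(4) xy x F lam by (auto simp: jswap_def)
        then have "\<bar>AH (jswap E2) y x c d\<bar> \<le> 17 * (CC / n ^ 3)" by (rule AH_small [OF cd(1) xy'(2)])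
        with S1 1 show ?thesis by (rule fin) (use wA in \<open>simp add: add_ac\<close>)
      qed
    next
      case 4
      have "\<bar>w (x, y)\<bar> \<le> CC * (L ^ 3 / n ^ 3)" using corner [OF 4 x y, of 0 0] unfolding pd00 by (simp add: tgt_def)
      then show ?thesis using C0 by (intro fin [of 0 0 0]) auto
    qed
  qed (use Bm Bb b0 g0 in auto)
  also have "\<dots> = 2 * g + 2 * b" by simp
  also have "\<dots> \<le> (2400 * CC\<^sup>2 + 10 ^ 9 * \<kappa>) * (L ^ 3 / n ^ 3)\<^sup>2"
  proof -
    have e: "(L ^ 3 / n ^ 3)\<^sup>2 = L ^ 6 / n ^ 6" by (simp add: power_divide power_mult [symmetric])
    have "2 * b = 8 * 10 ^ 8 * \<kappa> * (1 / n ^ 6)" unfolding b_def by simp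
    also have "\<dots> \<le> 10 ^ 9 * \<kappa> * (L ^ 6 / n ^ 6)"
      using \<kappa>(1) L_powers by (intro mult_mono divide_right_mono) auto
    finally have "2 * b \<le> 10 ^ 9 * \<kappa> * (L ^ 6 / n ^ 6)" .
    moreover have "2 * g = 2400 * CC\<^sup>2 * (L ^ 6 / n ^ 6)" unfolding g_def by simp
    ultimately show ?thesis unfolding e distrib_right by linarith
  qed
  finally have "(L2_norm_on unit_square w)\<^sup>2 \<le> (2400 * CC\<^sup>2 + 10 ^ 9 * \<kappa>) * (L ^ 3 / n ^ 3)\<^sup>2" .
  then have "L2_norm_on unit_square w \<le> sqrt ((2400 * CC\<^sup>2 + 10 ^ 9 * \<kappa>) * (L ^ 3 / n ^ 3)\<^sup>2)"
    by (rule real_le_rsqrt)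
  also have "\<dots> = sqrt (2400 * CC\<^sup>2 + 10 ^ 9 * \<kappa>) * (L ^ 3 / n ^ 3)"
    using L1 by (simp add: real_sqrt_mult)
  finally show ?thesis .
qed

end

subsection \<open>Application to the solution decomposition\<close>

text \<open>Each summand serves an assumption on the mesh constant: 27 B for s N and s L^3, the two
  quotients for the bounds of h, the exponential for the variation of a layer over 4 h, and the
  powers for the case lambda = 1/4, where N itself is bounded.\<close>

definition mesh_const :: "real \<Rightarrow> real \<Rightarrow> real \<Rightarrow> real" where
  "mesh_const B cst lam0 = 1 + 27 * B + 4 * lam0 / cst + cst / (4 * lam0) + exp (16 * lam0)
     + (8 * B * lam0 / cst) ^ 4 + (8 * B * lam0 / cst) ^ 6"

lemma ln_le_2_sqrt: "1 \<le> x \<Longrightarrow> ln x \<le> 2 * sqrt (x::real)"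
  using ln_bound [of "sqrt x"] by (simp add: ln_sqrt)

text \<open>If lambda is not cut off, the full decay at the transition point equals N to the power -
  lam0, and \<open>lam0 >= 3\<close> makes two thirds of it worth N^-2 and all of it worth
  N^-3.\<close>

lemma shishkin_transition_point:
  fixes N :: nat
  assumes N: "8 dvd N" "0 < N" and c: "0 < cst" and l0: "3 \<le> lam0"
    and s: "0 < s" "s \<le> 1" "s \<le> B / real N" and lam: "lam = min (1 / 4) (lam0 * s / cst * ln (real N))"
  shows "shishkin N lam s (cst / 3) (mesh_const B cst lam0)"
proof -
  define n L G where "n = real N" and "L = ln n" and "G = mesh_const B cst lam0"
  have n: "8 \<le> n" using N by (auto simp: n_def elim: dvdE)
  have L: "0 < L" "L \<le> n" using n ln_bound [of n] by (auto simp: L_def)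
  have sn: "s * n \<le> B" using s(3) n by (simp add: n_def field_simps)
  have B: "0 < B" using sn s n by (smt (verit) mult_pos_pos)
  have pos: "0 \<le> 4 * lam0 / cst" "0 \<le> cst / (4 * lam0)" "0 \<le> exp (16 * lam0)" "0 \<le> (8 * B * lam0 / cst) ^ 4" "0 \<le> (8 * B * lam0 / cst) ^ 6"
    using c l0 B by auto
  have G: "1 \<le> G" "27 * B \<le> G" "B \<le> G" "4 * lam0 / cst \<le> G" "cst / (4 * lam0) \<le> G" "exp (16 * lam0) \<le> G"
    "(8 * B * lam0 / cst) ^ 4 \<le> G" "(8 * B * lam0 / cst) ^ 6 \<le> G"
    using pos B unfolding G_def mesh_const_def by linarith+
  let ?r = "lam0 * s / cst * L"
  have r: "0 < ?r" using l0 s c L by simp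
  have lm: "lam = min (1 / 4) ?r" unfolding lam L_def n_def by simp
  have lam0: "0 < lam" "lam \<le> 1 / 4" "lam \<le> ?r" using r unfolding lm by (simp, simp only: min.cobounded1, simp only: min.cobounded2)
  have mesh: "mesh N lam" using N lam0 by unfold_locales auto
  have hn: "mesh.h N lam * n = 4 * lam" using n mesh.h_def [OF mesh] by (simp add: n_def)
  \<comment> \<open>The cut-off is active only if 1 <= 4 lam0 s L / cst. With s <= B / n and L <= 2
    sqrt n this bounds sqrt n by 8 B lam0 / cst.\<close>
  have big: "n ^ 2 \<le> G \<and> n ^ 3 \<le> G" if "lam \<noteq> ?r"
  proof -
    have "1 / 4 \<le> ?r" using that unfolding lm by linarith
    then have "cst \<le> 4 * lam0 * s * L" using c by (simp add: field_simps)
    also have "\<dots> \<le> 4 * lam0 * (B / n) * (2 * sqrt n)"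
      using l0 s B n L ln_le_2_sqrt [of n] by (intro mult_mono) (auto simp: n_def L_def)
    also have "\<dots> = 8 * B * lam0 / sqrt n" using n real_sqrt_mult_self [of n] by (simp add: field_simps)
    finally have "sqrt n \<le> 8 * B * lam0 / cst" using c n by (simp add: field_simps)
    then have "sqrt n ^ 4 \<le> (8 * B * lam0 / cst) ^ 4" "sqrt n ^ 6 \<le> (8 * B * lam0 / cst) ^ 6"
      using n by (auto intro!: power_mono)
    moreover have "sqrt n ^ 4 = (sqrt n ^ 2) ^ 2" "sqrt n ^ 6 = (sqrt n ^ 2) ^ 3" by (simp_all flip: power_mult)
    ultimately show ?thesis using G n by simp
  qed
  have decay: "exp (- (real m * (cst / 3)) * lam / s) * n ^ m \<le> G" if m: "m = 2 \<or> m = 3" for m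
  proof (cases "lam = ?r")
    case True
    have "- (real m * (cst / 3)) * lam / s = - (lam0 / 3) * (real m * L)" unfolding True using s c by (simp add: field_simps)
    also have "\<dots> \<le> - 1 * (real m * L)" using l0 L by (intro mult_right_mono) auto
    finally have "exp (- (real m * (cst / 3)) * lam / s) \<le> exp (- 1 * (real m * L))" by (simp only: exp_le_cancel_iff)
    also have "\<dots> = 1 / n ^ m" using n unfolding L_def by (simp add: exp_minus exp_of_nat_mult inverse_eq_divide)
    finally have "exp (- (real m * (cst / 3)) * lam / s) * n ^ m \<le> 1 / n ^ m * n ^ m" using n by (intro mult_right_mono) auto
    then show ?thesis using G n by simp
  next
    case False
    have "exp (- (real m * (cst / 3)) * lam / s) * n ^ m \<le> 1 * n ^ m"
      using c lam0 s n by (intro mult_right_mono) (auto simp: divide_nonpos_pos mult_nonneg_nonneg)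
    also have "\<dots> \<le> G" using big [OF False] m by auto
    finally show ?thesis .
  qed
  have "shishkin N lam s (cst / 3) G"
  proof (rule shishkin.intro [OF mesh shishkin_axioms.intro], unfold n_def [symmetric] L_def [symmetric])
    show "s * n \<le> G" using sn G by linarith
    have "4 * lam \<le> 4 * lam0 / cst * (s * L)" using mult_left_mono [OF lam0(3), of 4] by (simp add: ac_simps)
    also have "\<dots> \<le> G * (s * L)" using G s L by (intro mult_right_mono) auto
    finally show "mesh.h N lam * n \<le> G * s * L" unfolding hn by (simp add: mult.assoc)
    have "s * L \<le> G * (4 * lam)"
    proof (cases "lam = ?r")
      case True
      have "s * L = cst / (4 * lam0) * (4 * lam)" unfolding True using c l0 by simp
      also have "\<dots> \<le> G * (4 * lam)" using G lam0 by (intro mult_right_mono) auto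
      finally show ?thesis .
    next
      case False
      then have "4 * lam = 1" unfolding lm by linarith
      moreover have "s * L \<le> s * n" using s L by simp
      ultimately show ?thesis using sn G(3) by simp
    qed
    then show "s * L \<le> G * n * mesh.h N lam" unfolding hn [symmetric] by (simp add: ac_simps)
    have "s * L ^ 3 \<le> s * (27 * n)" using ln_cube_le [of n] n s unfolding L_def by (intro mult_left_mono) auto
    then show "s * L ^ 3 \<le> G" using sn G by linarith
    \<comment> \<open>As h n = 4 lam, the exponent is at most 16 lam0 L / n, and L <= n.\<close>
    have "12 * (cst / 3) * mesh.h N lam / s = 16 * cst * lam / (s * n)"
      using hn n s by (simp add: field_simps)
    also have "\<dots> \<le> 16 * cst * ?r / (s * n)"
      using lam0 c s n by (intro divide_right_mono mult_left_mono) auto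
    also have "\<dots> = 16 * lam0 * (L / n)" using c s by (simp add: field_simps)
    also have "\<dots> \<le> 16 * lam0 * 1" using L n l0 by (intro mult_left_mono) auto
    finally have "exp (12 * (cst / 3) * mesh.h N lam / s) \<le> exp (16 * lam0)" by simp
    then show "exp (12 * (cst / 3) * mesh.h N lam / s) \<le> G" using G by linarith
    show "exp (- (2 * (cst / 3)) * lam / s) * n\<^sup>2 \<le> G" using decay [of 2] by simp
    show "exp (- (3 * (cst / 3)) * lam / s) * n ^ 3 \<le> G" using decay [of 3] by simp
  qed (use s c G in auto)
  then show ?thesis unfolding G_def .
qed

lemma powr_half: "0 < \<epsilon> \<Longrightarrow> \<epsilon> powr (real j / 2) = sqrt \<epsilon> ^ j"
  by (simp add: powr_half_sqrt [symmetric] powr_realpow [symmetric] powr_powr mult.commute)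

lemma powr_minus_half: "0 < \<epsilon> \<Longrightarrow> \<epsilon> powr (- real j / 2) = 1 / sqrt \<epsilon> ^ j"
  using powr_half [of \<epsilon> j] powr_minus [of \<epsilon> "real j / 2"] by (simp add: inverse_eq_divide)

lemma powr_quarter:
  assumes "0 < \<epsilon>"
  shows "\<epsilon> powr (1 / 4) = sqrt (sqrt \<epsilon>)" "\<epsilon> powr (3 / 4) = sqrt \<epsilon> * sqrt (sqrt \<epsilon>)" "\<epsilon> powr (- 1 / 4) = 1 / sqrt (sqrt \<epsilon>)"
proof -
  show 1: "\<epsilon> powr (1 / 4) = sqrt (sqrt \<epsilon>)" using assms by (simp add: powr_half_sqrt [symmetric] powr_powr)
  have "\<epsilon> powr (3 / 4) = \<epsilon> powr (1 / 2) * \<epsilon> powr (1 / 4)" unfolding powr_add [symmetric] by simp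
  then show "\<epsilon> powr (3 / 4) = sqrt \<epsilon> * sqrt (sqrt \<epsilon>)" using 1 assms by (simp add: powr_half_sqrt)
  show "\<epsilon> powr (- 1 / 4) = 1 / sqrt (sqrt \<epsilon>)" using 1 powr_minus [of \<epsilon> "1 / 4"] by (simp add: inverse_eq_divide)
qed

text \<open>The exponent is negative only for \<open>m = 3\<close>. Up to second order the smooth
  factor is therefore at most 2, which makes the layer constant 2 A.\<close>

lemma one_plus_powr_le:
  assumes e: "0 < \<epsilon>" "\<epsilon> \<le> 1" and m: "m \<le> 3"
  shows "1 + \<epsilon> powr (1 - real m / 2) \<le> 2 * (if m = 3 then 1 / sqrt \<epsilon> else 1)"
proof (cases "m = 3")
  case True
  have "\<epsilon> powr (1 - real m / 2) = 1 / sqrt \<epsilon>" using powr_minus_half [of \<epsilon> 1] e unfolding True by simp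
  moreover have "1 \<le> 1 / sqrt \<epsilon>" using e by simp
  ultimately show ?thesis using True by simp
next
  case False
  then have "\<epsilon> powr (1 - real m / 2) \<le> 1" using e m by (intro powr_le1) auto
  then show ?thesis using False by simp
qed

context shishkin
begin

definition eh :: "real \<Rightarrow> real" where "eh t = exp (- (3 * k) * t / s)"

lemma ex_eh: "ex t = eh t + eh (1 - t)" by (simp add: ex_def eh_def)

lemma eh_nonneg: "0 \<le> eh t" by (simp add: eh_def)

lemma jet_smooth_bound:
  assumes "smooth_part_bound A (s\<^sup>2) V" "i + j \<le> 3" "p \<in> {0..1}" "q \<in> {0..1}" "0 \<le> A"
  shows "\<bar>jet_of V i j p q\<bar> \<le> 2 * A * (if i + j = 3 then 1 / s else 1)"
proof -
  have "\<bar>jet_of V i j p q\<bar> \<le> A * (1 + s\<^sup>2 powr (1 - real (i + j) / 2))"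
    using assms unfolding smooth_part_bound_def jet_of_def by auto
  also have "\<dots> \<le> A * (2 * (if i + j = 3 then 1 / sqrt (s\<^sup>2) else 1))"
    using s assms by (intro mult_left_mono one_plus_powr_le) (auto simp: power_le_one)
  finally show ?thesis using s by (simp add: mult.commute [of A] split: if_splits)
qed

lemma jet_layer_bound:
  assumes "\<bar>v\<bar> \<le> A * (1 + s\<^sup>2 powr (1 - real i / 2)) * s\<^sup>2 powr (- real j / 2) * exp (- (3 * k) * t / sqrt (s\<^sup>2))"
    "i \<le> 3" "0 \<le> A"
  shows "\<bar>v\<bar> \<le> 2 * A * (if i = 3 then 1 / s else 1) / s ^ j * eh t"
proof -
  have "\<bar>v\<bar> \<le> A * (1 + s\<^sup>2 powr (1 - real i / 2)) * (1 / s ^ j) * eh t"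
    using assms(1) s powr_minus_half [of "s\<^sup>2" j] by (simp add: eh_def)
  also have "\<dots> \<le> A * (2 * (if i = 3 then 1 / sqrt (s\<^sup>2) else 1)) * (1 / s ^ j) * eh t"
    using s assms eh_nonneg by (intro mult_right_mono mult_left_mono one_plus_powr_le) (auto simp: power_le_one)
  finally show ?thesis using s by (simp add: mult.commute [of A] split: if_splits)
qed

lemma jet_h_layer_bound:
  assumes "h_layer_bound A (3 * k) (s\<^sup>2) \<delta> V" "0 \<le> A" "i + j \<le> 3" "p \<in> {0..1}" "q \<in> {0..1}"
  shows "\<bar>jet_of V i j p q\<bar> \<le> 2 * A * (if i = 3 then 1 / s else 1) / s ^ j * eh (\<delta> q)"
  by (rule jet_layer_bound) (use assms in \<open>unfold h_layer_bound_def jet_of_def, fast, simp_all\<close>)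

lemma jet_v_layer_bound:
  assumes "v_layer_bound A (3 * k) (s\<^sup>2) \<delta> V" "0 \<le> A" "i + j \<le> 3" "p \<in> {0..1}" "q \<in> {0..1}"
  shows "\<bar>jet_of V i j p q\<bar> \<le> 2 * A * (if j = 3 then 1 / s else 1) / s ^ i * eh (\<delta> p)"
  by (rule jet_layer_bound) (use assms in \<open>unfold v_layer_bound_def jet_of_def, fast, simp_all\<close>)

lemma jet_corner_layer_bound:
  assumes "corner_layer_bound A (3 * k) (s\<^sup>2) \<delta> \<delta>' V" "i + j \<le> 3" "p \<in> {0..1}" "q \<in> {0..1}"
  shows "\<bar>jet_of V i j p q\<bar> \<le> A / s ^ (i + j) * (eh (\<delta> p) * eh (\<delta>' q))"
proof -
  have "\<bar>jet_of V i j p q\<bar> \<le> A * s\<^sup>2 powr (- real (i + j) / 2) * exp (- (3 * k) * (\<delta> p + \<delta>' q) / sqrt (s\<^sup>2))"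
    using assms unfolding corner_layer_bound_def jet_of_def by fast
  also have "\<dots> = A / s ^ (i + j) * (eh (\<delta> p) * eh (\<delta>' q))"
    using s powr_minus_half [of "s\<^sup>2" "i + j"]
    by (simp add: eh_def exp_add [symmetric] ring_distribs add_divide_distrib diff_divide_distrib)
  finally show ?thesis .
qed

lemma problem_of_decomposition:
  assumes dec: "solution_decomposition A (3 * k) (s\<^sup>2) u S E1 E2 E3 E4 E12 E23 E34 E41"
    and u: "C_closed 3 u" and sg: "edge_assignment lam N \<sigma>"
  shows "0 \<le> A" "problem N lam s k G (2 * A) u \<sigma> (jet_of S) (jadd (jet_of E1) (jet_of E3)) (jadd (jet_of E2) (jet_of E4))
     (jadd (jadd (jet_of E12) (jet_of E23)) (jadd (jet_of E34) (jet_of E41))) (jet_of E1) (jet_of E2) (jet_of E3) (jet_of E4)"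
proof -
  note d = dec [unfolded solution_decomposition_def h_layer_bound_def v_layer_bound_def corner_layer_bound_def]
  have sp: "smooth_part_bound A (s\<^sup>2) S" using d by blast
  \<comment> \<open>The sign of \<open>A\<close> is not assumed; it follows from the bound of the
    smooth part at a single point.\<close>
  have "\<bar>pd 0 0 S (0, 0)\<bar> \<le> A * (1 + s\<^sup>2)"
    using sp s unfolding smooth_part_bound_def by (auto dest!: spec [of _ "0 :: nat"] dest: bspec [of _ _ 0])
  then have "0 \<le> A * (1 + s\<^sup>2)" by linarith
  moreover have "0 < 1 + s\<^sup>2" by (simp add: add_pos_nonneg)
  ultimately show A: "0 \<le> A" by (simp only: zero_le_mult_iff) linarith
  have J: "C3_jet (jet_of S)" "C3_jet (jet_of E1)" "C3_jet (jet_of E2)" "C3_jet (jet_of E3)" "C3_jet (jet_of E4)"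
    "C3_jet (jet_of E12)" "C3_jet (jet_of E23)" "C3_jet (jet_of E34)" "C3_jet (jet_of E41)" "C3_jet (jet_of u)"
    using d u by (auto intro!: C3_jet_of simp: smooth_part_bound_def)
  let ?h = "\<lambda>i j t. 2 * A * (if i = 3 then 1 / s else 1) / s ^ j * eh t"
  have h: "\<bar>jet_of E1 i j p q\<bar> \<le> ?h i j q" "\<bar>jet_of E3 i j p q\<bar> \<le> ?h i j (1 - q)"
    "\<bar>jet_of E2 i j p q\<bar> \<le> ?h j i p" "\<bar>jet_of E4 i j p q\<bar> \<le> ?h j i (1 - p)"
    if "i + j \<le> 3" "p \<in> {0..1}" "q \<in> {0..1}" for i j p q
    by (rule jet_h_layer_bound jet_v_layer_bound; use that dec A in \<open>simp add: solution_decomposition_def\<close>)+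
  let ?c = "\<lambda>i j t r. A / s ^ (i + j) * (eh t * eh r)"
  have c: "\<bar>jet_of E12 i j p q\<bar> \<le> ?c i j p q" "\<bar>jet_of E23 i j p q\<bar> \<le> ?c i j p (1 - q)"
    "\<bar>jet_of E34 i j p q\<bar> \<le> ?c i j (1 - p) (1 - q)" "\<bar>jet_of E41 i j p q\<bar> \<le> ?c i j (1 - p) q"
    if "i + j \<le> 3" "p \<in> {0..1}" "q \<in> {0..1}" for i j p q
    by (rule jet_corner_layer_bound; use that dec in \<open>simp add: solution_decomposition_def\<close>)+
  let ?EH = "jadd (jet_of E1) (jet_of E3)" and ?EV = "jadd (jet_of E2) (jet_of E4)"
  let ?Q = "jadd (jadd (jet_of E12) (jet_of E23)) (jadd (jet_of E34) (jet_of E41))"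
  have sum: "jet_of u i j p q = jadd (jet_of S) (jadd (jadd ?EH ?EV) ?Q) i j p q"
    if "i + j \<le> 3" "p \<in> {0..1}" "q \<in> {0..1}" for i j p q
  proof (rule C3_jet_eq [OF J(10) _ _ that])
    fix x y :: real assume "x \<in> {0..1}" "y \<in> {0..1}"
    then have "u (x, y) = S (x, y) + (E1 (x, y) + E2 (x, y) + E3 (x, y) + E4 (x, y)) + E12 (x, y) + E23 (x, y) + E34 (x, y) + E41 (x, y)"
      using dec unfolding solution_decomposition_def by blast
    then show "jet_of u 0 0 x y = jadd (jet_of S) (jadd (jadd ?EH ?EV) ?Q) 0 0 x y"
      by (simp add: jadd_def jet_of_def pd_def)
  qed (intro C3_jadd J)
  have lay: "layers (2 * A) (jet_of S) ?EH ?EV ?Q"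
    unfolding layers_def
  proof (intro conjI allI ballI impI C3_jadd J)
    fix i j :: nat and x y :: real assume ij: "i + j \<le> 3" and xy: "x \<in> {0..1}" "y \<in> {0..1}"
    note H = h [OF ij xy] and C = c [OF ij xy]
    show "\<bar>jet_of S i j x y\<bar> \<le> 2 * A * (if i + j = 3 then 1 / s else 1)" by (rule jet_smooth_bound [OF sp ij xy A])
    show "\<bar>?EH i j x y\<bar> \<le> 2 * A * (if i = 3 then 1 / s else 1) / s ^ j * ex y"
      using H(1,2) unfolding jadd_def ex_eh distrib_left by linarith
    show "\<bar>?EV i j x y\<bar> \<le> 2 * A * (if j = 3 then 1 / s else 1) / s ^ i * ex x"
      using H(3,4) unfolding jadd_def ex_eh distrib_left by linarith
    \<comment> \<open>The product of \<open>ex x\<close> and \<open>ex y\<close> expands into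
      exactly the four corner decays.\<close>
    have "\<bar>?Q i j x y\<bar> \<le> ?c i j x y + ?c i j x (1 - y) + ?c i j (1 - x) (1 - y) + ?c i j (1 - x) y"
      using C unfolding jadd_def by linarith
    also have "\<dots> = A / s ^ (i + j) * (ex x * ex y)" unfolding ex_eh by (simp only: distrib_left distrib_right add_ac)
    also have "\<dots> \<le> 2 * A / s ^ (i + j) * (ex x * ex y)"
      using A s eh_nonneg by (intro mult_right_mono divide_right_mono) (auto simp: ex_eh)
    finally show "\<bar>?Q i j x y\<bar> \<le> 2 * A / s ^ (i + j) * (ex x * ex y)" .
  qed (use A in auto)
  have h0: "\<bar>jet_of E1 0 0 p q\<bar> \<le> 2 * A * exp (- (3 * k) * q / s)" "\<bar>jet_of E3 0 0 p q\<bar> \<le> 2 * A * exp (- (3 * k) * (1 - q) / s)"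
    "\<bar>jet_of E2 0 0 p q\<bar> \<le> 2 * A * exp (- (3 * k) * p / s)" "\<bar>jet_of E4 0 0 p q\<bar> \<le> 2 * A * exp (- (3 * k) * (1 - p) / s)"
    if "p \<in> {0..1}" "q \<in> {0..1}" for p q
    using h [of 0 0, OF _ that] by (simp_all add: eh_def)
  show "problem N lam s k G (2 * A) u \<sigma> (jet_of S) ?EH ?EV ?Q (jet_of E1) (jet_of E2) (jet_of E3) (jet_of E4)"
    by (rule problem.intro [OF shishkin_axioms problem_axioms.intro])
      (use lay u sg J(2-5) h0 sum in \<open>auto simp: jadd_def add.assoc\<close>)
qed

end

lemma L2_norm_on_nonneg: "0 \<le> L2_norm_on D v"
  unfolding L2_norm_on_def set_lebesgue_integral_def by (intro real_sqrt_ge_zero integral_nonneg_AE) auto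

lemma nn_integral_sqr_jet_of:
  assumes v: "C_closed 3 v" and ij: "i + j \<le> 3" and D: "D \<in> sets borel" "D \<subseteq> closed_unit_square"
    and le: "L2_norm_on D (pd i j v) \<le> X"
  shows "(\<integral>\<^sup>+ z. sqr (jet_of v i j) D z \<partial>lborel) \<le> ennreal (X\<^sup>2)"
proof -
  have "(L2_norm_on D (pd i j v))\<^sup>2 \<le> X\<^sup>2" using le by (intro power_mono L2_norm_on_nonneg)
  moreover have "sqr (jet_of v i j) D = (\<lambda>z. indicator D z * ennreal ((pd i j v z)\<^sup>2))"
    by (auto simp: sqr_def jet_of_def)
  moreover have "continuous_on closed_unit_square (pd i j v)" using v ij unfolding C_closed_def by blast
  ultimately show ?thesis using L2_norm_on_square_eq [OF _ D] by (simp add: ennreal_leI)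
qed

lemma L2_norm_on_le_H_seminorm_on:
  assumes "i + j = k"
  shows "L2_norm_on D (pd i j v) \<le> H_seminorm_on k D v"
proof -
  have "(L2_norm_on D (pd i (k - i) v))\<^sup>2 \<le> (\<Sum>i\<le>k. (L2_norm_on D (pd i (k - i) v))\<^sup>2)"
    using assms by (intro member_le_sum) auto
  then have "(L2_norm_on D (pd i j v))\<^sup>2 \<le> (\<Sum>i\<le>k. (L2_norm_on D (pd i (k - i) v))\<^sup>2)"
    using assms by (metis add_diff_cancel_left')
  then show ?thesis unfolding H_seminorm_on_def by (rule real_le_rsqrt)
qed

lemma H_seminorm_on_nonneg: "0 \<le> H_seminorm_on k D v"
  unfolding H_seminorm_on_def by (simp add: sum_nonneg)

lemma Omega_sets:
  assumes "0 < lam" "lam \<le> 1 / 4"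
  shows "Omega1 lam \<in> sets borel" "Omega1 lam \<subseteq> closed_unit_square" "Omega2 lam \<in> sets borel" "Omega2 lam \<subseteq> closed_unit_square"
    "Omega3 lam \<in> sets borel" "Omega3 lam \<subseteq> closed_unit_square" "Omega4 lam \<in> sets borel" "Omega4 lam \<subseteq> closed_unit_square"
  using assms by (auto simp: Omega1_def Omega2_def Omega3_def Omega4_def intro!: borel_open open_Times)

theorem lemma23:
  fixes c f :: "real \<times> real \<Rightarrow> real"
    and cst lam0 A B K :: real
  assumes "C_inf_closed c" and "C_inf_closed f"
    and "cst > 0" and "\<forall>z \<in> closed_unit_square. 2 * cst\<^sup>2 \<le> c z"
    and "f (0, 0) = 0" and "f (0, 1) = 0" and "f (1, 1) = 0" and "f (1, 0) = 0"
    and "lam0 \<ge> 3"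
  shows "\<exists>C>0. \<forall>\<epsilon> (N::nat) u S E1 E2 E3 E4 E12 E23 E34 E41 lam \<sigma> w.
    0 < \<epsilon> \<and> \<epsilon> \<le> 1 \<and> 0 < N \<and> 8 dvd N \<and> sqrt \<epsilon> \<le> B / real N \<and>
    solves_bvp \<epsilon> c f u \<and>
    solution_decomposition A cst \<epsilon> u S E1 E2 E3 E4 E12 E23 E34 E41 \<and>
    lam = transition_point lam0 cst \<epsilon> N \<and>
    edge_assignment lam N \<sigma> \<and>
    w = (\<lambda>z. u z - quasi_interp lam N \<sigma> u z)
    \<longrightarrow>
    L2_norm_on unit_square w
      \<le> C * (1 / real N ^ 2 + \<epsilon> powr (1 / 4) * (1 / real N ^ 2) * ln (real N) ^ 2) \<and>
    \<epsilon> powr (1 / 4) * H_seminorm_on 1 unit_square w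
      \<le> C * (\<epsilon> powr (1 / 4) * (1 / real N) + (1 / real N ^ 2) * ln (real N) ^ 2) \<and>
    \<epsilon> powr (3 / 4) * macro_H2_error lam N w
      \<le> C * (\<epsilon> * (1 / real N) * ln (real N) ^ 2 + (1 / real N) * ln (real N)) \<and>
    (\<epsilon> powr (1 / 4) \<le> 1 / ln (real N) ^ 2 \<longrightarrow>
      L2_norm_on unit_square w \<le> C * (1 / real N ^ 2) \<and>
      \<epsilon> powr (3 / 4) * macro_H2_error lam N w \<le> C * ((1 / real N) * ln (real N))) \<and>
    (H_seminorm_on 3 unit_square S \<le> K * \<epsilon> powr (- 1 / 4) \<longrightarrow>
      \<epsilon> powr (1 / 4) * H_seminorm_on 1 unit_square w
        \<le> C * ((1 / real N ^ 2) * ln (real N) ^ 2)) \<and>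
    (\<epsilon> powr (1 / 4) \<le> 1 / ln (real N) ^ 3 \<and>
     H_seminorm_on 3 unit_square S
       + (L2_norm_on (Omega1 lam) (pd 3 0 E1) + L2_norm_on (Omega3 lam) (pd 3 0 E3))
       + (L2_norm_on (Omega2 lam) (pd 0 3 E2) + L2_norm_on (Omega4 lam) (pd 0 3 E4)) \<le> K \<longrightarrow>
      L2_norm_on unit_square w \<le> C * ((1 / real N ^ 3) * ln (real N) ^ 3))"
proof -
  define G where "G = mesh_const B cst lam0"
  define CC where "CC = 10 ^ 7 * G ^ 9 * (2 * A)"
  define c1 c2 c3 c4 c5 where "c1 = 30 * CC * G"
    and "c2 = (sqrt (8 * (G + 12 / (cst / 3))) + 4) * CC"
    and "c3 = sqrt (12 * (G + 8 / (cst / 3))) * CC"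
    and "c4 = sqrt (8 * (G + 16 / (cst / 3)) * CC\<^sup>2 + 8 * CC\<^sup>2 + 10 ^ 8 * K\<^sup>2)"
    and "c5 = sqrt (2400 * CC\<^sup>2 + 10 ^ 9 * K\<^sup>2)"
  \<comment> \<open>Absolute values are taken because the sign of \<open>A\<close>, and so of
    \<open>CC\<close>, is known only once a decomposition is given, whereas \<open>C\<close> has to
    be fixed beforehand.\<close>
  define C where "C = 1 + \<bar>c1\<bar> + \<bar>c2\<bar> + \<bar>c3\<bar> + \<bar>c4\<bar> + \<bar>c5\<bar>"
  have C: "c1 \<le> C" "c2 \<le> C" "c3 \<le> C" "c4 \<le> C" "c5 \<le> C" "0 < C" unfolding C_def by linarith+
  show ?thesis
  proof (intro exI [of _ C] conjI [OF C(6)] allI impI, elim conjE)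
    fix \<epsilon> :: real and N :: nat and u S E1 E2 E3 E4 E12 E23 E34 E41 :: "real \<times> real \<Rightarrow> real"
      and lam :: real and \<sigma> :: "real \<times> real \<Rightarrow> edge" and w :: "real \<times> real \<Rightarrow> real"
    assume e: "0 < \<epsilon>" "\<epsilon> \<le> 1" and N: "0 < N" "8 dvd N" and eN: "sqrt \<epsilon> \<le> B / real N"
      and bvp: "solves_bvp \<epsilon> c f u" and dec: "solution_decomposition A cst \<epsilon> u S E1 E2 E3 E4 E12 E23 E34 E41"
      and lam: "lam = transition_point lam0 cst \<epsilon> N" and sg: "edge_assignment lam N \<sigma>"
      and w: "w = (\<lambda>z. u z - quasi_interp lam N \<sigma> u z)"
    define s where "s = sqrt \<epsilon>"
    have s: "0 < s" "s \<le> 1" "s\<^sup>2 = \<epsilon>" "s \<le> B / real N" using e eN unfolding s_def by auto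
    interpret M: shishkin N lam s "cst / 3" G
      unfolding G_def
      by (rule shishkin_transition_point [OF N(2,1) \<open>cst > 0\<close> \<open>lam0 \<ge> 3\<close> s(1,2,4)])
        (simp add: lam transition_point_def s_def)
    have dec': "solution_decomposition A (3 * (cst / 3)) (s\<^sup>2) u S E1 E2 E3 E4 E12 E23 E34 E41"
      using dec by (simp add: s)
    have u: "C_closed 3 u" using bvp unfolding solves_bvp_def by blast
    note P = M.problem_of_decomposition(2) [OF dec' u sg]
    have CC: "problem.CC G (2 * A) = CC" unfolding problem.CC_def [OF P] CC_def ..
    have w': "problem.w N lam u \<sigma> = w" unfolding problem.w_def [OF P] w ..
    note facts = problem.error_L2 [OF P, unfolded CC w'] problem.error_H1 [OF P, unfolded CC w']
      problem.error_H2 [OF P, unfolded CC w'] problem.error_H1_smooth [OF P, unfolded CC w']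
      problem.error_L2_smooth [OF P, unfolded CC w']
    note q = powr_quarter [OF e(1), folded s_def]
    have L: "0 \<le> ln (real N)" using M.L1 by simp
    \<comment> \<open>Passes to the common constant and adds the further summands on the right-hand
      sides of the stated bounds.\<close>
    have up: "X \<le> C * Z" if "X \<le> d * Y" "d \<le> C" "0 \<le> Y" "Y \<le> Z" for X Y Z d
      using that C(6) by (smt (verit) mult_left_mono mult_right_mono)
    have cl: "C_closed 3 S" "C_closed 3 E1" "C_closed 3 E2" "C_closed 3 E3" "C_closed 3 E4"
      using dec unfolding solution_decomposition_def smooth_part_bound_def h_layer_bound_def v_layer_bound_def by auto
    have L2: "L2_norm_on unit_square w \<le> c1 * (1 / real N ^ 2)" using facts(1) unfolding c1_def by simp
    have H2: "\<epsilon> powr (3 / 4) * macro_H2_error lam N w \<le> c3 * ((1 / real N) * ln (real N))"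
      using facts(3) unfolding c3_def q by simp
    show "L2_norm_on unit_square w
        \<le> C * (1 / real N ^ 2 + \<epsilon> powr (1 / 4) * (1 / real N ^ 2) * ln (real N) ^ 2) \<and>
      \<epsilon> powr (1 / 4) * H_seminorm_on 1 unit_square w
        \<le> C * (\<epsilon> powr (1 / 4) * (1 / real N) + (1 / real N ^ 2) * ln (real N) ^ 2) \<and>
      \<epsilon> powr (3 / 4) * macro_H2_error lam N w
        \<le> C * (\<epsilon> * (1 / real N) * ln (real N) ^ 2 + (1 / real N) * ln (real N)) \<and>
      (\<epsilon> powr (1 / 4) \<le> 1 / ln (real N) ^ 2 \<longrightarrow>
        L2_norm_on unit_square w \<le> C * (1 / real N ^ 2) \<and>
        \<epsilon> powr (3 / 4) * macro_H2_error lam N w \<le> C * ((1 / real N) * ln (real N))) \<and>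
      (H_seminorm_on 3 unit_square S \<le> K * \<epsilon> powr (- 1 / 4) \<longrightarrow>
        \<epsilon> powr (1 / 4) * H_seminorm_on 1 unit_square w
          \<le> C * ((1 / real N ^ 2) * ln (real N) ^ 2)) \<and>
      (\<epsilon> powr (1 / 4) \<le> 1 / ln (real N) ^ 3 \<and>
       H_seminorm_on 3 unit_square S
         + (L2_norm_on (Omega1 lam) (pd 3 0 E1) + L2_norm_on (Omega3 lam) (pd 3 0 E3))
         + (L2_norm_on (Omega2 lam) (pd 0 3 E2) + L2_norm_on (Omega4 lam) (pd 0 3 E4)) \<le> K \<longrightarrow>
        L2_norm_on unit_square w \<le> C * ((1 / real N ^ 3) * ln (real N) ^ 3))"
    proof (intro conjI impI, goal_cases)
      case 1
      show ?case by (rule up [OF L2 C(1)]) auto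
    next
      case 2
      show ?case by (rule up [where d = c2, OF _ C(2) _ order_refl]) (use facts(2) L s in \<open>simp_all add: c2_def q\<close>)
    next
      case 3
      show ?case by (rule up [OF H2 C(3)]) (use L e in auto)
    next
      case 4
      show ?case by (rule up [OF L2 C(1)]) auto
    next
      case 5
      show ?case by (rule up [OF H2 C(3)]) (use L in auto)
    next
      case 6
      have "(\<integral>\<^sup>+ z. sqr (jet_of S i j) unit_square z \<partial>lborel) \<le> ennreal (K\<^sup>2 / s)" if "i + j = 3" for i j
      proof -
        \<comment> \<open>The bound K eps^(-1/4) equals K / sqrt s; its square has the required form
          with kappa = K^2.\<close>
        have "L2_norm_on unit_square (pd i j S) \<le> K * (1 / sqrt s)"
          using L2_norm_on_le_H_seminorm_on [OF that] 6 unfolding q by (rule order_trans)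
        then have "(\<integral>\<^sup>+ z. sqr (jet_of S i j) unit_square z \<partial>lborel) \<le> ennreal ((K * (1 / sqrt s))\<^sup>2)"
          using that by (intro nn_integral_sqr_jet_of cl problem.square_meas [OF P]) auto
        then show ?thesis using s by (simp add: power_mult_distrib power_divide)
      qed
      then have "sqrt s * H_seminorm_on 1 unit_square w \<le> c4 * ((ln (real N))\<^sup>2 / (real N)\<^sup>2)"
        unfolding c4_def by (intro facts(4)) auto
      then show ?case by (intro up [where d = c4, OF _ C(4) _ order_refl]) (auto simp: q)
    next
      case 7
      note nn = L2_norm_on_nonneg [of "Omega1 lam" "pd 3 0 E1"] L2_norm_on_nonneg [of "Omega3 lam" "pd 3 0 E3"]
        L2_norm_on_nonneg [of "Omega2 lam" "pd 0 3 E2"] L2_norm_on_nonneg [of "Omega4 lam" "pd 0 3 E4"]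
        H_seminorm_on_nonneg [of 3 unit_square S]
      note O = Omega_sets [OF M.lam]
      have "H_seminorm_on 3 unit_square S \<le> K" "L2_norm_on (Omega1 lam) (pd 3 0 E1) \<le> K" "L2_norm_on (Omega3 lam) (pd 3 0 E3) \<le> K"
        "L2_norm_on (Omega2 lam) (pd 0 3 E2) \<le> K" "L2_norm_on (Omega4 lam) (pd 0 3 E4) \<le> K"
        using 7 nn by linarith+
      then have "L2_norm_on unit_square w \<le> c5 * ((ln (real N)) ^ 3 / (real N) ^ 3)"
        unfolding c5_def
        by (intro facts(5) nn_integral_sqr_jet_of cl O problem.square_meas [OF P])
          (auto intro: order_trans [OF L2_norm_on_le_H_seminorm_on])
      then show ?case using L by (intro up [where d = c5, OF _ C(5) _ order_refl]) auto
    qed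
  qed
qed

end
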